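(* Let $M>0$. Every complete SS-CMC hypersurface in the Kruskal extension is one of the following, where $H\in\mathbb{R}$ denotes its mean curvature, $c$ is a real constant, and the additive constants $\bar c_i$ of the joined pieces are such that the pieces connect smoothly across $r=2M$: (1) $c<c_H$: $\Sigma^1_{H,c}\cup\{t=f_2^*(r),\,0<r<2M\}$, in regions I and II. (2) $c=c_H$: $\Sigma^1_{H,c}\cup\{t=f_2^*(r),\,r_H<r<2M\}$, in regions I and II. (3) $c_H<c<-8M^3H$: $\Sigma^1_{H,c}\cup\{t=f_2^*(r)\text{ or }t=f_2^{**}(r),\ r''\le r<2M\}\cup\Sigma^3_{H,c}$, in regions I, II and I$'$. (4) $c>C_H$: $\Sigma^1_{H,c}\cup\{t=f_4^{**}(r),\,0<r<2M\}$, in regions I and II$'$. (5) $c=C_H$: $\Sigma^1_{H,c}\cup\{t=f_4^{**}(r),\,R_H<r<2M\}$, in regions I and II$'$. (6) $-8M^3H<c<C_H$: $\Sigma^1_{H,c}\cup\{t=f_4^*(r)\text{ or }t=f_4^{**}(r),\ r''\le r<2M\}\cup\Sigma^3_{H,c}$, in regions I, II$'$ and I$'$. (7) $c=-8M^3H$: $\Sigma^1_{H,c}\cup\Sigma^3_{H,c}$, joined at the sphere $U=V=0$. (8) $c=c_H$: $\{t=f_2^*(r),\,0<r<r_H\}$ or $\{t=f_2^{**}(r),\,0<r<r_H\}$, in region II. (9) $c_H<c<\max(0,-8M^3H)$ with $f_2$ defined on a component $(0,r']$: $\{t=f_2^*(r)\text{ or }t=f_2^{**}(r),\ 0<r\le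 r'\}$, in region II. (10) $c=C_H$: $\{t=f_4^*(r),\,0<r<R_H\}$ or $\{t=f_4^{**}(r),\,0<r<R_H\}$, in region II$'$. (11) $\min(0,-8M^3H)<c<C_H$ with $f_4$ defined on a component $(0,r']$: $\{t=f_4^*(r)\text{ or }t=f_4^{**}(r),\ 0<r\le r'\}$, in region II$'$. (12) Hypersurfaces starting from region I$'$: $\Sigma^3_{H,c}$ joined with $\{t=f_2^{**}(r)\}$ in region II over $0<r<2M$ if $c<c_H$, or over $r_H<r<2M$ if $c=c_H$; and $\Sigma^3_{H,c}$ joined with $\{t=f_4^{*}(r)\}$ in region II$'$ over $0<r<2M$ if $c>C_H$, or over $R_H<r<2M$ if $c=C_H$. (13) Cylindrical hypersurfaces $\{r=r_0\}$, $r_0\in(0,2M)$ constant, in region II or in region II$'$.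
   Context: Kruskal extension: for $M>0$ and $h(r)=1-\frac{2M}{r}$, it is the manifold $\{(U,V)\in\mathbb{R}^2: UV>-2M\}\times\mathbb{S}^2$ with metric $\mathrm{d}s^2=\frac{16M^2e^{-r/2M}}{r}\,\mathrm{d}U\,\mathrm{d}V+r^2(\mathrm{d}\theta^2+\sin^2\theta\,\mathrm{d}\phi^2)$, where $r>0$ is determined by $(r-2M)e^{r/2M}=UV$. With $X=\frac{V+U}2$, $T=\frac{V-U}2$ one has $\mathrm{d}U\,\mathrm{d}V=-\mathrm{d}T^2+\mathrm{d}X^2$, and $\partial_T$ is taken to be future directed. Regions: I $=\{U>0,V>0\}$, II $=\{U<0,V>0\}$, I$'=\{U<0,V<0\}$, II$'=\{U>0,V<0\}$. In each region one uses coordinates $(t,r,\theta,\phi)$ with $t=2M\ln|V/U|$; equivalently, with $u=t-(r+2M\ln|r-2M|)$, $v=t+(r+2M\ln|r-2M|)$, one has $|U|=e^{-u/4M}$, $|V|=e^{v/4M}$. In these coordinates $\mathrm{d}s^2=-h\,\mathrm{d}t^2+h^{-1}\mathrm{d}r^2+r^2(\mathrm{d}\theta^2+\sin^2\theta\,\mathrm{d}\phi^2)$; regions I, I$'$ correspond to $r>2M$ and II, II$'$ to $0<r<2M$. The future direction is increasing $t$ in I, decreasing $r$ in II, decreasing $t$ in I$'$, increasing $r$ in II$'$. SS-CMC means spacelike, spherically symmetric, with constant mean curvature; hypersurfaces are smooth and connected. The mean curvature is $H=\frac13\sum_i\langle\nabla_{e_i}N,e_i\rangle$, where $N$ is the future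 directed unit timelike normal and $\{e_i\}$ is an orthonormal tangent frame. A hypersurface is complete if it has no boundary and is a closed subset of the spacetime. Let $k_H(r)=-Hr^3-r^{3/2}(2M-r)^{1/2}$ and $\tilde k_H(r)=-Hr^3+r^{3/2}(2M-r)^{1/2}$ on $(0,2M)$; $r_H$ is the unique minimum point of $k_H$, $c_H=k_H(r_H)$; $R_H$ is the unique maximum point of $\tilde k_H$, $C_H=\tilde k_H(R_H)$. One has $c_H<-8M^3H<C_H$. $\Sigma^1_{H,c}$: the hypersurface $t=f_1(r)$, $r>2M$, in region I with $f_1(r)=\int_{r_1}^r\frac{l_1(x)}{h(x)}\frac{\mathrm{d}x}{\sqrt{1+l_1(x)^2}}+\bar c_1$, $l_1(r)=\frac1{\sqrt{h(r)}}\left(Hr+\frac{c}{r^2}\right)$, for some $\bar c_1\in\mathbb{R}$ ($r_1>2M$ fixed). $\Sigma^3_{H,c}$: the hypersurface $t=f_3(r)$, $r>2M$, in region I$'$ with $f_3(r)=\int_{r_3}^r\frac{l_3(x)}{h(x)}\frac{\mathrm{d}x}{\sqrt{1+l_3(x)^2}}+\bar c_3$, $l_3=-l_1$, for some $\bar c_3\in\mathbb{R}$ ($r_3>2M$ fixed). In region II: $l_2(r)=\frac1{\sqrt{-h(r)}}\left(-Hr-\frac{c}{r^2}\right)$, $f_2^*(r)=\int_{r_2}^r\frac1{-h(x)}\sqrt{\frac{l_2^2}{l_2^2-1}}\,\mathrm{d}x+\bar c_2$, $f_2^{**}(r)=\int_{r_2'}^r\frac1{h(x)}\sqrt{\frac{l_2^2}{l_2^2-1}}\,\mathrm{d}x+\bar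 c_2'$, defined where $k_H(r)>c$ (equivalently $l_2>1$) and also where $k_H(r)=c$ and the integral is finite; $f_2$ refers to either function. In region II$'$: $l_4(r)=\frac1{\sqrt{-h(r)}}\left(Hr+\frac{c}{r^2}\right)$, $f_4^*(r)=\int_{r_4}^r\frac1{-h(x)}\sqrt{\frac{l_4^2}{l_4^2-1}}\,\mathrm{d}x+\bar c_4$, $f_4^{**}(r)=\int_{r_4'}^r\frac1{h(x)}\sqrt{\frac{l_4^2}{l_4^2-1}}\,\mathrm{d}x+\bar c_4'$, defined where $\tilde k_H(r)<c$ (equivalently $l_4>1$) and also where $\tilde k_H(r)=c$ and the integral is finite; $f_4$ refers to either function. The base points lie in the interval under consideration. When both branches (starred and double-starred) over an interval $(0,r']$ or $[r'',2M)$ are used together, the base points are both taken equal to the endpoint $r'$ (resp. $r''$), where $k_H=c$ (resp. $\tilde k_H=c$), and the additive constants of the two branches are equal. Pieces in adjacent regions connect smoothly if their union, together with the limiting 2-sphere on the common boundary $r=2M$, is a smooth spacelike hypersurface; unions include these limiting spheres. *)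

theory Defs
  imports "HOL-Analysis.Analysis"
begin

section \<open>Smooth maps\<close>

primrec C_diff_on :: "nat \<Rightarrow> 'a::euclidean_space set \<Rightarrow> ('a \<Rightarrow> 'b::euclidean_space) \<Rightarrow> bool" where
  "C_diff_on 0 W f \<longleftrightarrow> continuous_on W f"
| "C_diff_on (Suc n) W f \<longleftrightarrow>
     (\<forall>p\<in>W. f differentiable (at p)) \<and>
     (\<forall>v. C_diff_on n W (\<lambda>p. frechet_derivative f (at p) v))"

text \<open>Intended for open \<open>W\<close> only.\<close>

definition smooth_on :: "'a::euclidean_space set \<Rightarrow> ('a \<Rightarrow> 'b::euclidean_space) \<Rightarrow> bool" where
  "smooth_on W f \<longleftrightarrow> (\<forall>n. C_diff_on n W f)"

definition tangent_space :: "'a::euclidean_space set \<Rightarrow> 'a \<Rightarrow> 'a set" where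
  "tangent_space A p =
     {v. \<exists>\<gamma> e. e > 0 \<and> smooth_on {-e<..<e} \<gamma> \<and> \<gamma> ` {-e<..<e} \<subseteq> A \<and> \<gamma> 0 = p \<and>
               (\<gamma> has_vector_derivative v) (at (0::real))}"


section \<open>The Kruskal extension\<close>

text \<open>
  The unit sphere is taken in Euclidean 3-space, so a point of the Kruskal extension is
  a triple \<open>(U, V, x)\<close> with \<open>norm x = 1\<close>, and tangent vectors are triples as well.
\<close>

type_synonym event = "real \<times> real \<times> (real^3)"

definition kruskal :: "real \<Rightarrow> event set" where
  "kruskal M = {(U, V, x). U * V > - 2 * M \<and> norm x = 1}"

fun radius :: "real \<Rightarrow> event \<Rightarrow> real" where
  "radius M (U, V, x) = (THE r. r > 0 \<and> (r - 2 * M) * exp (r / (2 * M)) = U * V)"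

fun time_coord :: "real \<Rightarrow> event \<Rightarrow> real" where
  "time_coord M (U, V, x) = 2 * M * ln \<bar>V / U\<bar>"

text \<open>
  The quadratic form of \<open>dU dV\<close> is \<open>(a, b) \<mapsto> a * b\<close>, hence its polarization carries a factor 1/2,
  which turns the coefficient 16 into 8. The round metric is the restriction
  of the Euclidean inner product. The formula is used on the whole open set
  \<open>{(U, V, x). U * V > - 2 * M}\<close> of the 5-dimensional vector space; the
  Kruskal metric is its restriction to vectors tangent to \<open>kruskal M\<close>.
\<close>

fun metric :: "real \<Rightarrow> event \<Rightarrow> event \<Rightarrow> event \<Rightarrow> real" where
  "metric M p (a, b, \<xi>) (a', b', \<xi>') =
     8 * M\<^sup>2 * exp (- radius M p / (2 * M)) / radius M p * (a * b' + b * a')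
     + (radius M p)\<^sup>2 * (\<xi> \<bullet> \<xi>')"

text \<open>\<open>\<partial>\<^sub>T = \<partial>\<^sub>V - \<partial>\<^sub>U\<close>; a timelike vector is future directed iff its product with \<open>\<partial>\<^sub>T\<close> is negative.\<close>

definition future_directed :: "real \<Rightarrow> event \<Rightarrow> event \<Rightarrow> bool" where
  "future_directed M p n \<longleftrightarrow> metric M p n n < 0 \<and> metric M p n (-1, 1, 0) < 0"

definition regionI :: "real \<Rightarrow> event set" where
  "regionI M = {(U, V, x) \<in> kruskal M. U > 0 \<and> V > 0}"

definition regionII :: "real \<Rightarrow> event set" where
  "regionII M = {(U, V, x) \<in> kruskal M. U < 0 \<and> V > 0}"

definition regionI' :: "real \<Rightarrow> event set" where
  "regionI' M = {(U, V, x) \<in> kruskal M. U < 0 \<and> V < 0}"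

definition regionII' :: "real \<Rightarrow> event set" where
  "regionII' M = {(U, V, x) \<in> kruskal M. U > 0 \<and> V < 0}"


section \<open>Complete spacelike spherically symmetric CMC hypersurfaces\<close>

text \<open>Embedded hypersurface of \<open>kruskal M\<close> (without boundary): locally a regular level set.\<close>

definition smooth_hypersurface :: "real \<Rightarrow> event set \<Rightarrow> bool" where
  "smooth_hypersurface M S \<longleftrightarrow>
     S \<noteq> {} \<and> S \<subseteq> kruskal M \<and>
     (\<forall>p\<in>S. \<exists>W (F :: event \<Rightarrow> real). open W \<and> p \<in> W \<and> smooth_on W F \<and>
        S \<inter> W = {q \<in> kruskal M \<inter> W. F q = 0} \<and>
        (\<forall>q\<in>S \<inter> W. \<exists>v\<in>tangent_space (kruskal M) q. frechet_derivative F (at q) v \<noteq> 0))"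

definition spacelike_hypersurface :: "real \<Rightarrow> event set \<Rightarrow> bool" where
  "spacelike_hypersurface M S \<longleftrightarrow>
     smooth_hypersurface M S \<and>
     (\<forall>p\<in>S. \<forall>v\<in>tangent_space S p. v \<noteq> 0 \<longrightarrow> metric M p v v > 0)"

definition spherically_symmetric :: "event set \<Rightarrow> bool" where
  "spherically_symmetric S \<longleftrightarrow>
     (\<forall>Q. rotation_matrix Q \<longrightarrow> (\<forall>U V x. (U, V, x) \<in> S \<longrightarrow> (U, V, Q *v x) \<in> S))"

definition unit_normal :: "real \<Rightarrow> event set \<Rightarrow> event \<Rightarrow> event" where
  "unit_normal M S p =
     (THE n. n \<in> tangent_space (kruskal M) p \<and> (\<forall>v\<in>tangent_space S p. metric M p n v = 0) \<and>
             metric M p n n = -1 \<and> future_directed M p n)"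

text \<open>
  \<open>cov_deriv_inner M p X N DN Y\<close> is the inner product of \<open>\<nabla>\<^sub>X N\<close> with \<open>Y\<close> at \<open>p\<close>, where \<open>DN\<close> is the
  componentwise derivative of the field \<open>N\<close> in the direction \<open>X\<close>; the last three terms are
  the Christoffel symbols of the first kind contracted with \<open>X\<close>, \<open>N\<close> and \<open>Y\<close>. They are taken for
  the metric on the open subset of the 5-dimensional space. Since the Levi-Civita
  connection of the submanifold \<open>kruskal M\<close> is the tangential part of that of the ambient
  metric, for \<open>X\<close>, \<open>N\<close>, \<open>Y\<close> tangent to \<open>kruskal M\<close> this is the product for the Levi-Civita
  connection of the Kruskal metric.
\<close>

definition metric_deriv :: "real \<Rightarrow> event \<Rightarrow> event \<Rightarrow> event \<Rightarrow> event \<Rightarrow> real" where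
  "metric_deriv M p v a b = frechet_derivative (\<lambda>q. metric M q a b) (at p) v"

definition cov_deriv_inner ::
    "real \<Rightarrow> event \<Rightarrow> event \<Rightarrow> event \<Rightarrow> event \<Rightarrow> event \<Rightarrow> real" where
  "cov_deriv_inner M p X N DN Y =
     metric M p DN Y
     + (metric_deriv M p X N Y + metric_deriv M p N X Y - metric_deriv M p Y X N) / 2"

definition orthonormal_frame :: "real \<Rightarrow> event set \<Rightarrow> event \<Rightarrow> (nat \<Rightarrow> event) \<Rightarrow> bool" where
  "orthonormal_frame M S p e \<longleftrightarrow>
     (\<forall>i<3. e i \<in> tangent_space S p) \<and>
     (\<forall>i<3. \<forall>j<3. metric M p (e i) (e j) = (if i = j then 1 else 0))"

text \<open>
  The normal field is only defined along \<open>S\<close>, so it is differentiated within \<open>S\<close>; on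
  vectors tangent to \<open>S\<close> the derivative \<open>D\<close> is unique.
\<close>

definition has_mean_curvature :: "real \<Rightarrow> event set \<Rightarrow> event \<Rightarrow> real \<Rightarrow> bool" where
  "has_mean_curvature M S p H \<longleftrightarrow>
     (\<exists>D. (unit_normal M S has_derivative D) (at p within S) \<and>
          (\<forall>e. orthonormal_frame M S p e \<longrightarrow>
               H = (1 / 3) * (\<Sum>i<3. cov_deriv_inner M p (e i) (unit_normal M S p) (D (e i)) (e i))))"

definition SS_CMC :: "real \<Rightarrow> real \<Rightarrow> event set \<Rightarrow> bool" where
  "SS_CMC M H S \<longleftrightarrow>
     spacelike_hypersurface M S \<and> connected S \<and> spherically_symmetric S \<and>
     (\<forall>p\<in>S. has_mean_curvature M S p H)"

text \<open>Absence of boundary is part of \<open>smooth_hypersurface\<close>.\<close>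

definition complete_SS_CMC :: "real \<Rightarrow> real \<Rightarrow> event set \<Rightarrow> bool" where
  "complete_SS_CMC M H S \<longleftrightarrow> SS_CMC M H S \<and> closedin (top_of_set (kruskal M)) S"


section \<open>Graphs over the radial coordinate\<close>

definition h :: "real \<Rightarrow> real \<Rightarrow> real" where
  "h M r = 1 - 2 * M / r"

definition graph :: "real \<Rightarrow> event set \<Rightarrow> (real \<Rightarrow> real) \<Rightarrow> real set \<Rightarrow> event set" where
  "graph M R f J = {p \<in> R. radius M p \<in> J \<and> time_coord M p = f (radius M p)}"

definition kH :: "real \<Rightarrow> real \<Rightarrow> real \<Rightarrow> real" where
  "kH M H r = - H * r ^ 3 - r powr (3/2) * (2 * M - r) powr (1/2)"

definition kH' :: "real \<Rightarrow> real \<Rightarrow> real \<Rightarrow> real" where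
  "kH' M H r = - H * r ^ 3 + r powr (3/2) * (2 * M - r) powr (1/2)"

definition r_min :: "real \<Rightarrow> real \<Rightarrow> real" where
  "r_min M H = arg_min_on (kH M H) {0<..<2 * M}"

definition c_min :: "real \<Rightarrow> real \<Rightarrow> real" where
  "c_min M H = kH M H (r_min M H)"

definition R_max :: "real \<Rightarrow> real \<Rightarrow> real" where
  "R_max M H = arg_max_on (kH' M H) {0<..<2 * M}"

definition C_max :: "real \<Rightarrow> real \<Rightarrow> real" where
  "C_max M H = kH' M H (R_max M H)"

definition l1 :: "real \<Rightarrow> real \<Rightarrow> real \<Rightarrow> real \<Rightarrow> real" where
  "l1 M H c r = 1 / sqrt (h M r) * (H * r + c / r\<^sup>2)"

definition l2 :: "real \<Rightarrow> real \<Rightarrow> real \<Rightarrow> real \<Rightarrow> real" where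
  "l2 M H c r = 1 / sqrt (- h M r) * (- H * r - c / r\<^sup>2)"

definition l3 :: "real \<Rightarrow> real \<Rightarrow> real \<Rightarrow> real \<Rightarrow> real" where
  "l3 M H c r = - l1 M H c r"

definition l4 :: "real \<Rightarrow> real \<Rightarrow> real \<Rightarrow> real \<Rightarrow> real" where
  "l4 M H c r = 1 / sqrt (- h M r) * (H * r + c / r\<^sup>2)"

text \<open>In the following functions \<open>b\<close> is the base point and \<open>k\<close> the additive constant.\<close>

definition f1 :: "real \<Rightarrow> real \<Rightarrow> real \<Rightarrow> real \<Rightarrow> real \<Rightarrow> real \<Rightarrow> real" where
  "f1 M H c b k r = (LBINT x=b..r. l1 M H c x / h M x * (1 / sqrt (1 + (l1 M H c x)\<^sup>2))) + k"

definition f3 :: "real \<Rightarrow> real \<Rightarrow> real \<Rightarrow> real \<Rightarrow> real \<Rightarrow> real \<Rightarrow> real" where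
  "f3 M H c b k r = (LBINT x=b..r. l3 M H c x / h M x * (1 / sqrt (1 + (l3 M H c x)\<^sup>2))) + k"

definition f2_star :: "real \<Rightarrow> real \<Rightarrow> real \<Rightarrow> real \<Rightarrow> real \<Rightarrow> real \<Rightarrow> real" where
  "f2_star M H c b k r =
     (LBINT x=b..r. 1 / (- h M x) * sqrt ((l2 M H c x)\<^sup>2 / ((l2 M H c x)\<^sup>2 - 1))) + k"

definition f2_dstar :: "real \<Rightarrow> real \<Rightarrow> real \<Rightarrow> real \<Rightarrow> real \<Rightarrow> real \<Rightarrow> real" where
  "f2_dstar M H c b k r =
     (LBINT x=b..r. 1 / h M x * sqrt ((l2 M H c x)\<^sup>2 / ((l2 M H c x)\<^sup>2 - 1))) + k"

definition f4_star :: "real \<Rightarrow> real \<Rightarrow> real \<Rightarrow> real \<Rightarrow> real \<Rightarrow> real \<Rightarrow> real" where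
  "f4_star M H c b k r =
     (LBINT x=b..r. 1 / (- h M x) * sqrt ((l4 M H c x)\<^sup>2 / ((l4 M H c x)\<^sup>2 - 1))) + k"

definition f4_dstar :: "real \<Rightarrow> real \<Rightarrow> real \<Rightarrow> real \<Rightarrow> real \<Rightarrow> real \<Rightarrow> real" where
  "f4_dstar M H c b k r =
     (LBINT x=b..r. 1 / h M x * sqrt ((l4 M H c x)\<^sup>2 / ((l4 M H c x)\<^sup>2 - 1))) + k"

text \<open>
  Domains of definition: at a point where \<open>kH = c\<close> (resp. \<open>kH' = c\<close>) the integral from some
  base point in an adjacent interval must be finite; the starred and double-starred integrands
  differ only by sign.
\<close>

definition f2_dom :: "real \<Rightarrow> real \<Rightarrow> real \<Rightarrow> real set" where
  "f2_dom M H c =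
     {r \<in> {0<..<2 * M}. kH M H r > c \<or>
        (kH M H r = c \<and>
         (\<exists>b\<in>{0<..<2 * M}. b \<noteq> r \<and> (\<forall>x\<in>open_segment b r. kH M H x > c) \<and>
            interval_lebesgue_integrable lborel (ereal b) (ereal r)
              (\<lambda>x. 1 / (- h M x) * sqrt ((l2 M H c x)\<^sup>2 / ((l2 M H c x)\<^sup>2 - 1)))))}"

definition f4_dom :: "real \<Rightarrow> real \<Rightarrow> real \<Rightarrow> real set" where
  "f4_dom M H c =
     {r \<in> {0<..<2 * M}. kH' M H r < c \<or>
        (kH' M H r = c \<and>
         (\<exists>b\<in>{0<..<2 * M}. b \<noteq> r \<and> (\<forall>x\<in>open_segment b r. kH' M H x < c) \<and>
            interval_lebesgue_integrable lborel (ereal b) (ereal r)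
              (\<lambda>x. 1 / (- h M x) * sqrt ((l4 M H c x)\<^sup>2 / ((l4 M H c x)\<^sup>2 - 1)))))}"

definition Sigma1 :: "real \<Rightarrow> real \<Rightarrow> real \<Rightarrow> real \<Rightarrow> real \<Rightarrow> event set" where
  "Sigma1 M H c b k = graph M (regionI M) (f1 M H c b k) {2 * M<..}"

definition Sigma3 :: "real \<Rightarrow> real \<Rightarrow> real \<Rightarrow> real \<Rightarrow> real \<Rightarrow> event set" where
  "Sigma3 M H c b k = graph M (regionI' M) (f3 M H c b k) {2 * M<..}"

text \<open>Both branches over an interval, with common base point and common additive constant.\<close>

definition both2 :: "real \<Rightarrow> real \<Rightarrow> real \<Rightarrow> real \<Rightarrow> real \<Rightarrow> real set \<Rightarrow> event set" where
  "both2 M H c b k J =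
     graph M (regionII M) (f2_star M H c b k) J \<union> graph M (regionII M) (f2_dstar M H c b k) J"

definition both4 :: "real \<Rightarrow> real \<Rightarrow> real \<Rightarrow> real \<Rightarrow> real \<Rightarrow> real set \<Rightarrow> event set" where
  "both4 M H c b k J =
     graph M (regionII' M) (f4_star M H c b k) J \<union> graph M (regionII' M) (f4_dstar M H c b k) J"


section \<open>Joining pieces across the horizon\<close>

definition limit_set :: "real \<Rightarrow> event set \<Rightarrow> event set \<Rightarrow> event set" where
  "limit_set M A B = {p \<in> kruskal M. radius M p = 2 * M} \<inter> closure A \<inter> closure B"

definition joined :: "real \<Rightarrow> event set \<Rightarrow> event set \<Rightarrow> event set" where
  "joined M A B = A \<union> limit_set M A B \<union> B"

text \<open>
  Requiring the common limit set to be an actual 2-sphere excludes pieces that do not meet,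
  whose disjoint union would be a smooth hypersurface too.
\<close>

definition connect_smoothly_at ::
    "real \<Rightarrow> real \<Rightarrow> real \<Rightarrow> event set \<Rightarrow> event set \<Rightarrow> bool" where
  "connect_smoothly_at M U V A B \<longleftrightarrow>
     limit_set M A B = {U} \<times> {V} \<times> sphere 0 1 \<and> spacelike_hypersurface M (joined M A B)"

definition connect_smoothly :: "real \<Rightarrow> event set \<Rightarrow> event set \<Rightarrow> bool" where
  "connect_smoothly M A B \<longleftrightarrow> (\<exists>U V. connect_smoothly_at M U V A B)"

end

theory Submission
  imports Defs
begin

text \<open>
  A spacelike spherically symmetric hypersurface is the rotation orbit of a graph \<open>V = g U\<close> over an
  open interval. Let \<open>p\<close> be the derivative of the radius \<open>r\<close> along this curve with respect to arc
  length, and \<open>w\<close> the product of the Killing field \<open>\<partial>\<^sub>t\<close> with its unit tangent. The mean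
  curvature equation has the first integral \<open>w = - H r - c / r\<^sup>2\<close>, and \<open>p\<^sup>2 = w\<^sup>2 + h(r)\<close>, so the
  radius moves like a particle in a one-dimensional potential whose turning points are the solutions
  of \<open>k\<^sub>H = c\<close>. Closedness of the hypersurface forces the curve to run to the ends of the range of \<open>r\<close>
  admitted by \<open>k\<^sub>H \<ge> c\<close>, or to stay at an equilibrium; the shape of \<open>k\<^sub>H\<close> leaves the listed
  cases. The isometry swapping \<open>U\<close> and \<open>V\<close> exchanges the two interior regions and replaces
  \<open>(H, c)\<close> by \<open>(- H, - c)\<close>.
\<close>

section \<open>Smooth maps and the implicit function theorem\<close>

text \<open>Completeness is only closedness in the extension; a priori a profile could stop at a
  regular radius with \<open>(U, V)\<close> running off to infinity. The estimate that excludes this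
  is \<open>(ln V)' = 1 / (4 M (p + w))\<close> per arc length: where \<open>p + w\<close> is
  bounded below, any bounded quantity growing at a definite rate (the radius, or \<open>p\<close>
  itself near a simple turning point) bounds \<open>V\<close> and hence \<open>U\<close>, and a
  bounded monotone pair would converge to a point of the curve beyond which the curve continues. At
  a double zero of \<open>p\<^sup>2\<close> no such quantity exists, the approach is asymptotic, and
  this is where \<open>c = c_min M H\<close> and \<open>c = C_max M H\<close> split off.

  The horizon is the other obstacle, since \<open>t\<close> is singular there. But \<open>p\<close>
  and \<open>w\<close> stay regular, and \<open>p + w\<close>, \<open>p - w\<close> are positive
  multiples of \<open>V\<close> and \<open>U\<close>, so their signs tell the region. The locale
  \<open>profile\<close> allows an arbitrary parameter of speed \<open>m\<close> and treats
  \<open>u\<close> and \<open>v\<close> alike, so that the reflection \<open>X \<mapsto> -X\<close>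
  and the time reversal give instances again, and many statements are transferred by
  interpretation.\<close>

lemma C_diff_on_subset:
  "C_diff_on n W f \<Longrightarrow> W' \<subseteq> W \<Longrightarrow> C_diff_on n W' f"
proof (induction n arbitrary: f)
  case 0
  then show ?case by (auto intro: continuous_on_subset)
next
  case (Suc n)
  then show ?case by auto
qed

lemma C_diff_on_cong:
  assumes "open W" "\<And>x. x \<in> W \<Longrightarrow> f x = g x" "C_diff_on n W f"
  shows "C_diff_on n W g"
  using assms(2,3)
proof (induction n arbitrary: f g)
  case 0
  then show ?case using continuous_on_cong by fastforce
next
  case (Suc n)
  have fg: "frechet_derivative f (at p) = frechet_derivative g (at p)" if "p \<in> W" for p
    using Suc.prems frechet_derivative_transform_within_open[OF _ assms(1) that] that by auto
  have "g differentiable (at p)" if "p \<in> W" for p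
  proof -
    from Suc.prems that obtain D where "(f has_derivative D) (at p)"
      by (auto simp: differentiable_def)
    from has_derivative_transform_within_open[OF this assms(1) that] Suc.prems(1) show ?thesis
      by (auto simp: differentiable_def)
  qed
  moreover have "C_diff_on n W (\<lambda>p. frechet_derivative g (at p) v)" for v
    by (rule Suc.IH[of "\<lambda>p. frechet_derivative f (at p) v"]) (use fg Suc.prems in auto)
  ultimately show ?case by auto
qed

lemma C_diff_on_Suc_imp: "C_diff_on (Suc n) W f \<Longrightarrow> C_diff_on n W f"
proof (induction n arbitrary: f)
  case 0
  then show ?case
    by (auto simp: continuous_on_eq_continuous_within
        intro: continuous_at_imp_continuous_at_within[OF differentiable_imp_continuous_within])
next
  case (Suc n)
  then show ?case by auto
qed

lemma C_diff_on_const: "C_diff_on n W (\<lambda>_. c)"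
  by (induction n arbitrary: c) auto

lemma C_diff_on_add:
  assumes "open W" "C_diff_on n W f" "C_diff_on n W g"
  shows "C_diff_on n W (\<lambda>p. f p + g p)"
  using assms(2,3)
proof (induction n arbitrary: f g)
  case 0
  then show ?case by (auto intro: continuous_intros)
next
  case (Suc n)
  have d: "frechet_derivative (\<lambda>p. f p + g p) (at p) v = frechet_derivative f (at p) v + frechet_derivative g (at p) v"
    if "p \<in> W" for p v
  proof -
    have "(f has_derivative frechet_derivative f (at p)) (at p)" "(g has_derivative frechet_derivative g (at p)) (at p)"
      using Suc.prems that by (auto simp: frechet_derivative_works[symmetric])
    from frechet_derivative_at[OF has_derivative_add[OF this]] show ?thesis
      by metis
  qed
  have "C_diff_on n W (\<lambda>p. frechet_derivative (\<lambda>p. f p + g p) (at p) v)" for v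
    by (rule C_diff_on_cong[OF assms(1) _ Suc.IH[of "\<lambda>p. frechet_derivative f (at p) v"
        "\<lambda>p. frechet_derivative g (at p) v"]])
       (use Suc.prems d in auto)
  then show ?case using Suc.prems by auto
qed

lemma C_diff_on_mult:
  fixes f g :: "'a::euclidean_space \<Rightarrow> real"
  assumes "open W" "C_diff_on n W f" "C_diff_on n W g"
  shows "C_diff_on n W (\<lambda>p. f p * g p)"
  using assms(2,3)
proof (induction n arbitrary: f g)
  case 0
  then show ?case by (auto intro: continuous_intros)
next
  case (Suc n)
  have d: "frechet_derivative (\<lambda>p. f p * g p) (at p) v = f p * frechet_derivative g (at p) v + frechet_derivative f
      (at p) v * g p"
    if "p \<in> W" for p v
  proof -
    have "(f has_derivative frechet_derivative f (at p)) (at p)" "(g has_derivative frechet_derivative g (at p)) (at p)"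
      using Suc.prems that by (auto simp: frechet_derivative_works[symmetric])
    from frechet_derivative_at[OF has_derivative_mult[OF this]] show ?thesis
      by metis
  qed
  have "C_diff_on n W (\<lambda>p. f p * frechet_derivative g (at p) v + frechet_derivative f (at p) v * g p)" for v
    using Suc.prems C_diff_on_Suc_imp[OF Suc.prems(1)] C_diff_on_Suc_imp[OF Suc.prems(2)]
    by (intro C_diff_on_add assms(1) Suc.IH) auto
  then have "C_diff_on n W (\<lambda>p. frechet_derivative (\<lambda>p. f p * g p) (at p) v)" for v
    by (rule C_diff_on_cong[OF assms(1), rotated]) (use d in auto)
  then show ?case using Suc.prems by auto
qed

text \<open>The derivative of \<open>1 / f\<close> contains \<open>1 / f\<close> again, multiplied
  by derivatives of \<open>f\<close>; so the induction over the order keeps \<open>f\<close> fixed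
  and reuses its own claim of lower order.\<close>

lemma C_diff_on_inverse:
  fixes f :: "'a::euclidean_space \<Rightarrow> real"
  assumes "open W" "\<And>p. p \<in> W \<Longrightarrow> f p \<noteq> 0" "C_diff_on n W f"
  shows "C_diff_on n W (\<lambda>p. inverse (f p))"
  using assms(3)
proof (induction n)
  case 0
  then show ?case using assms by (auto intro: continuous_intros)
next
  case (Suc n)
  have fd: "(f has_derivative frechet_derivative f (at p)) (at p)" if "p \<in> W" for p
    using Suc.prems that by (auto simp: frechet_derivative_works[symmetric])
  have d: "((\<lambda>p. inverse (f p)) has_derivative
      (\<lambda>v. - (inverse (f p) * frechet_derivative f (at p) v * inverse (f p)))) (at p)" if "p \<in> W" for p
    using Deriv.has_derivative_inverse[OF assms(2)[OF that] fd[OF that]] .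
  have i: "C_diff_on n W (\<lambda>p. inverse (f p))"
    using Suc.IH C_diff_on_Suc_imp[OF Suc.prems] by auto
  have "C_diff_on n W (\<lambda>p. - 1 * (inverse (f p) * frechet_derivative f (at p) v * inverse (f p)))" for v
    using Suc.prems by (intro C_diff_on_mult C_diff_on_const assms i) auto
  then have "C_diff_on n W (\<lambda>p. frechet_derivative (\<lambda>p. inverse (f p)) (at p) v)" for v
    by (rule C_diff_on_cong[OF assms(1), rotated]) (use frechet_derivative_at[OF d] in \<open>auto dest: fun_cong\<close>)
  then show ?case using d differentiableI by (auto intro: differentiableI)
qed

lemma smooth_on_has_derivative:
  "smooth_on W f \<Longrightarrow> p \<in> W \<Longrightarrow> (f has_derivative frechet_derivative f (at p)) (at p)"
  unfolding smooth_on_def by (metis C_diff_on.simps(2) frechet_derivative_works)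

lemma smooth_on_frechet_derivative:
  "smooth_on W f \<Longrightarrow> smooth_on W (\<lambda>p. frechet_derivative f (at p) v)"
  unfolding smooth_on_def by (metis C_diff_on.simps(2))

lemma smooth_on_continuous: "smooth_on W f \<Longrightarrow> continuous_on W f"
  unfolding smooth_on_def by (metis C_diff_on.simps(1))

text \<open>For one real variable a tower of successive vector derivatives replaces the directional
  Frechet derivatives in \<open>C_diff_on\<close>.\<close>

lemma smooth_on_curveI:
  fixes G :: "nat \<Rightarrow> real \<Rightarrow> 'b::euclidean_space"
  assumes "open W" "\<And>n t. t \<in> W \<Longrightarrow> (G n has_vector_derivative G (Suc n) t) (at t)"
  shows "smooth_on W (G 0)"
proof -
  \<comment> \<open>Differentiating in the direction \<open>v\<close> multiplies the next member of
    the tower by \<open>v\<close>, hence the free scalar \<open>c\<close> in the induction.\<close>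
  have c: "C_diff_on n W (\<lambda>t. c *\<^sub>R G k t)" for n k c
  proof (induction n arbitrary: k c)
    case 0
    have "continuous_on W (G k)"
      using has_vector_derivative_continuous[OF assms(2)]
      by (meson continuous_at_imp_continuous_on)
    then show ?case by (auto intro: continuous_intros)
  next
    case (Suc n)
    have d: "((\<lambda>t. c *\<^sub>R G k t) has_derivative (\<lambda>v. (v * c) *\<^sub>R G (Suc k) t)) (at t)" if "t \<in> W" for t
      using has_derivative_scaleR_right[OF assms(2)[OF that, of k, unfolded has_vector_derivative_def], of c]
      by (simp add: mult.commute)
    have "C_diff_on n W (\<lambda>t. frechet_derivative (\<lambda>t. c *\<^sub>R G k t) (at t) v)" for v
      by (rule C_diff_on_cong[OF assms(1) _ Suc.IH[of "v * c" "Suc k"]])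
         (use frechet_derivative_at[OF d] in \<open>auto dest: fun_cong\<close>)
    then show ?case using d by (auto intro: differentiableI)
  qed
  show ?thesis unfolding smooth_on_def using c[of _ 1 0] by simp
qed

text \<open>
  Differentiating an identity \<open>g' t = \<psi> (p0 + t e + g t d)\<close> with smooth \<open>\<psi>\<close> again gives a derivative
  of this form, so \<open>g\<close> is smooth as soon as it is differentiable.
\<close>

lemma smooth_on_graph_curve:
  fixes \<psi> :: "'a::euclidean_space \<Rightarrow> real"
  assumes "open W" "smooth_on W \<psi>" "open T"
    and "\<And>t. t \<in> T \<Longrightarrow> p0 + t *\<^sub>R e + g t *\<^sub>R d \<in> W"
    and "\<And>t. t \<in> T \<Longrightarrow> (g has_real_derivative \<psi> (p0 + t *\<^sub>R e + g t *\<^sub>R d)) (at t)"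
  shows "smooth_on T (\<lambda>t. p0 + t *\<^sub>R e + g t *\<^sub>R d)"
proof -
  define \<gamma> where "\<gamma> = (\<lambda>t. p0 + t *\<^sub>R e + g t *\<^sub>R d)"
  \<comment> \<open>\<open>P (Suc n)\<close> is the derivative of \<open>P n\<close> in the
    direction \<open>e + \<psi> d\<close>, the velocity of the curve; so \<open>P n\<close> along
    the curve is the derivative of order \<open>Suc n\<close> of \<open>g\<close>.\<close>
  define P :: "nat \<Rightarrow> 'a \<Rightarrow> real" where
    "P = rec_nat \<psi> (\<lambda>_ q p. frechet_derivative q (at p) e + \<psi> p * frechet_derivative q (at p) d)"
  have P0: "P 0 = \<psi>" and PS: "P (Suc n) = (\<lambda>p. frechet_derivative (P n) (at p) e + \<psi> p * frechet_derivative (P n)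
      (at p) d)" for n
    by (simp_all add: P_def)
  have sm: "smooth_on W (P n)" for n
  proof (induction n)
    case (Suc n)
    then show ?case using smooth_on_frechet_derivative[OF Suc] assms(1,2)
      unfolding PS smooth_on_def by (auto intro!: C_diff_on_add C_diff_on_mult)
  qed (use assms P0 in auto)
  have \<gamma>': "(\<gamma> has_vector_derivative (e + \<psi> (\<gamma> t) *\<^sub>R d)) (at t)" if "t \<in> T" for t
    using assms(5)[OF that] unfolding \<gamma>_def
    by (auto intro!: derivative_eq_intros simp: has_vector_derivative_def has_field_derivative_def algebra_simps)
  have Pd: "((\<lambda>t. P n (\<gamma> t)) has_real_derivative P (Suc n) (\<gamma> t)) (at t)" if "t \<in> T" for n t
  proof -
    have "\<gamma> t \<in> W" using assms(4)[OF that] by (simp add: \<gamma>_def)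
    note D = smooth_on_has_derivative[OF sm[of n] this]
    have "((P n \<circ> \<gamma>) has_vector_derivative frechet_derivative (P n) (at (\<gamma> t)) (e + \<psi> (\<gamma> t) *\<^sub>R d)) (at t)"
      using vector_derivative_diff_chain_within[OF \<gamma>'[OF that] has_derivative_at_withinI[OF D]] .
    moreover have "frechet_derivative (P n) (at (\<gamma> t)) (e + \<psi> (\<gamma> t) *\<^sub>R d) = P (Suc n) (\<gamma> t)"
      using linear_add[OF has_derivative_linear[OF D]] linear_scale[OF has_derivative_linear[OF D]]
      by (simp add: PS)
    ultimately show ?thesis by (simp add: has_real_derivative_iff_has_vector_derivative o_def)
  qed
  \<comment> \<open>The affine part contributes \<open>e\<close> to the first derivative and nothing
    afterwards.\<close>
  define G where "G n t = (if n = 0 then \<gamma> t else if n = 1 then e + P 0 (\<gamma> t) *\<^sub>R d else P (n - 1) (\<gamma> t) *\<^sub>R d)" for n t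
  have G0: "G 0 = \<gamma>" by (auto simp: G_def)
  have "smooth_on T (G 0)"
  proof (rule smooth_on_curveI[OF assms(3)])
    fix n t assume t: "t \<in> T"
    have s: "((\<lambda>t. P k (\<gamma> t) *\<^sub>R d) has_vector_derivative P (Suc k) (\<gamma> t) *\<^sub>R d) (at t)" for k
      using has_vector_derivative_scaleR[OF Pd[OF t, of k] has_vector_derivative_const[of d "at t"]] by simp
    consider "n = 0" | "n = 1" | k where "n = Suc (Suc k)" by (metis One_nat_def not0_implies_Suc)
    then show "(G n has_vector_derivative G (Suc n) t) (at t)"
    proof cases
      case 1 then show ?thesis using \<gamma>'[OF t] by (simp add: G0) (simp add: G_def P0)
    next
      case 2
      have G1: "G (Suc 0) = (\<lambda>x. e + P 0 (\<gamma> x) *\<^sub>R d)" by (auto simp: G_def)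
      from 2 show ?thesis using has_vector_derivative_add[OF has_vector_derivative_const[of e "at t"] s[of 0]]
        by (simp add: G1) (simp add: G_def)
    next
      case 3
      have G2: "G (Suc (Suc k)) = (\<lambda>x. P (Suc k) (\<gamma> x) *\<^sub>R d)" by (auto simp: G_def)
      from 3 show ?thesis using s[of "Suc k"] by (simp add: G2) (simp add: G_def)
    qed
  qed
  then show ?thesis by (simp add: G0 \<gamma>_def)
qed

text \<open>Implicit function theorem in the plane through \<open>p0\<close> spanned by
  \<open>e\<close> and \<open>d\<close>. Strict monotonicity in the direction \<open>d\<close> and
  opposite signs at the two ends give \<open>g\<close>; its differentiability comes from the inverse
  of the map from \<open>(t, y)\<close> to \<open>(t, F)\<close>, and smoothness from the resulting
  formula for the derivative. The zero set is described in a whole box, because a hypersurface is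
  locally all of a level set.\<close>

lemma implicit_curve:
  fixes F :: "'a::euclidean_space \<Rightarrow> real"
  assumes W: "open W" and F: "smooth_on W F" and p0: "p0 \<in> W" "F p0 = 0"
    and nz: "frechet_derivative F (at p0) d \<noteq> 0"
  obtains \<delta> \<epsilon> g where "\<delta> > 0" "\<epsilon> > 0" "g 0 = 0"
    "smooth_on {-\<delta><..<\<delta>} (\<lambda>t. p0 + t *\<^sub>R e + g t *\<^sub>R d)"
    "\<And>t y. \<bar>t\<bar> < \<delta> \<Longrightarrow> \<bar>y\<bar> < \<epsilon> \<Longrightarrow> p0 + t *\<^sub>R e + y *\<^sub>R d \<in> W \<and> (F (p0 + t *\<^sub>R e + y *\<^sub>R d) = 0 \<longleftrightarrow> y = g t)"
    "\<And>t. \<bar>t\<bar> < \<delta> \<Longrightarrow> \<bar>g t\<bar> < \<epsilon>"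
    "\<And>t. \<bar>t\<bar> < \<delta> \<Longrightarrow> (g has_real_derivative
        - frechet_derivative F (at (p0 + t *\<^sub>R e + g t *\<^sub>R d)) e / frechet_derivative F (at (p0 + t *\<^sub>R e + g t *\<^sub>R
            d)) d) (at t)"
proof -
  \<comment> \<open>The sign that makes \<open>s * F\<close> increasing in the direction
    \<open>d\<close>.\<close>
  define s where "s = sgn (frechet_derivative F (at p0) d)"
  have s: "s \<noteq> 0" "s * s = 1" using nz by (auto simp: s_def sgn_if)
  define E where "E t y = p0 + t *\<^sub>R e + y *\<^sub>R d" for t y :: real
  define Fe where "Fe p = frechet_derivative F (at p) e" for p
  define Fd where "Fd p = frechet_derivative F (at p) d" for p
  have smd: "smooth_on W Fd" unfolding Fd_def[abs_def] by (rule smooth_on_frechet_derivative[OF F])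
  have sme: "smooth_on W Fe" unfolding Fe_def[abs_def] by (rule smooth_on_frechet_derivative[OF F])
  define W' where "W' = W \<inter> (\<lambda>p. s * Fd p) -` {0<..}"
  have W': "open W'"
    unfolding W'_def
    by (intro continuous_open_preimage continuous_intros smooth_on_continuous[OF smd] W)
  have E0: "E 0 0 = p0" by (simp add: E_def)
  have p0W: "p0 \<in> W'" using p0 nz by (auto simp: W'_def s_def Fd_def sgn_if)
  have cE: "continuous_on UNIV (\<lambda>z. E (fst z) (snd z))" unfolding E_def by (intro continuous_intros)
  then have "open ((\<lambda>z. E (fst z) (snd z)) -` W')" using W' by (rule open_vimage[rotated])
  moreover have "(0, 0) \<in> (\<lambda>z. E (fst z) (snd z)) -` W'" using E0 p0W by simp
  ultimately obtain A B where AB: "open A" "open B" "(0, 0) \<in> A \<times> B" "A \<times> B \<subseteq> (\<lambda>z. E (fst z) (snd z)) -` W'"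
    by (rule open_prod_elim)
  obtain r1 where r1: "r1 > 0" "ball 0 r1 \<subseteq> A" using AB openE[of A 0] by auto
  obtain r2 where r2: "r2 > 0" "ball 0 r2 \<subseteq> B" using AB openE[of B 0] by auto
  \<comment> \<open>Half of the radius, so that the closed range
    \<open>\<bar>y\<bar> \<le> \<epsilon>\<close> is still inside \<open>B\<close>.\<close>
  define \<epsilon> where "\<epsilon> = r2 / 2"
  have \<epsilon>: "\<epsilon> > 0" using r2 by (simp add: \<epsilon>_def)
  have inW': "E t y \<in> W'" if "\<bar>t\<bar> < r1" "\<bar>y\<bar> \<le> \<epsilon>" for t y
  proof -
    have "t \<in> A" "y \<in> B" using r1 r2 that by (auto simp: \<epsilon>_def subset_iff)
    then show ?thesis using AB(4) by auto
  qed
  have FD: "(F has_derivative frechet_derivative F (at (E t y))) (at (E t y))" if "\<bar>t\<bar> < r1" "\<bar>y\<bar> \<le> \<epsilon>" for t y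
    using smooth_on_has_derivative[OF F] inW'[OF that] by (auto simp: W'_def)
  have EF: "((\<lambda>z. F (E (fst z) (snd z))) has_derivative (\<lambda>h. fst h * Fe (E t y) + snd h * Fd (E t y))) (at (t, y))"
    if ty: "\<bar>t\<bar> < r1" "\<bar>y\<bar> \<le> \<epsilon>" for t y
  proof -
    have 1: "((\<lambda>z. E (fst z) (snd z)) has_derivative (\<lambda>h. fst h *\<^sub>R e + snd h *\<^sub>R d)) (at (t, y))"
      unfolding E_def by (auto intro!: derivative_eq_intros)
    have 2: "(F has_derivative frechet_derivative F (at (E t y))) (at ((\<lambda>z. E (fst z) (snd z)) (t, y)))"
      using FD[OF ty] by simp
    have "linear (frechet_derivative F (at (E t y)))" using FD[OF ty] has_derivative_linear by blast
    then have "frechet_derivative F (at (E t y)) (fst h *\<^sub>R e + snd h *\<^sub>R d) = fst h * Fe (E t y) + snd h * Fd (E t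
        y)" for h :: "real \<times> real"
      by (simp add: linear_add linear_scale Fe_def Fd_def)
    then show ?thesis using diff_chain_at[OF 1 2] by (simp add: o_def)
  qed
  define \<phi> where "\<phi> t y = s * F (E t y)" for t y
  have \<phi>y: "((\<lambda>y. \<phi> t y) has_real_derivative s * Fd (E t y)) (at y)" if ty: "\<bar>t\<bar> < r1" "\<bar>y\<bar> \<le> \<epsilon>" for t y
  proof -
    have "((\<lambda>y. (t, y)) has_derivative (\<lambda>h. (0, h))) (at y)" by (auto intro!: derivative_eq_intros)
    from diff_chain_at[OF this EF[OF ty]] have "((\<lambda>y. F (E t y)) has_derivative (\<lambda>h. h * Fd (E t y))) (at y)"
      by (simp add: o_def)
    then have "((\<lambda>y. F (E t y)) has_real_derivative Fd (E t y)) (at y)"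
      unfolding has_field_derivative_def by (simp only: mult_commute_abs)
    then show ?thesis unfolding \<phi>_def by (rule DERIV_cmult)
  qed
  have mono: "\<phi> t y1 < \<phi> t y2" if "\<bar>t\<bar> < r1" "\<bar>y1\<bar> \<le> \<epsilon>" "\<bar>y2\<bar> \<le> \<epsilon>" "y1 < y2" for t y1 y2
    using that(4)
  proof (rule DERIV_pos_imp_increasing)
    fix x assume "y1 \<le> x" "x \<le> y2"
    then have "\<bar>x\<bar> \<le> \<epsilon>" using that by auto
    then show "\<exists>z. (\<phi> t has_real_derivative z) (at x) \<and> 0 < z"
      using \<phi>y[OF that(1)] inW'[OF that(1)] by (auto simp: W'_def)
  qed
  have \<phi>0: "\<phi> 0 0 = 0" using p0 by (simp add: \<phi>_def E0)
  have ct: "continuous_on {-r1<..<r1} (\<lambda>t. \<phi> t y)" if "\<bar>y\<bar> \<le> \<epsilon>" for y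
  proof -
    have cE: "continuous_on {-r1<..<r1} (\<lambda>t. E t y)" unfolding E_def by (intro continuous_intros)
    have "E t y \<in> W" if "t \<in> {-r1<..<r1}" for t using inW'[of t y] that \<open>\<bar>y\<bar> \<le> \<epsilon>\<close> by (auto simp: W'_def)
    then have "continuous_on {-r1<..<r1} (\<lambda>t. F (E t y))"
      using continuous_on_compose2[OF smooth_on_continuous[OF F] cE] by blast
    then show ?thesis unfolding \<phi>_def by (intro continuous_intros)
  qed
  have "open ({-r1<..<r1} \<inter> (\<lambda>t. \<phi> t \<epsilon>) -` {0<..})" "open ({-r1<..<r1} \<inter> (\<lambda>t. \<phi> t (-\<epsilon>)) -` {..<0})"
    using \<epsilon> by (auto intro!: continuous_open_preimage ct)
  then have "open (({-r1<..<r1} \<inter> (\<lambda>t. \<phi> t \<epsilon>) -` {0<..}) \<inter> ({-r1<..<r1} \<inter> (\<lambda>t. \<phi> t (-\<epsilon>)) -` {..<0}))"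
    by (rule open_Int)
  moreover have "0 \<in> ({-r1<..<r1} \<inter> (\<lambda>t. \<phi> t \<epsilon>) -` {0<..}) \<inter> ({-r1<..<r1} \<inter> (\<lambda>t. \<phi> t (-\<epsilon>)) -` {..<0})"
    using mono[of 0 0 \<epsilon>] mono[of 0 "-\<epsilon>" 0] r1 \<epsilon> \<phi>0 by auto
  ultimately obtain \<delta> where \<delta>: "\<delta> > 0" "ball 0 \<delta> \<subseteq> ({-r1<..<r1} \<inter> (\<lambda>t. \<phi> t \<epsilon>) -` {0<..}) \<inter> ({-r1<..<r1} \<inter> (\<lambda>t. \<phi> t
      (-\<epsilon>)) -` {..<0})"
    by (rule openE)
  have \<delta>r: "\<bar>t\<bar> < r1" "\<phi> t \<epsilon> > 0" "\<phi> t (-\<epsilon>) < 0" if "\<bar>t\<bar> < \<delta>" for t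
  proof -
    have "t \<in> ball 0 \<delta>" using that by simp
    with \<delta>(2) have "t \<in> ({-r1<..<r1} \<inter> (\<lambda>t. \<phi> t \<epsilon>) -` {0<..}) \<inter> ({-r1<..<r1} \<inter> (\<lambda>t. \<phi> t (-\<epsilon>)) -` {..<0})" by blast
    then show "\<bar>t\<bar> < r1" "\<phi> t \<epsilon> > 0" "\<phi> t (-\<epsilon>) < 0" by auto
  qed
  have "\<exists>y. \<bar>y\<bar> < \<epsilon> \<and> \<phi> t y = 0" if t: "\<bar>t\<bar> < \<delta>" for t
  proof -
    have "continuous_on {-\<epsilon>..\<epsilon>} (\<phi> t)"
    proof (rule continuous_at_imp_continuous_on, rule ballI)
      fix x assume "x \<in> {-\<epsilon>..\<epsilon>}"
      then show "isCont (\<phi> t) x" using DERIV_isCont[OF \<phi>y[OF \<delta>r(1)[OF t], of x]] by auto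
    qed
    then obtain y where y: "-\<epsilon> \<le> y" "y \<le> \<epsilon>" "\<phi> t y = 0"
      using IVT'[of "\<phi> t" "-\<epsilon>" 0 \<epsilon>] \<delta>r[OF t] \<epsilon> by auto
    then have "y \<noteq> \<epsilon>" "y \<noteq> -\<epsilon>" using \<delta>r[OF t] by auto
    then show ?thesis using y by (intro exI[of _ y]) auto
  qed
  then obtain g where g: "\<And>t. \<bar>t\<bar> < \<delta> \<Longrightarrow> \<bar>g t\<bar> < \<epsilon> \<and> \<phi> t (g t) = 0" by metis
  have uniq: "\<phi> t y = 0 \<longleftrightarrow> y = g t" if "\<bar>t\<bar> < \<delta>" "\<bar>y\<bar> < \<epsilon>" for t y
    using mono[OF \<delta>r(1)[OF that(1)], of y "g t"] mono[OF \<delta>r(1)[OF that(1)], of "g t" y] g[OF that(1)] that(2)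
    by (metis linorder_neqE_linordered_idom less_irrefl less_imp_le)
  have F0: "F (E t y) = 0 \<longleftrightarrow> \<phi> t y = 0" for t y using s by (simp add: \<phi>_def)
  have Fd0: "Fd (E t y) \<noteq> 0" if "\<bar>t\<bar> < r1" "\<bar>y\<bar> \<le> \<epsilon>" for t y
    using inW'[OF that] by (auto simp: W'_def)
  have gd: "(g has_real_derivative - Fe (E t (g t)) / Fd (E t (g t))) (at t)" if t: "\<bar>t\<bar> < \<delta>" for t
  proof -
    \<comment> \<open>The inverse of \<open>\<Phi>\<close> on this box sends \<open>(t, 0)\<close>
      to \<open>(t, g t)\<close>; differentiating it differentiates \<open>g\<close>.\<close>
    define B where "B = {-\<delta><..<\<delta>} \<times> {-\<epsilon><..<\<epsilon>}"
    define \<Phi> where "\<Phi> z = (fst z, F (E (fst z) (snd z)))" for z :: "real \<times> real"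
    have inj: "inj_on \<Phi> B"
    proof (rule inj_onI)
      fix x y assume *: "x \<in> B" "y \<in> B" "\<Phi> x = \<Phi> y"
      then have "\<phi> (fst x) (snd x) = \<phi> (fst x) (snd y)" by (auto simp: \<Phi>_def \<phi>_def)
      moreover have "\<bar>fst x\<bar> < r1" "\<bar>snd x\<bar> \<le> \<epsilon>" "\<bar>snd y\<bar> \<le> \<epsilon>" using *(1,2) \<delta>r(1)[of "fst x"] by (auto simp: B_def)
      ultimately have "snd x = snd y"
        using mono[of "fst x" "snd x" "snd y"] mono[of "fst x" "snd y" "snd x"]
            by (metis linorder_neqE_linordered_idom less_irrefl)
      then show "x = y" using *(3) by (simp add: \<Phi>_def prod_eq_iff)
    qed
    define f' where "f' z h = (fst h, fst h * Fe (E (fst z) (snd z)) + snd h * Fd (E (fst z) (snd z)))" for z h ::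
        "real \<times> real"
    define g' where "g' z h = (fst h, (snd h - fst h * Fe (E (fst z) (snd z))) / Fd (E (fst z) (snd z)))" for z h
        :: "real \<times> real"
    have "(inv_into B \<Phi> has_derivative g' (t, g t)) (at (\<Phi> (t, g t)))"
    proof (rule has_derivative_inverse_on[where S = B and f = \<Phi> and f' = f' and g' = g' and x = "(t, g t)"])
      show "open B" by (auto simp: B_def intro: open_Times)
      show "(\<Phi> has_derivative f' x) (at x)" if "x \<in> B" for x
      proof -
        have *: "\<bar>fst x\<bar> < r1" "\<bar>snd x\<bar> \<le> \<epsilon>" using that \<delta>r(1)[of "fst x"] by (auto simp: B_def)
        show ?thesis unfolding \<Phi>_def f'_def
          using has_derivative_Pair[OF has_derivative_fst[OF has_derivative_ident] EF[OF *, unfolded prod.collapse]] .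
      qed
      show "inv_into B \<Phi> (\<Phi> x) = x" if "x \<in> B" for x using inj that by (rule inv_into_f_f)
      show "(t, g t) \<in> B" using g[OF t] t by (auto simp: B_def)
      show "f' (t, g t) \<circ> g' (t, g t) = id"
        using Fd0[of t "g t"] \<delta>r(1)[OF t] g[OF t] by (auto simp: f'_def g'_def fun_eq_iff)
    qed
    moreover have "\<Phi> (t, g t) = (t, 0)" using g[OF t] F0 by (simp add: \<Phi>_def)
    ultimately have 1: "(inv_into B \<Phi> has_derivative g' (t, g t)) (at (t, 0))" by simp
    have "((\<lambda>t. (t, 0::real)) has_derivative (\<lambda>h. (h, 0))) (at t)" by (auto intro!: derivative_eq_intros)
    from diff_chain_at[OF this 1] have "((\<lambda>t. inv_into B \<Phi> (t, 0)) has_derivative (\<lambda>h. g' (t, g t) (h, 0))) (at t)"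
      by (simp add: o_def)
    from has_derivative_snd[OF this] have 2: "((\<lambda>t. snd (inv_into B \<Phi> (t, 0))) has_derivative (\<lambda>h. h * (- Fe (E t
        (g t)) / Fd (E t (g t))))) (at t)"
      by (simp add: g'_def)
    have "(g has_derivative (\<lambda>h. h * (- Fe (E t (g t)) / Fd (E t (g t))))) (at t)"
    proof (rule has_derivative_transform_within_open[OF 2, of "{-\<delta><..<\<delta>}"])
      fix x assume "x \<in> {-\<delta><..<\<delta>}"
      then have x: "\<bar>x\<bar> < \<delta>" by auto
      have "(x, g x) \<in> B" "\<Phi> (x, g x) = (x, 0)" using g[OF x] x F0 by (auto simp: B_def \<Phi>_def)
      then have "inv_into B \<Phi> (x, 0) = (x, g x)" using inv_into_f_f[OF inj] by metis
      then show "snd (inv_into B \<Phi> (x, 0)) = g x" by simp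
    qed (use t in auto)
    then show ?thesis unfolding has_field_derivative_def by (simp only: mult_commute_abs)
  qed
  show ?thesis
  proof (rule that[of \<delta> \<epsilon> g])
    show "g 0 = 0" using uniq[of 0 0] \<delta> \<epsilon> \<phi>0 by auto
    define \<psi> where "\<psi> p = - 1 * (Fe p * inverse (Fd p))" for p
    have sm\<psi>: "smooth_on W' \<psi>"
      unfolding smooth_on_def
    proof
      fix n
      have "C_diff_on n W' Fe" "C_diff_on n W' Fd"
        using sme smd C_diff_on_subset[of n W _ W'] by (auto simp: smooth_on_def W'_def)
      then show "C_diff_on n W' \<psi>" unfolding \<psi>_def
        by (intro C_diff_on_mult C_diff_on_const C_diff_on_inverse W') (auto simp: W'_def)
    qed
    show "smooth_on {-\<delta><..<\<delta>} (\<lambda>t. p0 + t *\<^sub>R e + g t *\<^sub>R d)"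
    proof (rule smooth_on_graph_curve[OF W' sm\<psi>])
      fix t assume "t \<in> {-\<delta><..<\<delta>}"
      then have t: "\<bar>t\<bar> < \<delta>" by auto
      show "p0 + t *\<^sub>R e + g t *\<^sub>R d \<in> W'" using inW'[of t "g t"] \<delta>r(1)[OF t] g[OF t] by (simp add: E_def)
      show "(g has_real_derivative \<psi> (p0 + t *\<^sub>R e + g t *\<^sub>R d)) (at t)"
        using gd[OF t] by (simp add: \<psi>_def E_def divide_inverse)
    qed auto
    show "p0 + t *\<^sub>R e + y *\<^sub>R d \<in> W \<and> (F (p0 + t *\<^sub>R e + y *\<^sub>R d) = 0) = (y = g t)" if "\<bar>t\<bar> < \<delta>" "\<bar>y\<bar> < \<epsilon>" for t y
      using inW'[of t y] \<delta>r(1)[OF that(1)] that uniq[OF that] F0[of t y] by (auto simp: W'_def E_def)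
  qed (use \<delta> \<epsilon> g gd in \<open>auto simp: Fe_def Fd_def E_def\<close>)
qed

section \<open>Tangent vectors realized by explicit curves\<close>

lemma tangent_spaceI:
  assumes "e > 0" "smooth_on {-e<..<e} \<gamma>" "\<And>t. \<bar>t\<bar> < e \<Longrightarrow> \<gamma> t \<in> A" "\<gamma> 0 = p" "(\<gamma> has_vector_derivative v) (at 0)"
  shows "v \<in> tangent_space A p"
  unfolding tangent_space_def using assms by (auto intro!: exI[of _ \<gamma>] exI[of _ e])

lemma tangent_space_mono: "A \<subseteq> B \<Longrightarrow> tangent_space A p \<subseteq> tangent_space B p"
  unfolding tangent_space_def by fast

lemma tangent_space_affine:
  fixes p v :: "'a::euclidean_space"
  assumes "e > 0" "\<And>t. \<bar>t\<bar> < e \<Longrightarrow> p + t *\<^sub>R v \<in> A"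
  shows "v \<in> tangent_space A p"
proof (rule tangent_spaceI[OF assms(1)])
  have 1: "((\<lambda>t. p + t *\<^sub>R v) has_vector_derivative v) (at t)" for t
    by (auto intro!: derivative_eq_intros)
  define G where "G n = (if n = 0 then \<lambda>t. p + t *\<^sub>R v else if n = 1 then \<lambda>_. v else (\<lambda>_. 0))" for n :: nat
  have "smooth_on {-e<..<e} (G 0)"
    by (rule smooth_on_curveI) (use 1 in \<open>auto simp: G_def\<close>)
  then show "smooth_on {-e<..<e} (\<lambda>t. p + t *\<^sub>R v)" by (simp add: G_def)
  show "((\<lambda>t. p + t *\<^sub>R v) has_vector_derivative v) (at 0)" by (rule 1)
qed (use assms in auto)

text \<open>The great circle through \<open>x\<close> with velocity \<open>\<xi>\<close> is the
  required curve. For \<open>\<xi> = 0\<close> both \<open>\<omega>\<close> and \<open>y\<close> are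
  zero and the curve is constant.\<close>

lemma sphere_tangent:
  fixes x \<xi> :: "real^3" and U V :: real
  assumes "norm x = 1" "\<xi> \<bullet> x = 0" and A: "\<And>y. norm y = 1 \<Longrightarrow> (U, V, y) \<in> A"
  shows "(0, 0, \<xi>) \<in> tangent_space A (U, V, x)"
proof -
  define \<omega> where "\<omega> = norm \<xi>"
  define y where "y = \<xi> /\<^sub>R \<omega>"
  have xy: "x \<bullet> y = 0" "\<omega> *\<^sub>R y = \<xi>" using assms
    by (auto simp: y_def \<omega>_def inner_commute) (cases "\<xi> = 0"; simp)
  have x1: "x \<bullet> x = 1" using assms by (simp add: norm_eq_1)
  have y1: "y \<bullet> y = 1 \<or> y = 0"
    by (auto simp: y_def \<omega>_def power2_norm_eq_inner[symmetric] power2_eq_square)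
  define \<sigma> where "\<sigma> t = cos (\<omega> * t) *\<^sub>R x + sin (\<omega> * t) *\<^sub>R y" for t
  have n1: "norm (\<sigma> t) = 1" for t
  proof (cases "\<omega> = 0")
    case True then show ?thesis using assms(1) by (simp add: \<sigma>_def)
  next
    case False
    then have "y \<bullet> y = 1" using y1 xy(2) \<omega>_def by auto
    then have "\<sigma> t \<bullet> \<sigma> t = (cos (\<omega> * t))\<^sup>2 + (sin (\<omega> * t))\<^sup>2"
      using xy x1 by (simp add: \<sigma>_def inner_add_left inner_add_right inner_commute power2_eq_square)
    then show ?thesis by (simp add: norm_eq_1)
  qed
  define G where "G n t = (if n = 0 then (U, V, \<sigma> t) else
    (0, 0, \<omega> ^ n *\<^sub>R (cos (\<omega> * t + real n * (pi/2)) *\<^sub>R x + sin (\<omega> * t + real n * (pi/2)) *\<^sub>R y)))" for n t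
  \<comment> \<open>Each differentiation multiplies by \<open>\<omega>\<close> and advances the
    phase by a quarter turn, which gives all derivatives in closed form.\<close>
  define K where "K n t = \<omega> ^ n *\<^sub>R (cos (\<omega> * t + real n * (pi/2)) *\<^sub>R x + sin (\<omega> * t + real n * (pi/2)) *\<^sub>R y)" for n t
  have K: "(K n has_vector_derivative K (Suc n) t) (at t)" for n t
  proof -
    have e: "\<omega> * t + real (Suc n) * (pi/2) = (\<omega> * t + real n * (pi/2)) + pi/2"
      by (simp add: algebra_simps add_divide_distrib)
    have c: "cos (\<omega> * t + real (Suc n) * (pi/2)) = - sin (\<omega> * t + real n * (pi/2))"
            "sin (\<omega> * t + real (Suc n) * (pi/2)) = cos (\<omega> * t + real n * (pi/2))"
      by (simp_all only: e cos_add sin_add cos_pi_half sin_pi_half) simp_all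
    have "(K n has_vector_derivative \<omega> ^ n *\<^sub>R ((- sin (\<omega> * t + real n * (pi/2)) * \<omega>) *\<^sub>R x + (cos (\<omega> * t + real n
        * (pi/2)) * \<omega>) *\<^sub>R y)) (at t)"
      unfolding K_def
      by (auto intro!: derivative_eq_intros simp: has_vector_derivative_def has_field_derivative_def algebra_simps)
    then show ?thesis by (subst K_def, simp only: c) (simp add: algebra_simps)
  qed
  have Kp: "((\<lambda>t. (a, b, K n t)) has_vector_derivative (0, 0, K (Suc n) t)) (at t)" for a b :: real and n t
    using has_vector_derivative_Pair[OF has_vector_derivative_const has_vector_derivative_Pair[OF
        has_vector_derivative_const K]] .
  have K0: "\<sigma> = K 0" by (auto simp: \<sigma>_def K_def fun_eq_iff)
  have G: "G 0 = (\<lambda>t. (U, V, K 0 t))" "G (Suc n) = (\<lambda>t. (0, 0, K (Suc n) t))" for n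
    by (auto simp: G_def K0 fun_eq_iff) (auto simp: K_def)
  have GG: "(G n has_vector_derivative G (Suc n) t) (at t)" for n t
    by (cases n) (simp_all add: G Kp)
  show ?thesis
  proof (rule tangent_spaceI[of 1 "G 0"])
    show "smooth_on {-1<..<1} (G 0)" by (rule smooth_on_curveI) (use GG in auto)
    show "G 0 t \<in> A" for t using A[OF n1[of t]] by (simp add: G K0)
    show "G 0 0 = (U, V, x)" by (simp add: G K_def)
    show "(G 0 has_vector_derivative (0, 0, \<xi>)) (at 0)"
    proof -
      have "K 1 0 = \<xi>" using xy by (simp add: K_def)
      then show ?thesis using GG[of 0 0] by (simp add: G)
    qed
  qed auto
qed

lemma has_vector_derivative_components:
  assumes "(\<gamma> has_vector_derivative (a, b, \<xi>)) (at t within T)"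
  shows "((\<lambda>t. fst (\<gamma> t)) has_vector_derivative a) (at t within T)"
    "((\<lambda>t. fst (snd (\<gamma> t))) has_vector_derivative b) (at t within T)"
    "((\<lambda>t. snd (snd (\<gamma> t))) has_vector_derivative \<xi>) (at t within T)"
  using bounded_linear.has_vector_derivative[OF bounded_linear_fst assms]
    bounded_linear.has_vector_derivative[OF bounded_linear_fst bounded_linear.has_vector_derivative[OF
        bounded_linear_snd assms]]
    bounded_linear.has_vector_derivative[OF bounded_linear_snd bounded_linear.has_vector_derivative[OF
        bounded_linear_snd assms]]
  by simp_all

text \<open>Differentiate the constraint \<open>x \<bullet> x = 1\<close> along a curve.\<close>

lemma tangent_kruskal_orth:
  assumes "(a, b, \<xi>) \<in> tangent_space (kruskal M) (U, V, x)"
  shows "\<xi> \<bullet> x = 0"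
proof -
  obtain \<gamma> e where g: "e > 0" "\<gamma> ` {-e<..<e} \<subseteq> kruskal M" "\<gamma> 0 = (U, V, x)"
    "(\<gamma> has_vector_derivative (a, b, \<xi>)) (at (0::real))"
    using assms by (auto simp: tangent_space_def)
  define \<sigma> where "\<sigma> t = snd (snd (\<gamma> t))" for t
  have s: "(\<sigma> has_vector_derivative \<xi>) (at 0)"
    using has_vector_derivative_components(3)[OF g(4)] by (simp add: \<sigma>_def[abs_def])
  have "((\<lambda>t. \<sigma> t \<bullet> \<sigma> t) has_real_derivative (2 * (\<xi> \<bullet> x))) (at 0)"
  proof -
    have "(\<sigma> has_derivative (\<lambda>t. t *\<^sub>R \<xi>)) (at 0)" using s by (simp add: has_vector_derivative_def)
    from has_derivative_inner[OF this this] g(3) show ?thesis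
      by (auto simp: has_field_derivative_def \<sigma>_def inner_commute algebra_simps elim!: has_derivative_eq_rhs)
  qed
  moreover have "((\<lambda>t. \<sigma> t \<bullet> \<sigma> t) has_real_derivative 0) (at 0)"
  proof (rule has_field_derivative_transform_within_open[OF DERIV_const[of 1], of "{-e<..<e}"])
    fix y assume "y \<in> {-e<..<e}"
    then have "\<gamma> y \<in> kruskal M" using g(2) by (auto simp: image_subset_iff)
    then show "1 = \<sigma> y \<bullet> \<sigma> y" by (auto simp: kruskal_def \<sigma>_def norm_eq_1)
  qed (use g in auto)
  ultimately show ?thesis using DERIV_unique by fastforce
qed

lemma smooth_on_add_const: "open W \<Longrightarrow> smooth_on W f \<Longrightarrow> smooth_on W (\<lambda>p. f p + c)"
  unfolding smooth_on_def using C_diff_on_add C_diff_on_const by blast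

section \<open>The radius as a function of \<open>U V\<close>\<close>

definition kappa :: "real \<Rightarrow> real \<Rightarrow> real" where
  "kappa M r = (r - 2 * M) * exp (r / (2 * M))"

text \<open>Stated like \<open>radius\<close>, so that \<open>radius M (U, V, x)\<close> becomes
  \<open>rho M (U * V)\<close> by unfolding alone.\<close>

definition rho :: "real \<Rightarrow> real \<Rightarrow> real" where
  "rho M y = (THE r. r > 0 \<and> kappa M r = y)"

lemma radius_rho: "radius M (U, V, x) = rho M (U * V)"
  by (simp add: rho_def kappa_def)

lemma kappa_deriv:
  assumes "M > 0"
  shows "(kappa M has_real_derivative r / (2 * M) * exp (r / (2 * M))) (at r)"
  unfolding kappa_def[abs_def] using assms
  by (auto intro!: derivative_eq_intros simp: field_simps)

lemma kappa_mono:
  assumes "M > 0" "0 \<le> x" "x < y"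
  shows "kappa M x < kappa M y"
proof -
  have "continuous_on {x..y} (kappa M)"
    using kappa_deriv[OF assms(1)] by (meson DERIV_isCont continuous_at_imp_continuous_on)
  from DERIV_pos_imp_increasing_open[OF assms(3) _ this] show ?thesis
    using kappa_deriv[OF assms(1)] assms by (metis divide_pos_pos exp_gt_zero le_less_trans less_imp_le
        mult_pos_pos zero_less_numeral)
qed

lemma kappa_surj:
  assumes "M > 0" "y > - 2 * M"
  obtains r where "r > 0" "kappa M r = y"
proof -
  \<comment> \<open>There \<open>kappa\<close> equals \<open>\<bar>y\<bar>\<close> times an
    exponential that is at least \<open>1\<close>.\<close>
  define R where "R = 2 * M + \<bar>y\<bar>"
  have "kappa M R \<ge> y"
  proof -
    have "\<bar>y\<bar> * exp (R / (2 * M)) \<ge> \<bar>y\<bar> * 1"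
      using assms by (intro mult_left_mono) (auto simp: R_def)
    then show ?thesis by (simp add: kappa_def R_def)
  qed
  moreover have "kappa M 0 = - 2 * M" by (simp add: kappa_def)
  moreover have "continuous_on {0..R} (kappa M)"
    using kappa_deriv[OF assms(1)] by (meson DERIV_isCont continuous_at_imp_continuous_on)
  ultimately obtain r where "0 \<le> r" "kappa M r = y"
    using IVT'[of "kappa M" 0 y R] assms by (auto simp: R_def)
  moreover have "r \<noteq> 0" using \<open>kappa M 0 = _\<close> assms calculation by auto
  ultimately show ?thesis using that[of r] by auto
qed

lemma rho_kappa: "M > 0 \<Longrightarrow> r > 0 \<Longrightarrow> rho M (kappa M r) = r"
  unfolding rho_def using kappa_mono[of M]
  by (intro the_equality) (auto, metis less_eq_real_def linorder_neqE_linordered_idom less_irrefl)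

lemma rho_pos: "M > 0 \<Longrightarrow> y > - 2 * M \<Longrightarrow> rho M y > 0"
  and kappa_rho: "M > 0 \<Longrightarrow> y > - 2 * M \<Longrightarrow> kappa M (rho M y) = y"
  using kappa_surj[of M y] rho_kappa by metis+

lemma kappa_gt: "M > 0 \<Longrightarrow> r > 0 \<Longrightarrow> kappa M r > - 2 * M"
  using kappa_mono[of M 0 r] by (simp add: kappa_def)

lemma rho_deriv:
  assumes "M > 0" "y > - 2 * M"
  shows "(rho M has_real_derivative 2 * M * exp (- rho M y / (2 * M)) / rho M y) (at y)"
proof -
  define r where "r = rho M y"
  have r: "r > 0" "kappa M r = y" using rho_pos kappa_rho assms by (auto simp: r_def)
  define d where "d r = r / (2 * M) * exp (r / (2 * M))" for r
  have "d r \<noteq> 0" using r assms by (simp add: d_def)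
  have "(rho M has_derivative (*) (inverse (d r))) (at (kappa M r))"
  proof (rule has_derivative_inverse_on[where S = "{0<..}" and f = "kappa M" and f' = "\<lambda>r. (*) (d r)"
        and g' = "\<lambda>r. (*) (inverse (d r))" and x = r])
    show "(kappa M has_derivative (*) (d x)) (at x)" for x
      using kappa_deriv[OF assms(1), of x] by (simp add: has_field_derivative_def d_def)
  qed (use rho_kappa assms r \<open>d r \<noteq> 0\<close> in auto)
  moreover have "inverse (d r) = 2 * M * exp (- r / (2 * M)) / r"
    using r assms by (simp add: d_def exp_minus field_simps)
  ultimately show ?thesis by (simp add: has_field_derivative_def r r_def[symmetric])
qed

lemma metric_eq:
  "metric M (U, V, x) (a, b, \<xi>) (a', b', \<xi>') =
    8 * M\<^sup>2 * exp (- rho M (U * V) / (2 * M)) / rho M (U * V) * (a * b' + b * a') + (rho M (U * V))\<^sup>2 * (\<xi> \<bullet> \<xi>')"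
  by (simp only: metric.simps radius_rho)

declare metric.simps [simp del] radius.simps [simp del]

lemma kruskal_iff: "(U, V, x) \<in> kruskal M \<longleftrightarrow> U * V > - 2 * M \<and> norm x = 1"
  by (auto simp: kruskal_def)

lemma rotation_transitive:
  fixes x y :: "real^3"
  assumes "norm x = 1" "norm y = 1"
  obtains Q where "rotation_matrix Q" "Q *v x = y"
proof -
  obtain f where f: "orthogonal_transformation f" "det (matrix f) = 1" "f x = y"
    using rotation_exists_1[of x y] assms by auto
  then have "rotation_matrix (matrix f)"
    using orthogonal_transformation_matrix by (auto simp: rotation_matrix_def)
  moreover have "matrix f *v x = y"
    using matrix_works[of f] orthogonal_transformation_linear[OF f(1)] f(3) by (simp add: linear_matrix_vector_mul_eq)
  ultimately show ?thesis using that by blast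
qed

section \<open>Spherically symmetric spacelike hypersurfaces\<close>

lemma level_set_tangent:
  assumes "open W" "p \<in> W" "smooth_on W F" "\<And>q. q \<in> S \<inter> W \<Longrightarrow> F q = (0::real)" "v \<in> tangent_space S p"
  shows "frechet_derivative F (at p) v = 0"
proof -
  obtain \<gamma> e where g: "e > 0" "\<gamma> ` {-e<..<e} \<subseteq> S" "\<gamma> 0 = p" "smooth_on {-e<..<e} \<gamma>"
    "(\<gamma> has_vector_derivative v) (at (0::real))"
    using assms(5) by (auto simp: tangent_space_def)
  define T where "T = {-e<..<e} \<inter> \<gamma> -` W"
  have T: "open T" "0 \<in> T"
    unfolding T_def using g assms smooth_on_continuous[OF g(4)] by (auto intro!: continuous_open_preimage)
  have "(F has_derivative frechet_derivative F (at p)) (at (\<gamma> 0))"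
    using smooth_on_has_derivative[OF assms(3,2)] g by simp
  from vector_derivative_diff_chain_within[OF g(5) has_derivative_at_withinI[OF this]]
  have "((F \<circ> \<gamma>) has_vector_derivative frechet_derivative F (at p) v) (at 0)" .
  moreover have "((F \<circ> \<gamma>) has_vector_derivative 0) (at 0)"
  proof (rule has_vector_derivative_transform_within_open[OF has_vector_derivative_const[of 0] T])
    fix t assume "t \<in> T"
    then have "\<gamma> t \<in> S \<inter> W" using g(2) by (auto simp: T_def)
    then show "0 = (F \<circ> \<gamma>) t" using assms(4) by simp
  qed
  ultimately show ?thesis using vector_derivative_unique_at by blast
qed

locale sym_surface =
  fixes M :: real and S :: "event set"
  assumes M: "M > 0" and spacelike: "spacelike_hypersurface M S" and sym: "spherically_symmetric S"
begin

lemma S_kruskal: "S \<subseteq> kruskal M"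
  using spacelike by (auto simp: spacelike_hypersurface_def smooth_hypersurface_def)

lemma sphere_fill: "(U, V, x) \<in> S \<Longrightarrow> norm y = 1 \<Longrightarrow> (U, V, y) \<in> S"
  using rotation_transitive[of x y] sym S_kruskal
  unfolding spherically_symmetric_def by (metis kruskal_iff subsetD)

lemma metric_pos:
  assumes "p \<in> S" "v \<in> tangent_space S p" "v \<noteq> 0"
  shows "metric M p v v > 0"
  using assms spacelike by (auto simp: spacelike_hypersurface_def)

text \<open>In the box around \<open>(U0, V0)\<close> all of \<open>S\<close> is the graph, not only
  one sheet of it. The tangent vector is recorded because it has to come from a smooth curve,
  whereas only continuity of \<open>g\<close> and its derivative at \<open>U0\<close> are
  kept.\<close>

definition local_graph :: "real \<Rightarrow> real \<Rightarrow> real \<Rightarrow> real \<Rightarrow> (real \<Rightarrow> real) \<Rightarrow> real \<Rightarrow> bool" where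
  "local_graph U0 V0 \<delta> \<epsilon> g g' \<longleftrightarrow> \<delta> > 0 \<and> \<epsilon> > 0 \<and> g' > 0 \<and> g U0 = V0 \<and>
     (\<forall>U. \<bar>U - U0\<bar> < \<delta> \<longrightarrow> \<bar>g U - V0\<bar> < \<epsilon>) \<and> continuous_on {U0-\<delta><..<U0+\<delta>} g \<and>
     (g has_real_derivative g') (at U0) \<and>
     (\<forall>U V x. \<bar>U - U0\<bar> < \<delta> \<longrightarrow> \<bar>V - V0\<bar> < \<epsilon> \<longrightarrow> norm x = 1 \<longrightarrow> ((U, V, x) \<in> S \<longleftrightarrow> V = g U)) \<and>
     (\<forall>x. norm x = 1 \<longrightarrow> (1, g', 0) \<in> tangent_space S (U0, V0, x))"

text \<open>The differential of a level function of \<open>S\<close> is nonzero on some vector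
  tangent to the extension, but it kills the spherical vectors, which are tangent to
  \<open>S\<close> by symmetry. So its \<open>U\<close>- or its \<open>V\<close>-component is
  nonzero, and a vanishing \<open>V\<close>-component would make the null vector
  \<open>\<partial>\<^sub>V\<close> tangent to \<open>S\<close>.\<close>

lemma local_graph_exists:
  assumes S: "(U0, V0, x0) \<in> S"
  obtains \<delta> \<epsilon> g g' where "local_graph U0 V0 \<delta> \<epsilon> g g'"
proof -
  define p0 where "p0 = (U0, V0, x0)"
  have x0: "norm x0 = 1" using S S_kruskal kruskal_iff by blast
  obtain W and F :: "event \<Rightarrow> real" where W0: "open W" "p0 \<in> W" "smooth_on W F"
    "S \<inter> W = {q \<in> kruskal M \<inter> W. F q = 0}"
    "\<forall>q\<in>S \<inter> W. \<exists>v\<in>tangent_space (kruskal M) q. frechet_derivative F (at q) v \<noteq> 0"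
  proof -
    have "\<forall>p\<in>S. \<exists>W (F :: event \<Rightarrow> real). open W \<and> p \<in> W \<and> smooth_on W F \<and>
        S \<inter> W = {q \<in> kruskal M \<inter> W. F q = 0} \<and>
        (\<forall>q\<in>S \<inter> W. \<exists>v\<in>tangent_space (kruskal M) q. frechet_derivative F (at q) v \<noteq> 0)"
      using spacelike unfolding spacelike_hypersurface_def smooth_hypersurface_def by blast
    from bspec[OF this S] show thesis using that unfolding p0_def by blast
  qed
  \<comment> \<open>Inside \<open>W1\<close> a point whose last component is a unit vector belongs
    to the extension, so membership in \<open>S\<close> is just \<open>F = 0\<close>.\<close>
  define W1 where "W1 = W \<inter> (\<lambda>q. fst q * fst (snd q)) -` {-2 * M<..}"
  have W1: "open W1"
    unfolding W1_def by (intro open_Int W0 open_vimage continuous_intros)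
  have p0S: "p0 \<in> S" using S by (simp add: p0_def)
  have p0W: "p0 \<in> W1" using S S_kruskal W0 by (auto simp: W1_def p0_def kruskal_iff)
  have smW1: "smooth_on W1 F" using W0(3) C_diff_on_subset unfolding smooth_on_def W1_def by blast
  have F0: "F p0 = 0" using W0(2,4) p0S by blast
  have inS: "(U, V, x0) \<in> S \<longleftrightarrow> F (U, V, x0) = 0" if "(U, V, x0) \<in> W1" for U V
  proof -
    have "(U, V, x0) \<in> kruskal M \<inter> W" using that x0 by (auto simp: W1_def kruskal_iff)
    then show ?thesis using W0(4) by blast
  qed
  have lin: "linear (frechet_derivative F (at p0))"
    using smooth_on_has_derivative[OF W0(3,2)] has_derivative_linear by blast
  obtain v where v: "v \<in> tangent_space (kruskal M) p0" "frechet_derivative F (at p0) v \<noteq> 0"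
    using W0(2,5) p0S by blast
  obtain a b \<xi> where abx: "v = (a, b, \<xi>)" by (cases v) auto
  have "\<xi> \<bullet> x0 = 0" using tangent_kruskal_orth v(1) by (simp add: abx p0_def)
  then have "(0, 0, \<xi>) \<in> tangent_space S p0"
    unfolding p0_def using sphere_tangent[OF x0] sphere_fill[OF S] by blast
  then have "frechet_derivative F (at p0) (0, 0, \<xi>) = 0"
    using level_set_tangent[OF W0(1,2,3)] W0(4) by blast
  moreover have "v = a *\<^sub>R (1, 0, 0) + b *\<^sub>R (0, 1, 0) + (0, 0, \<xi>)" by (simp add: abx)
  ultimately have vv: "a * frechet_derivative F (at p0) (1, 0, 0) + b * frechet_derivative F (at p0) (0, 1, 0) \<noteq> 0"
    using v(2) lin by (simp only: linear_add[OF lin] linear_scale[OF lin]) simp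
  have dV: "frechet_derivative F (at p0) (0, 1, 0) \<noteq> 0"
  proof
    \<comment> \<open>Then \<open>S\<close> is locally a graph of \<open>U\<close> over
      \<open>V\<close> with slope zero at \<open>p0\<close>, so the null direction
      \<open>(0, 1, 0)\<close> is tangent to a spacelike hypersurface.\<close>
    assume dV0: "frechet_derivative F (at p0) (0, 1, 0) = 0"
    then have dU: "frechet_derivative F (at p0) (1, 0, 0) \<noteq> 0" using vv by auto
    obtain \<delta> \<epsilon> g where g: "\<delta> > 0" "\<epsilon> > 0" "g 0 = 0"
      "smooth_on {-\<delta><..<\<delta>} (\<lambda>t. p0 + t *\<^sub>R (0, 1, 0) + g t *\<^sub>R (1, 0, 0))"
      "\<And>t y. \<bar>t\<bar> < \<delta> \<Longrightarrow> \<bar>y\<bar> < \<epsilon> \<Longrightarrow> p0 + t *\<^sub>R (0, 1, 0) + y *\<^sub>R (1, 0, 0) \<in> W1 \<and> (F (p0 + t *\<^sub>R (0, 1, 0) + y *\<^sub>R (1,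
          0, 0)) = 0 \<longleftrightarrow> y = g t)"
      "\<And>t. \<bar>t\<bar> < \<delta> \<Longrightarrow> \<bar>g t\<bar> < \<epsilon>"
      "\<And>t. \<bar>t\<bar> < \<delta> \<Longrightarrow> (g has_real_derivative
        - frechet_derivative F (at (p0 + t *\<^sub>R (0, 1, 0) + g t *\<^sub>R (1, 0, 0))) (0, 1, 0) / frechet_derivative F (at
            (p0 + t *\<^sub>R (0, 1, 0) + g t *\<^sub>R (1, 0, 0))) (1, 0, 0)) (at t)"
      using implicit_curve[OF W1 smW1 p0W F0 dU, of "(0, 1, 0)" thesis] by blast
    have "(0, 1, 0) \<in> tangent_space S p0"
    proof (rule tangent_spaceI[OF g(1) g(4)])
      show "p0 + t *\<^sub>R (0, 1, 0) + g t *\<^sub>R (1, 0, 0) \<in> S" if "\<bar>t\<bar> < \<delta>" for t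
        using g(5)[OF that g(6)[OF that]] inS[of "U0 + g t" "V0 + t"] by (simp add: p0_def)
      have "(g has_real_derivative 0) (at 0)" using g(7)[of 0] g(1,3) dV0 by (simp add: zero_prod_def[symmetric])
      then have g0: "(g has_derivative (\<lambda>h. h * 0)) (at 0)" by (simp only: has_field_derivative_def mult_commute_abs)
      show "((\<lambda>t. p0 + t *\<^sub>R (0, 1, 0) + g t *\<^sub>R (1, 0, 0)) has_vector_derivative (0, 1, 0)) (at 0)"
        unfolding has_vector_derivative_def by (rule derivative_eq_intros g0 refl | simp add: zero_prod_def)+
    qed (use g in \<open>auto simp: zero_prod_def[symmetric]\<close>)
    then have "metric M p0 (0, 1, 0) (0, 1, 0) > 0" using metric_pos[OF p0S] by (auto simp: zero_prod_def)
    then show False by (simp add: p0_def metric_eq)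
  qed
  obtain \<delta> \<epsilon> g where g: "\<delta> > 0" "\<epsilon> > 0" "g 0 = 0"
      "smooth_on {-\<delta><..<\<delta>} (\<lambda>t. p0 + t *\<^sub>R (1, 0, 0) + g t *\<^sub>R (0, 1, 0))"
      "\<And>t y. \<bar>t\<bar> < \<delta> \<Longrightarrow> \<bar>y\<bar> < \<epsilon> \<Longrightarrow> p0 + t *\<^sub>R (1, 0, 0) + y *\<^sub>R (0, 1, 0) \<in> W1 \<and> (F (p0 + t *\<^sub>R (1, 0, 0) + y *\<^sub>R (0,
          1, 0)) = 0 \<longleftrightarrow> y = g t)"
      "\<And>t. \<bar>t\<bar> < \<delta> \<Longrightarrow> \<bar>g t\<bar> < \<epsilon>"
      "\<And>t. \<bar>t\<bar> < \<delta> \<Longrightarrow> (g has_real_derivative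
        - frechet_derivative F (at (p0 + t *\<^sub>R (1, 0, 0) + g t *\<^sub>R (0, 1, 0))) (1, 0, 0) / frechet_derivative F (at
            (p0 + t *\<^sub>R (1, 0, 0) + g t *\<^sub>R (0, 1, 0))) (0, 1, 0)) (at t)"
    using implicit_curve[OF W1 smW1 p0W F0 dV, of "(1, 0, 0)" thesis] by blast
  obtain g' where g': "(g has_real_derivative g') (at 0)" using g(7)[of 0] g(1) by auto
  have tan: "(1, g', 0) \<in> tangent_space S (U0, V0, x)" if x: "norm x = 1" for x
  proof (rule tangent_spaceI[OF g(1)])
    have "smooth_on {-\<delta><..<\<delta>} (\<lambda>t. (p0 + t *\<^sub>R (1, 0, 0) + g t *\<^sub>R (0, 1, 0)) + (0, 0, x - x0))"
      by (rule smooth_on_add_const[OF _ g(4)]) auto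
    moreover have "(\<lambda>t. (p0 + t *\<^sub>R (1, 0, 0) + g t *\<^sub>R (0, 1, 0)) + (0, 0, x - x0)) = (\<lambda>t. (U0 + t, V0 + g t, x))"
      by (auto simp: p0_def)
    ultimately show "smooth_on {-\<delta><..<\<delta>} (\<lambda>t. (U0 + t, V0 + g t, x))" by simp
    show "(U0 + t, V0 + g t, x) \<in> S" if "\<bar>t\<bar> < \<delta>" for t
      using g(5)[OF that g(6)[OF that]] inS[of "U0 + t" "V0 + g t"] sphere_fill[OF _ x] by (auto simp: p0_def)
    have g0: "(g has_derivative (\<lambda>h. h * g')) (at 0)" using g' by (simp only: has_field_derivative_def mult_commute_abs)
    show "((\<lambda>t. (U0 + t, V0 + g t, x)) has_vector_derivative (1, g', 0)) (at 0)"
      unfolding has_vector_derivative_def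
      by (rule derivative_eq_intros g0 refl | simp add: zero_prod_def)+
  qed (use g in auto)
  \<comment> \<open>The square of \<open>(1, g', 0)\<close> is a positive multiple of
    \<open>g'\<close>, so spacelike means increasing.\<close>
  have "metric M p0 (1, g', 0) (1, g', 0) > 0" using metric_pos[OF p0S] tan[OF x0] by (auto simp: zero_prod_def p0_def)
  moreover have "rho M (U0 * V0) > 0" using S S_kruskal M rho_pos by (auto simp: kruskal_iff)
  ultimately have "g' > 0" using M by (auto simp: p0_def metric_eq zero_less_mult_iff zero_less_divide_iff)
  have "continuous_on {U0-\<delta><..<U0+\<delta>} (\<lambda>U. V0 + g (U - U0))"
  proof (rule continuous_at_imp_continuous_on, rule ballI)
    fix U assume "U \<in> {U0-\<delta><..<U0+\<delta>}"
    then have "\<bar>U - U0\<bar> < \<delta>" by auto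
    then have "isCont g (U - U0)" using g(7) DERIV_isCont by blast
    then show "isCont (\<lambda>U. V0 + g (U - U0)) U" by (intro continuous_intros isCont_o2[of U "\<lambda>U. U - U0" g]) auto
  qed
  moreover have "((\<lambda>U. V0 + g (U - U0)) has_real_derivative g') (at U0)"
  proof -
    have "((\<lambda>U. g (U - U0)) has_real_derivative g' * 1) (at U0)"
      by (rule DERIV_chain2[where f = g and g = "\<lambda>U. U - U0"]) (use g' in \<open>auto intro!: derivative_eq_intros\<close>)
    then show ?thesis by (auto intro!: derivative_eq_intros)
  qed
  moreover have "(U, V, x) \<in> S \<longleftrightarrow> V = V0 + g (U - U0)" if "\<bar>U - U0\<bar> < \<delta>" "\<bar>V - V0\<bar> < \<epsilon>" "norm x = 1" for U V x
    using g(5)[OF that(1,2)] inS[of U V] sphere_fill[OF _ that(3)] sphere_fill[OF _ x0] by (auto simp: p0_def)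
  ultimately have "local_graph U0 V0 \<delta> \<epsilon> (\<lambda>U. V0 + g (U - U0)) g'"
    unfolding local_graph_def using g(1,2,3,6) \<open>g' > 0\<close> tan by auto
  then show ?thesis using that by blast
qed

end

section \<open>From local graphs to one global graph\<close>

lemma no_interior_max:
  fixes f :: "real \<Rightarrow> real"
  assumes "e > 0" "continuous_on {c-e..c+e} f" "inj_on f {c-e..c+e}" "\<And>x. x \<in> {c-e..c+e} \<Longrightarrow> f x \<le> f c"
  shows False
proof -
  have ne: "f x \<noteq> f y" if "x \<in> {c-e..c+e}" "y \<in> {c-e..c+e}" "x \<noteq> y" for x y
    using assms(3) that by (auto dest: inj_onD)
  have lt: "f (c - e) < f c" "f (c + e) < f c"
    using assms(4)[of "c - e"] assms(4)[of "c + e"] ne[of "c - e" c] ne[of "c + e" c] assms(1) by force+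
  \<comment> \<open>The larger of the two end values is attained again on the other side of
    \<open>c\<close>.\<close>
  show False
  proof (cases "f (c - e) \<ge> f (c + e)")
    case True
    have "continuous_on {c..c+e} f" using assms(1,2) by (auto elim: continuous_on_subset)
    then obtain x where "c \<le> x" "x \<le> c + e" "f x = f (c - e)"
      using IVT2'[of f "c + e" "f (c - e)" c] True lt assms(1) by auto
    then show False using ne[of x "c - e"] assms(1) by auto
  next
    case False
    have "continuous_on {c-e..c} f" using assms(1,2) by (auto elim: continuous_on_subset)
    then obtain x where "c - e \<le> x" "x \<le> c" "f x = f (c + e)"
      using IVT'[of f "c - e" "f (c + e)" c] False lt assms(1) by auto
    then show False using ne[of x "c + e"] assms(1) by auto
  qed
qed

text \<open>If the end values agreed, maximum and minimum would both sit at the ends, so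
  \<open>f\<close> would be constant, against local injectivity.\<close>

lemma locally_inj_endpoints:
  fixes f :: "real \<Rightarrow> real"
  assumes ab: "a < b" and cont: "continuous_on {a..b} f"
    and loc: "\<And>c. c \<in> {a..b} \<Longrightarrow> \<exists>e>0. inj_on f ({a..b} \<inter> {c-e..c+e})"
  shows "f a \<noteq> f b"
proof
  assume eq: "f a = f b"
  \<comment> \<open>Stated for any \<open>g\<close> that inherits injectivity from \<open>f\<close>,
    so that it serves \<open>f\<close> and \<open>- f\<close>.\<close>
  have no_max: False if g: "continuous_on {a..b} g" "\<And>X. inj_on f X \<Longrightarrow> inj_on g X"
      and c: "a < c" "c < b" "\<And>x. x \<in> {a..b} \<Longrightarrow> g x \<le> g c" for g :: "real \<Rightarrow> real" and c
  proof -
    obtain e where e: "e > 0" "inj_on f ({a..b} \<inter> {c-e..c+e})" using loc[of c] c by auto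
    define d where "d = min e (min (c - a) (b - c))"
    have d: "d > 0" "{c-d..c+d} \<subseteq> {a..b} \<inter> {c-e..c+e}" using e c by (auto simp: d_def)
    show False
      using no_interior_max[OF d(1), of c g] continuous_on_subset[OF g(1)] g(2)[OF inj_on_subset[OF e(2) d(2)]] d(2) c(3)
      by blast
  qed
  obtain m where m: "m \<in> {a..b}" "\<And>x. x \<in> {a..b} \<Longrightarrow> f m \<le> f x"
    using continuous_attains_inf[OF compact_Icc _ cont] ab by auto
  obtain n where n: "n \<in> {a..b}" "\<And>x. x \<in> {a..b} \<Longrightarrow> f x \<le> f n"
    using continuous_attains_sup[OF compact_Icc _ cont] ab by auto
  have "m = a \<or> m = b"
    using no_max[of "\<lambda>x. - f x" m] m cont by (force intro!: continuous_intros simp: inj_on_def)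
  moreover have "n = a \<or> n = b" using no_max[of f n] n cont by force
  ultimately have "f m = f a" "f n = f a" using eq by auto
  then have const: "f x = f a" if "x \<in> {a..b}" for x using m(2)[OF that] n(2)[OF that] by auto
  obtain e where e: "e > 0" "inj_on f ({a..b} \<inter> {a-e..a+e})" using loc[of a] ab by auto
  have "f a = f (a + min e (b - a))" using const[of "a + min e (b - a)"] ab e by auto
  then have "a = a + min e (b - a)"
    using inj_onD[OF e(2), of a "a + min e (b - a)"] e(1) ab by (simp add: min_def split: if_splits)
  then show False using e(1) ab by (simp add: min_def split: if_splits)
qed

text \<open>
  A connected plane curve that is locally a graph over the first axis is path connected; along an
  injective path the first coordinate is locally injective, so it takes different values at the ends.
\<close>

lemma locally_graph_inj:
  fixes \<Gamma> :: "(real \<times> real) set"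
  assumes conn: "connected \<Gamma>"
    and loc: "\<And>U0 V0. (U0, V0) \<in> \<Gamma> \<Longrightarrow> \<exists>\<delta>>0. \<exists>\<epsilon>>0. \<exists>g. continuous_on {U0-\<delta><..<U0+\<delta>} g \<and>
      (\<forall>U. \<bar>U - U0\<bar> < \<delta> \<longrightarrow> \<bar>g U - V0\<bar> < \<epsilon>) \<and>
      (\<forall>U V. \<bar>U - U0\<bar> < \<delta> \<longrightarrow> \<bar>V - V0\<bar> < \<epsilon> \<longrightarrow> ((U, V) \<in> \<Gamma> \<longleftrightarrow> V = g U))"
  shows "inj_on fst \<Gamma>"
proof -
  \<comment> \<open>Such neighbourhoods meet \<open>\<Gamma>\<close> in path connected sets; hence
    path components are open, and connectedness upgrades to path connectedness.\<close>
  have box: "\<exists>W. open W \<and> p \<in> W \<and> inj_on fst (\<Gamma> \<inter> W) \<and> path_connected (\<Gamma> \<inter> W)" if p: "p \<in> \<Gamma>" for p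
  proof -
    obtain U0 V0 where p0: "p = (U0, V0)" by (cases p)
    obtain \<delta> \<epsilon> g where g: "\<delta> > 0" "\<epsilon> > 0" "continuous_on {U0-\<delta><..<U0+\<delta>} g"
      "\<And>U. \<bar>U - U0\<bar> < \<delta> \<Longrightarrow> \<bar>g U - V0\<bar> < \<epsilon>"
      "\<And>U V. \<bar>U - U0\<bar> < \<delta> \<Longrightarrow> \<bar>V - V0\<bar> < \<epsilon> \<Longrightarrow> ((U, V) \<in> \<Gamma> \<longleftrightarrow> V = g U)"
      using loc[of U0 V0] p p0 by auto
    define W where "W = {U0-\<delta><..<U0+\<delta>} \<times> {V0-\<epsilon><..<V0+\<epsilon>}"
    have WG: "\<Gamma> \<inter> W = (\<lambda>U. (U, g U)) ` {U0-\<delta><..<U0+\<delta>}"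
    proof (intro set_eqI iffI)
      fix q assume "q \<in> \<Gamma> \<inter> W"
      then obtain U V where "q = (U, V)" "(U, V) \<in> \<Gamma>" "\<bar>U - U0\<bar> < \<delta>" "\<bar>V - V0\<bar> < \<epsilon>"
        by (cases q) (auto simp: W_def abs_less_iff)
      then show "q \<in> (\<lambda>U. (U, g U)) ` {U0-\<delta><..<U0+\<delta>}" using g(5) by (auto simp: abs_less_iff)
    next
      fix q assume "q \<in> (\<lambda>U. (U, g U)) ` {U0-\<delta><..<U0+\<delta>}"
      then obtain U where "q = (U, g U)" "\<bar>U - U0\<bar> < \<delta>" by (auto simp: abs_less_iff)
      then show "q \<in> \<Gamma> \<inter> W" using g(4)[of U] g(5)[of U "g U"] by (auto simp: W_def abs_less_iff)
    qed
    have "path_connected ((\<lambda>U. (U, g U)) ` {U0-\<delta><..<U0+\<delta>})"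
      by (intro path_connected_continuous_image continuous_intros g convex_imp_path_connected) auto
    moreover have "inj_on fst ((\<lambda>U. (U, g U)) ` {U0-\<delta><..<U0+\<delta>})" by (auto simp: inj_on_def)
    moreover have "open W" "p \<in> W" using g by (auto simp: W_def p0 open_Times)
    ultimately show ?thesis unfolding WG[symmetric] by blast
  qed
  have "path_component \<Gamma> a b" if "a \<in> \<Gamma>" "b \<in> \<Gamma>" for a b
  proof (rule connected_equivalence_relation[OF conn that])
    show "\<exists>T. openin (top_of_set \<Gamma>) T \<and> a \<in> T \<and> (\<forall>x\<in>T. path_component \<Gamma> a x)" if a: "a \<in> \<Gamma>" for a
    proof -
      obtain W where W: "open W" "a \<in> W" "path_connected (\<Gamma> \<inter> W)" using box[OF a] by blast
      have "path_component (\<Gamma> \<inter> W) a x" if "x \<in> \<Gamma> \<inter> W" for x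
        using W a that by (simp add: path_connected_component)
      then have "path_component \<Gamma> a x" if "x \<in> \<Gamma> \<inter> W" for x
        using path_component_of_subset[of "\<Gamma> \<inter> W" \<Gamma>] that by blast
      then show ?thesis using W a by (intro exI[of _ "\<Gamma> \<inter> W"]) auto
    qed
  qed (auto intro: path_component_sym path_component_trans)
  then have pc: "path_connected \<Gamma>" by (simp add: path_connected_component)
  show ?thesis
  proof (rule inj_onI, rule ccontr)
    fix x y assume xy: "x \<in> \<Gamma>" "y \<in> \<Gamma>" "fst x = fst y" "x \<noteq> y"
    \<comment> \<open>An arc, because local injectivity of the first coordinate along it also uses
      that the parametrization is injective.\<close>
    then obtain c where c: "arc c" "path_image c \<subseteq> \<Gamma>" "pathstart c = x" "pathfinish c = y"
      using pc path_connected_arcwise by metis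
    have cc: "continuous_on {0..1} c" using c(1) arc_imp_path path_def by blast
    have inj: "inj_on c {0..1}" using c(1) by (simp add: arc_def)
    have "fst (c 0) \<noteq> fst (c 1)"
    proof (rule locally_inj_endpoints[of 0 1 "\<lambda>s. fst (c s)"])
      show "continuous_on {0..1} (\<lambda>s. fst (c s))" using cc by (intro continuous_intros)
      fix s assume s: "s \<in> {0..1::real}"
      have cs: "c s \<in> \<Gamma>" using c(2) s by (auto simp: path_image_def)
      obtain W where W: "open W" "c s \<in> W" "inj_on fst (\<Gamma> \<inter> W)" using box[OF cs] by blast
      obtain T where T: "open T" "T \<inter> {0..1} = c -` W \<inter> {0..1}"
        using cc W(1) continuous_on_open_invariant by metis
      then have "s \<in> T" using s W by auto
      then obtain e where e: "e > 0" "cball s e \<subseteq> T" using T(1) open_contains_cball by metis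
      have "inj_on (\<lambda>s. fst (c s)) ({0..1} \<inter> {s-e..s+e})"
      proof (rule inj_onI)
        fix u v assume uv: "u \<in> {0..1} \<inter> {s-e..s+e}" "v \<in> {0..1} \<inter> {s-e..s+e}" "fst (c u) = fst (c v)"
        then have "u \<in> T" "v \<in> T" using e by (auto simp: subset_iff dist_real_def)
        then have "u \<in> T \<inter> {0..1}" "v \<in> T \<inter> {0..1}" using uv by auto
        then have "c u \<in> W" "c v \<in> W" unfolding T(2) by auto
        then have "c u \<in> \<Gamma> \<inter> W" "c v \<in> \<Gamma> \<inter> W" using uv c(2) by (auto simp: path_image_def)
        then have "c u = c v" using W(3) uv(3) by (auto dest: inj_onD)
        then show "u = v" using inj uv by (auto dest: inj_onD)
      qed
      then show "\<exists>e>0. inj_on (\<lambda>s. fst (c s)) ({0..1} \<inter> {s-e..s+e})" using e by blast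
    qed simp
    then show False using c xy by (simp add: pathstart_def pathfinish_def)
  qed
qed

section \<open>The profile function of a connected hypersurface\<close>

locale connected_surface = sym_surface +
  assumes conn: "connected S"
begin

definition "\<Gamma> = {(U, V). \<exists>x. (U, V, x) \<in> S}"
definition "J = fst ` \<Gamma>"
definition "g U = (THE V. (U, V) \<in> \<Gamma>)"

lemma S_iff: "norm x = 1 \<Longrightarrow> (U, V, x) \<in> S \<longleftrightarrow> (U, V) \<in> \<Gamma>"
  unfolding \<Gamma>_def using sphere_fill by auto

lemma norm_S: "(U, V, x) \<in> S \<Longrightarrow> norm x = 1"
  using S_kruskal kruskal_iff by blast

lemma \<Gamma>_image: "\<Gamma> = (\<lambda>q. (fst q, fst (snd q))) ` S"
  by (force simp: \<Gamma>_def image_iff)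

lemma unit_exists: obtains e :: "real^3" where "norm e = 1"
  using vector_choose_size[of 1] by auto

lemma \<Gamma>_local:
  assumes "(U0, V0) \<in> \<Gamma>"
  obtains \<delta> \<epsilon> k k' where "local_graph U0 V0 \<delta> \<epsilon> k k'"
    "\<And>U V. \<bar>U - U0\<bar> < \<delta> \<Longrightarrow> \<bar>V - V0\<bar> < \<epsilon> \<Longrightarrow> ((U, V) \<in> \<Gamma> \<longleftrightarrow> V = k U)"
proof -
  obtain x0 where "(U0, V0, x0) \<in> S" using assms by (auto simp: \<Gamma>_def)
  then obtain \<delta> \<epsilon> k k' where k: "local_graph U0 V0 \<delta> \<epsilon> k k'" by (rule local_graph_exists)
  obtain e :: "real^3" where "norm e = 1" by (rule unit_exists)
  then have "((U, V) \<in> \<Gamma> \<longleftrightarrow> V = k U)" if "\<bar>U - U0\<bar> < \<delta>" "\<bar>V - V0\<bar> < \<epsilon>" for U V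
    using k that S_iff[of e U V] by (auto simp: local_graph_def)
  with k show ?thesis using that by blast
qed

lemma inj_\<Gamma>: "inj_on fst \<Gamma>"
proof (rule locally_graph_inj)
  show "connected \<Gamma>" unfolding \<Gamma>_image
    by (intro connected_continuous_image conn continuous_intros)
  fix U0 V0 assume "(U0, V0) \<in> \<Gamma>"
  then obtain \<delta> \<epsilon> k k' where k: "local_graph U0 V0 \<delta> \<epsilon> k k'"
    "\<And>U V. \<bar>U - U0\<bar> < \<delta> \<Longrightarrow> \<bar>V - V0\<bar> < \<epsilon> \<Longrightarrow> ((U, V) \<in> \<Gamma> \<longleftrightarrow> V = k U)" by (rule \<Gamma>_local) blast
  show "\<exists>\<delta>>0. \<exists>\<epsilon>>0. \<exists>g. continuous_on {U0-\<delta><..<U0+\<delta>} g \<and>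
      (\<forall>U. \<bar>U - U0\<bar> < \<delta> \<longrightarrow> \<bar>g U - V0\<bar> < \<epsilon>) \<and>
      (\<forall>U V. \<bar>U - U0\<bar> < \<delta> \<longrightarrow> \<bar>V - V0\<bar> < \<epsilon> \<longrightarrow> ((U, V) \<in> \<Gamma> \<longleftrightarrow> V = g U))"
    by (rule exI[of _ \<delta>], intro conjI, use k in \<open>simp add: local_graph_def\<close>,
        rule exI[of _ \<epsilon>], intro conjI, use k in \<open>simp add: local_graph_def\<close>,
        rule exI[of _ k], use k in \<open>simp add: local_graph_def\<close>)
qed

lemma \<Gamma>_iff: "(U, V) \<in> \<Gamma> \<longleftrightarrow> U \<in> J \<and> V = g U"
proof -
  have "g U = V" if "(U, V) \<in> \<Gamma>" for U V
    unfolding g_def using that inj_onD[OF inj_\<Gamma>] by (intro the_equality) force+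
  then show ?thesis unfolding J_def by force
qed

lemma S_iff': "(U, V, x) \<in> S \<longleftrightarrow> U \<in> J \<and> V = g U \<and> norm x = 1"
  using S_iff \<Gamma>_iff norm_S by blast

lemma J_conn: "connected J" and J_nonempty: "J \<noteq> {}"
proof -
  have J: "J = fst ` S" by (auto simp: J_def \<Gamma>_image image_image)
  show "connected J" unfolding J by (intro connected_continuous_image conn continuous_intros)
  show "J \<noteq> {}" using spacelike unfolding J spacelike_hypersurface_def smooth_hypersurface_def by auto
qed

lemma g_local:
  assumes "U0 \<in> J"
  shows "\<exists>\<delta>>0. {U0-\<delta><..<U0+\<delta>} \<subseteq> J \<and> (\<exists>k'>0. (g has_real_derivative k') (at U0) \<and>
     (\<forall>x. norm x = 1 \<longrightarrow> (1, k', 0) \<in> tangent_space S (U0, g U0, x)))"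
proof -
  have "(U0, g U0) \<in> \<Gamma>" using assms \<Gamma>_iff by auto
  then obtain \<delta> \<epsilon> k k' where k: "local_graph U0 (g U0) \<delta> \<epsilon> k k'"
    "\<And>U V. \<bar>U - U0\<bar> < \<delta> \<Longrightarrow> \<bar>V - g U0\<bar> < \<epsilon> \<Longrightarrow> ((U, V) \<in> \<Gamma> \<longleftrightarrow> V = k U)" by (rule \<Gamma>_local) blast
  have in\<Gamma>: "(U, k U) \<in> \<Gamma>" if "\<bar>U - U0\<bar> < \<delta>" for U
    using k(2)[OF that, of "k U"] k(1) that by (auto simp: local_graph_def)
  have gk: "U \<in> J" "g U = k U" if "\<bar>U - U0\<bar> < \<delta>" for U
    using in\<Gamma>[OF that] by (auto simp: \<Gamma>_iff)
  have d: "\<delta> > 0" "k' > 0" "(k has_real_derivative k') (at U0)" using k(1) by (auto simp: local_graph_def)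
  have "(g has_real_derivative k') (at U0)"
    by (rule has_field_derivative_transform_within_open[OF d(3), of "{U0-\<delta><..<U0+\<delta>}"]) (use d gk in \<open>auto simp:
        abs_less_iff\<close>)
  moreover have "{U0-\<delta><..<U0+\<delta>} \<subseteq> J" using gk(1) by (auto simp: abs_less_iff)
  moreover have "\<forall>x. norm x = 1 \<longrightarrow> (1, k', 0) \<in> tangent_space S (U0, g U0, x)"
    using k(1) by (simp add: local_graph_def)
  ultimately show ?thesis using d by blast
qed

lemma J_open: "open J"
  unfolding open_dist
proof
  fix U0 assume "U0 \<in> J"
  then obtain \<delta> where "\<delta> > 0" "{U0-\<delta><..<U0+\<delta>} \<subseteq> J" using g_local by blast
  then show "\<exists>e>0. \<forall>y. dist y U0 < e \<longrightarrow> y \<in> J"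
    by (intro exI[of _ \<delta>]) (auto simp: dist_real_def subset_iff abs_less_iff)
qed

definition "g' U = deriv g U"

lemma g_deriv: "U \<in> J \<Longrightarrow> (g has_real_derivative g' U) (at U)"
  and g'_pos: "U \<in> J \<Longrightarrow> g' U > 0"
  and g'_tangent: "U \<in> J \<Longrightarrow> norm x = 1 \<Longrightarrow> (1, g' U, 0) \<in> tangent_space S (U, g U, x)"
  using g_local DERIV_imp_deriv unfolding g'_def by metis+

end

section \<open>Unit normal and mean curvature in null coordinates\<close>

lemma C_diff_on_scale_arg:
  fixes f :: "real \<Rightarrow> 'b::euclidean_space"
  assumes "open W'" "\<And>t. t \<in> W' \<Longrightarrow> c * t \<in> W" "C_diff_on n W f"
  shows "C_diff_on n W' (\<lambda>t. f (c * t))"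
  using assms(3)
proof (induction n arbitrary: f)
  case 0
  then have "continuous_on W f" by simp
  then show ?case using assms(2)
    by (auto intro!: continuous_on_compose2[of W f W' "\<lambda>t. c * t"] continuous_intros)
next
  case (Suc n)
  have d: "((\<lambda>t. f (c * t)) has_derivative (\<lambda>v. frechet_derivative f (at (c * t)) (c * v))) (at t)" if "t \<in> W'" for t
  proof -
    have "(f has_derivative frechet_derivative f (at (c * t))) (at (c * t))"
      using Suc.prems assms(2)[OF that] by (auto simp: frechet_derivative_works[symmetric])
    moreover have "((\<lambda>t. c * t) has_derivative (\<lambda>v. c * v)) (at t)" by (auto intro!: derivative_eq_intros)
    ultimately show ?thesis using diff_chain_at[of "\<lambda>t. c * t" "\<lambda>v. c * v" t f] by (simp add: o_def)
  qed
  have "C_diff_on n W' (\<lambda>t. frechet_derivative f (at (c * t)) (c * v))" for v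
    using Suc.IH[of "\<lambda>t. frechet_derivative f (at t) (c * v)"] Suc.prems by simp
  then have "C_diff_on n W' (\<lambda>t. frechet_derivative (\<lambda>t. f (c * t)) (at t) v)" for v
    by (rule C_diff_on_cong[OF assms(1), rotated]) (use frechet_derivative_at[OF d] in \<open>auto dest: fun_cong\<close>)
  then show ?case using d by (auto intro: differentiableI)
qed

lemma tangent_space_scale:
  assumes "v \<in> tangent_space A p"
  shows "c *\<^sub>R v \<in> tangent_space A p"
proof -
  obtain \<gamma> e where g: "e > 0" "\<gamma> ` {-e<..<e} \<subseteq> A" "\<gamma> 0 = p" "smooth_on {-e<..<e} \<gamma>"
    "(\<gamma> has_vector_derivative v) (at (0::real))"
    using assms by (auto simp: tangent_space_def)
  \<comment> \<open>Dividing by \<open>\<bar>c\<bar> + 1\<close> covers \<open>c = 0\<close> as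
    well.\<close>
  define e' where "e' = e / (\<bar>c\<bar> + 1)"
  have e': "e' > 0" using g by (simp add: e'_def)
  have sub: "\<bar>c * t\<bar> < e" if "\<bar>t\<bar> < e'" for t
  proof -
    have "\<bar>c * t\<bar> \<le> (\<bar>c\<bar> + 1) * \<bar>t\<bar>" by (simp add: abs_mult mult_right_mono)
    also have "\<dots> < (\<bar>c\<bar> + 1) * e'" using that by (intro mult_strict_left_mono) auto
    also have "\<dots> = e" by (simp add: e'_def)
    finally show ?thesis .
  qed
  show ?thesis
  proof (rule tangent_spaceI[OF e'])
    show "smooth_on {-e'<..<e'} (\<lambda>t. \<gamma> (c * t))"
    proof -
      have "c * t \<in> {-e<..<e}" if "t \<in> {-e'<..<e'}" for t
      proof -
        have "\<bar>t\<bar> < e'" using that by auto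
        then have "\<bar>c * t\<bar> < e" by (rule sub)
        then show ?thesis unfolding greaterThanLessThan_iff abs_less_iff by (metis minus_less_iff)
      qed
      then show ?thesis
        using g(4) C_diff_on_scale_arg[of "{-e'<..<e'}" c "{-e<..<e}"] unfolding smooth_on_def by auto
    qed
    show "\<gamma> (c * t) \<in> A" if "\<bar>t\<bar> < e'" for t
      using sub[OF that] g(2) by (auto simp: image_subset_iff abs_less_iff)
    have "((\<lambda>t. c * t) has_vector_derivative c) (at 0)"
      by (auto intro!: derivative_eq_intros simp: has_vector_derivative_def)
    from vector_diff_chain_at[OF this, of \<gamma> v] g(5)
    show "((\<lambda>t. \<gamma> (c * t)) has_vector_derivative c *\<^sub>R v) (at 0)" by (simp add: o_def)
  qed (use g in simp)
qed

text \<open>The derivative \<open>D\<close> is taken within \<open>S\<close>, so it is evaluated by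
  composing with a curve that stays in \<open>A\<close>. This serves for the normal field, which is
  constant on each sphere.\<close>

lemma derivative_zero_along:
  assumes "v \<in> tangent_space A p" "A \<subseteq> S" "(f has_derivative D) (at p within S)" "\<And>q. q \<in> A \<Longrightarrow> f q = k"
  shows "D v = 0"
proof -
  obtain \<gamma> e where g: "e > 0" "\<gamma> ` {-e<..<e} \<subseteq> A" "\<gamma> 0 = p"
    "(\<gamma> has_vector_derivative v) (at (0::real))"
    using assms by (auto simp: tangent_space_def)
  have "(f has_derivative D) (at (\<gamma> 0) within \<gamma> ` {-e<..<e})"
    using has_derivative_subset[OF assms(3)] g assms(2) by blast
  from vector_derivative_diff_chain_within[OF has_vector_derivative_at_within[OF g(4)] this]
  have "((f \<circ> \<gamma>) has_vector_derivative D v) (at 0 within {-e<..<e})" .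
  then have "((f \<circ> \<gamma>) has_vector_derivative D v) (at 0)"
    using g(1) by (simp add: at_within_open[of 0 "{-e<..<e}"])
  moreover have "((f \<circ> \<gamma>) has_vector_derivative 0) (at 0)"
    by (rule has_vector_derivative_transform_within_open[OF has_vector_derivative_const[of k], of "{-e<..<e}"])
       (use g assms(4) in \<open>auto simp: image_subset_iff\<close>)
  ultimately show ?thesis using vector_derivative_unique_at by blast
qed

text \<open>The metric coefficients depend on the point only through \<open>r\<close>;
  \<open>dr\<close> is the differential of the radius, and \<open>1 / (2 * M) + 1 / r\<close> is
  minus the logarithmic derivative of \<open>exp (- r / (2 * M)) / r\<close>.\<close>

lemma metric_deriv_eq:
  fixes M U V :: real
  assumes M: "M > 0" and UV: "U * V > - 2 * M"
  defines "r \<equiv> rho M (U * V)" and "dr \<equiv> \<lambda>v1 v2. 2 * M * exp (- rho M (U * V) / (2 * M)) / rho M (U * V) * (v1 * V + U * v2)"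
  shows "metric_deriv M (U, V, x) (v1, v2, \<zeta>) (a, b, \<xi>) (a', b', \<xi>') =
    - (8 * M\<^sup>2 * exp (- r / (2 * M)) / r) * (1 / (2 * M) + 1 / r) * dr v1 v2 * (a * b' + b * a') + 2 * r * dr v1 v2
        * (\<xi> \<bullet> \<xi>')"
proof -
  have r: "r > 0" using rho_pos M UV by (simp add: r_def)
  define R where "R q = rho M (fst q * fst (snd q))" for q :: event
  have m: "(\<lambda>q. metric M q (a, b, \<xi>) (a', b', \<xi>')) =
     (\<lambda>q. 8 * M\<^sup>2 * exp (- R q / (2 * M)) / R q * (a * b' + b * a') + (R q)\<^sup>2 * (\<xi> \<bullet> \<xi>'))"
    by (rule ext, case_tac q) (auto simp: metric_eq R_def)
  have 1: "(rho M has_derivative (\<lambda>h. h * (2 * M * exp (- r / (2 * M)) / r))) (at (fst (U, V, x) * fst (snd (U, V, x))))"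
    using rho_deriv[OF M UV] unfolding has_field_derivative_def r_def by (simp only: mult_commute_abs fst_conv snd_conv)
  have 2: "((\<lambda>q. fst q * fst (snd q)) has_derivative (\<lambda>h. fst h * V + U * fst (snd h))) (at (U, V, x))"
    by (auto intro!: derivative_eq_intros)
  have dR: "(R has_derivative (\<lambda>h. dr (fst h) (fst (snd h)))) (at (U, V, x))"
    using diff_chain_at[OF 2 1] unfolding R_def dr_def r_def o_def by (simp add: mult.commute)
  have Rp: "R (U, V, x) = r" by (simp add: R_def r_def)
  have "((\<lambda>q. 8 * M\<^sup>2 * exp (- R q / (2 * M)) / R q * (a * b' + b * a') + (R q)\<^sup>2 * (\<xi> \<bullet> \<xi>')) has_derivative
    (\<lambda>h. - (8 * M\<^sup>2 * exp (- r / (2 * M)) / r) * (1 / (2 * M) + 1 / r) * dr (fst h) (fst (snd h)) * (a * b' + b *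
        a') + 2 * r * dr (fst h) (fst (snd h)) * (\<xi> \<bullet> \<xi>'))) (at (U, V, x))"
    using r M by (auto intro!: derivative_eq_intros dR ext simp: Rp) (simp add: field_simps power2_eq_square)
  from frechet_derivative_at[OF this] show ?thesis
    by (simp add: metric_deriv_def m fun_eq_iff)
qed

lemma orthonormal_complement:
  fixes x :: "real^3"
  assumes "norm x = 1"
  obtains y z where "y \<bullet> x = 0" "z \<bullet> x = 0" "y \<bullet> z = 0" "y \<bullet> y = 1" "z \<bullet> z = 1"
proof -
  obtain A :: "real^3^3" where A: "rotation_matrix A" "A *v (axis 1 1) = x"
    using rotation_matrix_exists_basis[of x 1] assms by auto
  have "orthogonal_transformation ((*v) A)"
    using A by (simp add: rotation_matrix_def orthogonal_transformation_matrix)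
  then have inn: "(A *v u) \<bullet> (A *v v) = u \<bullet> v" for u v by (simp add: orthogonal_transformation_def)
  show ?thesis
    by (rule that[of "A *v axis 2 1" "A *v axis 3 1"]; unfold A(2)[symmetric] inn) (simp_all add: inner_axis_axis)
qed

context connected_surface
begin

text \<open>In null coordinates the metric is \<open>F dU dV\<close> plus \<open>r\<^sup>2\<close>
  times the round one. The unit tangent of the profile is \<open>(a, b)\<close>, the future unit
  normal is \<open>(- a, b)\<close>, and \<open>w\<close> is both the product of the Killing field
  with the tangent and minus the derivative of \<open>r\<close> along the normal.\<close>

definition "r U = rho M (U * g U)"
definition "F U = 16 * M\<^sup>2 * exp (- r U / (2 * M)) / r U"
definition "a U = 1 / sqrt (F U * g' U)"
definition "b U = g' U * a U"
definition "w U = 2 * M * exp (- r U / (2 * M)) / r U * (a U * g U - U * b U)"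

lemma UV: "U \<in> J \<Longrightarrow> U * g U > - 2 * M"
  using S_iff' S_kruskal kruskal_iff unit_exists by (metis subsetD)

lemma r_pos: "U \<in> J \<Longrightarrow> r U > 0"
  using rho_pos[OF M UV] by (simp add: r_def)

lemma F_pos: "U \<in> J \<Longrightarrow> F U > 0"
  using r_pos M by (simp add: F_def)

lemma a_pos: "U \<in> J \<Longrightarrow> a U > 0" and b_pos: "U \<in> J \<Longrightarrow> b U > 0" and Fab: "U \<in> J \<Longrightarrow> F U * a U * b U = 1"
proof -
  assume U: "U \<in> J"
  note p = F_pos[OF U] g'_pos[OF U]
  show "a U > 0" using p by (simp add: a_def)
  then show "b U > 0" using p by (simp add: b_def)
  have "F U * a U * b U = F U * g' U * (a U)\<^sup>2" by (simp add: b_def power2_eq_square)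
  also have "\<dots> = 1" using p by (simp add: a_def power_divide)
  finally show "F U * a U * b U = 1" .
qed

lemma metric_F:
  "metric M (U, g U, x) (v1, v2, \<xi>) (v1', v2', \<xi>') = F U / 2 * (v1 * v2' + v2 * v1') + (r U)\<^sup>2 * (\<xi> \<bullet> \<xi>')"
  by (simp add: metric_eq F_def r_def)

lemma tangent_S:
  assumes "(v1, v2, \<xi>) \<in> tangent_space S (U, g U, x)" "U \<in> J"
  shows "v2 = g' U * v1" "\<xi> \<bullet> x = 0"
proof -
  show "\<xi> \<bullet> x = 0" using tangent_kruskal_orth assms tangent_space_mono[OF S_kruskal] by blast
  obtain \<gamma> e where g: "e > 0" "\<gamma> ` {-e<..<e} \<subseteq> S" "\<gamma> 0 = (U, g U, x)"
    "(\<gamma> has_vector_derivative (v1, v2, \<xi>)) (at (0::real))"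
    using assms by (auto simp: tangent_space_def)
  note c = has_vector_derivative_components[OF g(4), folded has_real_derivative_iff_has_vector_derivative]
  have "(g has_real_derivative g' U) (at (fst (\<gamma> 0)))" using g_deriv[OF assms(2)] g(3) by simp
  from DERIV_chain2[OF this c(1)] have 1: "((\<lambda>t. g (fst (\<gamma> t))) has_real_derivative g' U * v1) (at 0)" .
  have "((\<lambda>t. fst (snd (\<gamma> t))) has_real_derivative g' U * v1) (at 0)"
  proof (rule has_field_derivative_transform_within_open[OF 1, of "{-e<..<e}"])
    fix t assume "t \<in> {-e<..<e}"
    then have "\<gamma> t \<in> S" using g(2) by blast
    then show "g (fst (\<gamma> t)) = fst (snd (\<gamma> t))" by (cases "\<gamma> t") (simp add: S_iff')
  qed (use g in auto)
  then show "v2 = g' U * v1" using c(2) DERIV_unique by blast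
qed

lemma sphere_tangent_S:
  assumes "U \<in> J" "norm x = 1" "\<xi> \<bullet> x = 0"
  shows "(0, 0, \<xi>) \<in> tangent_space S (U, g U, x)"
  by (rule sphere_tangent[OF assms(2,3)]) (use assms S_iff' in auto)

text \<open>Orthogonality to the spheres removes the spherical part, orthogonality to the profile
  fixes the direction in the \<open>(U, V)\<close> plane, the norm fixes the length and the time
  orientation the sign.\<close>

lemma unit_normal_eq:
  assumes U: "U \<in> J" and x: "norm x = 1"
  shows "unit_normal M S (U, g U, x) = (- a U, b U, 0)"
  unfolding unit_normal_def
proof (rule the_equality)
  let ?p = "(U, g U, x)"
  note pos = F_pos[OF U] a_pos[OF U] b_pos[OF U] Fab[OF U] r_pos[OF U]
  \<comment> \<open>A straight line with fixed spherical component stays in the extension for a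
    short time.\<close>
  have 1: "(- a U, b U, 0) \<in> tangent_space (kruskal M) ?p"
  proof -
    have "open ((\<lambda>t. (U - t * a U) * (g U + t * b U)) -` {- 2 * M<..})"
      by (intro open_vimage continuous_intros)
    moreover have "0 \<in> (\<lambda>t. (U - t * a U) * (g U + t * b U)) -` {- 2 * M<..}" using UV[OF U] by simp
    ultimately obtain e where e: "e > 0" "ball 0 e \<subseteq> (\<lambda>t. (U - t * a U) * (g U + t * b U)) -` {- 2 * M<..}"
      by (rule openE)
    show ?thesis
    proof (rule tangent_space_affine[OF e(1)])
      fix t :: real assume "\<bar>t\<bar> < e"
      then have "t \<in> ball 0 e" by simp
      then have "(U - t * a U) * (g U + t * b U) > - 2 * M" using e(2) by auto
      then show "?p + t *\<^sub>R (- a U, b U, 0) \<in> kruskal M" using x by (simp add: kruskal_iff)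
    qed
  qed
  have 2: "metric M ?p (- a U, b U, 0) v = 0" if "v \<in> tangent_space S ?p" for v
    using tangent_S(1)[of _ _ _ U x] that U by (cases v) (auto simp: metric_F b_def)
  have 3: "metric M ?p (- a U, b U, 0) (- a U, b U, 0) = -1"
    using pos(4) by (simp add: metric_F mult.assoc)
  have 4: "future_directed M ?p (- a U, b U, 0)"
    using 3 pos by (simp add: future_directed_def metric_F mult_pos_neg)
  show "(- a U, b U, 0) \<in> tangent_space (kruskal M) ?p \<and> (\<forall>v\<in>tangent_space S ?p. metric M ?p (- a U, b U, 0) v = 0) \<and>
             metric M ?p (- a U, b U, 0) (- a U, b U, 0) = -1 \<and> future_directed M ?p (- a U, b U, 0)"
    using 1 2 3 4 by blast
  fix n assume n: "n \<in> tangent_space (kruskal M) ?p \<and> (\<forall>v\<in>tangent_space S ?p. metric M ?p n v = 0) \<and>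
             metric M ?p n n = -1 \<and> future_directed M ?p n"
  obtain n1 n2 \<nu> where nn: "n = (n1, n2, \<nu>)" by (cases n) auto
  \<comment> \<open>So \<open>(0, 0, \<nu>)\<close> is tangent to the sphere, and the normal may be
    tested against its own spherical part.\<close>
  have "\<nu> \<bullet> x = 0" using n tangent_kruskal_orth by (auto simp: nn)
  then have "metric M ?p n (0, 0, \<nu>) = 0" using n sphere_tangent_S[OF U x] by blast
  then have \<nu>: "\<nu> = 0" using pos by (simp add: nn metric_F)
  have "metric M ?p n (1, g' U, 0) = 0" using n g'_tangent[OF U x] by blast
  then have "n1 * g' U + n2 = 0" using pos by (simp add: nn metric_F)
  then have n2: "n2 = - g' U * n1" by (simp add: algebra_simps)
  have "metric M ?p n n = -1" using n by blast
  then have "F U * g' U * n1\<^sup>2 = 1" by (simp add: nn metric_F n2 \<nu> power2_eq_square mult_ac)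
  moreover have "F U * g' U * (a U)\<^sup>2 = 1" using pos(4) by (simp add: b_def power2_eq_square mult_ac)
  ultimately have "F U * g' U * n1\<^sup>2 = F U * g' U * (a U)\<^sup>2" by simp
  then have "n1\<^sup>2 = (a U)\<^sup>2" using pos(1) g'_pos[OF U] by simp
  moreover have "n1 < 0"
  proof -
    have "metric M ?p n (-1, 1, 0) < 0" using n by (simp add: future_directed_def)
    then have "F U * (n1 * (1 + g' U)) < 0" by (simp add: nn metric_F n2 algebra_simps)
    then have "n1 * (1 + g' U) < 0" using pos(1) by (simp add: mult_less_0_iff)
    then show ?thesis using g'_pos[OF U] by (simp add: mult_less_0_iff)
  qed
  ultimately have "n1 = - a U" using pos(2) by (auto simp: power2_eq_iff)
  then show "n = (- a U, b U, 0)" using n2 \<nu> by (simp add: nn b_def)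
qed

text \<open>The value of the mean curvature in the frame consisting of the unit tangent \<open>(a, b, 0)\<close> and two spherical vectors.\<close>

lemma mean_curvature_eq:
  assumes U: "U \<in> J" and x: "norm x = 1" and H: "has_mean_curvature M S (U, g U, x) H"
  obtains a' b' where "(a has_real_derivative a') (at U)" "(b has_real_derivative b') (at U)"
    "3 * H = F U / 2 * a U * (a U * b' - b U * a') + (1 / (4 * M) + 1 / (2 * r U)) * w U - 2 * w U / r U"
proof -
  let ?p = "(U, g U, x)"
  note pos = F_pos[OF U] a_pos[OF U] b_pos[OF U] Fab[OF U] r_pos[OF U]
  obtain D where D: "(unit_normal M S has_derivative D) (at ?p within S)"
    and DH: "\<And>e. orthonormal_frame M S ?p e \<Longrightarrow>
        H = (1 / 3) * (\<Sum>i<3. cov_deriv_inner M ?p (e i) (unit_normal M S ?p) (D (e i)) (e i))"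
    using H unfolding has_mean_curvature_def by blast
  have linD: "linear D" using D has_derivative_linear by blast
  \<comment> \<open>\<open>D\<close> is a derivative within \<open>S\<close>; along the profile with
    \<open>x\<close> fixed it becomes an ordinary derivative in \<open>U\<close>, which also yields
    differentiability of \<open>a\<close> and \<open>b\<close>.\<close>
  have "((\<lambda>t. (t, g t, x)) has_vector_derivative (1, g' U, 0)) (at U within J)"
    using has_vector_derivative_at_within[OF has_vector_derivative_Pair[OF has_vector_derivative_id
      has_vector_derivative_Pair[OF g_deriv[OF U, unfolded has_real_derivative_iff_has_vector_derivative]
          has_vector_derivative_const]]] .
  moreover have "(unit_normal M S has_derivative D) (at (U, g U, x) within (\<lambda>t. (t, g t, x)) ` J)"
    by (rule has_derivative_subset[OF D]) (use S_iff' x in auto)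
  ultimately have "((unit_normal M S \<circ> (\<lambda>t. (t, g t, x))) has_vector_derivative D (1, g' U, 0)) (at U within J)"
    by (rule vector_derivative_diff_chain_within)
  then have "((unit_normal M S \<circ> (\<lambda>t. (t, g t, x))) has_vector_derivative D (1, g' U, 0)) (at U)"
    using at_within_open[OF U J_open] by simp
  then have N: "((\<lambda>t. (- a t, b t, 0)) has_vector_derivative D (1, g' U, 0)) (at U)"
    by (rule has_vector_derivative_transform_within_open[OF _ J_open U]) (simp add: unit_normal_eq x)
  obtain d1 d2 \<delta> where Dd: "D (1, g' U, 0) = (d1, d2, \<delta>)" by (cases "D (1, g' U, 0)") auto
  note c = has_vector_derivative_components[OF N[unfolded Dd]]
  have da: "(a has_real_derivative (- d1)) (at U)"
    using DERIV_minus[OF c(1)[folded has_real_derivative_iff_has_vector_derivative]] by simp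
  have db: "(b has_real_derivative d2) (at U)"
    using c(2)[folded has_real_derivative_iff_has_vector_derivative] by simp
  have \<delta>0: "\<delta> = 0" using c(3) by simp (metis has_vector_derivative_const vector_derivative_unique_at)
  obtain y z where yz: "y \<bullet> x = 0" "z \<bullet> x = 0" "y \<bullet> z = 0" "y \<bullet> y = 1" "z \<bullet> z = 1"
    using orthonormal_complement[OF x] by blast
  define e :: "nat \<Rightarrow> event" where "e i = (if i = 0 then a U *\<^sub>R (1, g' U, 0) else (0, 0, (if i = 1 then y else z)
      /\<^sub>R r U))" for i
  have e0: "e 0 = (a U, b U, 0)" by (simp add: e_def b_def)
  have e12: "e 1 = (0, 0, y /\<^sub>R r U)" "e 2 = (0, 0, z /\<^sub>R r U)" by (simp_all add: e_def)
  have lt3: "(\<forall>i<3. P i) \<longleftrightarrow> P 0 \<and> P 1 \<and> P (2::nat)" for P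
    by (auto simp: less_Suc_eq numeral_3_eq_3 numeral_2_eq_2)
  have tS: "(0, 0, \<xi>) \<in> tangent_space S ?p" if "\<xi> \<bullet> x = 0" for \<xi> using sphere_tangent_S[OF U x that] .
  have frame: "orthonormal_frame M S ?p e"
    unfolding orthonormal_frame_def lt3
  proof (intro conjI)
    show "e 0 \<in> tangent_space S ?p" using tangent_space_scale[OF g'_tangent[OF U x]] by (simp add: e_def)
    show "e 1 \<in> tangent_space S ?p" "e 2 \<in> tangent_space S ?p" unfolding e12 by (rule tS; simp add: yz)+
  qed (use pos yz in \<open>simp_all add: e0 e12 e12(1)[unfolded One_nat_def] metric_F inner_commute power2_eq_square field_simps\<close>)
  have De0: "D (e 0) = (a U * d1, a U * d2, 0)"
    using linear_scale[OF linD, of "a U" "(1, g' U, 0)"] Dd \<delta>0 by (simp add: e_def)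
  \<comment> \<open>The normal does not change along a sphere, so spherical directions contribute
    Christoffel terms only.\<close>
  have Dsph: "D (0, 0, \<xi>) = 0" if "\<xi> \<bullet> x = 0" for \<xi>
  proof (rule derivative_zero_along[OF _ _ D])
    show "(0, 0, \<xi>) \<in> tangent_space {(U', V', y). U' = U \<and> V' = g U \<and> norm y = 1} ?p"
      by (rule sphere_tangent[OF x that]) auto
    show "{(U', V', y). U' = U \<and> V' = g U \<and> norm y = 1} \<subseteq> S" using S_iff' U by auto
    show "unit_normal M S q = (- a U, b U, 0)" if "q \<in> {(U', V', y). U' = U \<and> V' = g U \<and> norm y = 1}" for q
      using that unit_normal_eq[OF U] by auto
  qed
  have De: "D (e 1) = 0" "D (e 2) = 0" unfolding e12 by (rule Dsph; simp add: yz)+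
  define N where "N = (- a U, b U, 0 :: real^3)"
  note md = metric_deriv_eq[OF M UV[OF U], folded r_def]
  define k where "k = 2 * M * exp (- r U / (2 * M)) / r U"
  have wk: "w U = k * (a U * g U - U * b U)" by (simp add: w_def k_def)
  have Fk: "8 * M\<^sup>2 * exp (- r U / (2 * M)) / r U = F U / 2" by (simp add: F_def)
  note md' = md[folded k_def, unfolded Fk]
  have c0: "cov_deriv_inner M ?p (e 0) N (D (e 0)) (e 0) =
     F U / 2 * a U * (a U * d2 + b U * d1) + (1 / (4 * M) + 1 / (2 * r U)) * w U * (F U * a U * b U)"
    unfolding cov_deriv_inner_def De0 unfolding e0 N_def md' metric_F wk
    using M pos(5) by (simp add: field_simps)
  \<comment> \<open>What remains is half the derivative of \<open>r\<^sup>2\<close> along the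
    normal, divided by \<open>r\<^sup>2\<close>.\<close>
  have c1: "cov_deriv_inner M ?p (e 1) N (D (e 1)) (e 1) = - w U / r U"
    unfolding cov_deriv_inner_def De unfolding e12 N_def zero_prod_def md' metric_F wk
    using yz pos(5) by (simp add: field_simps)
  have c2: "cov_deriv_inner M ?p (e 2) N (D (e 2)) (e 2) = - w U / r U"
    unfolding cov_deriv_inner_def De unfolding e12 N_def zero_prod_def md' metric_F wk
    using yz pos(5) by (simp add: field_simps)
  have s3: "(\<Sum>i<3. f i) = f 0 + f 1 + f 2" for f :: "nat \<Rightarrow> real"
    by (simp add: numeral_3_eq_3 numeral_2_eq_2)
  have "3 * H = cov_deriv_inner M ?p (e 0) N (D (e 0)) (e 0) + cov_deriv_inner M ?p (e 1) N (D (e 1)) (e 1) +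
      cov_deriv_inner M ?p (e 2) N (D (e 2)) (e 2)"
    using DH[OF frame] unfolding unit_normal_eq[OF U x] N_def[symmetric] s3 by simp
  also have "\<dots> = F U / 2 * a U * (a U * d2 - b U * (- d1)) + (1 / (4 * M) + 1 / (2 * r U)) * w U - 2 * w U / r U"
    unfolding c0 c1 c2 pos(4) by (simp add: algebra_simps)
  finally show ?thesis using that[OF da db] by blast
qed

end

section \<open>The ordinary differential equation of the profile curve\<close>

text \<open>Twice the coefficient of \<open>V dU + U dV\<close> in \<open>dr\<close>. It is positive
  and regular across the horizon, and times \<open>kappa\<close> it gives
  \<open>4 * M * h\<close>.\<close>

definition horizon_factor :: "real \<Rightarrow> real \<Rightarrow> real" where
  "horizon_factor M r = 4 * M * exp (- r / (2 * M)) / r"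

definition wkill :: "real \<Rightarrow> real \<Rightarrow> real \<Rightarrow> real" where
  "wkill H c r = - (H * r + c / r\<^sup>2)"

definition Pf :: "real \<Rightarrow> real \<Rightarrow> real \<Rightarrow> real \<Rightarrow> real" where
  "Pf M H c r = h M r + (wkill H c r)\<^sup>2"

text \<open>Half of the derivative of \<open>Pf\<close>, in the shape in which it arises as the
  derivative of \<open>p\<close>. Together with \<open>p\<^sup>2 = Pf\<close> the radius obeys
  Newton's equation with force \<open>Qf\<close>.\<close>

definition Qf :: "real \<Rightarrow> real \<Rightarrow> real \<Rightarrow> real \<Rightarrow> real" where
  "Qf M H c r = M / r\<^sup>2 - 3 * H * wkill H c r - 2 * (wkill H c r)\<^sup>2 / r"

text \<open>
  Along a curve with unit tangent \<open>(a, b)\<close>, parametrized with speed \<open>m\<close>, \<open>p\<close> is the derivative of the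
  radius with respect to arc length and \<open>wkill H c r\<close> is the product of the Killing field
  \<open>\<partial>\<^sub>t = (V \<partial>\<^sub>V - U \<partial>\<^sub>U) / 4M\<close> with the unit tangent. Constancy of the mean curvature makes
  \<open>r\<^sup>2 \<langle>\<partial>\<^sub>t, (a, b)\<rangle> + H r\<^sup>3\<close> a constant, which is \<open>-c\<close>.
\<close>

locale profile =
  fixes M H c :: real and J :: "real set" and u v a b m r p :: "real \<Rightarrow> real"
  assumes M: "M > 0"
    and J_open: "open J" and J_conn: "connected J" and J_nonempty: "J \<noteq> {}"
    and r_pos: "\<And>s. s \<in> J \<Longrightarrow> r s > 0"
    and kappa_r: "\<And>s. s \<in> J \<Longrightarrow> kappa M (r s) = u s * v s"
    and u_deriv: "\<And>s. s \<in> J \<Longrightarrow> (u has_real_derivative m s * a s) (at s)"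
    and v_deriv: "\<And>s. s \<in> J \<Longrightarrow> (v has_real_derivative m s * b s) (at s)"
    and a_pos: "\<And>s. s \<in> J \<Longrightarrow> a s > 0"
    and b_pos: "\<And>s. s \<in> J \<Longrightarrow> b s > 0"
    and m_pos: "\<And>s. s \<in> J \<Longrightarrow> m s > 0"
    and m_cont: "continuous_on J m"
    and r_deriv: "\<And>s. s \<in> J \<Longrightarrow> (r has_real_derivative m s * p s) (at s)"
    and p_deriv: "\<And>s. s \<in> J \<Longrightarrow> (p has_real_derivative m s * Qf M H c (r s)) (at s)"
    and ab: "\<And>s. s \<in> J \<Longrightarrow> horizon_factor M (r s) * a s * b s = 1 / (4 * M)"
    and p_plus_w: "\<And>s. s \<in> J \<Longrightarrow> p s + wkill H c (r s) = horizon_factor M (r s) * v s * a s"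
    and p_minus_w: "\<And>s. s \<in> J \<Longrightarrow> p s - wkill H c (r s) = horizon_factor M (r s) * u s * b s"
    and closed: "closedin (top_of_set {(x, y). x * y > - 2 * M}) ((\<lambda>s. (u s, v s)) ` J)"

lemma horizon_factor_kappa:
  "M > 0 \<Longrightarrow> r > 0 \<Longrightarrow> horizon_factor M r * kappa M r = 4 * M * h M r"
  by (simp add: horizon_factor_def kappa_def h_def exp_minus field_simps)

section \<open>Evolution of \<open>p\<close> and \<open>w\<close> along the profile\<close>

locale cmc_surface = connected_surface +
  fixes H :: real
  assumes mean_curvature: "\<And>p. p \<in> S \<Longrightarrow> has_mean_curvature M S p H"
    and closed_S: "closedin (top_of_set (kruskal M)) S"
begin

text \<open>\<open>k\<close> is the coefficient in \<open>dr = k (V dU + U dV)\<close>, so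
  \<open>p\<close> is the derivative of \<open>r\<close> along the unit tangent, and
  \<open>- L\<close> is the logarithmic derivative of \<open>k\<close> with respect to
  \<open>r\<close>.\<close>

definition "k U = 2 * M * exp (- r U / (2 * M)) / r U"
definition "p U = k U * (a U * g U + U * b U)"
definition "L U = 1 / (2 * M) + 1 / r U"

lemma w_k: "w U = k U * (a U * g U - U * b U)"
  by (simp add: w_def k_def)

lemma F_k: "F U = 8 * M * k U"
  by (simp add: F_def k_def power2_eq_square)

lemma g'_ab: "U \<in> J \<Longrightarrow> g' U = b U / a U"
  using a_pos[of U] by (simp add: b_def)

lemma p_w: "p U + w U = 2 * k U * g U * a U" "p U - w U = 2 * k U * U * b U"
  by (simp_all add: p_def w_k algebra_simps)

lemma r_deriv: assumes U: "U \<in> J" shows "(r has_real_derivative p U / a U) (at U)"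
proof -
  have "((\<lambda>U. U * g U) has_real_derivative (g U + U * g' U)) (at U)"
    using g_deriv[OF U] by (auto intro!: derivative_eq_intros)
  from DERIV_chain2[OF rho_deriv[OF M UV[OF U]] this]
  have "(r has_real_derivative k U * (g U + U * g' U)) (at U)"
    by (simp add: r_def[abs_def] k_def)
  moreover have "k U * (g U + U * g' U) = p U / a U"
    using a_pos[OF U] by (simp add: p_def g'_ab[OF U] field_simps)
  ultimately show ?thesis by simp
qed

lemma k_deriv: assumes U: "U \<in> J" shows "(k has_real_derivative - k U * L U * (p U / a U)) (at U)"
proof -
  have "(k has_real_derivative (2 * M * (exp (- r U / (2 * M)) * (- (p U / a U) / (2 * M))) * r U -
      2 * M * exp (- r U / (2 * M)) * (p U / a U)) / (r U * r U)) (at U)"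
    unfolding k_def[abs_def] using r_deriv[OF U] r_pos[OF U] M
    by (auto intro!: derivative_eq_intros)
  moreover have "(2 * M * (exp (- r U / (2 * M)) * (- q / (2 * M))) * r U -
      2 * M * exp (- r U / (2 * M)) * q) / (r U * r U) = - k U * L U * q" for q
    using r_pos[OF U] M by (simp add: k_def L_def field_simps)
  ultimately show ?thesis by metis
qed

text \<open>The squared length \<open>h\<close> of the gradient of \<open>r\<close>, split along the
  spacelike tangent and the timelike normal.\<close>

lemma p_w_square: assumes U: "U \<in> J" shows "(p U)\<^sup>2 - (w U)\<^sup>2 = h M (r U)"
proof -
  have kap: "kappa M (r U) = U * g U" using kappa_rho[OF M UV[OF U]] by (simp add: r_def)
  have "(p U)\<^sup>2 - (w U)\<^sup>2 = (2 * k U * g U * a U) * (2 * k U * U * b U)"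
    unfolding p_w[symmetric] by (simp add: power2_eq_square algebra_simps)
  also have "\<dots> = (horizon_factor M (r U) * kappa M (r U)) * (F U * a U * b U) / (4 * M)"
    unfolding kap F_k using M r_pos[OF U] by (simp add: k_def horizon_factor_def field_simps)
  also have "\<dots> = h M (r U)"
    unfolding Fab[OF U] horizon_factor_kappa[OF M r_pos[OF U]] using M by simp
  finally show ?thesis .
qed

text \<open>Two linear relations determine the derivatives of \<open>a\<close> and \<open>b\<close>:
  the mean curvature equation gives \<open>a b' - b a'\<close> (\<open>E2\<close>), and
  differentiating the normalization \<open>F a b = 1\<close> gives \<open>a' b + a b'\<close>
  (\<open>E1\<close>). The rest is substitution.\<close>

lemma p_w_deriv:
  assumes U: "U \<in> J"
  shows "(w has_real_derivative (- 3 * H * p U - 2 * p U * w U / r U) / a U) (at U)"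
    "(p has_real_derivative (M / (r U)\<^sup>2 - 3 * H * w U - 2 * (w U)\<^sup>2 / r U) / a U) (at U)"
    "isCont a U"
proof -
  obtain x :: "real^3" where x: "norm x = 1" by (rule unit_exists)
  have "has_mean_curvature M S (U, g U, x) H" using mean_curvature U x S_iff' by blast
  then obtain a' b' where d: "(a has_real_derivative a') (at U)" "(b has_real_derivative b') (at U)"
    and "3 * H = F U / 2 * a U * (a U * b' - b U * a') + (1 / (4 * M) + 1 / (2 * r U)) * w U - 2 * w U / r U"
    using mean_curvature_eq[OF U x] by metis
  moreover have "1 / (4 * M) + 1 / (2 * r U) = L U / 2" by (simp add: L_def field_simps)
  moreover have "F U / 2 * a U * (a U * b' - b U * a') = (F U * a U * (a U * b' - b U * a')) / 2" by simp
  ultimately have E2: "F U * a U * (a U * b' - b U * a') = 2 * (3 * H - L U * w U / 2 + 2 * w U / r U)"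
    by simp
  show "isCont a U" using d DERIV_isCont by blast
  note pos = F_pos[OF U] a_pos[OF U] b_pos[OF U] r_pos[OF U]
  define q where "q = p U / a U"
  have "((\<lambda>U. 8 * M * k U * a U * b U) has_real_derivative
     8 * M * (- k U * L U * q) * a U * b U + 8 * M * k U * a' * b U + 8 * M * k U * a U * b') (at U)"
    using d k_deriv[OF U] by (auto intro!: derivative_eq_intros simp: q_def algebra_simps)
  moreover have "((\<lambda>U. 8 * M * k U * a U * b U) has_real_derivative 0) (at U)"
    by (rule has_field_derivative_transform_within_open[OF DERIV_const J_open U, of 1])
       (use Fab F_k in auto)
  ultimately have "8 * M * (- k U * L U * q) * a U * b U + 8 * M * k U * a' * b U + 8 * M * k U * a U * b' = 0"
    using DERIV_unique by blast
  then have "F U * (a' * b U + a U * b') = F U * (L U * q * a U * b U)"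
    unfolding F_k by (simp add: algebra_simps)
  then have E1: "a' * b U + a U * b' = L U * p U * b U" using pos by (simp add: q_def)
  have Fab': "F U * a U * b U = 1" by (rule Fab[OF U])
  have W: "k U * (a' * g U - U * b') * a U = - 3 * H * p U - 2 * p U * w U / r U + L U * p U * w U"
  proof -
    \<comment> \<open>The last summand is zero by the normalization; adding it produces the products
      that occur in \<open>p + w\<close>, \<open>p - w\<close> and \<open>E2\<close>.\<close>
    have "k U * (a' * g U - U * b') * a U = (a' * (2 * k U * g U * a U) - (2 * k U * U * b U) * (F U * a U * b') *
        a U) / 2 + (F U * a U * b U - 1) * (k U * U * a U * b')"
      by (simp add: field_simps)
    also have "\<dots> = (a' * (F U * a U * b U) * (p U + w U) - (p U - w U) * (F U * a U * b') * a U) / 2"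
      unfolding Fab' p_w by simp
    also have "\<dots> = (F U * a U * w U * (a' * b U + a U * b') - p U * (F U * a U * (a U * b' - b U * a'))) / 2"
      by (simp add: field_simps)
    also have "\<dots> = (w U * L U * p U * (F U * a U * b U) - p U * (2 * (3 * H - L U * w U / 2 + 2 * w U / r U))) / 2"
      unfolding E1 E2 by (simp add: field_simps)
    also have "\<dots> = - 3 * H * p U - 2 * p U * w U / r U + L U * p U * w U"
      unfolding Fab' using pos by (simp add: field_simps)
    finally show ?thesis .
  qed
  have kab: "2 * k U * a U * b U = 1 / (4 * M)" using Fab' M by (simp add: F_k field_simps)
  have Pp: "k U * (a' * g U + 2 * b U + U * b') * a U = L U * (p U)\<^sup>2 / 2 + L U * (w U)\<^sup>2 / 2 - 3 * H * w U - 2 *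
      (w U)\<^sup>2 / r U + 1 / (4 * M)"
  proof -
    have "k U * (a' * g U + 2 * b U + U * b') * a U = (a' * (2 * k U * g U * a U) + (2 * k U * U * b U) * (F U * a
        U * b') * a U) / 2 - (F U * a U * b U - 1) * (k U * U * a U * b') + 2 * k U * a U * b U"
      by (simp add: field_simps)
    also have "\<dots> = (a' * (F U * a U * b U) * (p U + w U) + (p U - w U) * (F U * a U * b') * a U) / 2 + (F U * a U *
        b U) / (4 * M)"
      unfolding Fab' p_w kab by simp
    also have "\<dots> = (F U * a U * p U * (a' * b U + a U * b') - w U * (F U * a U * (a U * b' - b U * a'))) / 2 + (F U
        * a U * b U) / (4 * M)"
      by (simp add: field_simps)
    also have "\<dots> = (p U * L U * p U * (F U * a U * b U) - w U * (2 * (3 * H - L U * w U / 2 + 2 * w U / r U))) / 2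
        + (F U * a U * b U) / (4 * M)"
      unfolding E1 E2 by (simp add: field_simps)
    also have "\<dots> = L U * (p U)\<^sup>2 / 2 + L U * (w U)\<^sup>2 / 2 - 3 * H * w U - 2 * (w U)\<^sup>2 / r U + 1 / (4 * M)"
      unfolding Fab' using pos M by (simp add: field_simps power2_eq_square)
    finally show ?thesis .
  qed
  define q2 where "q2 = b U / a U"
  have dg: "(g has_real_derivative q2) (at U)" using g_deriv[OF U] g'_ab[OF U] by (simp add: q2_def)
  have "(w has_real_derivative (- k U * L U * q) * (a U * g U - U * b U) + k U * (a' * g U + a U * q2 - (b U + U *
      b'))) (at U)"
    unfolding w_k[abs_def] using d k_deriv[OF U, folded q_def] dg by (auto intro!: derivative_eq_intros simp: algebra_simps)
  moreover have "(- k U * L U * q) * (a U * g U - U * b U) + k U * (a' * g U + a U * q2 - (b U + U * b')) =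
     (- L U * p U * w U + k U * (a' * g U - U * b') * a U) / a U"
    using pos by (simp add: q_def q2_def w_k field_simps)
  ultimately show "(w has_real_derivative (- 3 * H * p U - 2 * p U * w U / r U) / a U) (at U)"
    unfolding W by simp
  have "(p has_real_derivative (- k U * L U * q) * (a U * g U + U * b U) + k U * (a' * g U + a U * q2 + (b U + U *
      b'))) (at U)"
    unfolding p_def[abs_def] using d k_deriv[OF U, folded q_def] dg
        by (auto intro!: derivative_eq_intros simp: algebra_simps)
  moreover have "(- k U * L U * q) * (a U * g U + U * b U) + k U * (a' * g U + a U * q2 + (b U + U * b')) =
     (- L U * (p U)\<^sup>2 + k U * (a' * g U + 2 * b U + U * b') * a U) / a U"
    using pos by (simp add: q_def q2_def power2_eq_square p_def field_simps)
  \<comment> \<open>The terms with \<open>L\<close> combine to \<open>- L / 2\<close> times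
    \<open>p\<^sup>2 - w\<^sup>2\<close>, which is \<open>h\<close>.\<close>
  moreover have "- L U * (p U)\<^sup>2 + k U * (a' * g U + 2 * b U + U * b') * a U = M / (r U)\<^sup>2 - 3 * H * w U - 2 * (w U)\<^sup>2 / r U"
  proof -
    have "- L U * (p U)\<^sup>2 + k U * (a' * g U + 2 * b U + U * b') * a U = - (L U / 2) * ((p U)\<^sup>2 - (w U)\<^sup>2) + 1 / (4
        * M) - 3 * H * w U - 2 * (w U)\<^sup>2 / r U"
      unfolding Pp by (simp add: field_simps)
    also have "- (L U / 2) * ((p U)\<^sup>2 - (w U)\<^sup>2) + 1 / (4 * M) = M / (r U)\<^sup>2"
      unfolding p_w_square[OF U] using pos M by (simp add: L_def h_def field_simps power2_eq_square)
    finally show ?thesis .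
  qed
  ultimately show "(p has_real_derivative (M / (r U)\<^sup>2 - 3 * H * w U - 2 * (w U)\<^sup>2 / r U) / a U) (at U)" by simp
qed

lemma first_integral: "\<exists>c. \<forall>U\<in>J. w U = wkill H c (r U)"
proof -
  have "((\<lambda>U. (r U)\<^sup>2 * w U + H * (r U)^3) has_real_derivative 0) (at U)" if U: "U \<in> J" for U
  proof -
    have "((\<lambda>U. (r U)\<^sup>2 * w U + H * (r U)^3) has_real_derivative
      2 * r U * (p U / a U) * w U + (r U)\<^sup>2 * ((- 3 * H * p U - 2 * p U * w U / r U) / a U) + H * (3 * (r U)\<^sup>2 * (p
          U / a U))) (at U)"
      using r_deriv[OF U] p_w_deriv(1)[OF U]
      by (auto intro!: derivative_eq_intros simp: algebra_simps)
    moreover have "2 * r U * (p U / a U) * w U + (r U)\<^sup>2 * ((- 3 * H * p U - 2 * p U * w U / r U) / a U) + H * (3 *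
        (r U)\<^sup>2 * (p U / a U)) = 0"
      using r_pos[OF U] a_pos[OF U] by (simp add: field_simps power2_eq_square)
    ultimately show ?thesis by simp
  qed
  then obtain d where d: "\<And>U. U \<in> J \<Longrightarrow> (r U)\<^sup>2 * w U + H * (r U)^3 = d"
    using DERIV_zero_connected_constant[OF J_conn J_open finite.emptyI, of "\<lambda>U. (r U)\<^sup>2 * w U + H * (r U)^3"]
    by (metis (no_types, lifting) DERIV_isCont Diff_empty continuous_at_imp_continuous_on)
  have "w U = wkill H (- d) (r U)" if U: "U \<in> J" for U
    using d[OF U, symmetric] r_pos[OF U] by (simp add: wkill_def field_simps power2_eq_square power3_eq_cube)
  then show ?thesis by blast
qed

text \<open>A fixed unit vector \<open>e\<close> embeds the \<open>(U, V)\<close> domain into the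
  extension, and closedness pulls back.\<close>

lemma closed_\<Gamma>: "closedin (top_of_set {(x, y). x * y > - 2 * M}) ((\<lambda>s. (s, g s)) ` J)"
proof -
  obtain e :: "real^3" where e: "norm e = 1" by (rule unit_exists)
  have "{(x, y). x * y > - 2 * M} = {q :: real \<times> real. fst q * snd q > - 2 * M}" by auto
  have c: "continuous_on {(x, y). x * y > - 2 * M} (\<lambda>q :: real \<times> real. (fst q, snd q, e))"
    by (intro continuous_intros)
  have i: "(\<lambda>q. (fst q, snd q, e)) \<in> {(x, y). x * y > - 2 * M} \<rightarrow> kruskal M"
    using e by (auto simp: kruskal_iff)
  have "closedin (top_of_set {(x, y). x * y > - 2 * M}) ({(x, y). x * y > - 2 * M} \<inter> (\<lambda>q. (fst q, snd q, e)) -` S)"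
    using continuous_closedin_preimage_gen[OF c _ closed_S] i by blast
  moreover have "{(x, y). x * y > - 2 * M} \<inter> (\<lambda>q. (fst q, snd q, e)) -` S = (\<lambda>s. (s, g s)) ` J"
    using UV e by (auto simp: S_iff' image_iff)
  ultimately show ?thesis by simp
qed

text \<open>\<open>U\<close> itself is the parameter, with speed \<open>1 / a\<close>.\<close>

lemma profile_exists: "\<exists>c m. profile M H c J (\<lambda>U. U) g a b m r p"
proof -
  obtain c where c: "\<And>U. U \<in> J \<Longrightarrow> w U = wkill H c (r U)" using first_integral by blast
  have hk: "horizon_factor M (r U) = 2 * k U" for U by (simp add: horizon_factor_def k_def)
  have "profile M H c J (\<lambda>U. U) g a b (\<lambda>U. 1 / a U) r p"
  proof
    show "M > 0" "open J" "connected J" "J \<noteq> {}" by (fact M J_open J_conn J_nonempty)+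
    show "continuous_on J (\<lambda>U. 1 / a U)"
      using p_w_deriv(3) a_pos by (intro continuous_at_imp_continuous_on ballI continuous_intros) force+
    show "closedin (top_of_set {(x, y). x * y > - 2 * M}) ((\<lambda>s. (s, g s)) ` J)" by (rule closed_\<Gamma>)
    fix U assume U: "U \<in> J"
    show "r U > 0" "a U > 0" "b U > 0" "1 / a U > 0" using r_pos a_pos b_pos U by auto
    show "kappa M (r U) = U * g U" using kappa_rho[OF M UV[OF U]] by (simp add: r_def)
    show "((\<lambda>U. U) has_real_derivative 1 / a U * a U) (at U)" using a_pos[OF U] by (auto intro!: derivative_eq_intros)
    show "(g has_real_derivative 1 / a U * b U) (at U)" using g_deriv[OF U] g'_ab[OF U] by simp
    show "(r has_real_derivative 1 / a U * p U) (at U)" using r_deriv[OF U] by simp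
    show "(p has_real_derivative 1 / a U * Qf M H c (r U)) (at U)" using p_w_deriv(2)[OF U] c[OF U] by (simp add: Qf_def)
    show "horizon_factor M (r U) * a U * b U = 1 / (4 * M)" using Fab[OF U] M by (simp add: hk F_k field_simps)
    show "p U + wkill H c (r U) = horizon_factor M (r U) * g U * a U" using p_w(1)[of U] c[OF U] by (simp add: hk)
    show "p U - wkill H c (r U) = horizon_factor M (r U) * U * b U" using p_w(2)[of U] c[OF U] by (simp add: hk)
  qed
  then show ?thesis by blast
qed

end

section \<open>Dynamics of profile curves\<close>

lemma kappa_0_iff: "kappa M x = 0 \<longleftrightarrow> x = 2 * M"
  and kappa_pos_iff: "kappa M x > 0 \<longleftrightarrow> x > 2 * M"
  and kappa_neg_iff: "kappa M x < 0 \<longleftrightarrow> x < 2 * M"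
  by (auto simp: kappa_def zero_less_mult_iff mult_less_0_iff)

lemma kappa_le: "M > 0 \<Longrightarrow> 0 \<le> x \<Longrightarrow> x \<le> y \<Longrightarrow> kappa M x \<le> kappa M y"
  using kappa_mono[of M x y] by (cases "x = y") auto

lemma wkill_deriv: "x > 0 \<Longrightarrow> (wkill H c has_real_derivative - H + 2 * c / x ^ 3) (at x)"
  unfolding wkill_def[abs_def]
  by (auto intro!: derivative_eq_intros simp: field_simps power2_eq_square power3_eq_cube)

lemma Pf_deriv: assumes "x > 0" shows "(Pf M H c has_real_derivative 2 * Qf M H c x) (at x)"
proof -
  have "(Pf M H c has_real_derivative 2 * M / x\<^sup>2 + 2 * wkill H c x * (- H + 2 * c / x ^ 3)) (at x)"
    unfolding Pf_def[abs_def] h_def using assms wkill_deriv[OF assms, of H c]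
    by (auto intro!: derivative_eq_intros simp: field_simps power2_eq_square)
  moreover have "2 * M / x\<^sup>2 + 2 * wkill H c x * (- H + 2 * c / x ^ 3) = 2 * Qf M H c x"
    using assms by (simp add: Qf_def wkill_def field_simps power2_eq_square power3_eq_cube)
  ultimately show ?thesis by simp
qed

lemma isCont_Pf: "x > 0 \<Longrightarrow> isCont (Pf M H c) x" and isCont_wkill: "x > 0 \<Longrightarrow> isCont (wkill H c) x"
  using Pf_deriv wkill_deriv DERIV_isCont by blast+

lemma Qf_differentiable: assumes "x > 0" shows "\<exists>d. (Qf M H c has_real_derivative d) (at x)"
proof -
  define w' where "w' = - H + 2 * c / x ^ 3"
  have "(wkill H c has_real_derivative w') (at x)" using wkill_deriv[OF assms] by (simp add: w'_def)
  then have "(Qf M H c has_real_derivative - (2 * M) / x ^ 3 - 3 * H * w' - (4 * wkill H c x * w' * x - 2 * (wkill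
      H c x)\<^sup>2) / x\<^sup>2) (at x)"
    unfolding Qf_def[abs_def] using assms
    by (auto intro!: derivative_eq_intros simp: power2_eq_square power3_eq_cube field_simps)
  then show ?thesis by blast
qed

lemma isCont_Qf: "x > 0 \<Longrightarrow> isCont (Qf M H c) x"
  using Qf_differentiable DERIV_isCont by blast

lemma continuous_on_Pf: "T \<subseteq> {0<..} \<Longrightarrow> continuous_on T (Pf M H c)"
  and continuous_on_wkill: "T \<subseteq> {0<..} \<Longrightarrow> continuous_on T (wkill H c)"
  using isCont_Pf isCont_wkill by (auto intro!: continuous_at_imp_continuous_on)

lemma positive_lower_bound:
  fixes f :: "real \<Rightarrow> real"
  assumes "x \<le> y" "continuous_on {x..y} f" "\<And>t. t \<in> {x..y} \<Longrightarrow> f t > 0"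
  obtains k where "k > 0" "\<And>t. t \<in> {x..y} \<Longrightarrow> f t \<ge> k"
proof -
  obtain z where "z \<in> {x..y}" "\<And>t. t \<in> {x..y} \<Longrightarrow> f z \<le> f t"
    using continuous_attains_inf[OF compact_Icc _ assms(2)] assms(1) by auto
  then show ?thesis using that[of "f z"] assms(3) by blast
qed

lemma first_zero:
  fixes f :: "real \<Rightarrow> real"
  assumes "x \<le> y" "continuous_on {x..y} f" "f x > 0" "f y \<le> 0"
  obtains z where "x < z" "z \<le> y" "f z = 0" "\<And>t. x \<le> t \<Longrightarrow> t < z \<Longrightarrow> f t > 0"
proof -
  define Z where "Z = {x..y} \<inter> f -` {..0}"
  have "closed Z" unfolding Z_def
    by (rule continuous_closed_preimage[OF assms(2)]) auto
  moreover have "bounded Z" by (rule bounded_subset[of "{x..y}"]) (auto simp: Z_def)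
  ultimately have "compact Z" by (simp add: compact_eq_bounded_closed)
  moreover have "y \<in> Z" using assms by (auto simp: Z_def)
  ultimately obtain z where z: "z \<in> Z" "\<And>t. t \<in> Z \<Longrightarrow> z \<le> t"
    using compact_attains_inf[of Z] by auto
  have pos: "f t > 0" if "x \<le> t" "t < z" for t
    using z that by (force simp: Z_def)
  have zx: "x < z" using z(1) assms(3) by (auto simp: Z_def less_le)
  have "f z \<le> 0" "z \<le> y" using z by (auto simp: Z_def)
  moreover have "f z = 0"
  proof (rule ccontr)
    assume "f z \<noteq> 0"
    then have "f z < 0" using \<open>f z \<le> 0\<close> by simp
    have "continuous_on {x..z} f" using assms(2) \<open>z \<le> y\<close> by (auto elim: continuous_on_subset)
    then obtain t where "x \<le> t" "t \<le> z" "f t = 0"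
      using IVT2'[of f z 0 x] \<open>f z < 0\<close> assms(3) zx by auto
    then show False using pos[of t] \<open>f z < 0\<close> by (cases "t = z") auto
  qed
  ultimately show ?thesis using that[of z] zx pos by blast
qed

lemma last_zero:
  fixes f :: "real \<Rightarrow> real"
  assumes "x \<le> y" "continuous_on {x..y} f" "f y > 0" "f x \<le> 0"
  obtains z where "x \<le> z" "z < y" "f z = 0" "\<And>t. z < t \<Longrightarrow> t \<le> y \<Longrightarrow> f t > 0"
proof -
  have "continuous_on {-y..-x} (\<lambda>t. f (- t))"
    by (intro continuous_on_compose2[OF assms(2)] continuous_intros) auto
  then obtain z where z: "-y < z" "z \<le> -x" "f (- z) = 0" "\<And>t. -y \<le> t \<Longrightarrow> t < z \<Longrightarrow> f (- t) > 0"
    using first_zero[of "-y" "-x" "\<lambda>t. f (- t)"] assms by auto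
  show ?thesis
  proof (rule that[of "- z"])
    show "f t > 0" if "- z < t" "t \<le> y" for t using z(4)[of "- t"] that by simp
  qed (use z in auto)
qed

section \<open>Consequences of closedness: escape and Lyapunov estimates\<close>

context profile
begin

lemma J_seg: "s \<in> J \<Longrightarrow> t \<in> J \<Longrightarrow> s \<le> x \<Longrightarrow> x \<le> t \<Longrightarrow> x \<in> J"
  using J_conn connectedD_interval by blast

lemma J_right: assumes "s \<in> J" obtains t where "t > s" "t \<in> J"
proof -
  obtain e where "e > 0" "ball s e \<subseteq> J" using J_open assms openE by blast
  then show ?thesis using that[of "s + e / 2"] by (auto simp: subset_iff dist_real_def)
qed

lemma J_left: assumes "s \<in> J" obtains t where "t < s" "t \<in> J"
proof -
  obtain e where "e > 0" "ball s e \<subseteq> J" using J_open assms openE by blast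
  then show ?thesis using that[of "s - e / 2"] by (auto simp: subset_iff dist_real_def)
qed

lemma u_mono: assumes "s \<in> J" "t \<in> J" "s < t" shows "u s < u t"
  using assms(3)
proof (rule DERIV_pos_imp_increasing)
  fix x assume "s \<le> x" "x \<le> t"
  then have "x \<in> J" using J_seg assms by blast
  then show "\<exists>y. (u has_real_derivative y) (at x) \<and> 0 < y"
    using u_deriv m_pos a_pos mult_pos_pos by blast
qed

lemma v_mono: assumes "s \<in> J" "t \<in> J" "s < t" shows "v s < v t"
  using assms(3)
proof (rule DERIV_pos_imp_increasing)
  fix x assume "s \<le> x" "x \<le> t"
  then have "x \<in> J" using J_seg assms by blast
  then show "\<exists>y. (v has_real_derivative y) (at x) \<and> 0 < y"
    using v_deriv m_pos b_pos mult_pos_pos by blast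
qed

lemma cont_J: "continuous_on J u" "continuous_on J v" "continuous_on J r" "continuous_on J p"
  by (auto intro!: continuous_at_imp_continuous_on DERIV_isCont[OF u_deriv] DERIV_isCont[OF v_deriv]
      DERIV_isCont[OF r_deriv] DERIV_isCont[OF p_deriv])

lemma G_pos: "s \<in> J \<Longrightarrow> horizon_factor M (r s) > 0"
  using r_pos M by (simp add: horizon_factor_def)

lemma p_square: assumes "s \<in> J" shows "(p s)\<^sup>2 = Pf M H c (r s)"
proof -
  have "(p s)\<^sup>2 - (wkill H c (r s))\<^sup>2 = (p s + wkill H c (r s)) * (p s - wkill H c (r s))"
    by (simp add: power2_eq_square algebra_simps)
  also have "\<dots> = horizon_factor M (r s) * kappa M (r s) * (horizon_factor M (r s) * a s * b s)"
    unfolding p_plus_w[OF assms] p_minus_w[OF assms] kappa_r[OF assms] by (simp add: mult_ac)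
  also have "\<dots> = h M (r s)"
    unfolding ab[OF assms] horizon_factor_kappa[OF M r_pos[OF assms]] using M by simp
  finally show ?thesis by (simp add: Pf_def)
qed

lemma v_pos_iff: "s \<in> J \<Longrightarrow> v s > 0 \<longleftrightarrow> p s + wkill H c (r s) > 0"
  and u_pos_iff: "s \<in> J \<Longrightarrow> u s > 0 \<longleftrightarrow> p s - wkill H c (r s) > 0"
  and u_neg_iff: "s \<in> J \<Longrightarrow> u s < 0 \<longleftrightarrow> p s - wkill H c (r s) < 0"
  unfolding p_plus_w p_minus_w using G_pos[of s] a_pos[of s] b_pos[of s]
  by (auto simp: zero_less_mult_iff mult_less_0_iff)

lemma Pf_pos_imp_p: "s \<in> J \<Longrightarrow> p s > 0 \<Longrightarrow> p s = sqrt (Pf M H c (r s))"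
  using p_square[of s] by (metis less_imp_le real_sqrt_unique)

text \<open>\<open>u\<close> and \<open>v\<close> increase, so if bounded they converge. The bound
  on \<open>r\<close> keeps the limit inside the extension, closedness puts it on the curve, and the
  curve continues beyond it because \<open>J\<close> is open; there \<open>u\<close> would exceed
  its supremum.\<close>

lemma escape_right:
  assumes s1: "s1 \<in> J" and "x1 > 0"
    and bd: "\<And>s. s \<in> J \<Longrightarrow> s1 \<le> s \<Longrightarrow> u s \<le> B \<and> v s \<le> B \<and> x1 \<le> r s"
  shows False
proof -
  define T where "T = J \<inter> {s1..}"
  define X where "X = Sup (u ` T)"
  define Y where "Y = Sup (v ` T)"
  have T: "s1 \<in> T" using s1 by (simp add: T_def)
  have bu: "bdd_above (u ` T)" and bv: "bdd_above (v ` T)"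
    using bd by (auto simp: T_def intro!: bdd_aboveI[of _ B])
  have uX: "u s \<le> X" and vY: "v s \<le> Y" if "s \<in> T" for s
    unfolding X_def Y_def using that bu bv by (auto intro: cSUP_upper)
  have umono: "u s \<le> u t" and vmono: "v s \<le> v t" if "s \<in> T" "t \<in> T" "s \<le> t" for s t
    using u_mono[of s t] v_mono[of s t] that by (cases "s = t"; auto simp: T_def)+
  define A where "A = (\<lambda>s. (u s, v s)) ` T"
  have cl: "(X, Y) \<in> closure A"
    unfolding closure_approachable
  proof (intro allI impI)
    fix e :: real assume e: "e > 0"
    \<comment> \<open>The suprema of \<open>u\<close> and \<open>v\<close> are approached at
      different parameters; by monotonicity the later one serves both.\<close>
    have "X - e / 2 < X" "Y - e / 2 < Y" using e by auto
    then obtain t1 t2 where t: "t1 \<in> T" "X - e / 2 < u t1" "t2 \<in> T" "Y - e / 2 < v t2"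
      unfolding X_def Y_def using less_cSUP_iff[OF _ bu] less_cSUP_iff[OF _ bv] T by (metis empty_iff)
    define t where "t = max t1 t2"
    have tT: "t \<in> T" using t by (auto simp: t_def max_def)
    have "u t1 \<le> u t" "v t2 \<le> v t" using umono vmono t tT by (auto simp: t_def)
    then have "\<bar>u t - X\<bar> < e / 2" "\<bar>v t - Y\<bar> < e / 2" using t uX[OF tT] vY[OF tT] by auto
    moreover have "dist (u t, v t) (X, Y) \<le> \<bar>u t - X\<bar> + \<bar>v t - Y\<bar>"
      unfolding dist_Pair_Pair dist_real_def using sqrt_sum_squares_le_sum_abs[of "u t - X" "v t - Y"] by simp
    ultimately have "dist (u t, v t) (X, Y) < e" by linarith
    then show "\<exists>y\<in>A. dist y (X, Y) < e" using tT by (auto simp: A_def)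
  qed
  \<comment> \<open>The weak inequality \<open>r \<ge> x1\<close> survives in the limit and keeps
    \<open>X * Y\<close> above \<open>- 2 * M\<close>.\<close>
  have "closed {q :: real \<times> real. fst q * snd q \<ge> kappa M x1}"
    by (intro closed_Collect_le continuous_intros)
  moreover have "A \<subseteq> {q. fst q * snd q \<ge> kappa M x1}"
    using bd kappa_r kappa_le[OF M, of x1] \<open>x1 > 0\<close> by (force simp: A_def T_def)
  ultimately have "(X, Y) \<in> {q. fst q * snd q \<ge> kappa M x1}" using cl closure_minimal by blast
  then have D: "(X, Y) \<in> {(x, y). x * y > - 2 * M}" using kappa_gt[OF M \<open>x1 > 0\<close>] by auto
  obtain C where C: "closed C" "(\<lambda>s. (u s, v s)) ` J = {(x, y). x * y > - 2 * M} \<inter> C"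
    using closed closedin_closed by (metis (no_types, lifting))
  have "closure A \<subseteq> C" by (rule closure_minimal) (use C in \<open>auto simp: A_def T_def\<close>)
  then have "(X, Y) \<in> (\<lambda>s. (u s, v s)) ` J" using C cl D by auto
  then obtain s where s: "s \<in> J" "u s = X" by auto
  have "s1 \<le> s" using u_mono[OF s(1) s1] uX[OF T] s(2) by force
  obtain t where t: "t > s" "t \<in> J" using J_right s(1) by blast
  then have "u t \<le> X" using \<open>s1 \<le> s\<close> uX by (auto simp: T_def)
  then show False using u_mono[OF s(1) t(2) t(1)] s(2) by simp
qed

text \<open>The reflection \<open>X \<mapsto> -X\<close>.\<close>

lemma mirror: "profile M H c (uminus ` J) (\<lambda>s. - v (- s)) (\<lambda>s. - u (- s)) (\<lambda>s. b (- s)) (\<lambda>s. a (- s)) (\<lambda>s. m (- s))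
    (\<lambda>s. r (- s)) (\<lambda>s. - p (- s))"
proof
  have mJ: "- s \<in> J" if "s \<in> uminus ` J" for s using that by auto
  have ch: "((\<lambda>s. f (- s)) has_real_derivative - d) (at s)" if "(f has_real_derivative d) (at (- s))" for f d and s :: real
    using that by (simp add: DERIV_mirror)
  have ch': "((\<lambda>s. - f (- s)) has_real_derivative d) (at s)" if "(f has_real_derivative d) (at (- s))" for f d and s :: real
    using DERIV_minus[OF ch[OF that]] by simp
  show "M > 0" by (fact M)
  show "open (uminus ` J)" using J_open by (simp add: open_negations)
  show "connected (uminus ` J)" by (intro connected_continuous_image continuous_intros J_conn)
  show "uminus ` J \<noteq> {}" using J_nonempty by simp
  show "continuous_on (uminus ` J) (\<lambda>s. m (- s))"
    by (intro continuous_on_compose2[OF m_cont] continuous_intros) auto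
  define N :: "real \<times> real \<Rightarrow> real \<times> real" where "N = (\<lambda>q. (- snd q, - fst q))"
  have "homeomorphism {(x, y). x * y > - 2 * M} {(x, y). x * y > - 2 * M} N N"
    by (rule homeomorphismI) (auto simp: N_def mult.commute intro!: continuous_intros)
  then have "closedin (top_of_set {(x, y). x * y > - 2 * M}) (N ` (\<lambda>s. (u s, v s)) ` J)"
    using closed by (rule homeomorphism_imp_closed_map)
  moreover have "N ` (\<lambda>s. (u s, v s)) ` J = (\<lambda>s. (- v (- s), - u (- s))) ` uminus ` J"
    by (auto simp: N_def image_image)
  ultimately show "closedin (top_of_set {(x, y). x * y > - 2 * M}) ((\<lambda>s. (- v (- s), - u (- s))) ` uminus ` J)" by simp
  fix s assume "s \<in> uminus ` J"
  note s = mJ[OF this]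
  show "r (- s) > 0" "b (- s) > 0" "a (- s) > 0" "m (- s) > 0"
    using r_pos a_pos b_pos m_pos s by auto
  show "kappa M (r (- s)) = - v (- s) * - u (- s)" using kappa_r[OF s] by (simp add: mult.commute)
  show "((\<lambda>s. - v (- s)) has_real_derivative m (- s) * b (- s)) (at s)" by (rule ch'[OF v_deriv[OF s]])
  show "((\<lambda>s. - u (- s)) has_real_derivative m (- s) * a (- s)) (at s)" by (rule ch'[OF u_deriv[OF s]])
  show "((\<lambda>s. r (- s)) has_real_derivative m (- s) * - p (- s)) (at s)" using ch[OF r_deriv[OF s]] by simp
  show "((\<lambda>s. - p (- s)) has_real_derivative m (- s) * Qf M H c (r (- s))) (at s)" by (rule ch'[OF p_deriv[OF s]])
  show "horizon_factor M (r (- s)) * b (- s) * a (- s) = 1 / (4 * M)" using ab[OF s] by (simp add: mult_ac)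
  show "- p (- s) + wkill H c (r (- s)) = horizon_factor M (r (- s)) * - u (- s) * b (- s)" using p_minus_w[OF s] by simp
  show "- p (- s) - wkill H c (r (- s)) = horizon_factor M (r (- s)) * - v (- s) * a (- s)" using p_plus_w[OF s] by simp
qed

text \<open>Time reversal.\<close>

lemma wkill_minus: "wkill (- H) (- c) x = - wkill H c x" by (simp add: wkill_def)

lemma swap: "profile M (- H) (- c) J v u b a m r p"
proof
  define N :: "real \<times> real \<Rightarrow> real \<times> real" where "N = (\<lambda>q. (snd q, fst q))"
  have "homeomorphism {(x, y). x * y > - 2 * M} {(x, y). x * y > - 2 * M} N N"
    by (rule homeomorphismI) (auto simp: N_def mult.commute intro!: continuous_intros)
  then have "closedin (top_of_set {(x, y). x * y > - 2 * M}) (N ` (\<lambda>s. (u s, v s)) ` J)"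
    using closed by (rule homeomorphism_imp_closed_map)
  then show "closedin (top_of_set {(x, y). x * y > - 2 * M}) ((\<lambda>s. (v s, u s)) ` J)"
    by (simp add: N_def image_image)
  fix s assume s: "s \<in> J"
  show "kappa M (r s) = v s * u s" using kappa_r[OF s] by (simp add: mult.commute)
  show "(p has_real_derivative m s * Qf M (- H) (- c) (r s)) (at s)"
    using p_deriv[OF s] by (simp add: Qf_def wkill_minus)
  show "horizon_factor M (r s) * b s * a s = 1 / (4 * M)" using ab[OF s] by (simp add: mult_ac)
  show "p s + wkill (- H) (- c) (r s) = horizon_factor M (r s) * u s * b s"
    "p s - wkill (- H) (- c) (r s) = horizon_factor M (r s) * v s * a s"
    using p_minus_w[OF s] p_plus_w[OF s] by (simp_all add: wkill_minus)
qed (use M J_open J_conn J_nonempty r_pos u_deriv v_deriv a_pos b_pos m_pos m_cont r_deriv in auto)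

lemma escape_left:
  assumes s1: "s1 \<in> J" and "x1 > 0"
    and bd: "\<And>s. s \<in> J \<Longrightarrow> s \<le> s1 \<Longrightarrow> B \<le> u s \<and> B \<le> v s \<and> x1 \<le> r s"
  shows False
proof -
  interpret N: profile M H c "uminus ` J" "\<lambda>s. - v (- s)" "\<lambda>s. - u (- s)" "\<lambda>s. b (- s)" "\<lambda>s. a (- s)" "\<lambda>s. m (- s)"
      "\<lambda>s. r (- s)" "\<lambda>s. - p (- s)"
    by (rule mirror)
  show False
    by (rule N.escape_right[of "- s1" x1 "- B"]) (use assms in auto)
qed

text \<open>The growth of \<open>ln v\<close> per arc length depends on \<open>p + w\<close> only,
  since \<open>b / v\<close> is the quotient of \<open>a b\<close> and \<open>v a\<close>, and both
  are known up to the same factor.\<close>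

lemma v_log_deriv:
  assumes s: "s \<in> J" "v s > 0"
  shows "((\<lambda>s. ln (v s)) has_real_derivative m s / (4 * M * (p s + wkill H c (r s)))) (at s)"
proof -
  have "((\<lambda>s. ln (v s)) has_real_derivative m s * b s / v s) (at s)"
    using v_deriv[OF s(1)] s(2) by (auto intro!: derivative_eq_intros)
  moreover have "b s / v s = 1 / (4 * M * (p s + wkill H c (r s)))"
    using ab[OF s(1)] p_plus_w[OF s(1)] s(2) G_pos[OF s(1)] a_pos[OF s(1)] M by (simp add: field_simps)
  ultimately show ?thesis by (metis times_divide_eq_right mult.right_neutral)
qed

text \<open>Per arc length \<open>ln v\<close> grows at most by
  \<open>1 / (4 * M * \<delta>)\<close> and \<open>l\<close> at least by \<open>\<kappa>\<close>;
  the constant makes the two rates comparable.\<close>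

lemma lyapunov_mono:
  assumes st: "s \<in> J" "t \<in> J" "s \<le> t" and "\<delta> > 0" "\<kappa> > 0"
    and l: "\<And>x. s \<le> x \<Longrightarrow> x \<le> t \<Longrightarrow> v x > 0 \<and> p x + wkill H c (r x) \<ge> \<delta> \<and> (l has_real_derivative l' x) (at x) \<and> l' x \<ge> \<kappa> * m x"
  shows "ln (v t) - l t / (4 * M * \<delta> * \<kappa>) \<le> ln (v s) - l s / (4 * M * \<delta> * \<kappa>)"
  using st(3)
proof (rule DERIV_nonpos_imp_nonincreasing)
  fix x assume x: "s \<le> x" "x \<le> t"
  then have xJ: "x \<in> J" using J_seg st by blast
  have "((\<lambda>x. ln (v x) - l x / (4 * M * \<delta> * \<kappa>)) has_real_derivative m x / (4 * M * (p x + wkill H c (r x))) - l' x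
      / (4 * M * \<delta> * \<kappa>)) (at x)"
    using v_log_deriv[OF xJ] l[OF x] by (intro DERIV_diff DERIV_cdivide) auto
  moreover have "m x / (4 * M * (p x + wkill H c (r x))) \<le> m x / (4 * M * \<delta>)"
    using l[OF x] m_pos[OF xJ] M \<open>\<delta> > 0\<close> by (intro divide_left_mono mult_left_mono mult_pos_pos) auto
  moreover have "m x / (4 * M * \<delta>) = \<kappa> * m x / (4 * M * \<delta> * \<kappa>)" using \<open>\<kappa> > 0\<close> by simp
  moreover have "\<kappa> * m x / (4 * M * \<delta> * \<kappa>) \<le> l' x / (4 * M * \<delta> * \<kappa>)"
    using l[OF x] M \<open>\<delta> > 0\<close> \<open>\<kappa> > 0\<close> by (intro divide_right_mono) auto
  ultimately show "\<exists>y. ((\<lambda>x. ln (v x) - l x / (4 * M * \<delta> * \<kappa>)) has_real_derivative y) (at x) \<and> y \<le> 0"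
    by (intro exI conjI) (assumption, linarith)
qed

text \<open>A bound on \<open>l\<close> bounds \<open>v\<close>; then
  \<open>u = kappa M r / v\<close> is bounded, because \<open>v\<close> increases from a positive
  value and \<open>r \<le> x2\<close>. This is what \<open>escape_right\<close> forbids.\<close>

lemma lyapunov_right:
  assumes s1: "s1 \<in> J" and "\<delta> > 0" "\<kappa> > 0" "x1 > 0"
    and l: "\<And>s. s \<in> J \<Longrightarrow> s1 \<le> s \<Longrightarrow> v s > 0 \<and> p s + wkill H c (r s) \<ge> \<delta> \<and> (l has_real_derivative l' s) (at s) \<and>
       l' s \<ge> \<kappa> * m s \<and> l s \<le> \<Lambda> \<and> x1 \<le> r s \<and> r s \<le> x2"
  shows False
proof -
  define B where "B = exp (ln (v s1) + (\<Lambda> - l s1) / (4 * M * \<delta> * \<kappa>))"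
  define B' where "B' = \<bar>kappa M x2\<bar> / v s1"
  have v1: "v s1 > 0" using l[OF s1] by auto
  show False
  proof (rule escape_right[OF s1 \<open>x1 > 0\<close>, of "max B B'"])
    fix s assume s: "s \<in> J" "s1 \<le> s"
    have vs: "v s > 0" using l[OF s] by auto
    have "ln (v s) - l s / (4 * M * \<delta> * \<kappa>) \<le> ln (v s1) - l s1 / (4 * M * \<delta> * \<kappa>)"
      using l J_seg[OF s1 s(1)] by (intro lyapunov_mono[OF s1 s assms(2,3)]) blast
    moreover have "l s / (4 * M * \<delta> * \<kappa>) \<le> \<Lambda> / (4 * M * \<delta> * \<kappa>)"
      using l[OF s] M assms(2,3) by (intro divide_right_mono) auto
    ultimately have "ln (v s) \<le> ln (v s1) + (\<Lambda> - l s1) / (4 * M * \<delta> * \<kappa>)" by (simp add: diff_divide_distrib)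
    then have "v s \<le> B" unfolding B_def using vs by (metis exp_le_cancel_iff exp_ln)
    moreover have "u s \<le> B'"
    proof -
      have "u s * v s \<le> \<bar>kappa M x2\<bar>" using kappa_r[OF s(1)] kappa_le[OF M, of "r s" x2] l[OF s] r_pos[OF s(1)] by auto
      then have "u s \<le> \<bar>kappa M x2\<bar> / v s" using vs by (simp add: pos_le_divide_eq)
      also have "\<dots> \<le> B'" unfolding B'_def using v_mono[OF s1 s(1)] s(2) v1 vs
        by (intro divide_left_mono) (auto simp: less_le)
      finally show ?thesis .
    qed
    ultimately show "u s \<le> max B B' \<and> v s \<le> max B B' \<and> x1 \<le> r s" using l[OF s] by auto
  qed
qed

text \<open>To the left \<open>v\<close> stays above a positive \<open>B\<close>, and
  \<open>u v > - 2 M\<close> then bounds \<open>u\<close> from below, which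
  \<open>escape_left\<close> forbids.\<close>

lemma lyapunov_left:
  assumes s1: "s1 \<in> J" and "\<delta> > 0" "\<kappa> > 0" "x1 > 0"
    and l: "\<And>s. s \<in> J \<Longrightarrow> s \<le> s1 \<Longrightarrow> v s > 0 \<and> p s + wkill H c (r s) \<ge> \<delta> \<and> (l has_real_derivative l' s) (at s) \<and>
       l' s \<ge> \<kappa> * m s \<and> \<Lambda> \<le> l s \<and> x1 \<le> r s"
  shows False
proof -
  define B where "B = exp (ln (v s1) - (l s1 - \<Lambda>) / (4 * M * \<delta> * \<kappa>))"
  have B: "B > 0" by (simp add: B_def)
  show False
  proof (rule escape_left[OF s1 \<open>x1 > 0\<close>, of "min 0 (- (2 * M) / B)"])
    fix s assume s: "s \<in> J" "s \<le> s1"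
    have vs: "v s > 0" using l[OF s] by auto
    have "ln (v s1) - l s1 / (4 * M * \<delta> * \<kappa>) \<le> ln (v s) - l s / (4 * M * \<delta> * \<kappa>)"
      using l J_seg[OF s(1) s1] by (intro lyapunov_mono[OF s(1) s1 s(2) assms(2,3)]) blast
    moreover have "\<Lambda> / (4 * M * \<delta> * \<kappa>) \<le> l s / (4 * M * \<delta> * \<kappa>)"
      using l[OF s] M assms(2,3) by (intro divide_right_mono) auto
    ultimately have "ln (v s1) - (l s1 - \<Lambda>) / (4 * M * \<delta> * \<kappa>) \<le> ln (v s)" by (simp add: diff_divide_distrib)
    then have vB: "B \<le> v s" unfolding B_def using vs by (metis exp_le_cancel_iff exp_ln)
    have "- (2 * M) / B \<le> u s"
    proof -
      have "u s * v s > - (2 * M)" using kappa_r[OF s(1)] kappa_gt[OF M r_pos[OF s(1)]] by simp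
      then have "- (2 * M) / v s < u s" using vs by (simp only: pos_divide_less_eq)
      moreover have "2 * M / v s \<le> 2 * M / B" using vB B M vs by (intro divide_left_mono) auto
      ultimately show ?thesis by simp
    qed
    then show "min 0 (- (2 * M) / B) \<le> u s \<and> min 0 (- (2 * M) / B) \<le> v s \<and> x1 \<le> r s"
      using l[OF s] vs by auto
  qed
qed

end

section \<open>Reaching prescribed radii and turning points\<close>

context profile
begin

lemma cont_seg:
  assumes "s \<in> J" "t \<in> J"
  shows "continuous_on {s..t} r" "continuous_on {s..t} p"
proof -
  have "{s..t} \<subseteq> J" using J_seg[OF assms] by auto
  then show "continuous_on {s..t} r" "continuous_on {s..t} p"
    using continuous_on_subset[OF cont_J(3)] continuous_on_subset[OF cont_J(4)] by auto
qed

text \<open>While the radius is where \<open>Pf > 0\<close>, \<open>p\<close> cannot vanish, so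
  \<open>r\<close> keeps increasing; only an arrival at \<open>\<rho>\<close> could end this, and
  \<open>no0\<close> rules it out. It serves inside arguments by contradiction.\<close>

lemma persist_right:
  assumes s1: "s1 \<in> J" "p s1 > 0" "r s1 < \<rho>"
    and P0: "\<forall>x. r s1 \<le> x \<longrightarrow> x < \<rho> \<longrightarrow> Pf M H c x > 0"
    and no0: "\<forall>s\<in>J. s1 \<le> s \<longrightarrow> r s = \<rho> \<longrightarrow> \<not> (\<forall>t. s1 \<le> t \<longrightarrow> t < s \<longrightarrow> p t > 0)"
    and s: "s \<in> J" "s1 \<le> s"
  shows "p s > 0" "r s1 \<le> r s" "r s < \<rho>"
proof -
  have P: "Pf M H c x > 0" if "r s1 \<le> x" "x < \<rho>" for x using P0 that by blast
  have no: False if "s \<in> J" "s1 \<le> s" "r s = \<rho>" "\<And>t. s1 \<le> t \<Longrightarrow> t < s \<Longrightarrow> p t > 0" for s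
    using no0 that by blast
  have J: "x \<in> J" if "s1 \<le> x" "x \<le> t" "t \<in> J" for x t using J_seg s1(1) that by blast
  have mono: "r s1 \<le> r t" if t: "t \<in> J" "s1 \<le> t" and pos: "\<And>x. s1 \<le> x \<Longrightarrow> x < t \<Longrightarrow> p x > 0" for t
  proof (rule DERIV_nonneg_imp_increasing_open[OF t(2)])
    show "continuous_on {s1..t} r" using cont_seg(1)[OF s1(1) t(1)] .
    fix x assume "s1 < x" "x < t"
    then show "\<exists>y. (r has_real_derivative y) (at x) \<and> 0 \<le> y"
      using r_deriv[OF J[of x t]] m_pos[OF J[of x t]] pos[of x] t by (intro exI[of _ "m x * p x"]) auto
  qed
  have less: "r t < \<rho>" if t: "t \<in> J" "s1 \<le> t" and pos: "\<And>x. s1 \<le> x \<Longrightarrow> x < t \<Longrightarrow> p x > 0" for t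
  proof (rule ccontr)
    assume "\<not> r t < \<rho>"
    moreover have "continuous_on {s1..t} r" using cont_seg(1)[OF s1(1) t(1)] .
    ultimately obtain x where "s1 \<le> x" "x \<le> t" "r x = \<rho>" using IVT'[of r s1 \<rho> t] s1(3) t by auto
    then show False using no[of x] J[of x t] t pos by auto
  qed
  have pos: "p t > 0" if t: "t \<in> J" "s1 \<le> t" for t
  proof (rule ccontr)
    assume "\<not> p t > 0"
    moreover have "continuous_on {s1..t} p" using cont_seg(2)[OF s1(1) t(1)] .
    ultimately obtain z where z: "s1 < z" "z \<le> t" "p z = 0" "\<And>x. s1 \<le> x \<Longrightarrow> x < z \<Longrightarrow> p x > 0"
      using first_zero[of s1 t p] s1(2) t by auto
    have zJ: "z \<in> J" using J[of z t] z t by auto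
    have "Pf M H c (r z) > 0" using P less[OF zJ _ z(4)] mono[OF zJ _ z(4)] z(1) by auto
    then show False using p_square[OF zJ] z(3) by simp
  qed
  have posx: "p x > 0" if "s1 \<le> x" "x < s" for x using pos[of x] J[of x s] that s by auto
  show "p s > 0" "r s1 \<le> r s" "r s < \<rho>" using pos[OF s] mono[OF s posx] less[OF s posx] by auto
qed

lemma persist_left:
  assumes s1: "s1 \<in> J" "p s1 > 0" "\<rho> < r s1"
    and P0: "\<forall>x. \<rho> < x \<longrightarrow> x \<le> r s1 \<longrightarrow> Pf M H c x > 0"
    and no0: "\<forall>s\<in>J. s \<le> s1 \<longrightarrow> r s = \<rho> \<longrightarrow> \<not> (\<forall>t. s < t \<longrightarrow> t \<le> s1 \<longrightarrow> p t > 0)"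
    and s: "s \<in> J" "s \<le> s1"
  shows "p s > 0" "r s \<le> r s1" "\<rho> < r s"
proof -
  have P: "Pf M H c x > 0" if "\<rho> < x" "x \<le> r s1" for x using P0 that by blast
  have no: False if "s \<in> J" "s \<le> s1" "r s = \<rho>" "\<And>t. s < t \<Longrightarrow> t \<le> s1 \<Longrightarrow> p t > 0" for s
    using no0 that by blast
  have J: "x \<in> J" if "t \<le> x" "x \<le> s1" "t \<in> J" for x t using J_seg s1(1) that by blast
  have mono: "r t \<le> r s1" if t: "t \<in> J" "t \<le> s1" and pos: "\<And>x. t < x \<Longrightarrow> x \<le> s1 \<Longrightarrow> p x > 0" for t
  proof (rule DERIV_nonneg_imp_increasing_open[OF t(2)])
    show "continuous_on {t..s1} r" using cont_seg(1)[OF t(1) s1(1)] .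
    fix x assume "t < x" "x < s1"
    then show "\<exists>y. (r has_real_derivative y) (at x) \<and> 0 \<le> y"
      using r_deriv[OF J[of t x]] m_pos[OF J[of t x]] pos[of x] t by (intro exI[of _ "m x * p x"]) auto
  qed
  have less: "\<rho> < r t" if t: "t \<in> J" "t \<le> s1" and pos: "\<And>x. t < x \<Longrightarrow> x \<le> s1 \<Longrightarrow> p x > 0" for t
  proof (rule ccontr)
    assume "\<not> \<rho> < r t"
    moreover have "continuous_on {t..s1} r" using cont_seg(1)[OF t(1) s1(1)] .
    ultimately obtain x where "t \<le> x" "x \<le> s1" "r x = \<rho>" using IVT'[of r t \<rho> s1] s1(3) t by auto
    then show False using no[of x] J[of t x] t pos by auto
  qed
  have pos: "p t > 0" if t: "t \<in> J" "t \<le> s1" for t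
  proof (rule ccontr)
    assume "\<not> p t > 0"
    moreover have "continuous_on {t..s1} p" using cont_seg(2)[OF t(1) s1(1)] .
    ultimately obtain z where z: "t \<le> z" "z < s1" "p z = 0" "\<And>x. z < x \<Longrightarrow> x \<le> s1 \<Longrightarrow> p x > 0"
      using last_zero[of t s1 p] s1(2) t by auto
    have zJ: "z \<in> J" using J[of t z] z t by auto
    have "Pf M H c (r z) > 0" using P less[OF zJ _ z(4)] mono[OF zJ _ z(4)] z(2) by auto
    then show False using p_square[OF zJ] z(3) by simp
  qed
  have posx: "p x > 0" if "s < x" "x \<le> s1" for x using pos[of x] J[of s x] that s by auto
  show "p s > 0" "r s \<le> r s1" "\<rho> < r s" using pos[OF s] mono[OF s posx] less[OF s posx] by auto
qed

text \<open>On a stretch with \<open>p > 0\<close> one has \<open>p = sqrt Pf\<close>. The second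
  condition then reads \<open>p + w > 0\<close>, that is \<open>v > 0\<close>, which the estimate of
  \<open>ln v\<close> relies on.\<close>

definition adm :: "real \<Rightarrow> bool" where
  "adm x \<longleftrightarrow> Pf M H c x > 0 \<and> sqrt (Pf M H c x) + wkill H c x > 0"

text \<open>If \<open>\<rho>\<close> were missed, the radius itself would be a bounded Lyapunov
  function, with \<open>p\<close> bounded below on the compact range of radii.\<close>

lemma reach_right:
  assumes s1: "s1 \<in> J" "p s1 > 0" "r s1 < \<rho>" and A: "\<And>x. r s1 \<le> x \<Longrightarrow> x \<le> \<rho> \<Longrightarrow> adm x"
  shows "\<exists>s\<in>J. s1 \<le> s \<and> r s = \<rho> \<and> p s > 0"
proof (rule ccontr)
  assume none': "\<not> ?thesis"
  then have none: False if "s \<in> J" "s1 \<le> s" "r s = \<rho>" "p s > 0" for s using that none' by blast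
  have r1: "r s1 > 0" using r_pos s1 by blast
  have P: "Pf M H c x > 0" if "r s1 \<le> x" "x \<le> \<rho>" for x using A that by (simp add: adm_def)
  \<comment> \<open>At a first arrival \<open>p\<close> is a limit of positive values and nonzero by
    admissibility, hence positive, and such arrivals are excluded by assumption.\<close>
  have no: False if s: "s \<in> J" "s1 \<le> s" "r s = \<rho>" and pos: "\<And>t. s1 \<le> t \<Longrightarrow> t < s \<Longrightarrow> p t > 0" for s
  proof -
    have "p s \<noteq> 0" using p_square[OF s(1)] P[of \<rho>] s s1 by auto
    moreover have "p s \<ge> 0"
    proof (rule ccontr)
      assume "\<not> 0 \<le> p s"
      moreover have "continuous_on {s1..s} p" using cont_seg(2)[OF s1(1) s(1)] .
      ultimately obtain z where "s1 \<le> z" "z \<le> s" "p z = (p s) / 2" using IVT2'[of p s "p s / 2" s1] s s1 by auto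
      then show False using pos[of z] \<open>\<not> 0 \<le> p s\<close> by (cases "z = s") auto
    qed
    ultimately show False using none[OF s] by simp
  qed
  have "\<forall>x. r s1 \<le> x \<longrightarrow> x < \<rho> \<longrightarrow> Pf M H c x > 0" using P by simp
  moreover have "\<forall>s\<in>J. s1 \<le> s \<longrightarrow> r s = \<rho> \<longrightarrow> \<not> (\<forall>t. s1 \<le> t \<longrightarrow> t < s \<longrightarrow> p t > 0)"
    using no by blast
  ultimately have keep: "p s > 0" "r s1 \<le> r s" "r s < \<rho>" if "s \<in> J" "s1 \<le> s" for s
    by (rule persist_right[OF s1 _ _ that])+
  have sub: "{r s1..\<rho>} \<subseteq> {0<..}" using r1 by auto
  have c1: "continuous_on {r s1..\<rho>} (\<lambda>x. sqrt (Pf M H c x))"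
    by (rule continuous_on_real_sqrt[OF continuous_on_Pf[OF sub]])
  have c2: "continuous_on {r s1..\<rho>} (\<lambda>x. sqrt (Pf M H c x) + wkill H c x)"
    by (rule continuous_on_add[OF c1 continuous_on_wkill[OF sub]])
  obtain \<kappa> where k: "\<kappa> > 0" "\<And>x. x \<in> {r s1..\<rho>} \<Longrightarrow> sqrt (Pf M H c x) \<ge> \<kappa>"
    by (rule positive_lower_bound[OF less_imp_le[OF s1(3)] c1]) (use P in auto)
  obtain \<delta> where d: "\<delta> > 0" "\<And>x. x \<in> {r s1..\<rho>} \<Longrightarrow> sqrt (Pf M H c x) + wkill H c x \<ge> \<delta>"
    by (rule positive_lower_bound[OF less_imp_le[OF s1(3)] c2]) (use A in \<open>auto simp: adm_def\<close>)
  show False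
  proof (rule lyapunov_right[OF s1(1) d(1) k(1) r1, of r "\<lambda>s. m s * p s" \<rho> \<rho>])
    fix s assume s: "s \<in> J" "s1 \<le> s"
    note K = keep[OF s]
    have ps: "p s = sqrt (Pf M H c (r s))" using Pf_pos_imp_p[OF s(1) K(1)] .
    have "\<delta> \<le> p s + wkill H c (r s)" using d(2)[of "r s"] K ps by auto
    moreover have "\<kappa> \<le> p s" using k(2)[of "r s"] K ps by auto
    moreover have "\<kappa> * m s \<le> m s * p s" using m_pos[OF s(1)] \<open>\<kappa> \<le> p s\<close> by (simp add: mult.commute)
    ultimately show "v s > 0 \<and> p s + wkill H c (r s) \<ge> \<delta> \<and> (r has_real_derivative m s * p s) (at s) \<and>
       m s * p s \<ge> \<kappa> * m s \<and> r s \<le> \<rho> \<and> r s1 \<le> r s \<and> r s \<le> \<rho>"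
      using v_pos_iff[OF s(1)] r_deriv[OF s(1)] K d(1) by auto
  qed
qed

lemma reach_left:
  assumes s1: "s1 \<in> J" "p s1 > 0" "\<rho> < r s1" and \<rho>: "\<rho> > 0" and A: "\<And>x. \<rho> \<le> x \<Longrightarrow> x \<le> r s1 \<Longrightarrow> adm x"
  shows "\<exists>s\<in>J. s \<le> s1 \<and> r s = \<rho> \<and> p s > 0"
proof (rule ccontr)
  assume none': "\<not> ?thesis"
  then have none: False if "s \<in> J" "s \<le> s1" "r s = \<rho>" "p s > 0" for s using that none' by blast
  have P: "Pf M H c x > 0" if "\<rho> \<le> x" "x \<le> r s1" for x using A that by (simp add: adm_def)
  have no: False if s: "s \<in> J" "s \<le> s1" "r s = \<rho>" and pos: "\<And>t. s < t \<Longrightarrow> t \<le> s1 \<Longrightarrow> p t > 0" for s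
  proof -
    have "p s \<noteq> 0" using p_square[OF s(1)] P[of \<rho>] s s1 by auto
    moreover have "p s \<ge> 0"
    proof (rule ccontr)
      assume "\<not> 0 \<le> p s"
      moreover have "continuous_on {s..s1} p" using cont_seg(2)[OF s(1) s1(1)] .
      ultimately obtain z where "s \<le> z" "z \<le> s1" "p z = (p s) / 2" using IVT'[of p s "p s / 2" s1] s s1 by auto
      then show False using pos[of z] \<open>\<not> 0 \<le> p s\<close> by (cases "z = s") auto
    qed
    ultimately show False using none[OF s] by simp
  qed
  have "\<forall>x. \<rho> < x \<longrightarrow> x \<le> r s1 \<longrightarrow> Pf M H c x > 0" using P by simp
  moreover have "\<forall>s\<in>J. s \<le> s1 \<longrightarrow> r s = \<rho> \<longrightarrow> \<not> (\<forall>t. s < t \<longrightarrow> t \<le> s1 \<longrightarrow> p t > 0)"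
    using no by blast
  ultimately have keep: "p s > 0" "r s \<le> r s1" "\<rho> < r s" if "s \<in> J" "s \<le> s1" for s
    by (rule persist_left[OF s1 _ _ that])+
  have sub: "{\<rho>..r s1} \<subseteq> {0<..}" using \<rho> by auto
  have c1: "continuous_on {\<rho>..r s1} (\<lambda>x. sqrt (Pf M H c x))"
    by (rule continuous_on_real_sqrt[OF continuous_on_Pf[OF sub]])
  have c2: "continuous_on {\<rho>..r s1} (\<lambda>x. sqrt (Pf M H c x) + wkill H c x)"
    by (rule continuous_on_add[OF c1 continuous_on_wkill[OF sub]])
  obtain \<kappa> where k: "\<kappa> > 0" "\<And>x. x \<in> {\<rho>..r s1} \<Longrightarrow> sqrt (Pf M H c x) \<ge> \<kappa>"
    by (rule positive_lower_bound[OF less_imp_le[OF s1(3)] c1]) (use P in auto)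
  obtain \<delta> where d: "\<delta> > 0" "\<And>x. x \<in> {\<rho>..r s1} \<Longrightarrow> sqrt (Pf M H c x) + wkill H c x \<ge> \<delta>"
    by (rule positive_lower_bound[OF less_imp_le[OF s1(3)] c2]) (use A in \<open>auto simp: adm_def\<close>)
  show False
  proof (rule lyapunov_left[OF s1(1) d(1) k(1) \<rho>, of r "\<lambda>s. m s * p s" \<rho>])
    fix s assume s: "s \<in> J" "s \<le> s1"
    note K = keep[OF s]
    have ps: "p s = sqrt (Pf M H c (r s))" using Pf_pos_imp_p[OF s(1) K(1)] .
    have "\<delta> \<le> p s + wkill H c (r s)" using d(2)[of "r s"] K ps by auto
    moreover have "\<kappa> \<le> p s" using k(2)[of "r s"] K ps by auto
    moreover have "\<kappa> * m s \<le> m s * p s" using m_pos[OF s(1)] \<open>\<kappa> \<le> p s\<close> by (simp add: mult.commute)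
    ultimately show "v s > 0 \<and> p s + wkill H c (r s) \<ge> \<delta> \<and> (r has_real_derivative m s * p s) (at s) \<and>
       m s * p s \<ge> \<kappa> * m s \<and> \<rho> \<le> r s \<and> \<rho> \<le> r s"
      using v_pos_iff[OF s(1)] r_deriv[OF s(1)] K d(1) by auto
  qed
qed

text \<open>Near a simple zero of \<open>Pf\<close> the momentum \<open>p\<close> itself serves as Lyapunov function.\<close>

lemma reach_turn_right:
  assumes s1: "s1 \<in> J" "p s1 > 0" "r s1 < \<rho>" and A: "\<And>x. r s1 \<le> x \<Longrightarrow> x < \<rho> \<Longrightarrow> adm x"
    and \<rho>: "Qf M H c \<rho> < 0" "wkill H c \<rho> > 0" "Pf M H c \<rho> = 0"
  shows "\<exists>s\<in>J. s1 \<le> s \<and> r s = \<rho>"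
proof (rule ccontr)
  assume none': "\<not> ?thesis"
  then have none: False if "s \<in> J" "s1 \<le> s" "r s = \<rho>" for s using that none' by blast
  have r1: "r s1 > 0" using r_pos s1 by blast
  have "isCont (Qf M H c) \<rho>" using isCont_Qf r1 s1(3) by auto
  \<comment> \<open>Near \<open>\<rho>\<close> the force stays below half its value there, so
    \<open>p\<close> decreases at a definite rate.\<close>
  then have "eventually (\<lambda>x. Qf M H c x < Qf M H c \<rho> / 2) (at \<rho>)"
    unfolding isCont_def using order_tendstoD(2)[of "Qf M H c" "Qf M H c \<rho>" "at \<rho>" "Qf M H c \<rho> / 2"] \<rho>(1) by simp
  then obtain d where d: "d > 0" "\<And>x. x \<noteq> \<rho> \<Longrightarrow> \<bar>x - \<rho>\<bar> < d \<Longrightarrow> Qf M H c x < Qf M H c \<rho> / 2"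
    unfolding eventually_at dist_real_def by auto
  define \<sigma> where "\<sigma> = max (r s1) (\<rho> - d / 2)"
  define \<kappa> where "\<kappa> = - Qf M H c \<rho> / 2"
  have k: "\<kappa> > 0" using \<rho> by (simp add: \<kappa>_def)
  have \<sigma>: "r s1 \<le> \<sigma>" "\<sigma> < \<rho>" using s1(3) d(1) by (auto simp: \<sigma>_def)
  have Q: "Qf M H c x \<le> - \<kappa>" if "\<sigma> \<le> x" "x \<le> \<rho>" for x
    using d(2)[of x] that d(1) \<rho>(1) by (cases "x = \<rho>") (auto simp: \<sigma>_def \<kappa>_def)
  \<comment> \<open>First advance to the radius \<open>\<sigma>\<close> in that neighbourhood; all
    radii up to \<open>\<sigma>\<close> are admissible, so \<open>reach_right\<close>
    applies.\<close>
  obtain s2 where s2: "s2 \<in> J" "s1 \<le> s2" "r s2 = \<sigma>" "p s2 > 0"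
  proof (cases "\<sigma> = r s1")
    case True then show ?thesis using that s1 by auto
  next
    case False
    then have "r s1 < \<sigma>" using \<sigma> by simp
    from reach_right[OF s1(1,2) this] A \<sigma>(2) that show ?thesis by force
  qed
  have P: "Pf M H c x > 0" if "r s2 \<le> x" "x < \<rho>" for x using A[of x] that \<sigma> s2 by (simp add: adm_def)
  have "r s2 < \<rho>" using s2 \<sigma> by simp
  have "\<forall>x. r s2 \<le> x \<longrightarrow> x < \<rho> \<longrightarrow> Pf M H c x > 0" using P by simp
  moreover have "\<forall>s\<in>J. s2 \<le> s \<longrightarrow> r s = \<rho> \<longrightarrow> \<not> (\<forall>t. s2 \<le> t \<longrightarrow> t < s \<longrightarrow> p t > 0)"
    using none s2(2) order_trans by blast
  ultimately have keep: "p s > 0" "r s2 \<le> r s" "r s < \<rho>" if "s \<in> J" "s2 \<le> s" for s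
    by (rule persist_right[OF s2(1,4) \<open>r s2 < \<rho>\<close> _ _ that])+
  have sub: "{\<sigma>..\<rho>} \<subseteq> {0<..}" using \<sigma> r1 by auto
  have c1: "continuous_on {\<sigma>..\<rho>} (\<lambda>x. sqrt (Pf M H c x))"
    by (rule continuous_on_real_sqrt[OF continuous_on_Pf[OF sub]])
  have c2: "continuous_on {\<sigma>..\<rho>} (\<lambda>x. sqrt (Pf M H c x) + wkill H c x)"
    by (rule continuous_on_add[OF c1 continuous_on_wkill[OF sub]])
  have pos: "sqrt (Pf M H c x) + wkill H c x > 0" if "x \<in> {\<sigma>..\<rho>}" for x
    using A[of x] \<rho> that \<sigma> by (cases "x = \<rho>") (auto simp: adm_def)
  obtain \<delta> where \<delta>: "\<delta> > 0" "\<And>x. x \<in> {\<sigma>..\<rho>} \<Longrightarrow> sqrt (Pf M H c x) + wkill H c x \<ge> \<delta>"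
    using positive_lower_bound[OF less_imp_le[OF \<sigma>(2)] c2 pos] by blast
  show False
  proof (rule lyapunov_right[OF s2(1) \<delta>(1) k(1), of \<sigma> "\<lambda>s. - p s" "\<lambda>s. - (m s * Qf M H c (r s))" 0 \<rho>])
    show "\<sigma> > 0" using \<sigma> r1 by simp
    fix s assume s: "s \<in> J" "s2 \<le> s"
    note K = keep[OF s]
    have ps: "p s = sqrt (Pf M H c (r s))" using Pf_pos_imp_p[OF s(1) K(1)] .
    have "\<delta> \<le> p s + wkill H c (r s)" using \<delta>(2)[of "r s"] K ps s2 by auto
    moreover have "Qf M H c (r s) \<le> - \<kappa>" using Q[of "r s"] K s2 by auto
    then have "m s * Qf M H c (r s) \<le> m s * - \<kappa>" using m_pos[OF s(1)] by (intro mult_left_mono) auto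
    ultimately show "v s > 0 \<and> p s + wkill H c (r s) \<ge> \<delta> \<and> ((\<lambda>s. - p s) has_real_derivative - (m s * Qf M H c (r
        s))) (at s) \<and>
       - (m s * Qf M H c (r s)) \<ge> \<kappa> * m s \<and> - p s \<le> 0 \<and> \<sigma> \<le> r s \<and> r s \<le> \<rho>"
      using v_pos_iff[OF s(1)] DERIV_minus[OF p_deriv[OF s(1)]] K \<delta>(1) s2 by (auto simp: mult.commute)
  qed
qed

lemma reach_turn_left:
  assumes s1: "s1 \<in> J" "p s1 > 0" "\<rho> < r s1" and \<rho>0: "\<rho> > 0" and A: "\<And>x. \<rho> < x \<Longrightarrow> x \<le> r s1 \<Longrightarrow> adm x"
    and \<rho>: "Qf M H c \<rho> > 0" "wkill H c \<rho> > 0" "Pf M H c \<rho> = 0"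
  shows "\<exists>s\<in>J. s \<le> s1 \<and> r s = \<rho>"
proof (rule ccontr)
  assume none': "\<not> ?thesis"
  then have none: False if "s \<in> J" "s \<le> s1" "r s = \<rho>" for s using that none' by blast
  have "isCont (Qf M H c) \<rho>" using isCont_Qf \<rho>0 by auto
  then have "eventually (\<lambda>x. Qf M H c x > Qf M H c \<rho> / 2) (at \<rho>)"
    unfolding isCont_def using order_tendstoD(1)[of "Qf M H c" "Qf M H c \<rho>" "at \<rho>" "Qf M H c \<rho> / 2"] \<rho>(1) by simp
  then obtain d where d: "d > 0" "\<And>x. x \<noteq> \<rho> \<Longrightarrow> \<bar>x - \<rho>\<bar> < d \<Longrightarrow> Qf M H c x > Qf M H c \<rho> / 2"
    unfolding eventually_at dist_real_def by auto
  define \<sigma> where "\<sigma> = min (r s1) (\<rho> + d / 2)"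
  define \<kappa> where "\<kappa> = Qf M H c \<rho> / 2"
  have k: "\<kappa> > 0" using \<rho> by (simp add: \<kappa>_def)
  have \<sigma>: "\<sigma> \<le> r s1" "\<rho> < \<sigma>" using s1(3) d(1) by (auto simp: \<sigma>_def)
  have Q: "Qf M H c x \<ge> \<kappa>" if "\<rho> \<le> x" "x \<le> \<sigma>" for x
    using d(2)[of x] that d(1) \<rho>(1) by (cases "x = \<rho>") (auto simp: \<sigma>_def \<kappa>_def)
  obtain s2 where s2: "s2 \<in> J" "s2 \<le> s1" "r s2 = \<sigma>" "p s2 > 0"
  proof (cases "\<sigma> = r s1")
    case True then show ?thesis using that s1 by auto
  next
    case False
    then have "\<sigma> < r s1" using \<sigma> by simp
    from reach_left[OF s1(1,2) this] A \<sigma>(2) \<rho>0 that show ?thesis by force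
  qed
  have P: "Pf M H c x > 0" if "\<rho> < x" "x \<le> r s2" for x using A[of x] that \<sigma> s2 by (simp add: adm_def)
  have "\<rho> < r s2" using s2 \<sigma> by simp
  have "\<forall>x. \<rho> < x \<longrightarrow> x \<le> r s2 \<longrightarrow> Pf M H c x > 0" using P by simp
  moreover have "\<forall>s\<in>J. s \<le> s2 \<longrightarrow> r s = \<rho> \<longrightarrow> \<not> (\<forall>t. s < t \<longrightarrow> t \<le> s2 \<longrightarrow> p t > 0)"
    using none s2(2) order_trans by blast
  ultimately have keep: "p s > 0" "r s \<le> r s2" "\<rho> < r s" if "s \<in> J" "s \<le> s2" for s
    by (rule persist_left[OF s2(1,4) \<open>\<rho> < r s2\<close> _ _ that])+
  have sub: "{\<rho>..\<sigma>} \<subseteq> {0<..}" using \<rho>0 by auto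
  have c1: "continuous_on {\<rho>..\<sigma>} (\<lambda>x. sqrt (Pf M H c x))"
    by (rule continuous_on_real_sqrt[OF continuous_on_Pf[OF sub]])
  have c2: "continuous_on {\<rho>..\<sigma>} (\<lambda>x. sqrt (Pf M H c x) + wkill H c x)"
    by (rule continuous_on_add[OF c1 continuous_on_wkill[OF sub]])
  have pos: "sqrt (Pf M H c x) + wkill H c x > 0" if "x \<in> {\<rho>..\<sigma>}" for x
    using A[of x] \<rho> that \<sigma> by (cases "x = \<rho>") (auto simp: adm_def)
  obtain \<delta> where \<delta>: "\<delta> > 0" "\<And>x. x \<in> {\<rho>..\<sigma>} \<Longrightarrow> sqrt (Pf M H c x) + wkill H c x \<ge> \<delta>"
    using positive_lower_bound[OF less_imp_le[OF \<sigma>(2)] c2 pos] by blast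
  show False
  proof (rule lyapunov_left[OF s2(1) \<delta>(1) k(1) \<rho>0, of p "\<lambda>s. m s * Qf M H c (r s)" 0])
    fix s assume s: "s \<in> J" "s \<le> s2"
    note K = keep[OF s]
    have ps: "p s = sqrt (Pf M H c (r s))" using Pf_pos_imp_p[OF s(1) K(1)] .
    have "\<delta> \<le> p s + wkill H c (r s)" using \<delta>(2)[of "r s"] K ps s2 by auto
    moreover have "Qf M H c (r s) \<ge> \<kappa>" using Q[of "r s"] K s2 by auto
    then have "m s * \<kappa> \<le> m s * Qf M H c (r s)" using m_pos[OF s(1)] by (intro mult_left_mono) auto
    ultimately show "v s > 0 \<and> p s + wkill H c (r s) \<ge> \<delta> \<and> (p has_real_derivative m s * Qf M H c (r s)) (at s) \<and>
       m s * Qf M H c (r s) \<ge> \<kappa> * m s \<and> 0 \<le> p s \<and> \<rho> \<le> r s"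
      using v_pos_iff[OF s(1)] p_deriv[OF s(1)] K \<delta>(1) s2 by (auto simp: mult.commute)
  qed
qed

lemma sign_const:
  assumes "continuous_on J f" "\<And>s. s \<in> J \<Longrightarrow> f s \<noteq> (0::real)" "s1 \<in> J" "f s1 > 0" "s \<in> J"
  shows "f s > 0"
proof (rule ccontr)
  assume "\<not> f s > 0"
  then have "f s \<le> 0" by simp
  have "connected (f ` J)" using connected_continuous_image[OF assms(1) J_conn] .
  from connectedD_interval[OF this imageI[OF assms(5)] imageI[OF assms(3)] \<open>f s \<le> 0\<close> less_imp_le[OF assms(4)]]
  obtain t where "t \<in> J" "f t = 0" by (metis imageE)
  then show False using assms(2) by blast
qed

text \<open>\<open>p\<close> has no zero, hence a fixed sign, and every radius in \<open>I\<close>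
  is separated from \<open>r s1\<close> by admissible radii only.\<close>

lemma onto:
  assumes I: "connected I" "open I" "I \<subseteq> {0<..}" and rI: "\<And>s. s \<in> J \<Longrightarrow> r s \<in> I"
    and A: "\<And>x. x \<in> I \<Longrightarrow> adm x" and s1: "s1 \<in> J" "p s1 > 0"
  shows "\<forall>s\<in>J. p s > 0" "r ` J = I"
proof -
  have "p s \<noteq> 0" if "s \<in> J" for s using p_square[OF that] A[OF rI[OF that]] by (auto simp: adm_def)
  then show "\<forall>s\<in>J. p s > 0" using sign_const[OF cont_J(4) _ s1] by blast
  have "\<rho> \<in> r ` J" if \<rho>: "\<rho> \<in> I" for \<rho>
  proof -
    have seg: "adm x" if "(\<rho> \<le> x \<and> x \<le> r s1) \<or> (r s1 \<le> x \<and> x \<le> \<rho>)" for x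
      using connectedD_interval[OF I(1) \<rho> rI[OF s1(1)], of x] connectedD_interval[OF I(1) rI[OF s1(1)] \<rho>, of x]
          that A by blast
    consider "\<rho> < r s1" | "\<rho> = r s1" | "r s1 < \<rho>" by linarith
    then show ?thesis
    proof cases
      case 1
      have "\<exists>s\<in>J. s \<le> s1 \<and> r s = \<rho> \<and> p s > 0"
        by (rule reach_left[OF s1 1]) (use \<rho> I seg in auto)
      then show ?thesis by blast
    next
      case 2 then show ?thesis using s1(1) by blast
    next
      case 3
      have "\<exists>s\<in>J. s1 \<le> s \<and> r s = \<rho> \<and> p s > 0"
        by (rule reach_right[OF s1 3]) (use seg in auto)
      then show ?thesis by blast
    qed
  qed
  then show "r ` J = I" using rI by auto
qed

text \<open>A Gronwall argument for \<open>(r - r s0)\<^sup>2 + p\<^sup>2\<close>.\<close>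

lemma equilibrium:
  assumes s0: "s0 \<in> J" "p s0 = 0" "Qf M H c (r s0) = 0" and s: "s \<in> J"
  shows "r s = r s0" "p s = 0"
proof -
  define R where "R = r s0"
  have R: "R > 0" using r_pos s0 by (simp add: R_def)
  define y where "y s = (r s - R)\<^sup>2 + (p s)\<^sup>2" for s
  have y0: "y s = 0 \<longleftrightarrow> r s = R \<and> p s = 0" for s by (simp add: y_def sum_power2_eq_zero_iff)
  have cy: "continuous_on J y" unfolding y_def using cont_J by (intro continuous_intros)
  obtain D where "(Qf M H c has_real_derivative D) (at R)" using Qf_differentiable[OF R] by blast
  then have "((\<lambda>x. Qf M H c x / (x - R)) \<longlongrightarrow> D) (at R)"
    using s0(3) by (simp add: has_field_derivative_iff R_def)
  then have "eventually (\<lambda>x. dist (Qf M H c x / (x - R)) D < 1) (at R)" by (rule tendstoD) simp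
  then obtain d where d: "d > 0" "\<And>x. x \<noteq> R \<Longrightarrow> \<bar>x - R\<bar> < d \<Longrightarrow> dist (Qf M H c x / (x - R)) D < 1"
    unfolding eventually_at dist_real_def by auto
  \<comment> \<open>Bounds the difference quotient of \<open>Qf\<close> at its zero
    \<open>R\<close>: a Lipschitz estimate at this one point.\<close>
  define K where "K = \<bar>D\<bar> + 1"
  have Q: "\<bar>Qf M H c x\<bar> \<le> K * \<bar>x - R\<bar>" if "\<bar>x - R\<bar> < d" for x
  proof (cases "x = R")
    case True then show ?thesis using s0(3) by (simp add: R_def)
  next
    case False
    then have "\<bar>Qf M H c x / (x - R)\<bar> \<le> K" using d(2)[of x] that unfolding dist_real_def K_def by linarith
    then show ?thesis using False by (simp add: abs_divide field_simps)
  qed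
  \<comment> \<open>The zero set of \<open>y\<close> is relatively open by the estimate below, its
    complement by continuity, and \<open>J\<close> is connected.\<close>
  have main: "\<exists>T. openin (top_of_set J) T \<and> a \<in> T \<and> (\<forall>x\<in>T. (y a = 0) = (y x = 0))" if a: "a \<in> J" for a
  proof (cases "y a = 0")
    case False
    have "openin (top_of_set J) (J \<inter> y -` (- {0}))"
      by (rule continuous_openin_preimage_gen[OF cy]) auto
    then show ?thesis using False a by (intro exI[of _ "J \<inter> y -` (- {0})"]) auto
  next
    case True
    then have ra: "r a = R" by (simp add: y0)
    have "openin (top_of_set J) (J \<inter> r -` {R - d<..<R + d})" "openin (top_of_set J) (J \<inter> m -` {..<m a + 1})"
      by (rule continuous_openin_preimage_gen[OF cont_J(3)] continuous_openin_preimage_gen[OF m_cont]; simp)+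
    then have "open ((J \<inter> r -` {R - d<..<R + d}) \<inter> (J \<inter> m -` {..<m a + 1}))"
      using openin_open_eq[OF J_open] by blast
    moreover have "a \<in> (J \<inter> r -` {R - d<..<R + d}) \<inter> (J \<inter> m -` {..<m a + 1})" using a ra d by auto
    ultimately obtain e where e: "e > 0" "ball a e \<subseteq> (J \<inter> r -` {R - d<..<R + d}) \<inter> (J \<inter> m -` {..<m a + 1})"
      by (rule openE)
    have B: "x \<in> J" "\<bar>r x - R\<bar> < d" "m x \<le> m a + 1" if "x \<in> ball a e" for x
  proof -
    have "x \<in> (J \<inter> r -` {R - d<..<R + d}) \<inter> (J \<inter> m -` {..<m a + 1})" using e(2) that by blast
    then show "x \<in> J" "\<bar>r x - R\<bar> < d" "m x \<le> m a + 1" by (auto simp: abs_less_iff)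
  qed
    \<comment> \<open>\<open>m\<close> is at most \<open>m a + 1\<close> nearby and
      \<open>2 * \<bar>r - R\<bar> * \<bar>p\<bar> \<le> y\<close>; together these give
      \<open>\<bar>y'\<bar> \<le> C y\<close>.\<close>
    define C where "C = (1 + K) * (m a + 1)"
    have yd: "(y has_real_derivative 2 * m x * ((r x - R) * p x + p x * Qf M H c (r x))) (at x)" if "x \<in> ball a e" for x
      unfolding y_def using r_deriv[OF B(1)[OF that]] p_deriv[OF B(1)[OF that]]
      by (auto intro!: derivative_eq_intros simp: algebra_simps)
    have yb: "\<bar>2 * m x * ((r x - R) * p x + p x * Qf M H c (r x))\<bar> \<le> C * y x" if "x \<in> ball a e" for x
    proof -
      have mx: "m x > 0" "m x \<le> m a + 1" using m_pos B that by auto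
      have "\<bar>(r x - R) * p x + p x * Qf M H c (r x)\<bar> \<le> \<bar>r x - R\<bar> * \<bar>p x\<bar> + \<bar>p x\<bar> * \<bar>Qf M H c (r x)\<bar>"
        by (metis abs_mult abs_triangle_ineq)
      also have "\<dots> \<le> \<bar>r x - R\<bar> * \<bar>p x\<bar> + \<bar>p x\<bar> * (K * \<bar>r x - R\<bar>)"
        using Q[OF B(2)[OF that]] by (intro add_left_mono mult_left_mono) auto
      also have "\<dots> = (1 + K) * (\<bar>r x - R\<bar> * \<bar>p x\<bar>)" by (simp add: algebra_simps)
      finally have 1: "2 * \<bar>(r x - R) * p x + p x * Qf M H c (r x)\<bar> \<le> (1 + K) * (2 * \<bar>r x - R\<bar> * \<bar>p x\<bar>)" by simp
      have "2 * \<bar>r x - R\<bar> * \<bar>p x\<bar> \<le> y x"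
        using sum_squares_bound[of "\<bar>r x - R\<bar>" "\<bar>p x\<bar>"] by (simp add: y_def)
      then have "(1 + K) * (2 * \<bar>r x - R\<bar> * \<bar>p x\<bar>) \<le> (1 + K) * y x" by (intro mult_left_mono) (auto simp: K_def)
      with 1 have 2: "2 * \<bar>(r x - R) * p x + p x * Qf M H c (r x)\<bar> \<le> (1 + K) * y x" by linarith
      have "\<bar>2 * m x * ((r x - R) * p x + p x * Qf M H c (r x))\<bar> = m x * (2 * \<bar>(r x - R) * p x + p x * Qf M H c (r x)\<bar>)"
        using mx by (simp add: abs_mult)
      also have "\<dots> \<le> m x * ((1 + K) * y x)" using 2 mx by (intro mult_left_mono) auto
      also have "\<dots> \<le> (m a + 1) * ((1 + K) * y x)" using mx by (intro mult_right_mono) (auto simp: K_def y_def)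
      finally show ?thesis by (simp add: C_def mult_ac)
    qed
    have "y x = 0" if x: "x \<in> ball a e" for x
    proof (cases "a \<le> x")
      case True
      have "y x * exp (- C * x) \<le> y a * exp (- C * a)" using True
      proof (rule DERIV_nonpos_imp_nonincreasing)
        fix t assume "a \<le> t" "t \<le> x"
        then have t: "t \<in> ball a e" using x by (auto simp: dist_real_def)
        show "\<exists>z. ((\<lambda>x. y x * exp (- C * x)) has_real_derivative z) (at t) \<and> z \<le> 0"
        proof (intro exI conjI)
          show "((\<lambda>x. y x * exp (- C * x)) has_real_derivative (2 * m t * ((r t - R) * p t + p t * Qf M H c (r t))
              - C * y t) * exp (- C * t)) (at t)"
            by (rule derivative_eq_intros yd[OF t] refl | simp add: algebra_simps)+
          show "(2 * m t * ((r t - R) * p t + p t * Qf M H c (r t)) - C * y t) * exp (- C * t) \<le> 0"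
            using yb[OF t] by (simp add: mult_le_0_iff)
        qed
      qed
      then have "y x * exp (- C * x) \<le> 0" using \<open>y a = 0\<close> by simp
      then have "y x \<le> 0" by (simp add: mult_le_0_iff)
      then show ?thesis by (simp add: y_def sum_power2_le_zero_iff)
    next
      case False
      then have "x \<le> a" by simp
      then have "y x * exp (C * x) \<le> y a * exp (C * a)"
      proof (rule DERIV_nonneg_imp_nondecreasing)
        fix t assume "x \<le> t" "t \<le> a"
        then have t: "t \<in> ball a e" using x by (auto simp: dist_real_def)
        show "\<exists>z. ((\<lambda>x. y x * exp (C * x)) has_real_derivative z) (at t) \<and> 0 \<le> z"
        proof (intro exI conjI)
          show "((\<lambda>x. y x * exp (C * x)) has_real_derivative (2 * m t * ((r t - R) * p t + p t * Qf M H c (r t)) +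
              C * y t) * exp (C * t)) (at t)"
            by (rule derivative_eq_intros yd[OF t] refl | simp add: algebra_simps)+
          show "0 \<le> (2 * m t * ((r t - R) * p t + p t * Qf M H c (r t)) + C * y t) * exp (C * t)"
            using yb[OF t] by (intro mult_nonneg_nonneg) auto
        qed
      qed
      then have "y x * exp (C * x) \<le> 0" using \<open>y a = 0\<close> by simp
      then have "y x \<le> 0" by (simp add: mult_le_0_iff)
      then show ?thesis by (simp add: y_def sum_power2_le_zero_iff)
    qed
    moreover have "ball a e \<subseteq> J" using B(1) by blast
    ultimately show ?thesis using True e(1) by (intro exI[of _ "ball a e"]) (auto intro: openin_open_subtopology
        simp: openin_open_eq[OF J_open])
  qed
  have "(y s0 = 0) = (y s = 0)"
    by (rule connected_equivalence_relation[OF J_conn s0(1) s]) (use main in auto)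
  then have "y s = 0" using y0[of s0] s0(2) by (simp add: R_def)
  then show "r s = r s0" "p s = 0" using y0 by (auto simp: R_def)
qed

end

section \<open>The functions \<open>kH\<close> and \<open>kH'\<close>\<close>

text \<open>The irrational part of \<open>kH\<close> written with a square root instead of real
  powers; in this form it is visibly continuous on the closed interval.\<close>

definition gk :: "real \<Rightarrow> real \<Rightarrow> real" where
  "gk M x = x * sqrt (x * (2 * M - x))"

lemma gk_powr: "0 < x \<Longrightarrow> x < 2 * M \<Longrightarrow> x powr (3/2) * (2 * M - x) powr (1/2) = gk M x"
proof -
  assume x: "0 < x" "x < 2 * M"
  have "x powr (3/2) = x powr (1 + 1/2)" by simp
  also have "\<dots> = x * sqrt x" using x by (simp only: powr_add powr_one powr_half_sqrt less_imp_le)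
  finally show ?thesis using x by (simp add: gk_def powr_half_sqrt real_sqrt_mult)
qed

lemma kH_gk: "0 < x \<Longrightarrow> x < 2 * M \<Longrightarrow> kH M H x = - H * x ^ 3 - gk M x"
  by (simp add: kH_def gk_powr)

lemma kH'_kH: "kH' M H x = - kH M (- H) x"
  by (simp add: kH_def kH'_def)

lemma gk_pos: "0 < x \<Longrightarrow> x < 2 * M \<Longrightarrow> gk M x > 0"
  by (simp add: gk_def)

lemma gk_h: "0 < x \<Longrightarrow> x < 2 * M \<Longrightarrow> gk M x = x\<^sup>2 * sqrt (- h M x)"
proof -
  assume x: "0 < x" "x < 2 * M"
  have "- h M x = (x * (2 * M - x)) / x\<^sup>2" using x by (simp add: h_def field_simps power2_eq_square)
  then have "sqrt (- h M x) = sqrt (x * (2 * M - x)) / x" using x by (simp add: real_sqrt_divide)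
  then show ?thesis using x by (simp add: gk_def power2_eq_square)
qed

text \<open>Ties the thresholds in the list to the sign of \<open>p\<^sup>2\<close>: up to the
  factor \<open>x\<^sup>2\<close>, the first factor of \<open>Pf\<close> inside the horizon is
  \<open>kH - c\<close>.\<close>

lemma kH_wkill:
  assumes "0 < x" "x < 2 * M"
  shows "kH M H x - c = x\<^sup>2 * (wkill H c x - sqrt (- h M x))"
  using assms by (simp add: kH_gk gk_h wkill_def field_simps power2_eq_square power3_eq_cube)

lemma h_neg: "0 < x \<Longrightarrow> x < 2 * M \<Longrightarrow> h M x < 0"
  by (simp add: h_def field_simps)

lemma h_pos: "M > 0 \<Longrightarrow> x > 2 * M \<Longrightarrow> h M x > 0"
  by (simp add: h_def field_simps)

lemma Pf_factor:
  assumes "0 < x" "x < 2 * M"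
  shows "Pf M H c x = (wkill H c x - sqrt (- h M x)) * (wkill H c x + sqrt (- h M x))"
proof -
  have "(sqrt (- h M x))\<^sup>2 = - h M x" using h_neg[OF assms] by simp
  then show ?thesis unfolding Pf_def by (simp add: algebra_simps power2_eq_square)
qed

lemma kH_gt_iff:
  assumes "0 < x" "x < 2 * M"
  shows "kH M H x > c \<longleftrightarrow> wkill H c x > sqrt (- h M x)"
    and "kH M H x = c \<longleftrightarrow> wkill H c x = sqrt (- h M x)"
proof -
  have "x\<^sup>2 > 0" using assms by simp
  then show "kH M H x > c \<longleftrightarrow> wkill H c x > sqrt (- h M x)" "kH M H x = c \<longleftrightarrow> wkill H c x = sqrt (- h M x)"
    using kH_wkill[OF assms, of H c]
    by (metis diff_gt_0_iff_gt zero_less_mult_pos mult_pos_pos, metis eq_iff_diff_eq_0 mult_eq_0_iff less_irrefl)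
qed

lemma kH_gt_imp:
  assumes "0 < x" "x < 2 * M" "kH M H x > c"
  shows "Pf M H c x > 0" "wkill H c x > 0"
proof -
  have s: "sqrt (- h M x) > 0" using h_neg[OF assms(1,2)] by simp
  have "wkill H c x > sqrt (- h M x)" using kH_gt_iff(1)[OF assms(1,2)] assms(3) by blast
  then have w: "wkill H c x - sqrt (- h M x) > 0" "wkill H c x + sqrt (- h M x) > 0" using s by linarith+
  show "Pf M H c x > 0" unfolding Pf_factor[OF assms(1,2)] by (rule mult_pos_pos[OF w])
  show "wkill H c x > 0" using w by linarith
qed

lemma kH_eq_imp:
  assumes "0 < x" "x < 2 * M" "kH M H x = c"
  shows "Pf M H c x = 0" "wkill H c x > 0"
proof -
  have s: "sqrt (- h M x) > 0" using h_neg[OF assms(1,2)] by simp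
  have "wkill H c x = sqrt (- h M x)" using kH_gt_iff(2)[OF assms(1,2)] assms(3) by blast
  then show "Pf M H c x = 0" "wkill H c x > 0" unfolding Pf_factor[OF assms(1,2)] using s by auto
qed

text \<open>The derivative of \<open>gk\<close> divided by \<open>x\<^sup>2\<close>. After this
  division the critical points of \<open>kH\<close> solve \<open>dk = - 3 H\<close>, with a monotone
  left side that does not involve \<open>H\<close>.\<close>

definition dk :: "real \<Rightarrow> real \<Rightarrow> real" where
  "dk M x = (3 * M - 2 * x) / (x * sqrt (x * (2 * M - x)))"

lemma gk_deriv:
  assumes "0 < x" "x < 2 * M"
  shows "(gk M has_real_derivative x\<^sup>2 * dk M x) (at x)"
proof -
  define s where "s = sqrt (x * (2 * M - x))"
  have s: "s > 0" "s * s = x * (2 * M - x)" using assms by (auto simp: s_def)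
  have "((\<lambda>x. x * (2 * M - x)) has_real_derivative (2 * M - 2 * x)) (at x)"
    by (auto intro!: derivative_eq_intros)
  from DERIV_chain2[OF DERIV_real_sqrt this]
  have "((\<lambda>x. sqrt (x * (2 * M - x))) has_real_derivative inverse s / 2 * (2 * M - 2 * x)) (at x)"
    using assms by (simp add: s_def)
  from DERIV_mult[OF DERIV_ident this]
  have "(gk M has_real_derivative s + x * (inverse s / 2 * (2 * M - 2 * x))) (at x)"
    by (simp add: gk_def[abs_def] s_def add.commute mult.commute)
  moreover have "s + x * (inverse s / 2 * (2 * M - 2 * x)) = x\<^sup>2 * dk M x"
  proof -
    have "s + x * (inverse s / 2 * (2 * M - 2 * x)) = (s * s + x * (M - x)) / s" using s(1) by (simp add: field_simps)
    also have "s * s + x * (M - x) = x * (3 * M - 2 * x)" unfolding s(2) by (simp add: algebra_simps)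
    also have "x * (3 * M - 2 * x) / s = x\<^sup>2 * dk M x"
      using assms s(1) unfolding dk_def s_def[symmetric] by (simp add: power2_eq_square)
    finally show ?thesis .
  qed
  ultimately show ?thesis by simp
qed

lemma kH_deriv:
  assumes "0 < x" "x < 2 * M"
  shows "(kH M H has_real_derivative - x\<^sup>2 * (3 * H + dk M x)) (at x)"
proof -
  have "((\<lambda>x. - H * x ^ 3 - gk M x) has_real_derivative - x\<^sup>2 * (3 * H + dk M x)) (at x)"
    using gk_deriv[OF assms] by (auto intro!: derivative_eq_intros simp: algebra_simps)
  then show ?thesis
    by (rule has_field_derivative_transform_within_open[of _ _ _ "{0<..<2 * M}"]) (use assms in \<open>auto simp: kH_gk\<close>)
qed

text \<open>As \<open>dk = (3 M - 2 t) / gk\<close>, the second term of the derivative contains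
  \<open>(3 M - 2 t) * dk\<close>, which is a square over \<open>gk\<close>; so both terms are
  negative or zero, the first one strictly.\<close>

lemma dk_decreasing:
  assumes "0 < x" "x < y" "y < 2 * M"
  shows "dk M y < dk M x"
  using assms(2)
proof (rule DERIV_neg_imp_decreasing)
  fix t assume t: "x \<le> t" "t \<le> y"
  then have t': "0 < t" "t < 2 * M" using assms by auto
  have "(gk M has_real_derivative t\<^sup>2 * dk M t) (at t)" by (rule gk_deriv[OF t'])
  moreover have "gk M t \<noteq> 0" using gk_pos[OF t'] by simp
  ultimately have "((\<lambda>t. (3 * M - 2 * t) / gk M t) has_real_derivative (- 2 * gk M t - (3 * M - 2 * t) * (t\<^sup>2 * dk
      M t)) / (gk M t * gk M t)) (at t)"
    by (auto intro!: derivative_eq_intros)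
  moreover have "(\<lambda>t. (3 * M - 2 * t) / gk M t) = dk M" by (simp add: dk_def gk_def fun_eq_iff)
  ultimately have d: "(dk M has_real_derivative (- 2 * gk M t - (3 * M - 2 * t) * (t\<^sup>2 * dk M t)) / (gk M t * gk M
      t)) (at t)"
    by simp
  have "(3 * M - 2 * t) * (t\<^sup>2 * dk M t) = t\<^sup>2 * ((3 * M - 2 * t)\<^sup>2 / gk M t)"
    by (simp add: dk_def gk_def power2_eq_square)
  then have "(3 * M - 2 * t) * (t\<^sup>2 * dk M t) \<ge> 0" using gk_pos[OF t'] by simp
  then have "(- 2 * gk M t - (3 * M - 2 * t) * (t\<^sup>2 * dk M t)) / (gk M t * gk M t) < 0"
    using gk_pos[OF t'] by (intro divide_neg_pos) auto
  with d show "\<exists>z. (dk M has_real_derivative z) (at t) \<and> z < 0" by blast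
qed

text \<open>\<open>dk\<close> tends to infinity at \<open>0\<close> and to minus infinity at
  \<open>2 M\<close>. Explicit points with values beyond \<open>K > 3 * \<bar>H\<bar>\<close> on
  either side and the intermediate value theorem give the zero.\<close>

lemma dk_zero:
  assumes M: "M > 0"
  obtains R where "0 < R" "R < 2 * M" "3 * H + dk M R = 0"
proof -
  define K where "K = 3 * \<bar>H\<bar> + 1"
  have K: "K > 0" by (simp add: K_def)
  \<comment> \<open>\<open>x \<le> M\<close> keeps the numerator at least \<open>M\<close> and the
    root at most \<open>2 M\<close>, so the quotient is at least \<open>1 / (2 * x)\<close>, which
    is at least \<open>K\<close>.\<close>
  define x where "x = min M (1 / (2 * K))"
  have x: "0 < x" "x \<le> M" "x * (2 * K) \<le> 1" using M K by (auto simp: x_def min_def field_simps)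
  have dx: "dk M x \<ge> K"
  proof -
    have s: "sqrt (x * (2 * M - x)) > 0" using x by simp
    have "x * (2 * M - x) \<le> (2 * M) * (2 * M)" using x by (intro mult_mono) auto
    then have s2: "sqrt (x * (2 * M - x)) \<le> 2 * M" using M by (intro real_le_lsqrt) (auto simp: power2_eq_square)
    have "K * (x * sqrt (x * (2 * M - x))) \<le> K * (x * (2 * M))"
      using s2 K x by (intro mult_left_mono) auto
    also have "\<dots> = M * (x * (2 * K))" by simp
    also have "\<dots> \<le> M * 1" using x M by (intro mult_left_mono) auto
    also have "\<dots> \<le> 3 * M - 2 * x" using x by simp
    finally show ?thesis using s x by (simp add: dk_def pos_le_divide_eq)
  qed
  \<comment> \<open>\<open>z \<le> M / 4\<close> makes the numerator at most \<open>- M / 2\<close>;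
    the other bound makes the root at most \<open>1 / (4 * K)\<close>, so the denominator is at most
    \<open>M / (2 * K)\<close>.\<close>
  define z where "z = min (M / 4) (1 / (32 * M * K\<^sup>2))"
  define y where "y = 2 * M - z"
  have z: "0 < z" "z \<le> M / 4" using M K by (auto simp: z_def)
  have "z \<le> 1 / (32 * M * K\<^sup>2)" by (simp add: z_def)
  then have z2: "z * (32 * M * K\<^sup>2) \<le> 1" using M K by (simp add: pos_le_divide_eq)
  have y: "0 < y" "y < 2 * M" using z M by (auto simp: y_def)
  have dy: "dk M y \<le> - K"
  proof -
    have s: "sqrt (y * (2 * M - y)) > 0" using y by simp
    have "y * (2 * M - y) = y * z" by (simp add: y_def)
    also have "\<dots> \<le> (2 * M) * z" using y z by (intro mult_right_mono) auto
    also have "\<dots> \<le> (1 / (4 * K))\<^sup>2" using z2 K by (simp add: power_divide field_simps power2_eq_square)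
    finally have s2: "sqrt (y * (2 * M - y)) \<le> 1 / (4 * K)" using K by (intro real_le_lsqrt) auto
    have "K * (y * sqrt (y * (2 * M - y))) \<le> K * (2 * M * (1 / (4 * K)))"
      using s2 K y s by (intro mult_left_mono mult_mono) auto
    also have "\<dots> = M / 2" using K by simp
    also have "\<dots> \<le> - (3 * M - 2 * y)" using z by (simp add: y_def)
    finally have "3 * M - 2 * y \<le> - K * (y * sqrt (y * (2 * M - y)))" by simp
    then show ?thesis using s y by (simp add: dk_def pos_divide_le_eq)
  qed
  have "x \<le> y" using x z M by (simp add: y_def)
  moreover have "continuous_on {x..y} (dk M)"
  proof -
    have "dk M t = (3 * M - 2 * t) / gk M t" for t by (simp add: dk_def gk_def)
    moreover have "continuous_on {x..y} (\<lambda>t. (3 * M - 2 * t) / gk M t)"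
    proof (intro continuous_on_divide ballI)
      have in2: "0 < t \<and> t < 2 * M" if "t \<in> {x..y}" for t using that x y by auto
      show "continuous_on {x..y} (\<lambda>t. 3 * M - 2 * t)" by (intro continuous_intros)
      show "continuous_on {x..y} (gk M)"
        by (intro continuous_at_imp_continuous_on ballI DERIV_isCont[OF gk_deriv]) (use in2 in auto)
      show "gk M t \<noteq> 0" if "t \<in> {x..y}" for t using gk_pos[of t M] in2[OF that] by simp
    qed
    ultimately show ?thesis by simp
  qed
  moreover have "dk M y \<le> - 3 * H" "- 3 * H \<le> dk M x" using dx dy by (auto simp: K_def)
  ultimately obtain R where "x \<le> R" "R \<le> y" "dk M R = - 3 * H"
    using IVT2'[of "dk M" y "- 3 * H" x] by auto
  then show ?thesis using that[of R] x y by auto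
qed

text \<open>The derivative of \<open>kH\<close> changes sign once, from negative to positive. The
  bounds \<open>0\<close> and \<open>- 8 * M ^ 3 * H\<close> are the values at the ends of the
  continuous extension \<open>ke\<close>.\<close>

lemma kH_shape:
  assumes M: "M > 0"
  shows "0 < r_min M H" "r_min M H < 2 * M" "3 * H + dk M (r_min M H) = 0"
    "\<And>x. 0 < x \<Longrightarrow> x < r_min M H \<Longrightarrow> - x\<^sup>2 * (3 * H + dk M x) < 0"
    "\<And>x. r_min M H < x \<Longrightarrow> x < 2 * M \<Longrightarrow> - x\<^sup>2 * (3 * H + dk M x) > 0"
    "\<And>x y. 0 < x \<Longrightarrow> x < y \<Longrightarrow> y \<le> r_min M H \<Longrightarrow> kH M H y < kH M H x"
    "\<And>x y. r_min M H \<le> x \<Longrightarrow> x < y \<Longrightarrow> y < 2 * M \<Longrightarrow> kH M H x < kH M H y"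
    "\<And>x. 0 < x \<Longrightarrow> x \<le> r_min M H \<Longrightarrow> kH M H x < 0"
    "\<And>x. r_min M H \<le> x \<Longrightarrow> x < 2 * M \<Longrightarrow> kH M H x < - 8 * M ^ 3 * H"
proof -
  obtain R where R: "0 < R" "R < 2 * M" "3 * H + dk M R = 0" using dk_zero[OF M] by blast
  have neg: "- x\<^sup>2 * (3 * H + dk M x) < 0" if "0 < x" "x < R" for x
    using dk_decreasing[OF that R(2)] R(3) that by (simp add: mult_pos_pos)
  have pos: "- x\<^sup>2 * (3 * H + dk M x) > 0" if "R < x" "x < 2 * M" for x
    using dk_decreasing[OF R(1) that] R(3) R(1) that by (simp add: mult_pos_neg)
  define ke where "ke x = - H * x ^ 3 - gk M x" for x
  have cont: "continuous_on {0..2 * M} ke" unfolding ke_def gk_def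
    by (intro continuous_intros)
  have ked: "(ke has_real_derivative - x\<^sup>2 * (3 * H + dk M x)) (at x)" if "0 < x" "x < 2 * M" for x
    unfolding ke_def using gk_deriv[OF that] by (auto intro!: derivative_eq_intros simp: algebra_simps)
  have dec: "ke y < ke x" if "0 \<le> x" "x < y" "y \<le> R" for x y
  proof (rule DERIV_neg_imp_decreasing_open[OF that(2)])
    show "continuous_on {x..y} ke" using cont by (rule continuous_on_subset) (use that R in auto)
    fix t assume "x < t" "t < y"
    then show "\<exists>z. (ke has_real_derivative z) (at t) \<and> z < 0"
      using ked[of t] neg[of t] that R by (intro exI[of _ "- t\<^sup>2 * (3 * H + dk M t)"] conjI) auto
  qed
  have inc: "ke x < ke y" if "R \<le> x" "x < y" "y \<le> 2 * M" for x y
  proof (rule DERIV_pos_imp_increasing_open[OF that(2)])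
    show "continuous_on {x..y} ke" using cont by (rule continuous_on_subset) (use that R in auto)
    fix t assume "x < t" "t < y"
    then show "\<exists>z. (ke has_real_derivative z) (at t) \<and> 0 < z"
      using ked[of t] pos[of t] that R by (intro exI[of _ "- t\<^sup>2 * (3 * H + dk M t)"] conjI) auto
  qed
  have k: "kH M H x = ke x" if "0 < x" "x < 2 * M" for x using that by (simp add: kH_gk ke_def)
  have min: "kH M H R < kH M H x" if "0 < x" "x < 2 * M" "x \<noteq> R" for x
    using dec[of x R] inc[of R x] that R k by (cases "x < R") auto
  \<comment> \<open>\<open>arg_min_on\<close> is a choice; uniqueness of the minimum point is what
    identifies it.\<close>
  have "r_min M H = R"
    unfolding r_min_def arg_min_on_def arg_min_def
  proof (rule some_equality)
    show "is_arg_min (kH M H) (\<lambda>x. x \<in> {0<..<2 * M}) R"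
      using R min by (auto simp: is_arg_min_def) (metis less_asym)
    fix x assume "is_arg_min (kH M H) (\<lambda>x. x \<in> {0<..<2 * M}) x"
    then show "x = R" using R min[of x] by (auto simp: is_arg_min_def)
  qed
  note RR = this
  show "0 < r_min M H" "r_min M H < 2 * M" "3 * H + dk M (r_min M H) = 0" using R RR by auto
  show "- x\<^sup>2 * (3 * H + dk M x) < 0" if "0 < x" "x < r_min M H" for x using neg that RR by auto
  show "- x\<^sup>2 * (3 * H + dk M x) > 0" if "r_min M H < x" "x < 2 * M" for x using pos that RR by auto
  show "kH M H y < kH M H x" if "0 < x" "x < y" "y \<le> r_min M H" for x y using dec[of x y] k[of x] k[of y] that R RR by auto
  show "kH M H x < kH M H y" if "r_min M H \<le> x" "x < y" "y < 2 * M" for x y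
      using inc[of x y] k[of x] k[of y] that R RR by auto
  show "kH M H x < 0" if "0 < x" "x \<le> r_min M H" for x using dec[of 0 x] k[of x] that R RR by (auto simp: ke_def gk_def)
  show "kH M H x < - 8 * M ^ 3 * H" if "r_min M H \<le> x" "x < 2 * M" for x
  proof -
    have "ke (2 * M) = - 8 * M ^ 3 * H" by (simp add: ke_def gk_def power_mult_distrib)
    then show ?thesis using inc[of x "2 * M"] k[of x] that R RR by auto
  qed
qed

lemma kH_ge_c_min: "M > 0 \<Longrightarrow> 0 < x \<Longrightarrow> x < 2 * M \<Longrightarrow> x \<noteq> r_min M H \<Longrightarrow> c_min M H < kH M H x"
  using kH_shape(6)[of M x "r_min M H" H] kH_shape(7)[of M H "r_min M H" x] unfolding c_min_def
  by (metis linorder_neqE_linordered_idom order.refl)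

text \<open>Differentiate \<open>x\<^sup>4 Pf = (kH - c) (kH - c + 2 gk)\<close> at a zero of the
  first factor: only the derivative of \<open>kH\<close> times \<open>2 gk\<close> survives.\<close>

lemma Qf_kH:
  assumes x: "0 < x" "x < 2 * M" and k: "kH M H x = c"
  shows "Qf M H c x = - x\<^sup>2 * (3 * H + dk M x) * gk M x / x ^ 4"
proof -
  define d where "d = - x\<^sup>2 * (3 * H + dk M x)"
  have eq: "y ^ 4 * Pf M H c y = (kH M H y - c) * (kH M H y - c + 2 * gk M y)" if "0 < y" "y < 2 * M" for y
    unfolding kH_wkill[OF that] gk_h[OF that] Pf_factor[OF that]
    by (simp add: algebra_simps power2_eq_square power4_eq_xxxx)
  have "((\<lambda>y. (kH M H y - c) * (kH M H y - c + 2 * gk M y)) has_real_derivative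
     d * (kH M H x - c + 2 * gk M x) + (kH M H x - c) * (d + 2 * (x\<^sup>2 * dk M x))) (at x)"
    using kH_deriv[OF x] gk_deriv[OF x] by (auto intro!: derivative_eq_intros simp: d_def)
  then have "((\<lambda>y. (kH M H y - c) * (kH M H y - c + 2 * gk M y)) has_real_derivative d * (2 * gk M x)) (at x)"
    by (simp add: k)
  then have "((\<lambda>y. y ^ 4 * Pf M H c y) has_real_derivative d * (2 * gk M x)) (at x)"
    by (rule has_field_derivative_transform_within_open[of _ _ _ "{0<..<2 * M}"]) (use x eq in auto)
  moreover have "((\<lambda>y. y ^ 4 * Pf M H c y) has_real_derivative 4 * x ^ 3 * Pf M H c x + x ^ 4 * (2 * Qf M H c x)) (at x)"
    using Pf_deriv[OF x(1)] by (auto intro!: derivative_eq_intros)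
  ultimately have "4 * x ^ 3 * Pf M H c x + x ^ 4 * (2 * Qf M H c x) = d * (2 * gk M x)" using DERIV_unique by blast
  then have "x ^ 4 * Qf M H c x = d * gk M x" using kH_eq_imp(1)[OF x k] by simp
  then have "Qf M H c x = d * gk M x / x ^ 4" using x by (simp add: eq_divide_eq mult.commute)
  then show ?thesis by (simp only: d_def)
qed

text \<open>In dynamical terms: a turning point left of \<open>r_min\<close> pushes towards smaller
  radii, one on the right towards larger radii, and \<open>r_min\<close> itself is a rest
  point.\<close>

lemma Qf_sign:
  assumes M: "M > 0" and x: "0 < x" "x < 2 * M" and k: "kH M H x = c"
  shows "x < r_min M H \<Longrightarrow> Qf M H c x < 0" "r_min M H < x \<Longrightarrow> Qf M H c x > 0" "x = r_min M H \<Longrightarrow> Qf M H c x = 0"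
proof -
  have x4: "x ^ 4 > 0" using x by simp
  show "x < r_min M H \<Longrightarrow> Qf M H c x < 0"
    unfolding Qf_kH[OF x k] using kH_shape(4)[OF M x(1)] gk_pos[OF x] x4 by (metis divide_neg_pos mult_neg_pos)
  show "r_min M H < x \<Longrightarrow> Qf M H c x > 0"
    unfolding Qf_kH[OF x k] using kH_shape(5)[OF M _ x(2)] gk_pos[OF x] x4 by (metis divide_pos_pos mult_pos_pos)
  show "x = r_min M H \<Longrightarrow> Qf M H c x = 0"
    unfolding Qf_kH[OF x k] using kH_shape(3)[OF M, of H] by simp
qed

section \<open>Classification of profile curves\<close>

lemma c_min_less: "M > 0 \<Longrightarrow> c_min M H < - 8 * M ^ 3 * H"
  unfolding c_min_def by (rule kH_shape(9)[OF _ order.refl kH_shape(2)])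

lemma continuous_on_kH: "continuous_on {0<..<2 * M} (kH M H)"
  by (intro continuous_at_imp_continuous_on ballI DERIV_isCont[OF kH_deriv]) auto

context profile
begin

lemma r_inside: "s \<in> J \<Longrightarrow> r s < 2 * M \<longleftrightarrow> u s * v s < 0"
  and r_outside: "s \<in> J \<Longrightarrow> r s > 2 * M \<longleftrightarrow> u s * v s > 0"
  and r_horizon: "s \<in> J \<Longrightarrow> r s = 2 * M \<longleftrightarrow> u s * v s = 0"
  unfolding kappa_r[symmetric] by (auto simp: kappa_neg_iff kappa_pos_iff kappa_0_iff)

text \<open>\<open>p + w > 0 > p - w\<close> gives \<open>w > 0\<close>; then
  \<open>p\<^sup>2 = (w - q) (w + q) \<ge> 0\<close> leaves only \<open>w \<ge> q\<close>, which is
  the condition \<open>kH \<ge> c\<close>.\<close>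

lemma region_II:
  assumes "s \<in> J" "u s < 0" "v s > 0"
  shows "r s < 2 * M" "wkill H c (r s) > 0" "kH M H (r s) \<ge> c" "p s = 0 \<longleftrightarrow> kH M H (r s) = c"
proof -
  show r: "r s < 2 * M" using r_inside assms by (simp add: mult_neg_pos)
  note r0 = r_pos[OF assms(1)]
  have *: "p s + wkill H c (r s) > 0" "p s - wkill H c (r s) < 0" using v_pos_iff u_neg_iff assms by auto
  then show w: "wkill H c (r s) > 0" by linarith
  define q where "q = sqrt (- h M (r s))"
  have q: "q > 0" using h_neg[OF r0 r] by (simp add: q_def)
  have P: "(p s)\<^sup>2 = (wkill H c (r s) - q) * (wkill H c (r s) + q)"
    unfolding p_square[OF assms(1)] q_def by (rule Pf_factor[OF r0 r])
  have "wkill H c (r s) - q \<ge> 0"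
  proof (rule ccontr)
    assume "\<not> ?thesis"
    then have "(wkill H c (r s) - q) * (wkill H c (r s) + q) < 0" using w q by (intro mult_neg_pos) auto
    then show False using P by (metis not_less zero_le_power2)
  qed
  then show "kH M H (r s) \<ge> c" using kH_wkill[OF r0 r, of H c] unfolding q_def
    by (metis diff_ge_0_iff_ge mult_nonneg_nonneg zero_le_power2)
  have "p s = 0 \<longleftrightarrow> wkill H c (r s) = q" using P w q by (auto simp: power2_eq_square)
  then show "p s = 0 \<longleftrightarrow> kH M H (r s) = c" using kH_gt_iff(2)[OF r0 r] by (simp add: q_def)
qed

lemma adm_inside: "0 < x \<Longrightarrow> x < 2 * M \<Longrightarrow> kH M H x > c \<Longrightarrow> adm x"
  using kH_gt_imp[of x M c H] unfolding adm_def by (metis add_pos_pos real_sqrt_gt_zero)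

text \<open>With \<open>h > 0\<close> the root of \<open>h + w\<^sup>2\<close> exceeds
  \<open>\<bar>w\<bar>\<close>, whatever the value of \<open>c\<close>.\<close>

lemma adm_outside: assumes "x > 2 * M" shows "adm x"
proof -
  have "h M x > 0" using h_pos M assms by simp
  then have "\<bar>wkill H c x\<bar> < sqrt (Pf M H c x)" unfolding Pf_def by (intro real_less_rsqrt) simp
  then have "sqrt (Pf M H c x) > 0" "sqrt (Pf M H c x) + wkill H c x > 0" by linarith+
  then show ?thesis by (simp add: adm_def)
qed

lemma wkill_horizon: "wkill H c (2 * M) = - (8 * M ^ 3 * H + c) / (4 * M\<^sup>2)"
  using M by (simp add: wkill_def power2_eq_square power3_eq_cube field_simps)

text \<open>On the horizon \<open>h = 0\<close>, so \<open>Pf = w\<^sup>2\<close>, and the bound on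
  \<open>c\<close> says that \<open>w > 0\<close> there.\<close>

lemma adm_horizon: assumes "c < - 8 * M ^ 3 * H" shows "adm (2 * M)"
proof -
  have w: "wkill H c (2 * M) > 0" unfolding wkill_horizon using assms M by (intro divide_pos_pos) auto
  moreover have "h M (2 * M) = 0" using M by (simp add: h_def)
  ultimately show ?thesis by (simp add: adm_def Pf_def)
qed

lemma adm_u_v: assumes "s \<in> J" "p s > 0" "adm (r s)" shows "v s > 0"
  using v_pos_iff[OF assms(1)] Pf_pos_imp_p[OF assms(1,2)] assms(3) by (simp add: adm_def)

text \<open>Every radius beyond the horizon is admissible, and in region I \<open>p\<close> is half
  the sum of the positive quantities \<open>p + w\<close> and \<open>p - w\<close>; so the whole
  range is reached.\<close>

lemma region_I_range:
  assumes s1: "s1 \<in> J" "u s1 > 0" "v s1 > 0"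
  shows "r ` {s \<in> J. u s > 0 \<and> v s > 0} = {2 * M<..}"
proof (intro equalityI subsetI)
  fix x assume "x \<in> r ` {s \<in> J. u s > 0 \<and> v s > 0}"
  then show "x \<in> {2 * M<..}" using r_outside by auto
next
  fix \<rho> assume "\<rho> \<in> {2 * M<..}"
  then have \<rho>: "\<rho> > 2 * M" by simp
  have p1: "p s1 > 0" using v_pos_iff u_pos_iff s1 by fastforce
  have r1: "r s1 > 2 * M" using r_outside s1 by auto
  have "\<exists>s\<in>J. r s = \<rho> \<and> p s > 0"
  proof (cases "\<rho> < r s1")
    case True
    then show ?thesis using reach_left[OF s1(1) p1 True] adm_outside \<rho> M by force
  next
    case False
    show ?thesis
    proof (cases "\<rho> = r s1")
      case True then show ?thesis using s1 p1 by blast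
    next
      case False
      then have "r s1 < \<rho>" using \<open>\<not> \<rho> < r s1\<close> by simp
      from reach_right[OF s1(1) p1 this] show ?thesis using adm_outside r1 by force
    qed
  qed
  then obtain s where s: "s \<in> J" "r s = \<rho>" "p s > 0" by blast
  have "v s > 0" using adm_u_v[OF s(1,3)] adm_outside \<rho> s(2) by simp
  moreover have "u s * v s > 0" using r_outside[OF s(1)] s(2) \<rho> by simp
  ultimately show "\<rho> \<in> r ` {s \<in> J. u s > 0 \<and> v s > 0}" using s by (auto simp: zero_less_mult_iff)
qed

lemma p_pos_region_I: "s \<in> J \<Longrightarrow> u s > 0 \<Longrightarrow> v s > 0 \<Longrightarrow> p s > 0"
  using v_pos_iff[of s] u_pos_iff[of s] by linarith

text \<open>In region I both coordinates are bounded below by \<open>0\<close> and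
  \<open>r > 2 M\<close>, so \<open>escape_left\<close> forbids staying there; in region I'
  \<open>escape_right\<close> does the same.\<close>

lemma meets_horizon:
  shows "\<exists>s\<in>J. u s * v s = 0 \<or> u s * v s < 0"
proof (rule ccontr)
  assume "\<not> ?thesis"
  then have pos: "u s * v s > 0" if "s \<in> J" for s using that by (metis linorder_neqE_linordered_idom)
  obtain s1 where s1: "s1 \<in> J" using J_nonempty by blast
  have conn: "u s \<noteq> 0" "v s \<noteq> 0" if "s \<in> J" for s using pos[OF that] by auto
  show False
  proof (cases "u s1 > 0")
    case True
    have u: "u s > 0" if "s \<in> J" for s using sign_const[OF cont_J(1) conn(1) s1 True that] .
    then have v: "v s > 0" if "s \<in> J" for s using pos[OF that] u[OF that] by (simp add: zero_less_mult_iff)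
    show False
      by (rule escape_left[OF s1, of "2 * M" 0]) (use u v r_outside pos M in \<open>auto simp: less_imp_le\<close>)
  next
    case False
    have "u s1 \<noteq> 0" using conn s1 by blast
    then have "- u s1 > 0" using False by simp
    have u: "u s < 0" if "s \<in> J" for s
      using sign_const[OF continuous_on_minus[OF cont_J(1)] _ s1 \<open>- u s1 > 0\<close> that] conn(1) by simp
    then have v: "v s < 0" if "s \<in> J" for s using pos[OF that] u[OF that] by (simp add: zero_less_mult_iff)
    show False
      by (rule escape_right[OF s1, of "2 * M" 0]) (use u v r_outside pos M in \<open>auto simp: less_imp_le\<close>)
  qed
qed

text \<open>There \<open>p + w\<close> and \<open>p - w\<close> both vanish, hence
  \<open>w = 0\<close> at radius \<open>2 M\<close>, a linear equation for \<open>c\<close>.\<close>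

lemma bifurcation:
  assumes s: "s \<in> J" "u s = 0" "v s = 0"
  shows "c = - 8 * M ^ 3 * H"
proof -
  have "p s + wkill H c (r s) = 0" "p s - wkill H c (r s) = 0" using p_plus_w p_minus_w s by simp_all
  then have "wkill H c (r s) = 0" by linarith
  moreover have "r s = 2 * M" using r_horizon s by simp
  ultimately show ?thesis using wkill_horizon M by (simp add: field_simps)
qed

lemma near_zero:
  assumes "s \<in> J"
  obtains e where "e > 0" "\<And>t. \<bar>t - s\<bar> < e \<Longrightarrow> t \<in> J"
proof -
  obtain e where "e > 0" "ball s e \<subseteq> J" using J_open assms openE by blast
  then show ?thesis using that[of e] by (auto simp: subset_iff dist_real_def abs_minus_commute)
qed

text \<open>At a horizon point with only one coordinate zero, a small step to the side where this
  coordinate gets the sign opposite to the other one enters region II or II'.\<close>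

lemma meets_interior_or_bifurcation:
  assumes "\<And>s. s \<in> J \<Longrightarrow> \<not> (u s < 0 \<and> v s > 0)" "\<And>s. s \<in> J \<Longrightarrow> \<not> (u s > 0 \<and> v s < 0)"
  shows "\<exists>s\<in>J. u s = 0 \<and> v s = 0"
proof -
  obtain s where s: "s \<in> J" "u s * v s \<le> 0" using meets_horizon by force
  then have "u s = 0 \<or> v s = 0" using assms[OF s(1)] by (auto simp: mult_le_0_iff)
  \<comment> \<open>\<open>f\<close> and \<open>g\<close> stand for \<open>u\<close> and
    \<open>v\<close> in either order.\<close>
  moreover have False if nz: "f s = 0" "g s > 0" and fg: "(f = u \<and> g = v) \<or> (f = v \<and> g = u)" for f g
  proof -
    have "continuous_on J g" using fg cont_J by auto
    then have "open (J \<inter> g -` {0<..})" by (intro continuous_open_preimage J_open) auto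
    moreover have "s \<in> J \<inter> g -` {0<..}" using s nz by auto
    ultimately obtain e where e: "e > 0" "ball s e \<subseteq> J \<inter> g -` {0<..}" by (rule openE)
    have "s - e / 2 \<in> ball s e" using e(1) by (simp add: dist_real_def)
    then have "s - e / 2 \<in> J \<inter> g -` {0<..}" using e(2) by blast
    then have t: "s - e / 2 \<in> J" "g (s - e / 2) > 0" by simp_all
    have "f (s - e / 2) < f s" using fg u_mono v_mono t(1) s(1) e(1) by auto
    then show False using nz t assms[OF t(1)] fg by auto
  qed
  moreover have False if nz: "f s = 0" "g s < 0" and fg: "(f = u \<and> g = v) \<or> (f = v \<and> g = u)" for f g
  proof -
    have "continuous_on J g" using fg cont_J by auto
    then have "open (J \<inter> g -` {..<0})" by (intro continuous_open_preimage J_open) auto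
    moreover have "s \<in> J \<inter> g -` {..<0}" using s nz by auto
    ultimately obtain e where e: "e > 0" "ball s e \<subseteq> J \<inter> g -` {..<0}" by (rule openE)
    have "s + e / 2 \<in> ball s e" using e(1) by (simp add: dist_real_def)
    then have "s + e / 2 \<in> J \<inter> g -` {..<0}" using e(2) by blast
    then have t: "s + e / 2 \<in> J" "g (s + e / 2) < 0" by simp_all
    have "f s < f (s + e / 2)" using fg u_mono v_mono t(1) s(1) e(1) by auto
    then show False using nz t assms[OF t(1)] fg by auto
  qed
  ultimately show ?thesis using s(1) by (metis linorder_neqE_linordered_idom)
qed

text \<open>Zeros can only be crossed upwards: a first return to zero would come from positive
  values, against the positive derivative at that zero.\<close>

lemma upcross:
  assumes d: "\<And>s. s \<in> J \<Longrightarrow> (f has_real_derivative f' s) (at s)"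
    and pos: "\<And>s. s \<in> J \<Longrightarrow> f s = 0 \<Longrightarrow> f' s > 0" and s0: "s0 \<in> J" "f s0 = 0" and s: "s \<in> J" "s0 < s"
  shows "f s > 0"
proof (rule ccontr)
  assume n: "\<not> f s > 0"
  obtain d where d1: "d > 0" "\<And>h. h > 0 \<Longrightarrow> h < d \<Longrightarrow> f s0 < f (s0 + h)"
    using DERIV_pos_inc_right[OF assms(1)[OF s0(1)] pos[OF s0]] by auto
  define k where "k = min (d / 2) ((s - s0) / 2)"
  define t where "t = s0 + k"
  have k0: "k > 0" unfolding k_def using d1(1) s(2) by simp
  have k1: "k \<le> d / 2" unfolding k_def by (rule min.cobounded1)
  have k2: "k \<le> (s - s0) / 2" unfolding k_def by (rule min.cobounded2)
  have k: "k < d" "k < s - s0" using k1 d1(1) k2 s(2) by (simp_all add: field_simps)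
  have t: "s0 < t" "t < s" "f t > 0" using k k0 d1(2)[of k] s0(2) by (auto simp: t_def)
  have tJ: "x \<in> J" if "t \<le> x" "x \<le> s" for x using J_seg[OF s0(1) s(1)] t that by auto
  have "continuous_on {t..s} f"
    by (intro continuous_at_imp_continuous_on ballI DERIV_isCont[OF d] tJ) auto
  then obtain z where z: "t < z" "z \<le> s" "f z = 0" "\<And>x. t \<le> x \<Longrightarrow> x < z \<Longrightarrow> f x > 0"
    using first_zero[of t s f] t n by (metis less_imp_le not_less)
  have zJ: "z \<in> J" using tJ z by auto
  obtain e where e: "e > 0" "\<And>h. h > 0 \<Longrightarrow> h < e \<Longrightarrow> f (z - h) < f z"
    using DERIV_pos_inc_left[OF d[OF zJ] pos[OF zJ z(3)]] by auto
  define l where "l = min (e / 2) ((z - t) / 2)"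
  have l0: "l > 0" unfolding l_def using e(1) z(1) by simp
  have l1: "l \<le> e / 2" unfolding l_def by (rule min.cobounded1)
  have l2: "l \<le> (z - t) / 2" unfolding l_def by (rule min.cobounded2)
  have "l < e" "t \<le> z - l" "z - l < z" using l0 l1 l2 e(1) z(1) by (simp_all add: field_simps)
  then show False using l0 e(2)[of l] z(4)[of "z - l"] z(3) by auto
qed

text \<open>Where \<open>kH = c\<close> the point lies in region II, in which
  \<open>kH \<ge> c\<close> persists, while just outside \<open>K\<close> one has
  \<open>kH < c\<close>. So the parameters with \<open>r\<close> in \<open>K\<close> form an open
  and closed set.\<close>

lemma barrier:
  assumes s1: "s1 \<in> J" "r s1 \<in> K" and K: "closed K"
    and bd: "\<And>s. s \<in> J \<Longrightarrow> r s \<in> K \<Longrightarrow> r s \<in> interior K \<or> (r s < 2 * M \<and> kH M H (r s) = c \<and>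
        (\<exists>\<epsilon>>0. \<forall>x. \<bar>x - r s\<bar> < \<epsilon> \<longrightarrow> x \<notin> K \<longrightarrow> kH M H x < c))"
    and s: "s \<in> J"
  shows "r s \<in> K"
proof -
  have op: "\<exists>T. openin (top_of_set J) T \<and> a \<in> T \<and> (\<forall>x\<in>T. (r a \<in> K) = (r x \<in> K))" if a: "a \<in> J" for a
  proof (cases "r a \<in> K")
    case False
    have "openin (top_of_set J) (J \<inter> r -` (- K))"
      by (rule continuous_openin_preimage_gen[OF cont_J(3)]) (use K in auto)
    then show ?thesis using False a by (intro exI[of _ "J \<inter> r -` (- K)"]) auto
  next
    case True
    consider "r a \<in> interior K" | "r a < 2 * M" "kH M H (r a) = c" "\<exists>\<epsilon>>0. \<forall>x. \<bar>x - r a\<bar> < \<epsilon> \<longrightarrow> x \<notin> K \<longrightarrow> kH M H x < c"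
      using bd[OF a True] by blast
    then show ?thesis
    proof cases
      case 1
      have "openin (top_of_set J) (J \<inter> r -` (interior K))"
        by (rule continuous_openin_preimage_gen[OF cont_J(3)]) auto
      then show ?thesis using 1 a True interior_subset[of K] by (intro exI[of _ "J \<inter> r -` (interior K)"]) auto
    next
      case 2
      then obtain \<epsilon> where \<epsilon>: "\<epsilon> > 0" "\<And>x. \<bar>x - r a\<bar> < \<epsilon> \<Longrightarrow> x \<notin> K \<Longrightarrow> kH M H x < c" by blast
      have "Pf M H c (r a) = 0" "wkill H c (r a) > 0" using kH_eq_imp[OF r_pos[OF a] 2(1,2)] by auto
      moreover have "p a = 0" using p_square[OF a] calculation by simp
      ultimately have uv: "u a < 0" "v a > 0" using v_pos_iff[OF a] u_neg_iff[OF a] by auto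
      define T where "T = (J \<inter> r -` {r a - \<epsilon><..<r a + \<epsilon>}) \<inter> ((J \<inter> u -` {..<0}) \<inter> (J \<inter> v -` {0<..}))"
      have "openin (top_of_set J) T"
        unfolding T_def by (intro openin_Int continuous_openin_preimage_gen[OF cont_J(3)]
            continuous_openin_preimage_gen[OF cont_J(1)] continuous_openin_preimage_gen[OF cont_J(2)]) auto
      moreover have "a \<in> T" using a \<epsilon> uv by (auto simp: T_def)
      moreover have "r x \<in> K" if "x \<in> T" for x
      proof (rule ccontr)
        assume "r x \<notin> K"
        moreover have "\<bar>r x - r a\<bar> < \<epsilon>" using that by (auto simp: T_def abs_less_iff)
        ultimately have "kH M H (r x) < c" using \<epsilon>(2) by blast
        moreover have "kH M H (r x) \<ge> c" using region_II(3)[of x] that by (auto simp: T_def)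
        ultimately show False by simp
      qed
      ultimately show ?thesis using True by blast
    qed
  qed
  have "(r s1 \<in> K) = (r s \<in> K)"
    by (rule connected_equivalence_relation[where R = "\<lambda>a b. (r a \<in> K) = (r b \<in> K)", OF J_conn s1(1) s _ _ op]) auto
  then show ?thesis using s1 by simp
qed

lemma upcross_left:
  assumes d: "\<And>s. s \<in> J \<Longrightarrow> (f has_real_derivative f' s) (at s)"
    and pos: "\<And>s. s \<in> J \<Longrightarrow> f s = 0 \<Longrightarrow> f' s > 0" and s0: "s0 \<in> J" "f s0 = 0" and s: "s \<in> J" "s < s0"
  shows "f s < 0"
proof -
  interpret N: profile M H c "uminus ` J" "\<lambda>s. - v (- s)" "\<lambda>s. - u (- s)" "\<lambda>s. b (- s)" "\<lambda>s. a (- s)" "\<lambda>s. m (- s)"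
      "\<lambda>s. r (- s)" "\<lambda>s. - p (- s)"
    by (rule mirror)
  have "- f (- (- s)) > 0"
  proof (rule N.upcross[of "\<lambda>s. - f (- s)" "\<lambda>s. f' (- s)" "- s0" "- s"])
    fix t assume "t \<in> uminus ` J"
    then have t: "- t \<in> J" by auto
    have "((\<lambda>t. f (- t)) has_real_derivative - f' (- t)) (at t)" using d[OF t] by (simp add: DERIV_mirror)
    from DERIV_minus[OF this] show "((\<lambda>s. - f (- s)) has_real_derivative f' (- t)) (at t)" by simp
    assume "- f (- t) = 0"
    then show "f' (- t) > 0" using pos[OF t] by simp
  qed (use s0 s in auto)
  then show ?thesis by simp
qed

lemma near_right:
  assumes "s0 \<in> J" "open X" "r s0 \<in> X"
  shows "\<exists>s\<in>J. s0 < s \<and> r s \<in> X" "\<exists>s\<in>J. s < s0 \<and> r s \<in> X"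
proof -
  have "open (J \<inter> r -` X)" by (intro continuous_open_preimage[OF cont_J(3) J_open] assms)
  moreover have "s0 \<in> J \<inter> r -` X" using assms by simp
  ultimately obtain e where e: "e > 0" "ball s0 e \<subseteq> J \<inter> r -` X" by (rule openE)
  have "s0 + e / 2 \<in> ball s0 e" "s0 - e / 2 \<in> ball s0 e" using e(1) by (simp_all add: dist_real_def)
  then have "s0 + e / 2 \<in> J \<inter> r -` X" "s0 - e / 2 \<in> J \<inter> r -` X" using e(2) by blast+
  then have "s0 < s0 + e / 2 \<and> r (s0 + e / 2) \<in> X" "s0 + e / 2 \<in> J" "s0 - e / 2 < s0 \<and> r (s0 - e / 2) \<in> X" "s0 - e / 2 \<in> J"
    using e(1) by simp_all
  then show "\<exists>s\<in>J. s0 < s \<and> r s \<in> X" "\<exists>s\<in>J. s < s0 \<and> r s \<in> X" by blast+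
qed

lemma turn_range_up:
  assumes s0: "s0 \<in> J" "r s0 = \<rho>" and p: "\<And>s. s \<in> J \<Longrightarrow> s0 < s \<Longrightarrow> p s > 0" and rr: "\<And>s. s \<in> J \<Longrightarrow> \<rho> \<le> r s"
    and A: "\<And>x. \<rho> < x \<Longrightarrow> adm x" and P: "Pf M H c \<rho> = 0"
  shows "r ` {s \<in> J. s0 < s} = {\<rho><..}"
proof (intro equalityI subsetI)
  fix x assume "x \<in> r ` {s \<in> J. s0 < s}"
  then obtain s where s: "s \<in> J" "s0 < s" "x = r s" by auto
  have "r s \<noteq> \<rho>" using p_square[OF s(1)] p[OF s(1,2)] P by auto
  then show "x \<in> {\<rho><..}" using rr[OF s(1)] s(3) by simp
next
  fix x assume "x \<in> {\<rho><..}"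
  then have x: "r s0 \<in> {..<x}" using s0 by simp
  \<comment> \<open>\<open>p\<close> vanishes at \<open>s0\<close> itself, so
    \<open>reach_right\<close> is started at a nearby parameter whose radius is still below
    \<open>x\<close>.\<close>
  obtain s2 where s2: "s2 \<in> J" "s0 < s2" "r s2 < x" using near_right(1)[OF s0(1) open_lessThan x] by auto
  have "\<rho> < r s2" using p_square[OF s2(1)] p[OF s2(1,2)] P rr[OF s2(1)] by (cases "r s2 = \<rho>") auto
  then have "\<exists>s\<in>J. s2 \<le> s \<and> r s = x \<and> p s > 0"
    by (intro reach_right[OF s2(1) p[OF s2(1,2)] s2(3)] A) auto
  then show "x \<in> r ` {s \<in> J. s0 < s}" using s2(2) by force
qed

lemma turn_range_down:
  assumes s0: "s0 \<in> J" "r s0 = \<rho>" and p: "\<And>s. s \<in> J \<Longrightarrow> s < s0 \<Longrightarrow> p s > 0" and rr: "\<And>s. s \<in> J \<Longrightarrow> r s \<le> \<rho>"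
    and A: "\<And>x. 0 < x \<Longrightarrow> x < \<rho> \<Longrightarrow> adm x" and P: "Pf M H c \<rho> = 0"
  shows "r ` {s \<in> J. s < s0} = {0<..<\<rho>}"
proof (intro equalityI subsetI)
  fix x assume "x \<in> r ` {s \<in> J. s < s0}"
  then obtain s where s: "s \<in> J" "s < s0" "x = r s" by auto
  have "r s \<noteq> \<rho>" using p_square[OF s(1)] p[OF s(1,2)] P by auto
  then show "x \<in> {0<..<\<rho>}" using rr[OF s(1)] s(3) r_pos[OF s(1)] by simp
next
  fix x assume "x \<in> {0<..<\<rho>}"
  then have x: "r s0 \<in> {x<..}" "x > 0" using s0 by auto
  obtain s2 where s2: "s2 \<in> J" "s2 < s0" "x < r s2" using near_right(2)[OF s0(1) open_greaterThan x(1)] by auto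
  have "r s2 < \<rho>" using p_square[OF s2(1)] p[OF s2(1,2)] P rr[OF s2(1)] by (cases "r s2 = \<rho>") auto
  then have "\<exists>s\<in>J. s \<le> s2 \<and> r s = x \<and> p s > 0"
    using x(2) by (intro reach_left[OF s2(1) p[OF s2(1,2)] s2(3) x(2)] A) auto
  then show "x \<in> r ` {s \<in> J. s < s0}" using s2(2) by force
qed

lemma region_II_p:
  assumes "s \<in> J" "u s < 0" "v s > 0" "kH M H (r s) > c" shows "p s \<noteq> 0"
  using region_II(4)[OF assms(1-3)] assms(4) by auto

section \<open>Types of motion of a profile that enters region II\<close>

definition "case_cyl r0 \<longleftrightarrow> 0 < r0 \<and> r0 < 2 * M \<and> (\<forall>s\<in>J. r s = r0 \<and> u s < 0 \<and> v s > 0) \<and> u ` J = {..<0}"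

text \<open>No turning point: the radius ranges from \<open>0\<close>, or from the double zero
  \<open>r_min\<close> that is approached but not attained, out to infinity.\<close>

definition "case_run \<rho> \<longleftrightarrow> ((c < c_min M H \<and> \<rho> = 0) \<or> (c = c_min M H \<and> \<rho> = r_min M H)) \<and> r ` J = {\<rho><..} \<and>
   (\<forall>x. \<rho> < x \<longrightarrow> x < 2 * M \<longrightarrow> kH M H x > c)"

definition "case_inner \<longleftrightarrow> c = c_min M H \<and> r ` J = {0<..<r_min M H} \<and> (\<forall>s\<in>J. u s < 0 \<and> v s > 0) \<and>
   (\<forall>x. 0 < x \<longrightarrow> x < r_min M H \<longrightarrow> kH M H x > c)"

text \<open>The radius comes in from infinity, turns at the simple zero \<open>\<rho>\<close>
  outside \<open>r_min\<close> and goes out again; \<open>case_in\<close> is the counterpart between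
  the singularity and \<open>r_min\<close>.\<close>

definition "case_out \<rho> s0 \<longleftrightarrow> c_min M H < c \<and> c < - 8 * M ^ 3 * H \<and> r_min M H < \<rho> \<and> \<rho> < 2 * M \<and> kH M H \<rho> = c \<and>
   s0 \<in> J \<and> r s0 = \<rho> \<and> p s0 = 0 \<and>
   (\<forall>s\<in>J. (s < s0 \<longrightarrow> p s < 0) \<and> (s0 < s \<longrightarrow> p s > 0) \<and> (s \<le> s0 \<longrightarrow> u s < 0) \<and> (s0 \<le> s \<longrightarrow> v s > 0)) \<and>
   r ` {s \<in> J. s0 < s} = {\<rho><..} \<and> r ` {s \<in> J. s < s0} = {\<rho><..}"

definition "case_in \<rho> s0 \<longleftrightarrow> c_min M H < c \<and> c < 0 \<and> 0 < \<rho> \<and> \<rho> < r_min M H \<and> kH M H \<rho> = c \<and>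
   s0 \<in> J \<and> r s0 = \<rho> \<and> p s0 = 0 \<and>
   (\<forall>s\<in>J. (s < s0 \<longrightarrow> p s > 0) \<and> (s0 < s \<longrightarrow> p s < 0) \<and> u s < 0 \<and> v s > 0) \<and>
   r ` {s \<in> J. s < s0} = {0<..<\<rho>} \<and> r ` {s \<in> J. s0 < s} = {0<..<\<rho>}"

text \<open>Inside the horizon \<open>u v < 0\<close>, so \<open>u\<close> keeps its sign along the
  connected parameter set.\<close>

lemma all_region_II:
  assumes "\<And>s. s \<in> J \<Longrightarrow> r s < 2 * M" "s1 \<in> J" "u s1 < 0" "s \<in> J"
  shows "u s < 0 \<and> v s > 0"
proof -
  have uv: "u s * v s < 0" if "s \<in> J" for s using r_inside[OF that] assms(1)[OF that] by simp
  have "- u s > 0"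
    by (rule sign_const[OF continuous_on_minus[OF cont_J(1)] _ assms(2) _ assms(4)]) (use uv assms(3) in fastforce)+
  then show ?thesis using uv[OF assms(4)] by (auto simp: mult_less_0_iff)
qed

text \<open>The radius is constant by \<open>equilibrium\<close>. If \<open>u\<close> missed a
  negative value, the curve would stay on one side of it, and there the bounds excluded by
  \<open>escape_left\<close> or \<open>escape_right\<close> would hold.\<close>

lemma cylinder:
  assumes s1: "s1 \<in> J" "u s1 < 0" "v s1 > 0" and eq: "s0 \<in> J" "p s0 = 0" "Qf M H c (r s0) = 0"
  shows "case_cyl (r s1)"
proof -
  have rr: "r s = r s1" if "s \<in> J" for s using equilibrium(1)[OF eq] that s1(1) by metis
  have r1: "0 < r s1" "r s1 < 2 * M" using r_pos s1 region_II(1) by auto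
  have uv: "u s < 0 \<and> v s > 0" if "s \<in> J" for s
    by (rule all_region_II[OF _ s1(1,2) that]) (use rr r1 in auto)
  have "x \<in> u ` J" if x: "x < 0" for x
  proof (rule ccontr)
    assume n: "x \<notin> u ` J"
    have cu: "connected (u ` J)" using connected_continuous_image[OF cont_J(1) J_conn] .
    show False
    proof (cases "x < u s1")
      case True
      have xu: "x < u s" if "s \<in> J" for s
      proof (rule ccontr)
        assume "\<not> x < u s"
        then have "x \<in> u ` J" using connectedD_interval[OF cu imageI[OF that] imageI[OF s1(1)], of x] True by simp
        then show False using n by simp
      qed
      show False
      proof (rule escape_left[OF s1(1) r1(1), of x])
        fix s assume s: "s \<in> J"
        show "x \<le> u s \<and> x \<le> v s \<and> r s1 \<le> r s" using uv[OF s] xu[OF s] rr[OF s] x by simp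
      qed
    next
      case False
      have ux: "u s < x" if "s \<in> J" for s
      proof (rule ccontr)
        assume "\<not> u s < x"
        then have "x \<in> u ` J" using connectedD_interval[OF cu imageI[OF s1(1)] imageI[OF that], of x] False by simp
        then show False using n by simp
      qed
      have vb: "v s \<le> kappa M (r s1) / x" if "s \<in> J" for s
      proof -
        have "v s * x \<ge> v s * u s" using ux[OF that] uv[OF that] by (intro mult_left_mono) auto
        then have "v s * x \<ge> kappa M (r s1)" using kappa_r[OF that] rr[OF that] by (simp add: mult.commute)
        then show ?thesis using x by (simp add: neg_le_divide_eq)
      qed
      show False
      proof (rule escape_right[OF s1(1) r1(1), of "max 0 (kappa M (r s1) / x)"])
        fix s assume s: "s \<in> J"
        show "u s \<le> max 0 (kappa M (r s1) / x) \<and> v s \<le> max 0 (kappa M (r s1) / x) \<and> r s1 \<le> r s"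
          using uv[OF s] vb[OF s] rr[OF s] by (auto simp: le_max_iff_disj)
      qed
    qed
  qed
  then have "u ` J = {..<0}" using uv by auto
  then show ?thesis using rr r1 uv by (simp add: case_cyl_def)
qed

text \<open>The barrier \<open>{\<rho>..}\<close> confines the radius, \<open>p\<close> vanishes
  only at \<open>\<rho>\<close>, and the positive force there makes \<open>p\<close> change sign
  exactly once. That \<open>\<rho>\<close> is attained at all is the Lyapunov argument, applied to
  the reflected curve if \<open>p < 0\<close> at the start.\<close>

lemma out_turn:
  assumes s1: "s1 \<in> J" "u s1 < 0" "v s1 > 0" and c: "c_min M H < c" and r1: "r_min M H < r s1"
  shows "\<exists>\<rho> s0. case_out \<rho> s0"
proof -
  interpret N: profile M H c "uminus ` J" "\<lambda>s. - v (- s)" "\<lambda>s. - u (- s)" "\<lambda>s. b (- s)" "\<lambda>s. a (- s)" "\<lambda>s. m (- s)"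
      "\<lambda>s. r (- s)" "\<lambda>s. - p (- s)"
    by (rule mirror)
  note rm = kH_shape(1,2)[OF M, of H]
  note R1 = region_II[OF s1]
  have c8: "c < - 8 * M ^ 3 * H" using kH_shape(9)[OF M less_imp_le[OF r1] R1(1)] R1(3) by simp
  have "continuous_on {r_min M H..r s1} (kH M H)"
    by (rule continuous_on_subset[OF continuous_on_kH[of M]]) (use rm R1 in auto)
  then obtain \<rho> where \<rho>: "r_min M H \<le> \<rho>" "\<rho> \<le> r s1" "kH M H \<rho> = c"
    using IVT'[of "kH M H" "r_min M H" c "r s1"] c R1(3) r1 by (auto simp: c_min_def)
  have rho: "r_min M H < \<rho>" "0 < \<rho>" "\<rho> < 2 * M" using \<rho> c rm R1 by (auto simp: c_min_def less_le)
  have gt: "kH M H x > c" if "\<rho> < x" "x < 2 * M" for x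
    using kH_shape(7)[OF M less_imp_le[OF rho(1)] that] \<rho>(3) by simp
  have lt: "kH M H x < c" if "r_min M H < x" "x < \<rho>" for x
    using kH_shape(7)[OF M less_imp_le[OF that(1)] that(2) rho(3)] \<rho>(3) by simp
  have A: "adm x" if "\<rho> < x" for x
  proof -
    consider "x < 2 * M" | "x = 2 * M" | "x > 2 * M" by linarith
    then show ?thesis
      using adm_inside[of x] gt[OF that] that rho adm_horizon[OF c8] adm_outside by cases auto
  qed
  note P0 = kH_eq_imp[OF rho(2,3) \<rho>(3)]
  have Q: "Qf M H c \<rho> > 0" using Qf_sign(2)[OF M rho(2,3) \<rho>(3) rho(1)] .
  have rK: "r s1 \<in> {\<rho>..}" using \<rho>(2) by simp
  \<comment> \<open>Between \<open>r_min\<close> and \<open>\<rho>\<close> one has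
    \<open>kH < c\<close> by monotonicity, so \<open>\<rho> - r_min\<close> is the width required of
    the barrier.\<close>
  have rr: "r s \<in> {\<rho>..}" if "s \<in> J" for s
  proof (rule barrier[OF s1(1) rK closed_atLeast _ that])
    fix s assume s: "s \<in> J" "r s \<in> {\<rho>..}"
    show "r s \<in> interior {\<rho>..} \<or> (r s < 2 * M \<and> kH M H (r s) = c \<and>
        (\<exists>\<epsilon>>0. \<forall>x. \<bar>x - r s\<bar> < \<epsilon> \<longrightarrow> x \<notin> {\<rho>..} \<longrightarrow> kH M H x < c))"
    proof (cases "r s = \<rho>")
      case True
      then show ?thesis using rho \<rho>(3) lt by (intro disjI2 conjI exI[of _ "\<rho> - r_min M H"]) (auto simp: abs_less_iff)
    next
      case False
      then show ?thesis using s by (simp add: interior_real_atLeast)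
    qed
  qed
  have zero: "r s = \<rho>" if "s \<in> J" "p s = 0" for s
    using p_square[OF that(1)] that(2) A[of "r s"] rr[OF that(1)] by (auto simp: adm_def less_le)
  have "\<exists>s0\<in>J. r s0 = \<rho>"
  proof -
    consider "p s1 = 0" | "p s1 > 0" | "p s1 < 0" by linarith
    then show ?thesis
    proof cases
      case 1 then show ?thesis using zero s1(1) by blast
    next
      case 2
      have "r s1 \<noteq> \<rho>" using R1(4) \<rho>(3) 2 by auto
      then have "\<rho> < r s1" using \<rho>(2) by simp
      from reach_turn_left[OF s1(1) 2 this rho(2) A Q P0(2,1)] show ?thesis by blast
    next
      case 3
      have "r s1 \<noteq> \<rho>" using R1(4) \<rho>(3) 3 by auto
      then have l: "\<rho> < r (- (- s1))" using \<rho>(2) by simp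
      have "\<exists>s\<in>uminus ` J. s \<le> - s1 \<and> r (- s) = \<rho>"
        by (rule N.reach_turn_left[OF _ _ l rho(2) A Q P0(2,1)]) (use s1 3 in \<open>auto simp: adm_def N.adm_def\<close>)
      then show ?thesis by auto
    qed
  qed
  then obtain s0 where s0: "s0 \<in> J" "r s0 = \<rho>" by blast
  have p0: "p s0 = 0" using p_square[OF s0(1)] P0(1) s0(2) by simp
  have dpos: "m s * Qf M H c (r s) > 0" if "s \<in> J" "p s = 0" for s
    using zero[OF that] Q m_pos[OF that(1)] by simp
  have up: "p s > 0" if "s \<in> J" "s0 < s" for s
    using upcross[OF p_deriv dpos s0(1) p0 that] .
  have dn: "p s < 0" if "s \<in> J" "s < s0" for s
    using upcross_left[OF p_deriv dpos s0(1) p0 that] .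
  have uv0: "u s0 < 0" "v s0 > 0" using v_pos_iff[OF s0(1)] u_neg_iff[OF s0(1)] p0 P0(2) s0(2) by auto
  have uneg: "u s < 0" if "s \<in> J" "s \<le> s0" for s using u_mono[OF that(1) s0(1)] uv0 that(2) by (cases "s = s0") auto
  have vpos: "v s > 0" if "s \<in> J" "s0 \<le> s" for s using v_mono[OF s0(1) that(1)] uv0 that(2) by (cases "s = s0") auto
  have "r ` {s \<in> J. s0 < s} = {\<rho><..}"
    by (rule turn_range_up[OF s0 up _ A P0(1)]) (use rr in auto)
  moreover have "(\<lambda>s. r (- s)) ` {s \<in> uminus ` J. - s0 < s} = {\<rho><..}"
    by (rule N.turn_range_up[OF _ _ _ _ _ P0(1)]) (use s0 dn rr A in \<open>auto simp: adm_def N.adm_def\<close>)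
  moreover have "(\<lambda>s. r (- s)) ` {s \<in> uminus ` J. - s0 < s} = r ` {s \<in> J. s < s0}"
    by (force simp: image_iff)
  ultimately have rg: "r ` {s \<in> J. s0 < s} = {\<rho><..}" "r ` {s \<in> J. s < s0} = {\<rho><..}" by simp_all
  have "\<forall>s\<in>J. (s < s0 \<longrightarrow> p s < 0) \<and> (s0 < s \<longrightarrow> p s > 0) \<and> (s \<le> s0 \<longrightarrow> u s < 0) \<and> (s0 \<le> s \<longrightarrow> v s > 0)"
    using up dn uneg vpos by blast
  with c c8 rho \<rho>(3) s0 p0 rg have "case_out \<rho> s0"
    unfolding case_out_def by (intro conjI)
  then show ?thesis by blast
qed

text \<open>The force at \<open>\<rho>\<close> is negative here, so \<open>- p\<close> takes the
  part of \<open>p\<close>; the barrier \<open>{..\<rho>}\<close> keeps the whole curve in region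
  II.\<close>

lemma in_turn:
  assumes s1: "s1 \<in> J" "u s1 < 0" "v s1 > 0" and c: "c_min M H < c" and r1: "r s1 < r_min M H"
  shows "\<exists>\<rho> s0. case_in \<rho> s0"
proof -
  interpret N: profile M H c "uminus ` J" "\<lambda>s. - v (- s)" "\<lambda>s. - u (- s)" "\<lambda>s. b (- s)" "\<lambda>s. a (- s)" "\<lambda>s. m (- s)"
      "\<lambda>s. r (- s)" "\<lambda>s. - p (- s)"
    by (rule mirror)
  note rm = kH_shape(1,2)[OF M, of H]
  note R1 = region_II[OF s1] and r0 = r_pos[OF s1(1)]
  have c0: "c < 0" using kH_shape(8)[OF M r0 less_imp_le[OF r1]] R1(3) by simp
  have "continuous_on {r s1..r_min M H} (kH M H)"
    by (rule continuous_on_subset[OF continuous_on_kH[of M]]) (use rm r0 in auto)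
  then obtain \<rho> where \<rho>: "r s1 \<le> \<rho>" "\<rho> \<le> r_min M H" "kH M H \<rho> = c"
    using IVT2'[of "kH M H" "r_min M H" c "r s1"] c R1(3) r1 by (auto simp: c_min_def)
  have rho: "\<rho> < r_min M H" "0 < \<rho>" "\<rho> < 2 * M" using \<rho> c rm r0 by (auto simp: c_min_def less_le)
  have gt: "kH M H x > c" if "0 < x" "x < \<rho>" for x
    using kH_shape(6)[OF M that less_imp_le[OF rho(1)]] \<rho>(3) by simp
  have lt: "kH M H x < c" if "\<rho> < x" "x < r_min M H" for x
    using kH_shape(6)[OF M rho(2) that(1) less_imp_le[OF that(2)]] \<rho>(3) by simp
  have A: "adm x" if "0 < x" "x < \<rho>" for x using adm_inside[OF that(1) _ gt[OF that]] that rho by simp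
  note P0 = kH_eq_imp[OF rho(2,3) \<rho>(3)]
  have Q: "Qf M H c \<rho> < 0" using Qf_sign(1)[OF M rho(2,3) \<rho>(3) rho(1)] .
  have rK: "r s1 \<in> {..\<rho>}" using \<rho>(1) by simp
  have rr: "r s \<in> {..\<rho>}" if "s \<in> J" for s
  proof (rule barrier[OF s1(1) rK closed_atMost _ that])
    fix s assume s: "s \<in> J" "r s \<in> {..\<rho>}"
    show "r s \<in> interior {..\<rho>} \<or> (r s < 2 * M \<and> kH M H (r s) = c \<and>
        (\<exists>\<epsilon>>0. \<forall>x. \<bar>x - r s\<bar> < \<epsilon> \<longrightarrow> x \<notin> {..\<rho>} \<longrightarrow> kH M H x < c))"
    proof (cases "r s = \<rho>")
      case True
      then show ?thesis using rho \<rho>(3) lt by (intro disjI2 conjI exI[of _ "r_min M H - \<rho>"]) (auto simp: abs_less_iff)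
    next
      case False
      then show ?thesis using s by (simp add: interior_real_atMost)
    qed
  qed
  have uv: "u s < 0 \<and> v s > 0" if "s \<in> J" for s
    by (rule all_region_II[OF _ s1(1,2) that]) (use rr rho in force)
  have zero: "r s = \<rho>" if "s \<in> J" "p s = 0" for s
    using p_square[OF that(1)] that(2) A[of "r s"] rr[OF that(1)] r_pos[OF that(1)] by (auto simp: adm_def less_le)
  have "\<exists>s0\<in>J. r s0 = \<rho>"
  proof -
    consider "p s1 = 0" | "p s1 > 0" | "p s1 < 0" by linarith
    then show ?thesis
    proof cases
      case 1 then show ?thesis using zero s1(1) by blast
    next
      case 2
      have "r s1 \<noteq> \<rho>" using R1(4) \<rho>(3) 2 by auto
      then have l: "r s1 < \<rho>" using \<rho>(1) by simp
      have "\<exists>s\<in>J. s1 \<le> s \<and> r s = \<rho>"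
        by (rule reach_turn_right[OF s1(1) 2 l _ Q P0(2,1)]) (use A r0 in auto)
      then show ?thesis by blast
    next
      case 3
      have "r s1 \<noteq> \<rho>" using R1(4) \<rho>(3) 3 by auto
      then have l: "r (- (- s1)) < \<rho>" using \<rho>(1) by simp
      have "\<exists>s\<in>uminus ` J. - s1 \<le> s \<and> r (- s) = \<rho>"
        by (rule N.reach_turn_right[OF _ _ l _ Q P0(2,1)]) (use s1 3 A r0 in \<open>auto simp: adm_def N.adm_def\<close>)
      then show ?thesis by auto
    qed
  qed
  then obtain s0 where s0: "s0 \<in> J" "r s0 = \<rho>" by blast
  have p0: "p s0 = 0" using p_square[OF s0(1)] P0(1) s0(2) by simp
  have pd: "((\<lambda>s. - p s) has_real_derivative - (m s * Qf M H c (r s))) (at s)" if "s \<in> J" for s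
    using DERIV_minus[OF p_deriv[OF that]] .
  have dpos: "- (m s * Qf M H c (r s)) > 0" if "s \<in> J" "- p s = 0" for s
    using zero[of s] that Q m_pos[OF that(1)] by (simp add: mult_pos_neg)
  have "- p s0 = 0" using p0 by simp
  have dn: "p s < 0" if "s \<in> J" "s0 < s" for s
    using upcross[OF pd dpos s0(1) \<open>- p s0 = 0\<close> that] by simp
  have up: "p s > 0" if "s \<in> J" "s < s0" for s
    using upcross_left[OF pd dpos s0(1) \<open>- p s0 = 0\<close> that] by simp
  have "r ` {s \<in> J. s < s0} = {0<..<\<rho>}"
    by (rule turn_range_down[OF s0 up _ A P0(1)]) (use rr in auto)
  moreover have "(\<lambda>s. r (- s)) ` {s \<in> uminus ` J. s < - s0} = {0<..<\<rho>}"
    by (rule N.turn_range_down[OF _ _ _ _ _ P0(1)]) (use s0 dn rr A in \<open>auto simp: adm_def N.adm_def\<close>)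
  moreover have "(\<lambda>s. r (- s)) ` {s \<in> uminus ` J. s < - s0} = r ` {s \<in> J. s0 < s}"
    by (force simp: image_iff)
  ultimately have rg: "r ` {s \<in> J. s < s0} = {0<..<\<rho>}" "r ` {s \<in> J. s0 < s} = {0<..<\<rho>}" by simp_all
  have "\<forall>s\<in>J. (s < s0 \<longrightarrow> p s > 0) \<and> (s0 < s \<longrightarrow> p s < 0) \<and> u s < 0 \<and> v s > 0"
    using up dn uv by blast
  with c c0 rho \<rho>(3) s0 p0 rg have "case_in \<rho> s0"
    unfolding case_in_def by (intro conjI)
  then show ?thesis by blast
qed

lemma run:
  assumes s1: "s1 \<in> J" "p s1 > 0" and \<rho>: "\<rho> \<ge> 0" "\<And>s. s \<in> J \<Longrightarrow> \<rho> < r s" and A: "\<And>x. \<rho> < x \<Longrightarrow> adm x"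
  shows "r ` J = {\<rho><..}" "\<forall>s\<in>J. p s > 0 \<and> v s > 0"
proof -
  have "{\<rho><..} \<subseteq> {0<..}" using \<rho>(1) by auto
  from onto[OF connected_Ioi open_greaterThan this, of s1] \<rho>(2) A s1
  have "\<forall>s\<in>J. p s > 0" "r ` J = {\<rho><..}" by auto
  then show "r ` J = {\<rho><..}" "\<forall>s\<in>J. p s > 0 \<and> v s > 0" using adm_u_v A \<rho>(2) by auto
qed

text \<open>Once rest points are excluded, \<open>c < c_min\<close> leaves no turning point; for
  \<open>c = c_min\<close> the only candidate \<open>r_min\<close> would be a rest point and so
  cannot be passed; \<open>c > c_min\<close> leaves one simple turning point on the side of
  \<open>r_min\<close> where the curve lies.\<close>

theorem class_II:
  assumes s1: "s1 \<in> J" "u s1 < 0" "v s1 > 0"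
  shows "(\<exists>r0. case_cyl r0) \<or>
    (\<exists>\<rho>. case_run \<rho> \<and> ((\<forall>s\<in>J. p s > 0 \<and> v s > 0) \<or> (\<forall>s\<in>J. p s < 0 \<and> u s < 0))) \<or>
    (case_inner \<and> ((\<forall>s\<in>J. p s > 0) \<or> (\<forall>s\<in>J. p s < 0))) \<or>
    (\<exists>\<rho> s0. case_out \<rho> s0) \<or> (\<exists>\<rho> s0. case_in \<rho> s0)"
proof (cases "\<exists>s0\<in>J. p s0 = 0 \<and> Qf M H c (r s0) = 0")
  case True
  then show ?thesis using cylinder[OF s1] by blast
next
  case noeq: False
  interpret N: profile M H c "uminus ` J" "\<lambda>s. - v (- s)" "\<lambda>s. - u (- s)" "\<lambda>s. b (- s)" "\<lambda>s. a (- s)" "\<lambda>s. m (- s)"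
      "\<lambda>s. r (- s)" "\<lambda>s. - p (- s)"
    by (rule mirror)
  have NA: "N.adm x \<longleftrightarrow> adm x" for x by (simp add: adm_def N.adm_def)
  note rm = kH_shape(1,2)[OF M, of H]
  note R1 = region_II[OF s1] and r0 = r_pos[OF s1(1)]
  \<comment> \<open>Covers \<open>c < c_min\<close> with \<open>\<rho> = 0\<close> and the outer
    branch of \<open>c = c_min\<close> with \<open>\<rho> = r_min\<close>; negative \<open>p\<close>
    is handled on the reflected curve.\<close>
  have run': ?thesis if c: "c \<le> c_min M H" and \<rho>: "(c < c_min M H \<and> \<rho> = 0) \<or> (c = c_min M H \<and> \<rho> = r_min M H)"
      "\<And>s. s \<in> J \<Longrightarrow> \<rho> < r s"
      and gt: "\<And>x. \<rho> < x \<Longrightarrow> x < 2 * M \<Longrightarrow> kH M H x > c" for \<rho>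
  proof -
    have \<rho>0: "\<rho> \<ge> 0" using \<rho>(1) rm by auto
    have c8: "c < - 8 * M ^ 3 * H" using c_min_less[OF M] c by (rule le_less_trans[rotated])
    have A: "adm x" if "\<rho> < x" for x
    proof -
      consider "x < 2 * M" | "x = 2 * M" | "x > 2 * M" by linarith
      then show ?thesis
        using adm_inside[of x] gt[OF that] that \<rho>0 adm_horizon[OF c8] adm_outside by cases auto
    qed
    have "p s1 \<noteq> 0" using region_II_p[OF s1 gt[OF \<rho>(2)[OF s1(1)] R1(1)]] .
    then consider "p s1 > 0" | "p s1 < 0" by linarith
    then show ?thesis
    proof cases
      case 1
      from run[OF s1(1) 1 \<rho>0 \<rho>(2) A] show ?thesis using \<rho>(1) gt unfolding case_run_def by blast
    next
      case 2
      have "- s1 \<in> uminus ` J" "- p (- (- s1)) > 0" using s1 2 by auto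
      note nrun = N.run[OF this \<rho>0]
      have *: "(\<lambda>s. r (- s)) ` uminus ` J = {\<rho><..}" "\<forall>s\<in>uminus ` J. - p (- s) > 0 \<and> - u (- s) > 0"
        by (rule nrun; use \<rho>(2) A NA in force)+
      have "r ` J = {\<rho><..}" using *(1) by (simp add: image_image)
      moreover have "\<forall>s\<in>J. p s < 0 \<and> u s < 0" using *(2) by simp
      ultimately show ?thesis using \<rho>(1) gt unfolding case_run_def by blast
    qed
  qed
  consider "c < c_min M H" | "c = c_min M H" | "c_min M H < c" by linarith
  then show ?thesis
  proof cases
    case 1
    have "c_min M H \<le> kH M H x" if "0 < x" "x < 2 * M" for x
      using kH_ge_c_min[OF M that, of H] by (cases "x = r_min M H") (auto simp: c_min_def)
    then have "kH M H x > c" if "0 < x" "x < 2 * M" for x using 1 that by (meson less_le_trans)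
    then show ?thesis using run'[of 0] 1 r_pos by auto
  next
    case 2
    \<comment> \<open>A passage through \<open>r_min\<close> would be a rest point, since
      \<open>Pf\<close> and \<open>Qf\<close> both vanish there.\<close>
    have ne: "r s \<noteq> r_min M H" if "s \<in> J" for s
    proof
      assume rs: "r s = r_min M H"
      have k: "kH M H (r s) = c" unfolding rs 2 c_min_def ..
      have "Qf M H c (r s) = 0" "Pf M H c (r s) = 0"
        using Qf_sign(3)[OF M _ _ k] kH_eq_imp(1)[OF _ _ k] rs rm by auto
      then show False using noeq p_square[OF that] that by auto
    qed
    have gt: "kH M H x > c" if "0 < x" "x < 2 * M" "x \<noteq> r_min M H" for x using kH_ge_c_min[OF M that] 2 by simp
    show ?thesis
    proof (cases "r s1 > r_min M H")
      case True
      have "r s > r_min M H" if "s \<in> J" for s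
      proof -
        have "r s - r_min M H > 0"
          by (rule sign_const[OF continuous_on_diff[OF cont_J(3) continuous_on_const] _ s1(1) _ that]) (use True ne in auto)
        then show ?thesis by simp
      qed
      then show ?thesis using run'[of "r_min M H"] 2 gt rm by auto
    next
      case False
      then have r1: "r s1 < r_min M H" using ne[OF s1(1)] by simp
      have rr: "r s < r_min M H" if "s \<in> J" for s
      proof -
        have "r_min M H - r s > 0"
          by (rule sign_const[OF continuous_on_diff[OF continuous_on_const cont_J(3)] _ s1(1) _ that]) (use r1 ne in force)+
        then show ?thesis by simp
      qed
      have uv: "u s < 0 \<and> v s > 0" if "s \<in> J" for s
        by (rule all_region_II[OF _ s1(1,2) that]) (use rr rm in force)
      have A: "adm x" if "x \<in> {0<..<r_min M H}" for x using adm_inside[of x] gt[of x] that rm by auto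
      have I: "connected {0<..<r_min M H}" "open {0<..<r_min M H}" "{0<..<r_min M H} \<subseteq> {0<..}" by auto
      have rI: "r s \<in> {0<..<r_min M H}" if "s \<in> J" for s using rr[OF that] r_pos[OF that] by simp
      have inner: "case_inner" if "r ` J = {0<..<r_min M H}"
        unfolding case_inner_def using that 2 uv gt rm by auto
      have "p s1 \<noteq> 0" using region_II_p[OF s1 gt[OF r0 R1(1)]] r1 by simp
      then consider "p s1 > 0" | "p s1 < 0" by linarith
      then show ?thesis
      proof cases
        case 1
        from onto[OF I rI A s1(1) 1] inner show ?thesis by blast
      next
        case 2
        have "- s1 \<in> uminus ` J" "- p (- (- s1)) > 0" using s1 2 by auto
        note nonto = N.onto[OF I _ _ this]
        have *: "\<forall>s\<in>uminus ` J. - p (- s) > 0" "(\<lambda>s. r (- s)) ` uminus ` J = {0<..<r_min M H}"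
          by (rule nonto; use rI A NA in force)+
        have "r ` J = {0<..<r_min M H}" using *(2) by (simp add: image_image)
        moreover have "\<forall>s\<in>J. p s < 0" using *(1) by simp
        ultimately show ?thesis using inner by blast
      qed
    qed
  next
    case 3
    have "r s1 \<noteq> r_min M H" using R1(3) 3 by (auto simp: c_min_def)
    then show ?thesis using out_turn[OF s1 3] in_turn[OF s1 3] by (meson linorder_neqE_linordered_idom)
  qed
qed

end

section \<open>The time coordinate as a function of the radius\<close>

lemma LBINT_deriv:
  fixes \<phi> :: "real \<Rightarrow> real"
  assumes I: "connected I" "open I" and cont: "continuous_on I \<phi>" and b: "b \<in> I" and x: "x \<in> I"
  shows "((\<lambda>x. LBINT y=b..x. \<phi> y) has_real_derivative \<phi> x) (at x)"
proof -
  obtain e where e: "e > 0" "cball x e \<subseteq> I" using I(2) x open_contains_cball by blast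
  \<comment> \<open>An interval that holds the base point and a neighbourhood of \<open>x\<close>,
    in whatever order they lie.\<close>
  define lo hi where "lo = min b (x - e)" and "hi = max b (x + e)"
  have "x - e \<in> I" "x + e \<in> I" using e by (auto simp: subset_iff dist_real_def)
  then have lh: "lo \<in> I" "hi \<in> I" using b by (auto simp: lo_def hi_def min_def max_def)
  have "{lo..hi} \<subseteq> I" using connectedD_interval[OF I(1) lh] by auto
  then have "continuous_on {lo..hi} \<phi>" using cont continuous_on_subset by blast
  then have "((\<lambda>x. LBINT y=b..x. \<phi> y) has_vector_derivative \<phi> x) (at x within {lo..hi})"
    using e(1) by (intro interval_integral_FTC2) (auto simp: lo_def hi_def)
  then have "((\<lambda>x. LBINT y=b..x. \<phi> y) has_vector_derivative \<phi> x) (at x within {lo<..<hi})"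
    by (rule has_vector_derivative_within_subset) auto
  moreover have "x \<in> {lo<..<hi}" using e(1) by (auto simp: lo_def hi_def)
  ultimately show ?thesis
    by (simp only: at_within_open[OF _ open_greaterThanLessThan] has_real_derivative_iff_has_vector_derivative)
qed

text \<open>The integrand may blow up at \<open>\<rho>\<close>. Being nonnegative, with an
  antiderivative that has a finite limit, it is integrable up to \<open>\<rho>\<close>, which is the
  finiteness demanded in \<open>f2_dom\<close>, and the base point can be moved to
  \<open>\<rho>\<close>.\<close>

lemma integral_left_endpoint:
  fixes \<phi> :: "real \<Rightarrow> real" and b :: real
  assumes cont: "continuous_on {\<alpha><..<\<rho>} \<phi>" and nonneg: "\<And>x. \<alpha> < x \<Longrightarrow> x < \<rho> \<Longrightarrow> \<phi> x \<ge> 0"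
    and b: "\<alpha> < b" "b < \<rho>" and lim: "((\<lambda>x::real. LBINT y=b..x. \<phi> y) \<longlongrightarrow> L) (at_left \<rho>)" and x: "\<alpha> < x" "x < \<rho>"
  shows "interval_lebesgue_integrable lborel (ereal x) (ereal \<rho>) \<phi>" "(LBINT y=\<rho>..x. \<phi> y) = (LBINT y=b..x. \<phi> y) - L"
proof -
  define T where "T x = (LBINT y=b..x. \<phi> y)" for x :: real
  have D: "(T has_real_derivative \<phi> y) (at y)" if "\<alpha> < y" "y < \<rho>" for y
    unfolding T_def using b that by (intro LBINT_deriv[of "{\<alpha><..<\<rho>}"] cont) auto
  have c: "isCont \<phi> y" if "\<alpha> < y" "y < \<rho>" for y
    using cont that by (simp add: continuous_on_eq_continuous_at)
  have "(T \<longlongrightarrow> T x) (at_right x)" using DERIV_isCont[OF D[OF x]] by (simp add: isCont_def filterlim_at_split)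
  then have A: "((T \<circ> real_of_ereal) \<longlongrightarrow> T x) (at_right (ereal x))" by (simp add: ereal_tendsto_simps)
  have "(T \<longlongrightarrow> L) (at_left \<rho>)" using lim by (simp add: T_def[abs_def])
  then have B: "((T \<circ> real_of_ereal) \<longlongrightarrow> L) (at_left (ereal \<rho>))" by (simp add: ereal_tendsto_simps)
  have ae: "AE y in lborel. ereal x < ereal y \<longrightarrow> ereal y < ereal \<rho> \<longrightarrow> 0 \<le> \<phi> y"
    by (rule AE_I2) (use nonneg x in auto)
  have 1: "set_integrable lborel (einterval (ereal x) (ereal \<rho>)) \<phi>"
    by (rule interval_integral_FTC_nonneg(1)[OF _ _ _ ae A B]) (use x D c in auto)
  have 2: "(LBINT y=x..\<rho>. \<phi> y) = L - T x"
    by (rule interval_integral_FTC_nonneg(2)[OF _ _ _ ae A B]) (use x D c in auto)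
  show "interval_lebesgue_integrable lborel (ereal x) (ereal \<rho>) \<phi>"
    using 1 x by (simp add: interval_lebesgue_integrable_def)
  show "(LBINT y=\<rho>..x. \<phi> y) = (LBINT y=b..x. \<phi> y) - L"
    using 2 interval_integral_endpoints_reverse[of "ereal \<rho>" "ereal x" \<phi>] by (simp add: T_def)
qed

lemma integral_right_endpoint:
  fixes \<phi> :: "real \<Rightarrow> real" and b :: real
  assumes cont: "continuous_on {\<rho><..<\<beta>} \<phi>" and nonneg: "\<And>x. \<rho> < x \<Longrightarrow> x < \<beta> \<Longrightarrow> \<phi> x \<ge> 0"
    and b: "\<rho> < b" "b < \<beta>" and lim: "((\<lambda>x::real. LBINT y=b..x. \<phi> y) \<longlongrightarrow> L) (at_right \<rho>)" and x: "\<rho> < x" "x < \<beta>"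
  shows "interval_lebesgue_integrable lborel (ereal x) (ereal \<rho>) \<phi>" "(LBINT y=\<rho>..x. \<phi> y) = (LBINT y=b..x. \<phi> y) - L"
proof -
  define T where "T x = (LBINT y=b..x. \<phi> y)" for x :: real
  have D: "(T has_real_derivative \<phi> y) (at y)" if "\<rho> < y" "y < \<beta>" for y
    unfolding T_def using b that by (intro LBINT_deriv[of "{\<rho><..<\<beta>}"] cont) auto
  have c: "isCont \<phi> y" if "\<rho> < y" "y < \<beta>" for y
    using cont that by (simp add: continuous_on_eq_continuous_at)
  have "(T \<longlongrightarrow> T x) (at_left x)" using DERIV_isCont[OF D[OF x]] by (simp add: isCont_def filterlim_at_split)
  then have B: "((T \<circ> real_of_ereal) \<longlongrightarrow> T x) (at_left (ereal x))" by (simp add: ereal_tendsto_simps)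
  have "(T \<longlongrightarrow> L) (at_right \<rho>)" using lim by (simp add: T_def[abs_def])
  then have A: "((T \<circ> real_of_ereal) \<longlongrightarrow> L) (at_right (ereal \<rho>))" by (simp add: ereal_tendsto_simps)
  have ae: "AE y in lborel. ereal \<rho> < ereal y \<longrightarrow> ereal y < ereal x \<longrightarrow> 0 \<le> \<phi> y"
    by (rule AE_I2) (use nonneg x in auto)
  have 1: "set_integrable lborel (einterval (ereal \<rho>) (ereal x)) \<phi>"
    by (rule interval_integral_FTC_nonneg(1)[OF _ _ _ ae A B]) (use x D c in auto)
  have 2: "(LBINT y=\<rho>..x. \<phi> y) = T x - L"
    by (rule interval_integral_FTC_nonneg(2)[OF _ _ _ ae A B]) (use x D c in auto)
  show "interval_lebesgue_integrable lborel (ereal x) (ereal \<rho>) \<phi>"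
    using 1 x by (simp add: interval_lebesgue_integrable_def)
  show "(LBINT y=\<rho>..x. \<phi> y) = (LBINT y=b..x. \<phi> y) - L" using 2 by (simp add: T_def)
qed

definition phi1 :: "real \<Rightarrow> real \<Rightarrow> real \<Rightarrow> real \<Rightarrow> real" where
  "phi1 M H c x = l1 M H c x / h M x * (1 / sqrt (1 + (l1 M H c x)\<^sup>2))"

definition phi2 :: "real \<Rightarrow> real \<Rightarrow> real \<Rightarrow> real \<Rightarrow> real" where
  "phi2 M H c x = 1 / (- h M x) * sqrt ((l2 M H c x)\<^sup>2 / ((l2 M H c x)\<^sup>2 - 1))"

text \<open>The right side is \<open>dt / dr\<close> along a profile with
  \<open>p = sqrt Pf\<close>; the identity behind it is
  \<open>1 + l1\<^sup>2 = Pf / h\<close>.\<close>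

lemma phi1_eq:
  assumes "M > 0" "x > 2 * M"
  shows "phi1 M H c x = - wkill H c x / (h M x * sqrt (Pf M H c x))"
proof -
  have h: "h M x > 0" using h_pos assms by simp
  have l: "l1 M H c x = - wkill H c x / sqrt (h M x)" by (simp add: l1_def wkill_def)
  have "1 + (l1 M H c x)\<^sup>2 = Pf M H c x / h M x" using h by (simp add: l power_divide Pf_def field_simps)
  then have "sqrt (1 + (l1 M H c x)\<^sup>2) = sqrt (Pf M H c x) / sqrt (h M x)" by (simp add: real_sqrt_divide)
  then show ?thesis using h by (simp add: phi1_def l)
qed

lemma phi2_eq:
  assumes "0 < x" "x < 2 * M" "kH M H x > c"
  shows "phi2 M H c x = wkill H c x / (- h M x * sqrt (Pf M H c x))"
proof -
  have h: "h M x < 0" using h_neg assms by simp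
  note P = kH_gt_imp[OF assms]
  have l: "l2 M H c x = wkill H c x / sqrt (- h M x)" by (simp add: l2_def wkill_def)
  have sq: "(l2 M H c x)\<^sup>2 = (wkill H c x)\<^sup>2 / (- h M x)" using h by (simp add: l power_divide)
  have "(l2 M H c x)\<^sup>2 - 1 = Pf M H c x / (- h M x)" using h unfolding sq by (simp add: Pf_def field_simps)
  then have "(l2 M H c x)\<^sup>2 / ((l2 M H c x)\<^sup>2 - 1) = (wkill H c x)\<^sup>2 / Pf M H c x" using h sq by simp
  then have "sqrt ((l2 M H c x)\<^sup>2 / ((l2 M H c x)\<^sup>2 - 1)) = wkill H c x / sqrt (Pf M H c x)"
    using P by (simp add: real_sqrt_divide)
  then show ?thesis by (simp add: phi2_def)
qed

lemma isCont_h: "x > 0 \<Longrightarrow> isCont (h M) x"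
  unfolding h_def[abs_def] by (intro continuous_intros) auto

lemma continuous_on_phi1:
  assumes "M > 0" shows "continuous_on {2 * M<..} (phi1 M H c)"
proof -
  have "continuous_on {2 * M<..} (\<lambda>x. - wkill H c x / (h M x * sqrt (Pf M H c x)))"
  proof (intro continuous_at_imp_continuous_on ballI)
    fix x assume "x \<in> {2 * M<..}"
    then have x: "x > 2 * M" "x > 0" using assms by auto
    have "h M x > 0" using h_pos assms x by simp
    moreover then have "Pf M H c x > 0" unfolding Pf_def by (intro add_pos_nonneg) auto
    ultimately show "isCont (\<lambda>x. - wkill H c x / (h M x * sqrt (Pf M H c x))) x"
      using isCont_wkill[OF x(2)] isCont_h[OF x(2)] isCont_Pf[OF x(2)] by (intro continuous_intros) auto
  qed
  then show ?thesis by (rule continuous_on_eq) (simp add: phi1_eq[OF assms])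
qed

lemma continuous_on_phi2:
  assumes "\<And>x. x \<in> I \<Longrightarrow> 0 < x \<and> x < 2 * M \<and> kH M H x > c" shows "continuous_on I (phi2 M H c)"
proof -
  have "continuous_on I (\<lambda>x. wkill H c x / (- h M x * sqrt (Pf M H c x)))"
  proof (intro continuous_at_imp_continuous_on ballI)
    fix x assume "x \<in> I"
    then have x: "0 < x" "x < 2 * M" "kH M H x > c" using assms by auto
    have "h M x < 0" "Pf M H c x > 0" using h_neg kH_gt_imp x by auto
    then show "isCont (\<lambda>x. wkill H c x / (- h M x * sqrt (Pf M H c x))) x"
      using isCont_wkill[OF x(1)] isCont_h[OF x(1)] isCont_Pf[OF x(1)] by (intro continuous_intros) auto
  qed
  then show ?thesis by (rule continuous_on_eq) (use assms in \<open>simp add: phi2_eq\<close>)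
qed

lemma phi2_nonneg:
  assumes "0 < x" "x < 2 * M" "kH M H x > c"
  shows "phi2 M H c x \<ge> 0"
proof -
  have "- h M x * sqrt (Pf M H c x) > 0"
    using h_neg[OF assms(1,2)] kH_gt_imp(1)[OF assms] by (intro mult_pos_pos) auto
  then show ?thesis
    unfolding phi2_eq[OF assms] using kH_gt_imp(2)[OF assms] by (intro divide_nonneg_pos less_imp_le)
qed

lemma f1_phi: "f1 M H c b k x = (LBINT y=b..x. phi1 M H c y) + k"
  by (simp add: f1_def phi1_def)

lemma f3_f1: "f3 M H c b k x = - f1 M H c b (- k) x"
  by (simp add: f3_def f1_def l3_def interval_lebesgue_integral_uminus[symmetric])

lemma f2_star_phi: "f2_star M H c b k x = (LBINT y=b..x. phi2 M H c y) + k"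
  by (simp add: f2_star_def phi2_def)

lemma f2_dstar_star: "f2_dstar M H c b k x = - f2_star M H c b (- k) x"
  by (simp add: f2_dstar_def f2_star_def interval_lebesgue_integral_uminus[symmetric])

lemma l4_l2: "l4 M H c x = l2 M (- H) (- c) x"
  by (simp add: l4_def l2_def)

lemma f4_f2: "f4_star M H c b k x = f2_star M (- H) (- c) b k x" "f4_dstar M H c b k x = f2_dstar M (- H) (- c) b k x"
  by (simp_all add: f4_star_def f4_dstar_def f2_star_def f2_dstar_def l4_l2)

lemma f4_dom_f2: "f4_dom M H c = f2_dom M (- H) (- c)"
  unfolding f4_dom_def f2_dom_def kH'_kH l4_l2 by (auto simp: minus_less_iff neg_eq_iff_add_eq_0 minus_equation_iff)

context profile
begin

definition "tc s = 2 * M * ln \<bar>v s / u s\<bar>"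

text \<open>The logarithmic derivatives of \<open>v\<close> and \<open>u\<close> per arc length are
  \<open>1 / (4 M (p + w))\<close> and \<open>1 / (4 M (p - w))\<close>, and
  \<open>(p + w) (p - w) = h\<close>.\<close>

lemma tc_deriv:
  assumes s: "s \<in> J" "u s \<noteq> 0" "v s \<noteq> 0"
  shows "(tc has_real_derivative - m s * wkill H c (r s) / h M (r s)) (at s)"
proof -
  \<comment> \<open>Squaring removes the absolute value, so one computation covers all sign
    combinations.\<close>
  have tc: "tc t = M * ln ((v t / u t)\<^sup>2)" if "v t / u t \<noteq> 0" for t
  proof -
    have "ln (\<bar>v t / u t\<bar>\<^sup>2) = real 2 * ln \<bar>v t / u t\<bar>" by (rule ln_realpow)
    then show ?thesis unfolding power2_abs tc_def by simp
  qed
  define D where "D = (m s * b s * u s - v s * (m s * a s)) / (u s * u s)"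
  have qd: "((\<lambda>t. v t / u t) has_real_derivative D) (at s)"
    unfolding D_def by (rule DERIV_divide[OF v_deriv[OF s(1)] u_deriv[OF s(1)] s(2)])
  have "((\<lambda>t. (v t / u t)\<^sup>2) has_real_derivative 2 * (v s / u s) * D) (at s)"
    using DERIV_power[OF qd, of 2] by (simp add: mult_ac)
  moreover have "(v s / u s)\<^sup>2 > 0" using s by simp
  ultimately have "((\<lambda>t. M * ln ((v t / u t)\<^sup>2)) has_real_derivative M * (inverse ((v s / u s)\<^sup>2) * (2 * (v s / u
      s) * D))) (at s)"
    by (intro DERIV_cmult DERIV_chain2[of ln _ "\<lambda>t. (v t / u t)\<^sup>2"] DERIV_ln)
  moreover have "M * (inverse ((v s / u s)\<^sup>2) * (2 * (v s / u s) * D)) = 2 * M * m s * (b s / v s - a s / u s)"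
    using s by (simp add: D_def field_simps power2_eq_square)
  moreover have "b s / v s - a s / u s = - 2 * wkill H c (r s) / (4 * M * h M (r s))"
  proof -
    define P N where "P = p s + wkill H c (r s)" and "N = p s - wkill H c (r s)"
    have PN: "P \<noteq> 0" "N \<noteq> 0" using s G_pos[OF s(1)] a_pos[OF s(1)] b_pos[OF s(1)]
      by (auto simp: P_def N_def p_plus_w[OF s(1)] p_minus_w[OF s(1)])
    have "b s / v s = 1 / (4 * M * P)" "a s / u s = 1 / (4 * M * N)"
      using ab[OF s(1)] s G_pos[OF s(1)] a_pos[OF s(1)] b_pos[OF s(1)] M
      unfolding P_def N_def p_plus_w[OF s(1)] p_minus_w[OF s(1)] by (simp_all add: field_simps)
    moreover have "P * N = h M (r s)" using p_square[OF s(1)] by (simp add: P_def N_def Pf_def power2_eq_square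
        algebra_simps)
    moreover have "1 / (4 * M * P) - 1 / (4 * M * N) = (N - P) / (4 * M * (P * N))"
      using PN M by (simp add: field_simps)
    ultimately show ?thesis by (simp add: P_def N_def)
  qed
  moreover have "2 * M * m s * (- 2 * wkill H c (r s) / (4 * M * h M (r s))) = - m s * wkill H c (r s) / h M (r s)"
    using M by simp
  ultimately have D: "((\<lambda>t. M * ln ((v t / u t)\<^sup>2)) has_real_derivative - m s * wkill H c (r s) / h M (r s)) (at s)" by simp
  have o: "open (J \<inter> u -` (- {0}))" "open (J \<inter> v -` (- {0}))"
    by (intro continuous_open_preimage[OF cont_J(1) J_open] continuous_open_preimage[OF cont_J(2) J_open]
        open_Compl closed_singleton)+
  show ?thesis
    by (rule has_field_derivative_transform_within_open[OF D open_Int[OF o]]) (use s tc in auto)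
qed

text \<open>As \<open>r' = m p\<close>, the condition on \<open>\<phi>\<close> says that
  \<open>\<phi>\<close> is \<open>dt / dr\<close>; the difference of the two sides then has zero
  derivative on a connected set.\<close>

lemma tc_integral:
  assumes C: "connected C" "open C" "C \<subseteq> J" and I: "connected I" "open I" "continuous_on I \<phi>" "bp \<in> I"
    and rI: "\<And>s. s \<in> C \<Longrightarrow> r s \<in> I" and uv: "\<And>s. s \<in> C \<Longrightarrow> u s \<noteq> 0 \<and> v s \<noteq> 0"
    and \<phi>: "\<And>s. s \<in> C \<Longrightarrow> \<phi> (r s) * p s = - wkill H c (r s) / h M (r s)"
  shows "\<exists>k. \<forall>s\<in>C. tc s = (LBINT y=bp..(r s). \<phi> y) + k"
proof -
  have D: "((\<lambda>s. tc s - (LBINT y=bp..(r s). \<phi> y)) has_real_derivative 0) (at s)" if s: "s \<in> C" for s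
  proof -
    have sJ: "s \<in> J" using s C by blast
    have "((\<lambda>s. LBINT y=bp..(r s). \<phi> y) has_real_derivative \<phi> (r s) * (m s * p s)) (at s)"
      by (rule DERIV_chain2[OF LBINT_deriv[OF I rI[OF s]] r_deriv[OF sJ]])
    from DERIV_diff[OF tc_deriv[OF sJ] this] uv[OF s]
    have "((\<lambda>s. tc s - (LBINT y=bp..(r s). \<phi> y)) has_real_derivative - m s * wkill H c (r s) / h M (r s) - \<phi> (r s)
        * (m s * p s)) (at s)" by blast
    moreover have "- m s * wkill H c (r s) / h M (r s) - \<phi> (r s) * (m s * p s) = m s * (- wkill H c (r s) / h M (r
        s) - \<phi> (r s) * p s)"
      by (simp add: algebra_simps)
    ultimately show ?thesis using \<phi>[OF s] by simp
  qed
  then have "continuous_on C (\<lambda>s. tc s - (LBINT y=bp..(r s). \<phi> y))"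
    by (intro continuous_at_imp_continuous_on ballI DERIV_isCont[OF D])
  then obtain k where "\<And>s. s \<in> C \<Longrightarrow> tc s - (LBINT y=bp..(r s). \<phi> y) = k"
    using DERIV_zero_connected_constant[OF C(1,2) finite.emptyI, of "\<lambda>s. tc s - (LBINT y=bp..(r s). \<phi> y)"] D by auto
  then show ?thesis by (intro exI[of _ k]) (auto simp: algebra_simps)
qed

lemma connected_part:
  assumes "\<And>s t x. s \<in> C \<Longrightarrow> t \<in> C \<Longrightarrow> s \<le> x \<Longrightarrow> x \<le> t \<Longrightarrow> x \<in> C" shows "connected (C :: real set)"
  unfolding connected_iff_interval using assms by blast

lemma open_uv: "open {s \<in> J. u s > 0 \<and> v s > 0}" "open {s \<in> J. u s < 0 \<and> v s > 0}"
proof -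
  have "{s \<in> J. u s > 0 \<and> v s > 0} = (J \<inter> u -` {0<..}) \<inter> (J \<inter> v -` {0<..})"
    "{s \<in> J. u s < 0 \<and> v s > 0} = (J \<inter> u -` {..<0}) \<inter> (J \<inter> v -` {0<..})" by auto
  then show "open {s \<in> J. u s > 0 \<and> v s > 0}" "open {s \<in> J. u s < 0 \<and> v s > 0}"
    by (simp_all add: open_Int continuous_open_preimage[OF cont_J(1) J_open] continuous_open_preimage[OF cont_J(2) J_open])
qed

lemma u_le: "s \<in> J \<Longrightarrow> t \<in> J \<Longrightarrow> s \<le> t \<Longrightarrow> u s \<le> u t" and v_le: "s \<in> J \<Longrightarrow> t \<in> J \<Longrightarrow> s \<le> t \<Longrightarrow> v s \<le> v t"
  using u_mono[of s t] v_mono[of s t] by (cases "s = t"; auto)+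

lemma connected_I: "connected {s \<in> J. u s > 0 \<and> v s > 0}"
proof (rule connected_part)
  fix s t x assume a: "s \<in> {s \<in> J. u s > 0 \<and> v s > 0}" "t \<in> {s \<in> J. u s > 0 \<and> v s > 0}" "s \<le> x" "x \<le> t"
  then have x: "x \<in> J" using J_seg by blast
  then show "x \<in> {s \<in> J. u s > 0 \<and> v s > 0}" using u_le[OF _ x a(3)] v_le[OF _ x a(3)] a by force
qed

lemma connected_II: "connected {s \<in> J. u s < 0 \<and> v s > 0}"
proof (rule connected_part)
  fix s t x assume a: "s \<in> {s \<in> J. u s < 0 \<and> v s > 0}" "t \<in> {s \<in> J. u s < 0 \<and> v s > 0}" "s \<le> x" "x \<le> t"
  then have x: "x \<in> J" using J_seg by blast
  then show "x \<in> {s \<in> J. u s < 0 \<and> v s > 0}" using u_le[OF x _ a(4)] v_le[OF _ x a(3)] a by force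
qed

lemma piece_I:
  assumes "bp > 2 * M"
  shows "\<exists>k. \<forall>s\<in>{s \<in> J. u s > 0 \<and> v s > 0}. tc s = f1 M H c bp k (r s)"
  unfolding f1_phi
proof (rule tc_integral[OF connected_I open_uv(1) _ connected_Ioi open_greaterThan continuous_on_phi1[OF M]])
  fix s assume "s \<in> {s \<in> J. u s > 0 \<and> v s > 0}"
  then have s: "s \<in> J" "u s > 0" "v s > 0" by auto
  then show r: "r s \<in> {2 * M<..}" using r_outside[OF s(1)] by simp
  show "u s \<noteq> 0 \<and> v s \<noteq> 0" using s by simp
  have ps: "p s = sqrt (Pf M H c (r s))" "p s > 0" using Pf_pos_imp_p[OF s(1)] p_pos_region_I[OF s] by auto
  then show "phi1 M H c (r s) * p s = - wkill H c (r s) / h M (r s)"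
    using phi1_eq[OF M, of "r s"] r by simp
qed (use assms in auto)

lemma piece_II:
  assumes C: "connected C" "open C" "C \<subseteq> J" and uv: "\<And>s. s \<in> C \<Longrightarrow> u s < 0 \<and> v s > 0 \<and> p s > 0"
    and I: "connected I" "open I" "\<And>x. x \<in> I \<Longrightarrow> 0 < x \<and> x < 2 * M \<and> kH M H x > c" "bp \<in> I" "\<And>s. s \<in> C \<Longrightarrow> r s \<in> I"
  shows "\<exists>k. \<forall>s\<in>C. tc s = f2_star M H c bp k (r s)"
  unfolding f2_star_phi
proof (rule tc_integral[OF C I(1,2) continuous_on_phi2[OF I(3)] I(4,5)])
  fix s assume s: "s \<in> C"
  show "u s \<noteq> 0 \<and> v s \<noteq> 0" using uv[OF s] by simp
  have "p s = sqrt (Pf M H c (r s))" "p s > 0" using Pf_pos_imp_p uv[OF s] s C(3) by auto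
  moreover have "phi2 M H c (r s) = wkill H c (r s) / (- h M (r s) * sqrt (Pf M H c (r s)))"
    using phi2_eq I(3)[OF I(5)[OF s]] by blast
  ultimately show "phi2 M H c (r s) * p s = - wkill H c (r s) / h M (r s)" by simp
qed

lemma isCont_tc: "s \<in> J \<Longrightarrow> u s \<noteq> 0 \<Longrightarrow> v s \<noteq> 0 \<Longrightarrow> isCont tc s"
  using tc_deriv DERIV_isCont by blast

text \<open>An interior base point gives the formula away from \<open>s0\<close>. Since
  \<open>t\<close> is continuous at the turning point, the integral has a limit there; this makes
  the improper integral finite and moves the base point to \<open>\<rho>\<close>, with the constant
  \<open>tc s0\<close> that both arms share.\<close>

lemma piece_in:
  assumes s0: "s0 \<in> J" "r s0 = \<rho>" and uv: "\<And>s. s \<in> J \<Longrightarrow> s \<le> s0 \<Longrightarrow> u s < 0 \<and> v s > 0" and p: "\<And>s. s \<in> J \<Longrightarrow> s < s0 \<Longrightarrow> p s > 0"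
    and rg: "r ` {s \<in> J. s < s0} = {0<..<\<rho>}" and \<rho>: "0 < \<rho>" "\<rho> < 2 * M" and gt: "\<And>x. 0 < x \<Longrightarrow> x < \<rho> \<Longrightarrow> kH M H x > c"
  shows "\<And>s. s \<in> J \<Longrightarrow> s \<le> s0 \<Longrightarrow> tc s = f2_star M H c \<rho> (tc s0) (r s)"
    "\<And>x. 0 < x \<Longrightarrow> x < \<rho> \<Longrightarrow> interval_lebesgue_integrable lborel (ereal x) (ereal \<rho>) (phi2 M H c)"
proof -
  define C where "C = {s \<in> J. s < s0}"
  define bp where "bp = \<rho> / 2"
  have bp: "0 < bp" "bp < \<rho>" using \<rho> by (auto simp: bp_def)
  have C: "connected C" "open C" "C \<subseteq> J"
  proof -
    show "connected C"
    proof (rule connected_part)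
      fix s t x assume a: "s \<in> C" "t \<in> C" "s \<le> x" "x \<le> t"
      then have "x \<in> J" using J_seg[of s t x] by (simp add: C_def)
      then show "x \<in> C" using a by (simp add: C_def)
    qed
    have "C = J \<inter> {..<s0}" by (auto simp: C_def)
    then show "open C" using open_Int[OF J_open open_lessThan] by simp
  qed (auto simp: C_def)
  have rC: "r s \<in> {0<..<\<rho>}" if "s \<in> C" for s unfolding rg[symmetric] using that by (simp add: C_def)
  have uvC: "u s < 0 \<and> v s > 0 \<and> p s > 0" if "s \<in> C" for s using uv[of s] p[of s] that by (simp add: C_def)
  have IC: "0 < x \<and> x < 2 * M \<and> kH M H x > c" if "x \<in> {0<..<\<rho>}" for x using gt[of x] \<rho> that by simp
  have bI: "bp \<in> {0<..<\<rho>}" using bp by simp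
  have "\<exists>k. \<forall>s\<in>C. tc s = f2_star M H c bp k (r s)"
    by (rule piece_II[OF C _ connected_Ioo open_greaterThanLessThan _ bI]) (erule uvC, erule IC, erule rC)
  then obtain k where k: "\<And>s. s \<in> C \<Longrightarrow> tc s = (LBINT y=bp..(r s). phi2 M H c y) + k" unfolding f2_star_phi by blast
  define L where "L = tc s0 - k"
  have lim: "((\<lambda>x::real. LBINT y=bp..x. phi2 M H c y) \<longlongrightarrow> L) (at_left \<rho>)"
  proof (rule tendstoI)
    fix e :: real assume e: "e > 0"
    have "isCont tc s0" using isCont_tc[OF s0(1)] uv[OF s0(1)] by simp
    then obtain d where d: "d > 0" "\<And>s. dist s s0 < d \<Longrightarrow> dist (tc s) (tc s0) < e"
      using e by (auto simp: continuous_at_eps_delta dist_commute)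
    obtain e' where e': "e' > 0" "\<And>t. \<bar>t - s0\<bar> < e' \<Longrightarrow> t \<in> J" using near_zero[OF s0(1)] by blast
    define s2 where "s2 = s0 - min d e' / 2"
    have s2: "s2 < s0" "s2 \<in> J" "s0 - s2 < d" using d e' by (auto simp: s2_def min_def)
    have s2C: "s2 \<in> C" using s2 by (simp add: C_def)
    \<comment> \<open>\<open>r\<close> increases up to \<open>s0\<close>, so radii close to
      \<open>\<rho>\<close> come from parameters close to \<open>s0\<close>.\<close>
    have "dist (LBINT y=bp..x. phi2 M H c y) L < e" if x: "r s2 < x" "x < \<rho>" for x
    proof -
      have "x \<in> r ` {s \<in> J. s < s0}" unfolding rg using x rC[OF s2C] by auto
      then obtain s where s: "s \<in> C" "x = r s" by (auto simp: C_def)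
      have "s2 < s"
      proof (rule ccontr)
        assume "\<not> s2 < s"
        then have ss: "s \<le> s2" by simp
        have "r s \<le> r s2" using ss
        proof (rule DERIV_nonneg_imp_nondecreasing)
          fix t assume "s \<le> t" "t \<le> s2"
          then have t: "t \<in> J" "t < s0" using J_seg[of s s2 t] s(1) s2 by (auto simp: C_def)
          then show "\<exists>y. (r has_real_derivative y) (at t) \<and> 0 \<le> y"
            using r_deriv[OF t(1)] m_pos[OF t(1)] p[OF t] by (intro exI[of _ "m t * p t"]) auto
        qed
        then show False using x s by simp
      qed
      then have "dist s s0 < d" using s s2 by (auto simp: C_def dist_real_def)
      then show ?thesis using d(2)[of s] k[OF s(1)] s(2) by (simp add: dist_real_def L_def)
    qed
    moreover have "r s2 < \<rho>" using rC[OF s2C] by simp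
    ultimately show "eventually (\<lambda>x. dist (LBINT y=bp..x. phi2 M H c y) L < e) (at_left \<rho>)"
      unfolding eventually_at_left[OF \<open>r s2 < \<rho>\<close>] by (intro exI[of _ "r s2"]) auto
  qed
  have cont: "continuous_on {0<..<\<rho>} (phi2 M H c)" by (rule continuous_on_phi2) (use gt \<rho> in auto)
  note E = integral_left_endpoint[OF cont phi2_nonneg bp lim]
  show "interval_lebesgue_integrable lborel (ereal x) (ereal \<rho>) (phi2 M H c)" if "0 < x" "x < \<rho>" for x
    by (rule E(1)) (use gt \<rho> that in auto)
  show "tc s = f2_star M H c \<rho> (tc s0) (r s)" if s: "s \<in> J" "s \<le> s0" for s
  proof (cases "s = s0")
    case True then show ?thesis by (simp add: f2_star_phi s0)
  next
    case False
    then have sC: "s \<in> C" using s by (simp add: C_def)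
    have "(LBINT y=\<rho>..(r s). phi2 M H c y) = (LBINT y=bp..(r s). phi2 M H c y) - L"
      by (rule E(2)) (use gt \<rho> rC[OF sC] in auto)
    then show ?thesis using k[OF sC] by (simp add: f2_star_phi L_def)
  qed
qed

text \<open>As \<open>piece_in\<close>, for an arm that leaves region II through the horizon; the
  formula is claimed up to the crossing, hence the restriction to \<open>u s < 0\<close>.\<close>

lemma piece_out:
  assumes s0: "s0 \<in> J" "r s0 = \<rho>" and v0: "u s0 < 0" "v s0 > 0" and p: "\<And>s. s \<in> J \<Longrightarrow> s0 < s \<Longrightarrow> p s > 0"
    and rg: "r ` {s \<in> J. s0 < s} = {\<rho><..}" and \<rho>: "0 < \<rho>" "\<rho> < 2 * M" and gt: "\<And>x. \<rho> < x \<Longrightarrow> x < 2 * M \<Longrightarrow> kH M H x > c"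
  shows "\<And>s. s \<in> J \<Longrightarrow> s0 \<le> s \<Longrightarrow> u s < 0 \<Longrightarrow> tc s = f2_star M H c \<rho> (tc s0) (r s)"
    "\<And>x. \<rho> < x \<Longrightarrow> x < 2 * M \<Longrightarrow> interval_lebesgue_integrable lborel (ereal x) (ereal \<rho>) (phi2 M H c)"
proof -
  define C where "C = {s \<in> J. s0 < s \<and> u s < 0}"
  define bp where "bp = (\<rho> + 2 * M) / 2"
  have bp: "\<rho> < bp" "bp < 2 * M" using \<rho> by (auto simp: bp_def)
  have vC: "v s > 0" if "s \<in> J" "s0 \<le> s" for s using v_le[OF s0(1) that] v0 by simp
  have C: "connected C" "open C" "C \<subseteq> J"
  proof -
    show "connected C"
    proof (rule connected_part)
      fix s t x assume a: "s \<in> C" "t \<in> C" "s \<le> x" "x \<le> t"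
      then have x: "x \<in> J" using J_seg by (auto simp: C_def)
      then show "x \<in> C" using u_le[OF x _ a(4)] a by (auto simp: C_def)
    qed
    have "C = (J \<inter> u -` {..<0}) \<inter> {s0<..}" by (auto simp: C_def)
    then show "open C"
      using open_Int[OF continuous_open_preimage[OF cont_J(1) J_open open_lessThan] open_greaterThan] by simp
  qed (auto simp: C_def)
  have rin: "r s \<in> {\<rho><..}" if "s \<in> J" "s0 < s" for s unfolding rg[symmetric] using that by simp
  have rC: "r s \<in> {\<rho><..<2 * M}" if "s \<in> C" for s
    using rin[of s] r_inside[of s] vC[of s] that by (auto simp: C_def mult_neg_pos)
  have uvC: "u s < 0 \<and> v s > 0 \<and> p s > 0" if "s \<in> C" for s using vC[of s] p[of s] that by (simp add: C_def)
  have IC: "0 < x \<and> x < 2 * M \<and> kH M H x > c" if "x \<in> {\<rho><..<2 * M}" for x using gt[of x] \<rho> that by simp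
  have bI: "bp \<in> {\<rho><..<2 * M}" using bp by simp
  have "\<exists>k. \<forall>s\<in>C. tc s = f2_star M H c bp k (r s)"
    by (rule piece_II[OF C _ connected_Ioo open_greaterThanLessThan _ bI]) (erule uvC, erule IC, erule rC)
  then obtain k where k: "\<And>s. s \<in> C \<Longrightarrow> tc s = (LBINT y=bp..(r s). phi2 M H c y) + k" unfolding f2_star_phi by blast
  define L where "L = tc s0 - k"
  have lim: "((\<lambda>x::real. LBINT y=bp..x. phi2 M H c y) \<longlongrightarrow> L) (at_right \<rho>)"
  proof (rule tendstoI)
    fix e :: real assume e: "e > 0"
    have "isCont tc s0" using isCont_tc[OF s0(1)] v0 by simp
    then obtain d where d: "d > 0" "\<And>s. dist s s0 < d \<Longrightarrow> dist (tc s) (tc s0) < e"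
      using e by (auto simp: continuous_at_eps_delta dist_commute)
    have "open (J \<inter> u -` {..<0})" by (rule continuous_open_preimage[OF cont_J(1) J_open open_lessThan])
    moreover have "s0 \<in> J \<inter> u -` {..<0}" using s0 v0 by simp
    ultimately obtain e' where e': "e' > 0" "ball s0 e' \<subseteq> J \<inter> u -` {..<0}" by (rule openE)
    define s2 where "s2 = s0 + min d e' / 2"
    have "s2 \<in> ball s0 e'" using d e' by (auto simp: s2_def min_def dist_real_def)
    then have "s2 \<in> J \<inter> u -` {..<0}" using e'(2) by blast
    then have s2: "s0 < s2" "s2 \<in> J" "s2 - s0 < d" "u s2 < 0" using d e' by (auto simp: s2_def min_def)
    have s2C: "s2 \<in> C" using s2 by (simp add: C_def)
    have "dist (LBINT y=bp..x. phi2 M H c y) L < e" if x: "\<rho> < x" "x < r s2" for x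
    proof -
      have "x \<in> r ` {s \<in> J. s0 < s}" unfolding rg using x by auto
      then obtain s where s: "s \<in> J" "s0 < s" "x = r s" by auto
      have ss: "s < s2"
      proof (rule ccontr)
        assume "\<not> s < s2"
        then have ss: "s2 \<le> s" by simp
        have "r s2 \<le> r s" using ss
        proof (rule DERIV_nonneg_imp_nondecreasing)
          fix t assume "s2 \<le> t" "t \<le> s"
          then have t: "t \<in> J" "s0 < t" using J_seg[of s2 s t] s(1) s2 by auto
          then show "\<exists>y. (r has_real_derivative y) (at t) \<and> 0 \<le> y"
            using r_deriv[OF t(1)] m_pos[OF t(1)] p[OF t] by (intro exI[of _ "m t * p t"]) auto
        qed
        then show False using x s by simp
      qed
      have sC: "s \<in> C" using s u_mono[OF s(1) s2(2) ss] s2(4) by (simp add: C_def)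
      have "dist s s0 < d" using s s2 ss by (auto simp: dist_real_def)
      then show ?thesis using d(2)[of s] k[OF sC] s(3) by (simp add: dist_real_def L_def)
    qed
    moreover have "\<rho> < r s2" using rC[OF s2C] by simp
    ultimately show "eventually (\<lambda>x. dist (LBINT y=bp..x. phi2 M H c y) L < e) (at_right \<rho>)"
      unfolding eventually_at_right[OF \<open>\<rho> < r s2\<close>] by (intro exI[of _ "r s2"]) auto
  qed
  have cont: "continuous_on {\<rho><..<2 * M} (phi2 M H c)" by (rule continuous_on_phi2) (use gt \<rho> in auto)
  note E = integral_right_endpoint[OF cont phi2_nonneg bp lim]
  show "interval_lebesgue_integrable lborel (ereal x) (ereal \<rho>) (phi2 M H c)" if "\<rho> < x" "x < 2 * M" for x
    by (rule E(1)) (use gt \<rho> that in auto)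
  show "tc s = f2_star M H c \<rho> (tc s0) (r s)" if s: "s \<in> J" "s0 \<le> s" "u s < 0" for s
  proof (cases "s = s0")
    case True then show ?thesis by (simp add: f2_star_phi s0)
  next
    case False
    then have sC: "s \<in> C" using s by (simp add: C_def)
    have "(LBINT y=\<rho>..(r s). phi2 M H c y) = (LBINT y=bp..(r s). phi2 M H c y) - L"
      by (rule E(2)) (use gt \<rho> rC[OF sC] in auto)
    then show ?thesis using k[OF sC] by (simp add: f2_star_phi L_def)
  qed
qed

text \<open>Reflection inverts the ratio \<open>v / u\<close>, as time reversal does, and so negates
  the time; this is how starred and double-starred branches are exchanged.\<close>

lemma tc_mirror:
  assumes "u (- s) \<noteq> 0" "v (- s) \<noteq> 0"
  shows "profile.tc M (\<lambda>s. - v (- s)) (\<lambda>s. - u (- s)) s = - tc (- s)"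
proof -
  interpret N: profile M H c "uminus ` J" "\<lambda>s. - v (- s)" "\<lambda>s. - u (- s)" "\<lambda>s. b (- s)" "\<lambda>s. a (- s)" "\<lambda>s. m (- s)"
      "\<lambda>s. r (- s)" "\<lambda>s. - p (- s)"
    by (rule mirror)
  show ?thesis using assms by (simp add: N.tc_def tc_def ln_div algebra_simps)
qed

lemma tc_swap:
  assumes "u s \<noteq> 0" "v s \<noteq> 0"
  shows "profile.tc M v u s = - tc s"
proof -
  interpret N: profile M "- H" "- c" J v u b a m r p by (rule swap)
  show ?thesis using assms by (simp add: N.tc_def tc_def ln_div algebra_simps)
qed

lemma region_I'_range:
  assumes s1: "s1 \<in> J" "u s1 < 0" "v s1 < 0"
  shows "r ` {s \<in> J. u s < 0 \<and> v s < 0} = {2 * M<..}"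
proof -
  interpret N: profile M H c "uminus ` J" "\<lambda>s. - v (- s)" "\<lambda>s. - u (- s)" "\<lambda>s. b (- s)" "\<lambda>s. a (- s)" "\<lambda>s. m (- s)"
      "\<lambda>s. r (- s)" "\<lambda>s. - p (- s)"
    by (rule mirror)
  have "(\<lambda>s. r (- s)) ` {s \<in> uminus ` J. - v (- s) > 0 \<and> - u (- s) > 0} = {2 * M<..}"
    by (rule N.region_I_range[of "- s1"]) (use s1 in auto)
  moreover have "(\<lambda>s. r (- s)) ` {s \<in> uminus ` J. - v (- s) > 0 \<and> - u (- s) > 0} = r ` {s \<in> J. u s < 0 \<and> v s < 0}"
    by (force simp: image_iff)
  ultimately show ?thesis by simp
qed

text \<open>Reflection exchanges regions I and I' and negates the time, in accordance with
  \<open>l3 = - l1\<close>.\<close>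

lemma piece_I':
  assumes "bp > 2 * M"
  shows "\<exists>k. \<forall>s\<in>{s \<in> J. u s < 0 \<and> v s < 0}. tc s = f3 M H c bp k (r s)"
proof -
  interpret N: profile M H c "uminus ` J" "\<lambda>s. - v (- s)" "\<lambda>s. - u (- s)" "\<lambda>s. b (- s)" "\<lambda>s. a (- s)" "\<lambda>s. m (- s)"
      "\<lambda>s. r (- s)" "\<lambda>s. - p (- s)"
    by (rule mirror)
  obtain k where k: "\<And>s. s \<in> uminus ` J \<Longrightarrow> - v (- s) > 0 \<Longrightarrow> - u (- s) > 0 \<Longrightarrow> N.tc s = f1 M H c bp k (r (- s))"
    using N.piece_I[OF assms] by auto
  have "tc s = f3 M H c bp (- k) (r s)" if "s \<in> {s \<in> J. u s < 0 \<and> v s < 0}" for s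
    using k[of "- s"] tc_mirror[of "- s"] that by (simp add: f3_f1)
  then show ?thesis by blast
qed

lemma piece_II_neg:
  assumes C: "connected C" "open C" "C \<subseteq> J" and uv: "\<And>s. s \<in> C \<Longrightarrow> u s < 0 \<and> v s > 0 \<and> p s < 0"
    and I: "connected I" "open I" "\<And>x. x \<in> I \<Longrightarrow> 0 < x \<and> x < 2 * M \<and> kH M H x > c" "bp \<in> I" "\<And>s. s \<in> C \<Longrightarrow> r s \<in> I"
  shows "\<exists>k. \<forall>s\<in>C. tc s = f2_dstar M H c bp k (r s)"
proof -
  interpret N: profile M H c "uminus ` J" "\<lambda>s. - v (- s)" "\<lambda>s. - u (- s)" "\<lambda>s. b (- s)" "\<lambda>s. a (- s)" "\<lambda>s. m (- s)"
      "\<lambda>s. r (- s)" "\<lambda>s. - p (- s)"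
    by (rule mirror)
  have "connected (uminus ` C)" "open (uminus ` C)" "uminus ` C \<subseteq> uminus ` J"
    using C by (auto intro!: connected_continuous_image continuous_intros simp: open_negations)
  then have "\<exists>k. \<forall>s\<in>uminus ` C. N.tc s = f2_star M H c bp k (r (- s))"
    by (rule N.piece_II[OF _ _ _ _ I(1-4)]) (use uv I(5) in auto)
  then obtain k where k: "\<And>s. s \<in> uminus ` C \<Longrightarrow> N.tc s = f2_star M H c bp k (r (- s))" by blast
  have "tc s = f2_dstar M H c bp (- k) (r s)" if "s \<in> C" for s
    using k[of "- s"] tc_mirror[of "- s"] that uv[OF that] by (simp add: f2_dstar_star)
  then show ?thesis by blast
qed

lemma piece_in_right:
  assumes s0: "s0 \<in> J" "r s0 = \<rho>" and uv: "\<And>s. s \<in> J \<Longrightarrow> s0 \<le> s \<Longrightarrow> u s < 0 \<and> v s > 0" and p: "\<And>s. s \<in> J \<Longrightarrow> s0 < s \<Longrightarrow> p s < 0"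
    and rg: "r ` {s \<in> J. s0 < s} = {0<..<\<rho>}" and \<rho>: "0 < \<rho>" "\<rho> < 2 * M" and gt: "\<And>x. 0 < x \<Longrightarrow> x < \<rho> \<Longrightarrow> kH M H x > c"
    and s: "s \<in> J" "s0 \<le> s"
  shows "tc s = f2_dstar M H c \<rho> (tc s0) (r s)"
proof -
  interpret N: profile M H c "uminus ` J" "\<lambda>s. - v (- s)" "\<lambda>s. - u (- s)" "\<lambda>s. b (- s)" "\<lambda>s. a (- s)" "\<lambda>s. m (- s)"
      "\<lambda>s. r (- s)" "\<lambda>s. - p (- s)"
    by (rule mirror)
  have rg': "(\<lambda>s. r (- s)) ` {s \<in> uminus ` J. s < - s0} = {0<..<\<rho>}" unfolding rg[symmetric] by (force simp: image_iff)
  have "N.tc (- s) = f2_star M H c \<rho> (N.tc (- s0)) (r (- (- s)))"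
    by (rule N.piece_in(1)[OF _ _ _ _ rg' \<rho> gt]) (use s0 uv p s in auto)
  then show ?thesis using tc_mirror[of "- s"] tc_mirror[of "- s0"] uv[OF s] uv[OF s0(1)] by (simp add: f2_dstar_star)
qed

lemma piece_out_left:
  assumes s0: "s0 \<in> J" "r s0 = \<rho>" and v0: "u s0 < 0" "v s0 > 0" and p: "\<And>s. s \<in> J \<Longrightarrow> s < s0 \<Longrightarrow> p s < 0"
    and rg: "r ` {s \<in> J. s < s0} = {\<rho><..}" and \<rho>: "0 < \<rho>" "\<rho> < 2 * M" and gt: "\<And>x. \<rho> < x \<Longrightarrow> x < 2 * M \<Longrightarrow> kH M H x > c"
    and s: "s \<in> J" "s \<le> s0" "v s > 0"
  shows "tc s = f2_dstar M H c \<rho> (tc s0) (r s)"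
proof -
  interpret N: profile M H c "uminus ` J" "\<lambda>s. - v (- s)" "\<lambda>s. - u (- s)" "\<lambda>s. b (- s)" "\<lambda>s. a (- s)" "\<lambda>s. m (- s)"
      "\<lambda>s. r (- s)" "\<lambda>s. - p (- s)"
    by (rule mirror)
  have rg': "(\<lambda>s. r (- s)) ` {s \<in> uminus ` J. - s0 < s} = {\<rho><..}" unfolding rg[symmetric] by (force simp: image_iff)
  have "N.tc (- s) = f2_star M H c \<rho> (N.tc (- s0)) (r (- (- s)))"
    by (rule N.piece_out(1)[OF _ _ _ _ _ rg' \<rho> gt]) (use s0 v0 p s in auto)
  moreover have "u s < 0" using u_le[OF s(1) s0(1) s(2)] v0 by simp
  ultimately show ?thesis using tc_mirror[of "- s"] tc_mirror[of "- s0"] v0 s(3) by (simp add: f2_dstar_star)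
qed

end

text \<open>The endpoint belongs to the domain because its integral is finite, and directly below it
  \<open>kH < c\<close>, so no connected part of the domain reaches further.\<close>

lemma component_right:
  assumes M: "M > 0" and \<rho>: "r_min M H < \<rho>" "\<rho> < 2 * M" "kH M H \<rho> = c"
    and int: "\<And>x. \<rho> < x \<Longrightarrow> x < 2 * M \<Longrightarrow> interval_lebesgue_integrable lborel (ereal x) (ereal \<rho>) (phi2 M H c)"
  shows "{\<rho>..<2 * M} \<in> components (f2_dom M H c)"
proof -
  have \<rho>0: "0 < \<rho>" using kH_shape(1)[OF M, of H] \<rho> by simp
  have gt: "kH M H x > c" if "\<rho> < x" "x < 2 * M" for x
    using kH_shape(7)[OF M less_imp_le[OF \<rho>(1)] that] \<rho>(3) by simp
  have lt: "kH M H x < c" if "r_min M H < x" "x < \<rho>" for x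
    using kH_shape(7)[OF M less_imp_le[OF that(1)] that(2) \<rho>(2)] \<rho>(3) by simp
  define b where "b = (\<rho> + 2 * M) / 2"
  have b: "\<rho> < b" "b < 2 * M" using \<rho> by (auto simp: b_def)
  have "\<rho> \<in> f2_dom M H c"
  proof -
    have "\<forall>x\<in>open_segment b \<rho>. kH M H x > c"
      using gt b by (auto simp: open_segment_eq_real_ivl)
    then show ?thesis using b \<rho> \<rho>0 int[OF b] unfolding f2_dom_def phi2_def[abs_def]
      by (intro CollectI conjI disjI2 bexI[of _ b]) auto
  qed
  moreover have "x \<in> f2_dom M H c" if "\<rho> < x" "x < 2 * M" for x
    using gt[OF that] \<rho>0 that by (simp add: f2_dom_def)
  ultimately have sub: "{\<rho>..<2 * M} \<subseteq> f2_dom M H c"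
    by (metis atLeastLessThan_iff order.order_iff_strict subsetI)
  show ?thesis
    unfolding in_components_maximal
  proof (intro conjI allI impI)
    fix D assume D: "D \<noteq> {} \<and> {\<rho>..<2 * M} \<subseteq> D \<and> D \<subseteq> f2_dom M H c \<and> connected D"
    have "\<rho> \<le> y" if "y \<in> D" for y
    proof (rule ccontr)
      assume y: "\<not> \<rho> \<le> y"
      \<comment> \<open>A point strictly between \<open>r_min\<close> and \<open>\<rho>\<close>,
        where \<open>kH\<close> is below \<open>c\<close>, that still separates \<open>y\<close>
        from \<open>\<rho>\<close>.\<close>
      define x where "x = (max y (r_min M H) + \<rho>) / 2"
      have x: "y \<le> x" "x \<le> \<rho>" "r_min M H < x" "x < \<rho>" using y \<rho> by (auto simp: x_def max_def)
      have "\<rho> \<in> D" using D \<rho> by (simp add: subset_iff)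
      then have "x \<in> D" using connectedD_interval[of D y \<rho> x] D that x(1,2) by simp
      then have "x \<in> f2_dom M H c" using D by (meson subsetD)
      then show False using lt[OF x(3,4)] by (auto simp: f2_dom_def)
    qed
    moreover have "y < 2 * M" if "y \<in> D" for y using that D by (auto simp: f2_dom_def)
    ultimately show "D = {\<rho>..<2 * M}" using D by auto
  qed (use sub \<rho> in auto)
qed

lemma component_left:
  assumes M: "M > 0" and \<rho>: "0 < \<rho>" "\<rho> < r_min M H" "kH M H \<rho> = c"
    and int: "\<And>x. 0 < x \<Longrightarrow> x < \<rho> \<Longrightarrow> interval_lebesgue_integrable lborel (ereal x) (ereal \<rho>) (phi2 M H c)"
  shows "{0<..\<rho>} \<in> components (f2_dom M H c)"
proof -
  have \<rho>0: "\<rho> < 2 * M" using kH_shape(2)[OF M, of H] \<rho> by simp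
  have gt: "kH M H x > c" if "0 < x" "x < \<rho>" for x
    using kH_shape(6)[OF M that less_imp_le[OF \<rho>(2)]] \<rho>(3) by simp
  have lt: "kH M H x < c" if "\<rho> < x" "x < r_min M H" for x
    using kH_shape(6)[OF M \<rho>(1) that(1) less_imp_le[OF that(2)]] \<rho>(3) by simp
  define b where "b = \<rho> / 2"
  have b: "0 < b" "b < \<rho>" using \<rho> by (auto simp: b_def)
  have "\<rho> \<in> f2_dom M H c"
  proof -
    have "\<forall>x\<in>open_segment b \<rho>. kH M H x > c"
      using gt b by (auto simp: open_segment_eq_real_ivl)
    then show ?thesis using b \<rho> \<rho>0 int[OF b] unfolding f2_dom_def phi2_def[abs_def]
      by (intro CollectI conjI disjI2 bexI[of _ b]) auto
  qed
  moreover have "x \<in> f2_dom M H c" if "0 < x" "x < \<rho>" for x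
    using gt[OF that] \<rho>0 that by (simp add: f2_dom_def)
  ultimately have sub: "{0<..\<rho>} \<subseteq> f2_dom M H c"
    by (metis greaterThanAtMost_iff order.order_iff_strict subsetI)
  show ?thesis
    unfolding in_components_maximal
  proof (intro conjI allI impI)
    fix D assume D: "D \<noteq> {} \<and> {0<..\<rho>} \<subseteq> D \<and> D \<subseteq> f2_dom M H c \<and> connected D"
    have "y \<le> \<rho>" if "y \<in> D" for y
    proof (rule ccontr)
      assume y: "\<not> y \<le> \<rho>"
      define x where "x = (min y (r_min M H) + \<rho>) / 2"
      have x: "x \<le> y" "\<rho> \<le> x" "x < r_min M H" "\<rho> < x" using y \<rho> by (auto simp: x_def min_def)
      have "\<rho> \<in> D" using D \<rho> by (simp add: subset_iff)
      then have "x \<in> D" using connectedD_interval[of D \<rho> y x] D that x(1,2) by simp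
      then have "x \<in> f2_dom M H c" using D by (meson subsetD)
      then show False using lt[OF x(4,3)] by (auto simp: f2_dom_def)
    qed
    moreover have "0 < y" if "y \<in> D" for y using that D by (auto simp: f2_dom_def)
    ultimately show "D = {0<..\<rho>}" using D by auto
  qed (use sub \<rho> in auto)
qed

section \<open>Types of motion together with their time functions\<close>

context profile
begin

abbreviation "JI \<equiv> {s \<in> J. u s > 0 \<and> v s > 0}"
abbreviation "JII \<equiv> {s \<in> J. u s < 0 \<and> v s > 0}"
abbreviation "JI' \<equiv> {s \<in> J. u s < 0 \<and> v s < 0}"

text \<open>Only what the hypersurface shows is kept: ranges over the part in region II, horizon
  crossings, nonempty outer parts and the time formula. All is phrased through \<open>u\<close> and
  \<open>v\<close>, so the time-reversed instance reads as a statement on region II'.\<close>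

definition "res_right \<longleftrightarrow> (\<exists>\<rho> bp k. ((c < c_min M H \<and> \<rho> = 0) \<or> (c = c_min M H \<and> \<rho> = r_min M H)) \<and> bp \<in> {\<rho><..<2 * M} \<and>
   (\<forall>s\<in>J. v s > 0) \<and> r ` JII = {\<rho><..<2 * M} \<and> (\<exists>z\<in>J. u z = 0) \<and> JI \<noteq> {} \<and> (\<forall>s\<in>JII. tc s = f2_star M H c bp k (r s)))"

definition "res_left \<longleftrightarrow> (\<exists>\<rho> bp k. ((c < c_min M H \<and> \<rho> = 0) \<or> (c = c_min M H \<and> \<rho> = r_min M H)) \<and> bp \<in> {\<rho><..<2 * M} \<and>
   (\<forall>s\<in>J. u s < 0) \<and> r ` JII = {\<rho><..<2 * M} \<and> (\<exists>z\<in>J. v z = 0) \<and> JI' \<noteq> {} \<and> (\<forall>s\<in>JII. tc s = f2_dstar M H c bp k (r s)))"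

definition "res_inner \<longleftrightarrow> c = c_min M H \<and> (\<exists>bp k. bp \<in> {0<..<r_min M H} \<and> JII = J \<and> r ` J = {0<..<r_min M H} \<and>
   ((\<forall>s\<in>J. tc s = f2_star M H c bp k (r s)) \<or> (\<forall>s\<in>J. tc s = f2_dstar M H c bp k (r s))))"

text \<open>\<open>A\<close> and \<open>B\<close> are the two arms; both contain the turning sphere,
  which is why both ranges include \<open>\<rho>\<close>.\<close>

definition "res_out \<longleftrightarrow> c_min M H < c \<and> c < - 8 * M ^ 3 * H \<and> (\<exists>\<rho> k A B. {\<rho>..<2 * M} \<in> components (f2_dom M H c) \<and>
    kH M H \<rho> = c \<and>
   JII = A \<union> B \<and> r ` A = {\<rho>..<2 * M} \<and> r ` B = {\<rho>..<2 * M} \<and> (\<forall>s\<in>A. tc s = f2_star M H c \<rho> k (r s)) \<and>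
       (\<forall>s\<in>B. tc s = f2_dstar M H c \<rho> k (r s)) \<and>
   (\<exists>z\<in>J. u z = 0 \<and> v z > 0) \<and> (\<exists>z\<in>J. v z = 0 \<and> u z < 0) \<and> JI \<noteq> {} \<and> JI' \<noteq> {} \<and> (\<forall>s\<in>J. u s < 0 \<or> v s > 0))"

definition "res_in \<longleftrightarrow> c_min M H < c \<and> c < 0 \<and> (\<exists>\<rho> k A B. {0<..\<rho>} \<in> components (f2_dom M H c) \<and> kH M H \<rho> = c \<and>
   JII = J \<and> J = A \<union> B \<and> r ` A = {0<..\<rho>} \<and> r ` B = {0<..\<rho>} \<and> (\<forall>s\<in>A. tc s = f2_star M H c \<rho> k (r s)) \<and>
       (\<forall>s\<in>B. tc s = f2_dstar M H c \<rho> k (r s)))"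

lemma JII_v: "(\<And>s. s \<in> J \<Longrightarrow> v s > 0) \<Longrightarrow> s \<in> J \<Longrightarrow> s \<in> JII \<longleftrightarrow> r s < 2 * M"
  and JII_u: "(\<And>s. s \<in> J \<Longrightarrow> u s < 0) \<Longrightarrow> s \<in> J \<Longrightarrow> s \<in> JII \<longleftrightarrow> r s < 2 * M"
  using r_inside[of s] by (auto simp: mult_less_0_iff dest: less_asym)

lemma case_run_right:
  assumes "case_run \<rho>" and pv: "\<And>s. s \<in> J \<Longrightarrow> p s > 0 \<and> v s > 0"
  shows res_right
proof -
  have c: "(c < c_min M H \<and> \<rho> = 0) \<or> (c = c_min M H \<and> \<rho> = r_min M H)" and rJ: "r ` J = {\<rho><..}"
    and gt: "\<And>x. \<rho> < x \<Longrightarrow> x < 2 * M \<Longrightarrow> kH M H x > c" using assms(1) unfolding case_run_def by auto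
  have \<rho>: "0 \<le> \<rho>" "\<rho> < 2 * M" using c M kH_shape(1,2)[OF M, of H] by auto
  define bp where "bp = (\<rho> + 2 * M) / 2"
  have bI: "bp \<in> {\<rho><..<2 * M}" using \<rho> by (auto simp: bp_def)
  have JII: "s \<in> JII \<longleftrightarrow> s \<in> J \<and> r s < 2 * M" for s using JII_v[of s] pv by auto
  have rg: "r ` JII = {\<rho><..<2 * M}"
  proof (intro equalityI subsetI)
    fix x assume "x \<in> r ` JII"
    then obtain s where s: "s \<in> JII" "x = r s" by blast
    then have "r s \<in> r ` J" by simp
    then show "x \<in> {\<rho><..<2 * M}" unfolding rJ using s JII[of s] by simp
  next
    fix x assume x: "x \<in> {\<rho><..<2 * M}"
    then have "x \<in> r ` J" unfolding rJ by simp
    then obtain s where "s \<in> J" "x = r s" by blast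
    then show "x \<in> r ` JII" using JII[of s] x by (intro image_eqI[of _ _ s]) auto
  qed
  \<comment> \<open>\<open>\<rho> < 2 M\<close>, so the horizon is crossed; \<open>3 M\<close> is
    just some radius outside it.\<close>
  have "2 * M \<in> r ` J" "3 * M \<in> r ` J" unfolding rJ using \<rho> M by auto
  then obtain z y where z: "z \<in> J" "r z = 2 * M" and y: "y \<in> J" "r y = 3 * M" by (metis imageE)
  have "u z = 0" using r_horizon[OF z(1)] z(2) pv[OF z(1)] by simp
  moreover have "u y > 0" using r_outside[OF y(1)] y(2) pv[OF y(1)] M by (simp add: zero_less_mult_iff)
  moreover have "\<exists>k. \<forall>s\<in>JII. tc s = f2_star M H c bp k (r s)"
  proof (rule piece_II[OF connected_II open_uv(2) _ _ connected_Ioo open_greaterThanLessThan _ bI])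
    show "u s < 0 \<and> v s > 0 \<and> p s > 0" if "s \<in> JII" for s using that pv by simp
    show "0 < x \<and> x < 2 * M \<and> kH M H x > c" if "x \<in> {\<rho><..<2 * M}" for x using that gt[of x] \<rho> by simp
    show "r s \<in> {\<rho><..<2 * M}" if "s \<in> JII" for s unfolding rg[symmetric] using that by (rule imageI)
  qed auto
  moreover have "y \<in> JI" if "u y > 0" using y pv that by simp
  ultimately show ?thesis unfolding res_right_def using c bI rg z pv by blast
qed

lemma case_run_left:
  assumes "case_run \<rho>" and pv: "\<And>s. s \<in> J \<Longrightarrow> p s < 0 \<and> u s < 0"
  shows res_left
proof -
  have c: "(c < c_min M H \<and> \<rho> = 0) \<or> (c = c_min M H \<and> \<rho> = r_min M H)" and rJ: "r ` J = {\<rho><..}"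
    and gt: "\<And>x. \<rho> < x \<Longrightarrow> x < 2 * M \<Longrightarrow> kH M H x > c" using assms(1) unfolding case_run_def by auto
  have \<rho>: "0 \<le> \<rho>" "\<rho> < 2 * M" using c M kH_shape(1,2)[OF M, of H] by auto
  define bp where "bp = (\<rho> + 2 * M) / 2"
  have bI: "bp \<in> {\<rho><..<2 * M}" using \<rho> by (auto simp: bp_def)
  have JII: "s \<in> JII \<longleftrightarrow> s \<in> J \<and> r s < 2 * M" for s using JII_u[of s] pv by auto
  have rg: "r ` JII = {\<rho><..<2 * M}"
  proof (intro equalityI subsetI)
    fix x assume "x \<in> r ` JII"
    then obtain s where s: "s \<in> JII" "x = r s" by blast
    then have "r s \<in> r ` J" by simp
    then show "x \<in> {\<rho><..<2 * M}" unfolding rJ using s JII[of s] by simp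
  next
    fix x assume x: "x \<in> {\<rho><..<2 * M}"
    then have "x \<in> r ` J" unfolding rJ by simp
    then obtain s where "s \<in> J" "x = r s" by blast
    then show "x \<in> r ` JII" using JII[of s] x by (intro image_eqI[of _ _ s]) auto
  qed
  have "2 * M \<in> r ` J" "3 * M \<in> r ` J" unfolding rJ using \<rho> M by auto
  then obtain z y where z: "z \<in> J" "r z = 2 * M" and y: "y \<in> J" "r y = 3 * M" by (metis imageE)
  have "u z \<noteq> 0" using pv[OF z(1)] by simp
  then have "v z = 0" using r_horizon[OF z(1)] z(2) by simp
  moreover have "v y < 0" using r_outside[OF y(1)] y(2) pv[OF y(1)] M by (simp add: zero_less_mult_iff)
  moreover have "\<exists>k. \<forall>s\<in>JII. tc s = f2_dstar M H c bp k (r s)"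
  proof (rule piece_II_neg[OF connected_II open_uv(2) _ _ connected_Ioo open_greaterThanLessThan _ bI])
    show "u s < 0 \<and> v s > 0 \<and> p s < 0" if "s \<in> JII" for s using that pv by simp
    show "0 < x \<and> x < 2 * M \<and> kH M H x > c" if "x \<in> {\<rho><..<2 * M}" for x using that gt[of x] \<rho> by simp
    show "r s \<in> {\<rho><..<2 * M}" if "s \<in> JII" for s unfolding rg[symmetric] using that by (rule imageI)
  qed auto
  moreover have "y \<in> JI'" if "v y < 0" using y pv that by simp
  ultimately show ?thesis unfolding res_left_def using c bI rg z pv by blast
qed

lemma case_inner_res:
  assumes "case_inner" "(\<forall>s\<in>J. p s > 0) \<or> (\<forall>s\<in>J. p s < 0)"
  shows res_inner
proof -
  have c: "c = c_min M H" "r ` J = {0<..<r_min M H}" and uv: "\<And>s. s \<in> J \<Longrightarrow> u s < 0 \<and> v s > 0"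
    and gt: "\<And>x. 0 < x \<Longrightarrow> x < r_min M H \<Longrightarrow> kH M H x > c" using assms(1) unfolding case_inner_def by auto
  have rm: "0 < r_min M H" "r_min M H < 2 * M" using kH_shape(1,2)[OF M] by auto
  define bp where "bp = r_min M H / 2"
  have bI: "bp \<in> {0<..<r_min M H}" using rm by (auto simp: bp_def)
  have JII: "JII = J" using uv by auto
  have IC: "0 < x \<and> x < 2 * M \<and> kH M H x > c" if "x \<in> {0<..<r_min M H}" for x using that gt[of x] rm by simp
  have rI: "r s \<in> {0<..<r_min M H}" if "s \<in> J" for s unfolding c(2)[symmetric] using that by (rule imageI)
  from assms(2) have "\<exists>k. (\<forall>s\<in>J. tc s = f2_star M H c bp k (r s)) \<or> (\<forall>s\<in>J. tc s = f2_dstar M H c bp k (r s))"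
  proof
    assume p: "\<forall>s\<in>J. p s > 0"
    have uvp: "u s < 0 \<and> v s > 0 \<and> p s > 0" if "s \<in> J" for s using uv p that by simp
    have "\<exists>k. \<forall>s\<in>J. tc s = f2_star M H c bp k (r s)"
      by (rule piece_II[OF J_conn J_open order.refl _ connected_Ioo open_greaterThanLessThan _ bI]) (erule uvp,
          erule IC, erule rI)
    then show ?thesis by blast
  next
    assume p: "\<forall>s\<in>J. p s < 0"
    have uvp: "u s < 0 \<and> v s > 0 \<and> p s < 0" if "s \<in> J" for s using uv p that by simp
    have "\<exists>k. \<forall>s\<in>J. tc s = f2_dstar M H c bp k (r s)"
      by (rule piece_II_neg[OF J_conn J_open order.refl _ connected_Ioo open_greaterThanLessThan _ bI]) (erule uvp,
          erule IC, erule rI)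
    then show ?thesis by blast
  qed
  then show ?thesis unfolding res_inner_def using c bI JII by blast
qed

lemma case_out_res:
  assumes "case_out \<rho> s0"
  shows res_out
proof -
  have c: "c_min M H < c" "c < - 8 * M ^ 3 * H" and \<rho>: "r_min M H < \<rho>" "\<rho> < 2 * M" "kH M H \<rho> = c"
    and s0: "s0 \<in> J" "r s0 = \<rho>"
    and q: "\<And>s. s \<in> J \<Longrightarrow> s < s0 \<Longrightarrow> p s < 0" "\<And>s. s \<in> J \<Longrightarrow> s0 < s \<Longrightarrow> p s > 0"
      "\<And>s. s \<in> J \<Longrightarrow> s \<le> s0 \<Longrightarrow> u s < 0" "\<And>s. s \<in> J \<Longrightarrow> s0 \<le> s \<Longrightarrow> v s > 0"
    and rg: "r ` {s \<in> J. s0 < s} = {\<rho><..}" "r ` {s \<in> J. s < s0} = {\<rho><..}"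
    using assms unfolding case_out_def by auto
  have \<rho>0: "0 < \<rho>" using \<rho>(1) kH_shape(1)[OF M, of H] by simp
  have uv0: "u s0 < 0" "v s0 > 0" using q(3,4)[OF s0(1)] by auto
  have gt: "kH M H x > c" if "\<rho> < x" "x < 2 * M" for x
    using kH_shape(7)[OF M less_imp_le[OF \<rho>(1)] that] \<rho>(3) by simp
  note out = piece_out[OF s0 uv0 q(2) rg(1) \<rho>0 \<rho>(2) gt]
  have star: "tc s = f2_star M H c \<rho> (tc s0) (r s)" if "s \<in> J" "s0 \<le> s" "u s < 0" for s
    using out(1) that by blast
  have dstar: "tc s = f2_dstar M H c \<rho> (tc s0) (r s)" if "s \<in> J" "s \<le> s0" "v s > 0" for s
    by (rule piece_out_left[OF s0 uv0 _ rg(2) \<rho>0 \<rho>(2) _ that]) (erule (1) q(1), erule (1) gt)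
  have int: "interval_lebesgue_integrable lborel (ereal x) (ereal \<rho>) (phi2 M H c)" if "\<rho> < x" "x < 2 * M" for x
    using out(2) that by blast
  have comp: "{\<rho>..<2 * M} \<in> components (f2_dom M H c)"
    by (rule component_right[OF M \<rho>]) (erule (1) int)
  define A where "A = {s \<in> JII. s0 \<le> s}"
  define B where "B = {s \<in> JII. s \<le> s0}"
  have inA: "s \<in> A \<longleftrightarrow> s \<in> J \<and> s0 \<le> s \<and> r s < 2 * M" for s
    using r_inside[of s] q(4)[of s] by (auto simp: A_def mult_less_0_iff dest: less_asym)
  have inB: "s \<in> B \<longleftrightarrow> s \<in> J \<and> s \<le> s0 \<and> r s < 2 * M" for s
    using r_inside[of s] q(3)[of s] by (auto simp: B_def mult_less_0_iff dest: less_asym)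
  have rA: "r ` A = {\<rho>..<2 * M}"
  proof (intro equalityI subsetI)
    fix x assume "x \<in> r ` A"
    then obtain s where s: "s \<in> A" "x = r s" by blast
    show "x \<in> {\<rho>..<2 * M}"
    proof (cases "s = s0")
      case True then show ?thesis using s s0 \<rho> by simp
    next
      case False
      then have "r s \<in> r ` {s \<in> J. s0 < s}" using s inA[of s] by simp
      then show ?thesis unfolding rg(1) using s inA[of s] by simp
    qed
  next
    fix x assume x: "x \<in> {\<rho>..<2 * M}"
    show "x \<in> r ` A"
    proof (cases "x = \<rho>")
      case True then show ?thesis using inA[of s0] s0 \<rho> by (intro image_eqI[of _ _ s0]) auto
    next
      case False
      then have "x \<in> r ` {s \<in> J. s0 < s}" unfolding rg(1) using x by simp
      then obtain s where "s \<in> J" "s0 < s" "x = r s" by blast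
      then show ?thesis using inA[of s] x by (intro image_eqI[of _ _ s]) auto
    qed
  qed
  have rB: "r ` B = {\<rho>..<2 * M}"
  proof (intro equalityI subsetI)
    fix x assume "x \<in> r ` B"
    then obtain s where s: "s \<in> B" "x = r s" by blast
    show "x \<in> {\<rho>..<2 * M}"
    proof (cases "s = s0")
      case True then show ?thesis using s s0 \<rho> by simp
    next
      case False
      then have "r s \<in> r ` {s \<in> J. s < s0}" using s inB[of s] by simp
      then show ?thesis unfolding rg(2) using s inB[of s] by simp
    qed
  next
    fix x assume x: "x \<in> {\<rho>..<2 * M}"
    show "x \<in> r ` B"
    proof (cases "x = \<rho>")
      case True then show ?thesis using inB[of s0] s0 \<rho> by (intro image_eqI[of _ _ s0]) auto
    next
      case False
      then have "x \<in> r ` {s \<in> J. s < s0}" unfolding rg(2) using x by simp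
      then obtain s where "s \<in> J" "s < s0" "x = r s" by blast
      then show ?thesis using inB[of s] x by (intro image_eqI[of _ _ s]) auto
    qed
  qed
  have "2 * M \<in> r ` {s \<in> J. s0 < s}" "3 * M \<in> r ` {s \<in> J. s0 < s}" unfolding rg(1) using \<rho> M by auto
  then obtain z y where z: "z \<in> J" "s0 < z" "r z = 2 * M" and y: "y \<in> J" "s0 < y" "r y = 3 * M"
      by (smt (verit) imageE mem_Collect_eq)
  have "2 * M \<in> r ` {s \<in> J. s < s0}" "3 * M \<in> r ` {s \<in> J. s < s0}" unfolding rg(2) using \<rho> M by auto
  then obtain z' y' where z': "z' \<in> J" "z' < s0" "r z' = 2 * M" and y': "y' \<in> J" "y' < s0" "r y' = 3 * M"
      by (smt (verit) imageE mem_Collect_eq)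
  have vz: "v z > 0" "v y > 0" "u z' < 0" "u y' < 0" using q(3,4) z y z' y' by simp_all
  have 1: "\<exists>z\<in>J. u z = 0 \<and> v z > 0" using r_horizon[OF z(1)] z vz by (intro bexI[of _ z]) auto
  have 2: "\<exists>z\<in>J. v z = 0 \<and> u z < 0" using r_horizon[OF z'(1)] z' vz by (intro bexI[of _ z']) auto
  have "u y > 0" using r_outside[OF y(1)] y vz M by (simp add: zero_less_mult_iff)
  then have 3: "JI \<noteq> {}" using y vz by blast
  have "v y' < 0" using r_outside[OF y'(1)] y' vz M by (simp add: zero_less_mult_iff)
  then have 4: "JI' \<noteq> {}" using y' vz by blast
  have 5: "\<forall>s\<in>J. u s < 0 \<or> v s > 0" using q(3,4) linear by blast
  have AB: "JII = A \<union> B" unfolding A_def B_def using linear by blast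
  have tA: "\<forall>s\<in>A. tc s = f2_star M H c \<rho> (tc s0) (r s)" using star by (simp add: A_def)
  have tB: "\<forall>s\<in>B. tc s = f2_dstar M H c \<rho> (tc s0) (r s)" using dstar by (simp add: B_def)
  show ?thesis unfolding res_out_def
    by (intro conjI exI[of _ \<rho>] exI[of _ "tc s0"] exI[of _ A] exI[of _ B] c comp \<rho>(3) AB rA rB tA tB 1 2 3 4 5)
qed

lemma case_in_res:
  assumes "case_in \<rho> s0"
  shows res_in
proof -
  have c: "c_min M H < c" "c < 0" and \<rho>: "0 < \<rho>" "\<rho> < r_min M H" "kH M H \<rho> = c"
    and s0: "s0 \<in> J" "r s0 = \<rho>"
    and q: "\<And>s. s \<in> J \<Longrightarrow> s < s0 \<Longrightarrow> p s > 0" "\<And>s. s \<in> J \<Longrightarrow> s0 < s \<Longrightarrow> p s < 0" and uv: "\<And>s. s \<in> J \<Longrightarrow> u s < 0 \<and> v s > 0"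
    and rg: "r ` {s \<in> J. s < s0} = {0<..<\<rho>}" "r ` {s \<in> J. s0 < s} = {0<..<\<rho>}"
    using assms unfolding case_in_def by auto
  have \<rho>0: "\<rho> < 2 * M" using \<rho>(2) kH_shape(2)[OF M, of H] by simp
  have gt: "kH M H x > c" if "0 < x" "x < \<rho>" for x
    using kH_shape(6)[OF M that less_imp_le[OF \<rho>(2)]] \<rho>(3) by simp
  have star: "tc s = f2_star M H c \<rho> (tc s0) (r s)" if "s \<in> J" "s \<le> s0" for s
    by (rule piece_in(1)[OF s0 _ _ rg(1) \<rho>(1) \<rho>0 _ that]) (erule uv, erule (1) q(1), erule (1) gt)
  have int: "interval_lebesgue_integrable lborel (ereal x) (ereal \<rho>) (phi2 M H c)" if "0 < x" "x < \<rho>" for x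
    by (rule piece_in(2)[OF s0 _ _ rg(1) \<rho>(1) \<rho>0 _ that]) (erule uv, erule (1) q(1), erule (1) gt)
  have dstar: "tc s = f2_dstar M H c \<rho> (tc s0) (r s)" if "s \<in> J" "s0 \<le> s" for s
    by (rule piece_in_right[OF s0 _ _ rg(2) \<rho>(1) \<rho>0 _ that]) (erule uv, erule (1) q(2), erule (1) gt)
  have comp: "{0<..\<rho>} \<in> components (f2_dom M H c)"
    by (rule component_left[OF M \<rho>]) (erule (1) int)
  define A where "A = {s \<in> J. s \<le> s0}"
  define B where "B = {s \<in> J. s0 \<le> s}"
  have "A = insert s0 {s \<in> J. s < s0}" "B = insert s0 {s \<in> J. s0 < s}" using s0 by (auto simp: A_def B_def)
  then have "r ` A = insert \<rho> {0<..<\<rho>}" "r ` B = insert \<rho> {0<..<\<rho>}" using rg s0(2) by simp_all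
  moreover have "insert \<rho> {0<..<\<rho>} = {0<..\<rho>}" using \<rho>(1) by auto
  ultimately have rA: "r ` A = {0<..\<rho>}" and rB: "r ` B = {0<..\<rho>}" by simp_all
  have JII: "JII = J" using uv by auto
  have AB: "J = A \<union> B" unfolding A_def B_def using linear by blast
  have tA: "\<forall>s\<in>A. tc s = f2_star M H c \<rho> (tc s0) (r s)" using star by (simp add: A_def)
  have tB: "\<forall>s\<in>B. tc s = f2_dstar M H c \<rho> (tc s0) (r s)" using dstar by (simp add: B_def)
  show ?thesis unfolding res_in_def
    by (intro conjI exI[of _ \<rho>] exI[of _ "tc s0"] exI[of _ A] exI[of _ B] c comp \<rho>(3) JII AB rA rB tA tB)
qed

theorem region_II_result:
  assumes "JII \<noteq> {}"
  shows "(\<exists>r0. case_cyl r0) \<or> res_right \<or> res_left \<or> res_inner \<or> res_out \<or> res_in"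
proof -
  obtain s1 where "s1 \<in> J" "u s1 < 0" "v s1 > 0" using assms by blast
  from class_II[OF this] show ?thesis
    using case_run_right case_run_left case_inner_res case_out_res case_in_res by blast
qed

end

text \<open>With \<open>kH' M H = - kH M (- H)\<close> both sides are the choice for one and the
  same predicate.\<close>

lemma R_max_r_min: "R_max M H = r_min M (- H)"
  by (simp add: R_max_def r_min_def arg_max_on_def arg_min_on_def arg_max_def arg_min_def is_arg_max_def
      is_arg_min_def kH'_kH)

lemma C_max_c_min: "C_max M H = - c_min M (- H)"
  by (simp add: C_max_def c_min_def R_max_r_min kH'_kH)

lemma limit_set_commute: "limit_set M A B = limit_set M B A"
  by (auto simp: limit_set_def)

lemma joined_commute: "joined M A B = joined M B A"
  by (auto simp: joined_def limit_set_commute[of M A B])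

lemma connect_smoothly_commute: "connect_smoothly M A B \<longleftrightarrow> connect_smoothly M B A"
  by (simp add: connect_smoothly_def connect_smoothly_at_def limit_set_commute[of M A B] joined_commute[of M A B])

section \<open>From pieces of the profile to graphs and joined hypersurfaces\<close>

context cmc_surface
begin

definition "lift C = {(U, V, x). U \<in> C \<and> V = g U \<and> norm (x :: real^3) = 1}"

lemma lift_J: "lift J = S"
  by (auto simp: lift_def S_iff')

lemma lift_Un: "lift (A \<union> B) = lift A \<union> lift B"
  by (auto simp: lift_def)

text \<open>The radius determines \<open>U V\<close>, the time determines
  \<open>\<bar>V / U\<bar>\<close>, and the region fixes both signs; together they determine
  \<open>(U, V)\<close>. The factors \<open>\<sigma>\<close> and \<open>\<tau>\<close> encode the
  signs, so that one proof covers all four regions.\<close>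

lemma lift_graph:
  assumes C: "C \<subseteq> J" and R: "\<And>U V x. (U, V, x) \<in> R \<longleftrightarrow> (U, V, x) \<in> kruskal M \<and> \<sigma> * U > 0 \<and> \<tau> * V > 0"
    and sg: "\<And>s. s \<in> C \<Longrightarrow> \<sigma> * s > 0 \<and> \<tau> * g s > 0" and K: "r ` C = K"
    and f: "\<And>s. s \<in> C \<Longrightarrow> 2 * M * ln \<bar>g s / s\<bar> = f (r s)"
  shows "lift C = graph M R f K"
proof (intro equalityI subsetI)
  fix q assume "q \<in> lift C"
  then obtain s x where q: "q = (s, g s, x)" "s \<in> C" "norm x = 1" by (auto simp: lift_def)
  then have "q \<in> R" using sg UV C by (auto simp: R kruskal_iff)
  moreover have "radius M q = r s" by (simp add: q(1) radius_rho r_def)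
  ultimately show "q \<in> graph M R f K" using q K f by (auto simp: graph_def)
next
  fix q assume q: "q \<in> graph M R f K"
  obtain U V x where qe: "q = (U, V, x)" by (cases q)
  have k: "(U, V, x) \<in> kruskal M" "\<sigma> * U > 0" "\<tau> * V > 0" and rK: "rho M (U * V) \<in> K"
    and t: "2 * M * ln \<bar>V / U\<bar> = f (rho M (U * V))"
    using q by (auto simp: graph_def qe R radius_rho)
  obtain s where s: "s \<in> C" "rho M (U * V) = r s" using rK K by auto
  note ss = sg[OF s(1)]
  have UVg: "U * V > - 2 * M" "norm x = 1" using k by (auto simp: kruskal_iff)
  have sJ: "s \<in> J" using s C by blast
  have prod: "U * V = s * g s"
    using kappa_rho[OF M UVg(1)] kappa_rho[OF M UV[OF sJ]] s(2) unfolding r_def by metis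
  have nz: "U \<noteq> 0" "V \<noteq> 0" "s \<noteq> 0" "g s \<noteq> 0" using k ss by auto
  have same_sign: "x * y > 0" if "\<alpha> * x > 0" "\<alpha> * y > 0" for \<alpha> x y :: real
    using that by (smt (verit) zero_less_mult_iff)
  have pos: "U * s > 0" "V * g s > 0"
    by (rule same_sign[OF k(2)], use ss in simp) (rule same_sign[OF k(3)], use ss in simp)
  have "2 * M * ln \<bar>V / U\<bar> = 2 * M * ln \<bar>g s / s\<bar>" unfolding t f[OF s(1)] s(2) ..
  then have ln: "ln \<bar>V / U\<bar> = ln \<bar>g s / s\<bar>" using M by simp
  have "\<bar>V / U\<bar> > 0" "\<bar>g s / s\<bar> > 0" using nz by simp_all
  with ln have "\<bar>V / U\<bar> = \<bar>g s / s\<bar>" by (simp only: ln_inj_iff)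
  then have "\<bar>V\<bar> / \<bar>U\<bar> = \<bar>g s\<bar> / \<bar>s\<bar>" by (simp only: abs_divide)
  then have "\<bar>V * s\<bar> = \<bar>g s * U\<bar>" using nz by (simp add: abs_mult frac_eq_eq)
  moreover have "(V * s) * (g s * U) > 0" using mult_pos_pos[OF pos] by (simp add: algebra_simps)
  ultimately have e: "V * s = g s * U" by (smt (verit) zero_less_mult_iff)
  have "g s * U\<^sup>2 = g s * s\<^sup>2"
  proof -
    have "g s * U\<^sup>2 = (V * s) * U" unfolding e by (simp add: power2_eq_square)
    also have "\<dots> = (U * V) * s" by simp
    also have "\<dots> = g s * s\<^sup>2" unfolding prod by (simp add: power2_eq_square)
    finally show ?thesis .
  qed
  then have "U\<^sup>2 = s\<^sup>2" using nz by simp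
  then have "U = s \<or> U = - s" by (simp add: power2_eq_iff)
  then have Us: "U = s" using pos(1) by (auto simp: mult_less_0_iff)
  moreover have "V = g s" using e nz Us by simp
  ultimately show "q \<in> lift C" using s UVg by (simp add: lift_def qe)
qed

text \<open>An open part of the profile corresponds to the intersection of \<open>S\<close> with an
  open set, so level functions and tangent vectors are inherited from \<open>S\<close>.\<close>

lemma lift_hypersurface:
  assumes T: "open T" "T \<subseteq> J" "T \<noteq> {}"
  shows "spacelike_hypersurface M (lift T)"
proof -
  define O' where "O' = {q :: event. fst q \<in> T}"
  have O: "open O'" unfolding O'_def using open_vimage_fst[OF T(1)] by (simp add: vimage_def)
  have L: "lift T = S \<inter> O'" using T(2) by (auto simp: lift_def O'_def S_iff')
  obtain s and e :: "real^3" where "s \<in> T" "norm e = 1" using T(3) unit_exists by blast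
  then have ne: "lift T \<noteq> {}" by (auto simp: lift_def)
  have sub: "lift T \<subseteq> S" using L by blast
  have hyp: "smooth_hypersurface M S" and sp: "\<And>p v. p \<in> S \<Longrightarrow> v \<in> tangent_space S p \<Longrightarrow> v \<noteq> 0 \<Longrightarrow> metric M p v v > 0"
    using spacelike unfolding spacelike_hypersurface_def by auto
  have "\<exists>W (F :: event \<Rightarrow> real). open W \<and> p \<in> W \<and> smooth_on W F \<and> lift T \<inter> W = {q \<in> kruskal M \<inter> W. F q = 0} \<and>
        (\<forall>q\<in>lift T \<inter> W. \<exists>v\<in>tangent_space (kruskal M) q. frechet_derivative F (at q) v \<noteq> 0)" if p: "p \<in> lift T" for p
  proof -
    obtain W and F :: "event \<Rightarrow> real" where W: "open W" "p \<in> W" "smooth_on W F" "S \<inter> W = {q \<in> kruskal M \<inter> W. F q = 0}"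
      "\<forall>q\<in>S \<inter> W. \<exists>v\<in>tangent_space (kruskal M) q. frechet_derivative F (at q) v \<noteq> 0"
      using hyp p sub unfolding smooth_hypersurface_def by blast
    have "lift T \<inter> (W \<inter> O') = {q \<in> kruskal M \<inter> (W \<inter> O'). F q = 0}" using W(4) L by blast
    moreover have "smooth_on (W \<inter> O') F" using W(3) C_diff_on_subset[of _ W F "W \<inter> O'"] by (auto simp: smooth_on_def)
    ultimately show ?thesis using W O p L by (intro exI[of _ "W \<inter> O'"] exI[of _ F]) auto
  qed
  moreover have "lift T \<subseteq> kruskal M" using sub hyp unfolding smooth_hypersurface_def by blast
  ultimately have "smooth_hypersurface M (lift T)" using ne unfolding smooth_hypersurface_def by blast
  moreover have "metric M p v v > 0" if "p \<in> lift T" "v \<in> tangent_space (lift T) p" "v \<noteq> 0" for p v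
    using sp[of p v] that sub tangent_space_mono[OF sub, of p] by blast
  ultimately show ?thesis unfolding spacelike_hypersurface_def by blast
qed

lemma closure_S: "A \<subseteq> S \<Longrightarrow> closure A \<inter> kruskal M \<subseteq> S"
proof -
  assume A: "A \<subseteq> S"
  obtain T where "closed T" "S = kruskal M \<inter> T" using closed_S unfolding closedin_closed by blast
  then show ?thesis using closure_minimal[of A T] A by blast
qed

text \<open>The pieces lie over opposite sides of \<open>z\<close>, so their closures can only meet
  over \<open>U = z\<close>. As \<open>S\<close> is closed, the common limit lies in the sphere over
  \<open>(z, g z)\<close>, and this sphere is approached from both sides.\<close>

lemma lift_join:
  assumes T: "open T" "T \<subseteq> J" and z: "z \<in> T" "r z = 2 * M"
  defines "A \<equiv> lift {s \<in> T. z < s}" and "B \<equiv> lift {s \<in> T. s < z}"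
  shows "connect_smoothly_at M z (g z) A B" "joined M A B = lift T"
proof -
  have zJ: "z \<in> J" using z T by blast
  have AS: "A \<subseteq> S" "B \<subseteq> S" using T(2) by (auto simp: A_def B_def lift_def S_iff')
  \<comment> \<open>\<open>P\<close> selects one side of \<open>z\<close>; the curve with fixed
    \<open>x\<close> tends to \<open>q\<close> along the one-sided filter.\<close>
  have cl: "q \<in> closure (lift {s \<in> T. P s})"
    if q: "q = (z, g z, x)" "norm x = 1" and F: "F = at z within {s. P s}" "F \<noteq> bot" for q x P F
  proof (rule Lim_in_closed_set[OF closed_closure _ F(2)])
    have "\<forall>\<^sub>F s in F. s \<in> T"
      unfolding F(1) using eventually_nhds_in_open[OF T(1) z(1)] by (auto simp: eventually_at_filter elim: eventually_mono)
    moreover have "\<forall>\<^sub>F s in F. P s" unfolding F(1) by (auto simp: eventually_at_filter)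
    ultimately show "\<forall>\<^sub>F s in F. (s, g s, x) \<in> closure (lift {s \<in> T. P s})"
      by eventually_elim (use q in \<open>intro subsetD[OF closure_subset], auto simp: lift_def\<close>)
    have "(g \<longlongrightarrow> g z) F" unfolding F(1)
      using DERIV_isCont[OF g_deriv[OF zJ]] by (simp add: continuous_at filterlim_at_withinI Lim_at_imp_Lim_at_within)
    then show "((\<lambda>s. (s, g s, x)) \<longlongrightarrow> q) F" unfolding q(1) F(1) by (intro tendsto_intros)
  qed
  have lim: "limit_set M A B = {z} \<times> {g z} \<times> sphere 0 1"
  proof (intro equalityI subsetI)
    fix q assume q: "q \<in> limit_set M A B"
    then have qc: "q \<in> closure A" "q \<in> closure B" "q \<in> kruskal M" by (auto simp: limit_set_def)
    have c: "closed {q :: event. z \<le> fst q}" "closed {q :: event. fst q \<le> z}"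
      by (intro closed_Collect_le continuous_intros)+
    have "A \<subseteq> {q. z \<le> fst q}" "B \<subseteq> {q. fst q \<le> z}" by (auto simp: A_def B_def lift_def)
    then have "fst q = z" using closure_minimal[OF _ c(1)] closure_minimal[OF _ c(2)] qc
      by (metis (mono_tags, lifting) mem_Collect_eq order_antisym subsetD)
    moreover have "q \<in> S" using closure_S[OF AS(1)] qc by blast
    ultimately show "q \<in> {z} \<times> {g z} \<times> sphere 0 1" by (cases q) (auto simp: S_iff')
  next
    fix q assume "q \<in> {z} \<times> {g z} \<times> sphere (0::real^3) 1"
    then obtain x where q: "q = (z, g z, x)" "norm x = 1" by auto
    have "q \<in> closure A" unfolding A_def
      by (rule cl[OF q refl]) (simp add: greaterThan_def[symmetric])
    moreover have "q \<in> closure B" unfolding B_def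
      by (rule cl[OF q refl]) (simp add: lessThan_def[symmetric])
    moreover have "q \<in> kruskal M" using q UV[OF zJ] by (simp add: kruskal_iff)
    moreover have "radius M q = 2 * M" using z(2) by (simp add: q(1) radius_rho r_def)
    ultimately show "q \<in> limit_set M A B" by (simp add: limit_set_def)
  qed
  show j: "joined M A B = lift T"
    unfolding joined_def lim using z(1)
    by (auto simp: A_def B_def lift_def) (metis linorder_less_linear)+
  show "connect_smoothly_at M z (g z) A B"
    unfolding connect_smoothly_at_def j using lim lift_hypersurface[OF T] z(1) by blast
qed

abbreviation "KI \<equiv> {s \<in> J. 0 < s \<and> 0 < g s}"
abbreviation "KII \<equiv> {s \<in> J. s < 0 \<and> 0 < g s}"
abbreviation "KI' \<equiv> {s \<in> J. s < 0 \<and> g s < 0}"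
abbreviation "KII' \<equiv> {s \<in> J. 0 < s \<and> g s < 0}"

lemma g_mono: "s \<in> J \<Longrightarrow> t \<in> J \<Longrightarrow> s < t \<Longrightarrow> g s < g t"
proof -
  obtain c m where "profile M H c J (\<lambda>U. U) g a b m r p" using profile_exists by blast
  then interpret P: profile M H c J "\<lambda>U. U" g a b m r p .
  show "s \<in> J \<Longrightarrow> t \<in> J \<Longrightarrow> s < t \<Longrightarrow> g s < g t" by (rule P.v_mono)
qed

lemma g_less_iff: "s \<in> J \<Longrightarrow> t \<in> J \<Longrightarrow> g s < g t \<longleftrightarrow> s < t"
  using g_mono by (metis linorder_less_linear order_less_asym)

lemma open_g: "open X \<Longrightarrow> open {s \<in> J. g s \<in> X}"
  using continuous_open_preimage[OF _ J_open, of g X] g_deriv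
  by (simp add: vimage_def Int_def continuous_at_imp_continuous_on DERIV_isCont[OF g_deriv])

lemma r_horizon: "s \<in> J \<Longrightarrow> s * g s = 0 \<Longrightarrow> r s = 2 * M"
  using kappa_rho[OF M UV, of s] kappa_0_iff[of M "r s"] by (simp add: r_def)

text \<open>A crossing at \<open>U = 0\<close>: the sign of \<open>V\<close> there tells which two
  regions are adjacent, and \<open>V = 0\<close> is the bifurcation sphere.\<close>

lemma join_zero:
  assumes "0 \<in> J"
  shows "g 0 > 0 \<Longrightarrow> connect_smoothly M (lift KI) (lift KII) \<and> joined M (lift KI) (lift KII) = lift {s \<in> J. g s > 0}"
    "g 0 < 0 \<Longrightarrow> connect_smoothly M (lift KII') (lift KI') \<and> joined M (lift KII') (lift KI') = lift {s \<in> J. g s < 0}"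
    "g 0 = 0 \<Longrightarrow> connect_smoothly_at M 0 0 (lift KI) (lift KI') \<and> joined M (lift KI) (lift KI') = S"
proof -
  have r0: "r 0 = 2 * M" using r_horizon[OF assms] by simp
  { assume g0: "g 0 > 0"
    have o: "open {s \<in> J. g s > 0}" using open_g[of "{0<..}"] by simp
    have "{s \<in> {s \<in> J. g s > 0}. 0 < s} = KI" "{s \<in> {s \<in> J. g s > 0}. s < 0} = KII" by auto
    with lift_join[OF o _ _ r0] assms g0
    show "connect_smoothly M (lift KI) (lift KII) \<and> joined M (lift KI) (lift KII) = lift {s \<in> J. g s > 0}"
      by (auto simp: connect_smoothly_def) }
  { assume g0: "g 0 < 0"
    have o: "open {s \<in> J. g s < 0}" using open_g[of "{..<0}"] by simp
    have "{s \<in> {s \<in> J. g s < 0}. 0 < s} = KII'" "{s \<in> {s \<in> J. g s < 0}. s < 0} = KI'" by auto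
    with lift_join[OF o _ _ r0] assms g0
    show "connect_smoothly M (lift KII') (lift KI') \<and> joined M (lift KII') (lift KI') = lift {s \<in> J. g s < 0}"
      by (auto simp: connect_smoothly_def) }
  { assume g0: "g 0 = 0"
    have "{s \<in> J. 0 < s} = KI" "{s \<in> J. s < 0} = KI'" using g_mono assms g0 by force+
    with lift_join[OF J_open order.refl assms r0] g0
    show "connect_smoothly_at M 0 0 (lift KI) (lift KI') \<and> joined M (lift KI) (lift KI') = S"
      by (simp add: lift_J) }
qed

lemma join_zero_g:
  assumes z: "z \<in> J" "g z = 0"
  shows "z > 0 \<Longrightarrow> connect_smoothly M (lift KI) (lift KII') \<and> joined M (lift KI) (lift KII') = lift {s \<in> J. s > 0}"
    "z < 0 \<Longrightarrow> connect_smoothly M (lift KII) (lift KI') \<and> joined M (lift KII) (lift KI') = lift {s \<in> J. s < 0}"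
proof -
  have r0: "r z = 2 * M" using r_horizon z by simp
  have sg: "z < s \<longleftrightarrow> 0 < g s" "s < z \<longleftrightarrow> g s < 0" if "s \<in> J" for s
    using g_less_iff[OF z(1) that] g_less_iff[OF that z(1)] z(2) by simp_all
  { assume z0: "z > 0"
    have o: "open {s \<in> J. s > 0}" using open_Int[OF J_open open_greaterThan[of 0]] by (simp add: Int_def)
    have "{s \<in> {s \<in> J. s > 0}. z < s} = KI" "{s \<in> {s \<in> J. s > 0}. s < z} = KII'" using sg by auto
    with lift_join[OF o _ _ r0] z z0
    show "connect_smoothly M (lift KI) (lift KII') \<and> joined M (lift KI) (lift KII') = lift {s \<in> J. s > 0}"
      by (auto simp: connect_smoothly_def) }
  { assume z0: "z < 0"
    have o: "open {s \<in> J. s < 0}" using open_Int[OF J_open open_lessThan[of 0]] by (simp add: Int_def)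
    have "{s \<in> {s \<in> J. s < 0}. z < s} = KII" "{s \<in> {s \<in> J. s < 0}. s < z} = KI'" using sg by auto
    with lift_join[OF o _ _ r0] z z0
    show "connect_smoothly M (lift KII) (lift KI') \<and> joined M (lift KII) (lift KI') = lift {s \<in> J. s < 0}"
      by (auto simp: connect_smoothly_def) }
qed

lemma lift_regions:
  shows "C \<subseteq> KI \<Longrightarrow> (\<And>s. s \<in> C \<Longrightarrow> 2 * M * ln \<bar>g s / s\<bar> = f (r s)) \<Longrightarrow> lift C = graph M (regionI M) f (r ` C)"
    "C \<subseteq> KII \<Longrightarrow> (\<And>s. s \<in> C \<Longrightarrow> 2 * M * ln \<bar>g s / s\<bar> = f (r s)) \<Longrightarrow> lift C = graph M (regionII M) f (r ` C)"
    "C \<subseteq> KI' \<Longrightarrow> (\<And>s. s \<in> C \<Longrightarrow> 2 * M * ln \<bar>g s / s\<bar> = f (r s)) \<Longrightarrow> lift C = graph M (regionI' M) f (r ` C)"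
    "C \<subseteq> KII' \<Longrightarrow> (\<And>s. s \<in> C \<Longrightarrow> 2 * M * ln \<bar>g s / s\<bar> = f (r s)) \<Longrightarrow> lift C = graph M (regionII' M) f (r ` C)"
proof -
  show "C \<subseteq> KI \<Longrightarrow> (\<And>s. s \<in> C \<Longrightarrow> 2 * M * ln \<bar>g s / s\<bar> = f (r s)) \<Longrightarrow> lift C = graph M (regionI M) f (r ` C)"
    by (rule lift_graph[where \<sigma> = 1 and \<tau> = 1]) (auto simp: regionI_def)
  show "C \<subseteq> KII \<Longrightarrow> (\<And>s. s \<in> C \<Longrightarrow> 2 * M * ln \<bar>g s / s\<bar> = f (r s)) \<Longrightarrow> lift C = graph M (regionII M) f (r ` C)"
    by (rule lift_graph[where \<sigma> = "-1" and \<tau> = 1]) (auto simp: regionII_def)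
  show "C \<subseteq> KI' \<Longrightarrow> (\<And>s. s \<in> C \<Longrightarrow> 2 * M * ln \<bar>g s / s\<bar> = f (r s)) \<Longrightarrow> lift C = graph M (regionI' M) f (r ` C)"
    by (rule lift_graph[where \<sigma> = "-1" and \<tau> = "-1"]) (auto simp: regionI'_def)
  show "C \<subseteq> KII' \<Longrightarrow> (\<And>s. s \<in> C \<Longrightarrow> 2 * M * ln \<bar>g s / s\<bar> = f (r s)) \<Longrightarrow> lift C = graph M (regionII' M) f (r ` C)"
    by (rule lift_graph[where \<sigma> = 1 and \<tau> = "-1"]) (auto simp: regionII'_def)
qed

lemma lift_I:
  assumes "profile M H c J (\<lambda>U. U) g a b m r p" "r1 > 2 * M" "KI \<noteq> {}"
  shows "\<exists>k. lift KI = Sigma1 M H c r1 k"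
proof -
  interpret P: profile M H c J "\<lambda>U. U" g a b m r p by (fact assms(1))
  obtain s where "s \<in> KI" using assms(3) by blast
  then have rg: "r ` KI = {2 * M<..}" using P.region_I_range[of s] by simp
  obtain k where "\<And>s. s \<in> KI \<Longrightarrow> 2 * M * ln \<bar>g s / s\<bar> = f1 M H c r1 k (r s)" using P.piece_I[OF assms(2)]
      by (auto simp: P.tc_def)
  from lift_regions(1)[OF order.refl this] show ?thesis unfolding Sigma1_def rg by blast
qed

lemma lift_I':
  assumes "profile M H c J (\<lambda>U. U) g a b m r p" "r3 > 2 * M" "KI' \<noteq> {}"
  shows "\<exists>k. lift KI' = Sigma3 M H c r3 k"
proof -
  interpret P: profile M H c J "\<lambda>U. U" g a b m r p by (fact assms(1))
  obtain s where "s \<in> KI'" using assms(3) by blast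
  then have rg: "r ` KI' = {2 * M<..}" using P.region_I'_range[of s] by simp
  obtain k where "\<And>s. s \<in> KI' \<Longrightarrow> 2 * M * ln \<bar>g s / s\<bar> = f3 M H c r3 k (r s)" using P.piece_I'[OF assms(2)]
      by (auto simp: P.tc_def)
  from lift_regions(3)[OF order.refl this] show ?thesis unfolding Sigma3_def rg by blast
qed

end

section \<open>Assembly of the list\<close>

context cmc_surface
begin

abbreviation "joins A B \<equiv> connect_smoothly M A B \<and> S = joined M A B"

text \<open>The alternatives are disjuncts of the final theorem with \<open>let\<close> unfolded, so
  that the final step is propositional.\<close>

lemma classification_II:
  assumes P: "profile M H c J (\<lambda>U. U) g a b m r p" and r1: "r1 > 2 * M" and r3: "r3 > 2 * M" and ne: "KII \<noteq> {}"
  shows "(c < c_min M H \<and>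
      (\<exists>k1 b k. b \<in> {0<..<2 * M} \<and>
        joins (Sigma1 M H c r1 k1) (graph M (regionII M) (f2_star M H c b k) {0<..<2 * M}))) \<or>
    (c = c_min M H \<and>
      (\<exists>k1 b k. b \<in> {r_min M H<..<2 * M} \<and>
        joins (Sigma1 M H c r1 k1) (graph M (regionII M) (f2_star M H c b k) {r_min M H<..<2 * M}))) \<or>
    (c_min M H < c \<and> c < - 8 * M ^ 3 * H \<and>
      (\<exists>k1 r'' k k3. {r''..<2 * M} \<in> components (f2_dom M H c) \<and> kH M H r'' = c \<and>
        connect_smoothly M (Sigma1 M H c r1 k1) (both2 M H c r'' k {r''..<2 * M}) \<and>
        connect_smoothly M (both2 M H c r'' k {r''..<2 * M}) (Sigma3 M H c r3 k3) \<and>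
        S = joined M (Sigma1 M H c r1 k1) (both2 M H c r'' k {r''..<2 * M}) \<union>
          joined M (both2 M H c r'' k {r''..<2 * M}) (Sigma3 M H c r3 k3))) \<or>
    (c = c_min M H \<and>
      (\<exists>b k. b \<in> {0<..<r_min M H} \<and>
        (S = graph M (regionII M) (f2_star M H c b k) {0<..<r_min M H} \<or>
         S = graph M (regionII M) (f2_dstar M H c b k) {0<..<r_min M H}))) \<or>
    (c_min M H < c \<and> c < max 0 (- 8 * M ^ 3 * H) \<and>
      (\<exists>r' k. {0<..r'} \<in> components (f2_dom M H c) \<and> kH M H r' = c \<and>
        S = both2 M H c r' k {0<..r'})) \<or>
    (c < c_min M H \<and>
      (\<exists>k3 b k. b \<in> {0<..<2 * M} \<and>
        joins (Sigma3 M H c r3 k3) (graph M (regionII M) (f2_dstar M H c b k) {0<..<2 * M}))) \<or>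
    (c = c_min M H \<and>
      (\<exists>k3 b k. b \<in> {r_min M H<..<2 * M} \<and>
        joins (Sigma3 M H c r3 k3) (graph M (regionII M) (f2_dstar M H c b k) {r_min M H<..<2 * M}))) \<or>
    (\<exists>r0\<in>{0<..<2 * M}. S = {p \<in> regionII M. radius M p = r0} \<or>
         S = {p \<in> regionII' M. radius M p = r0})"
proof -
  interpret P: profile M H c J "\<lambda>U. U" g a b m r p by (fact P)
  have tc: "2 * M * ln \<bar>g s / s\<bar> = P.tc s" for s by (simp add: P.tc_def)
  have ex: "(\<exists>r0. P.case_cyl r0) \<or> P.res_right \<or> P.res_left \<or> P.res_inner \<or> P.res_out \<or> P.res_in"
      by (rule P.region_II_result) (fact ne)
  have right: "lift C = graph M (regionII M) (f2_star M H c bp k) (r ` C)" if "C \<subseteq> KII" "\<And>s. s \<in> C \<Longrightarrow>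
      P.tc s = f2_star M H c bp k (r s)" for C bp k
    by (rule lift_regions(2)[OF that(1)]) (simp only: tc that(2))
  have left: "lift C = graph M (regionII M) (f2_dstar M H c bp k) (r ` C)" if "C \<subseteq> KII" "\<And>s. s \<in> C \<Longrightarrow>
      P.tc s = f2_dstar M H c bp k (r s)" for C bp k
    by (rule lift_regions(2)[OF that(1)]) (simp only: tc that(2))
  from ex consider r0 where "P.case_cyl r0" | "P.res_right" | "P.res_left" | "P.res_inner" | "P.res_out" |
      "P.res_in" by blast
  then show ?thesis
  proof cases
    case 1
    then have r0: "0 < r0" "r0 < 2 * M" and s: "\<And>s. s \<in> J \<Longrightarrow> r s = r0 \<and> s < 0 \<and> g s > 0" and J: "J = {..<0}"
      by (auto simp: P.case_cyl_def)
    have "S = {p \<in> regionII M. radius M p = r0}"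
    proof (intro equalityI subsetI)
      fix q assume "q \<in> S"
      moreover obtain U V x where q: "q = (U, V, x)" by (cases q)
      ultimately have "U \<in> J" "V = g U" "norm x = 1" by (simp_all add: S_iff')
      then show "q \<in> {p \<in> regionII M. radius M p = r0}"
        using s[of U] UV[of U] by (simp add: q regionII_def kruskal_iff radius_rho r_def)
    next
      fix q assume q: "q \<in> {p \<in> regionII M. radius M p = r0}"
      obtain U V x where qe: "q = (U, V, x)" by (cases q)
      have q: "U < 0" "U * V > - 2 * M" "norm x = 1" "rho M (U * V) = r0"
        using q by (auto simp: qe regionII_def kruskal_iff radius_rho)
      then have U: "U \<in> J" by (simp add: J)
      have "U * V = U * g U"
        using kappa_rho[OF M q(2)] kappa_rho[OF M UV[OF U]] s[OF U] q(4) unfolding r_def by metis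
      then show "q \<in> S" using U q by (simp add: qe S_iff')
    qed
    then show ?thesis using r0 by (intro disjI2 bexI[of _ r0] disjI1) auto
  next
    case 2
    then obtain \<rho> bp k z where c: "(c < c_min M H \<and> \<rho> = 0) \<or> (c = c_min M H \<and> \<rho> = r_min M H)"
      and bp: "bp \<in> {\<rho><..<2 * M}" and sg: "\<And>s. s \<in> J \<Longrightarrow> g s > 0" and rg: "r ` KII = {\<rho><..<2 * M}"
      and z: "z \<in> J" "z = 0" and KI: "KI \<noteq> {}" and t: "\<And>s. s \<in> KII \<Longrightarrow> P.tc s = f2_star M H c bp k (r s)"
      unfolding P.res_right_def by blast
    obtain k1 where k1: "lift KI = Sigma1 M H c r1 k1" using lift_I[OF P r1 KI] by blast
    have B: "lift KII = graph M (regionII M) (f2_star M H c bp k) {\<rho><..<2 * M}" using right[OF order.refl t] unfolding rg .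
    have T: "{s \<in> J. g s > 0} = J" using sg by auto
    note j = join_zero(1)[OF z(1)[unfolded z(2)], OF sg[OF z(1), unfolded z(2)], unfolded T lift_J B k1]
    have j': "connect_smoothly M (Sigma1 M H c r1 k1) (graph M (regionII M) (f2_star M H c bp k) {\<rho><..<2 * M})"
      "S = joined M (Sigma1 M H c r1 k1) (graph M (regionII M) (f2_star M H c bp k) {\<rho><..<2 * M})" using j by simp_all
    from c show ?thesis
    proof (elim disjE conjE)
      assume c: "c < c_min M H" and \<rho>: "\<rho> = 0"
      have "c < c_min M H" by (fact c)
      then show ?thesis by - (rule disjI1, use bp[unfolded \<rho>] j'[unfolded \<rho>] in blast)
    next
      assume c: "c = c_min M H" and "\<rho> = r_min M H"
      then have "c = c_min M H" and \<rho>: "\<rho> = r_min M H" by (simp_all)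
      then show ?thesis by - (rule disjI2, rule disjI1, use bp[unfolded \<rho>] j'[unfolded \<rho>] in blast)
    qed
  next
    case 3
    then obtain \<rho> bp k z where c: "(c < c_min M H \<and> \<rho> = 0) \<or> (c = c_min M H \<and> \<rho> = r_min M H)"
      and bp: "bp \<in> {\<rho><..<2 * M}" and sg: "\<And>s. s \<in> J \<Longrightarrow> s < 0" and rg: "r ` KII = {\<rho><..<2 * M}"
      and z: "z \<in> J" "g z = 0" and KI: "KI' \<noteq> {}" and t: "\<And>s. s \<in> KII \<Longrightarrow> P.tc s = f2_dstar M H c bp k (r s)"
      unfolding P.res_left_def by blast
    obtain k3 where k3: "lift KI' = Sigma3 M H c r3 k3" using lift_I'[OF P r3 KI] by blast
    have B: "lift KII = graph M (regionII M) (f2_dstar M H c bp k) {\<rho><..<2 * M}" using left[OF order.refl t] unfolding rg .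
    have T: "{s \<in> J. s < 0} = J" using sg by auto
    note j = join_zero_g(2)[OF z, OF sg[OF z(1)], unfolded T lift_J B k3]
    have j': "connect_smoothly M (Sigma3 M H c r3 k3) (graph M (regionII M) (f2_dstar M H c bp k) {\<rho><..<2 * M})"
      "S = joined M (Sigma3 M H c r3 k3) (graph M (regionII M) (f2_dstar M H c bp k) {\<rho><..<2 * M})"
      using j connect_smoothly_commute[of M "Sigma3 M H c r3 k3"] joined_commute[of M "Sigma3 M H c r3 k3"] by simp_all
    from c show ?thesis
    proof (elim disjE conjE)
      assume c: "c < c_min M H" and \<rho>: "\<rho> = 0"
      have "c < c_min M H" by (fact c)
      then show ?thesis by - (rule disjI2, rule disjI2, rule disjI2, rule disjI2, rule disjI2, rule disjI1, use
          bp[unfolded \<rho>] j'[unfolded \<rho>] in blast)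
    next
      assume c: "c = c_min M H" and "\<rho> = r_min M H"
      then have "c = c_min M H" and \<rho>: "\<rho> = r_min M H" by (simp_all)
      then show ?thesis by - (rule disjI2, rule disjI2, rule disjI2, rule disjI2, rule disjI2, rule disjI2, rule
          disjI1, use bp[unfolded \<rho>] j'[unfolded \<rho>] in blast)
    qed
  next
    case 4
    then obtain bp k where c: "c = c_min M H" and bp: "bp \<in> {0<..<r_min M H}" and KJ: "KII = J"
        and rg: "r ` J = {0<..<r_min M H}"
      and t: "(\<forall>s\<in>J. P.tc s = f2_star M H c bp k (r s)) \<or> (\<forall>s\<in>J. P.tc s = f2_dstar M H c bp k (r s))"
      unfolding P.res_inner_def by blast
    have sub: "J \<subseteq> KII" by (simp only: KJ order.refl)
    have c': "c = c_min M H" using c by (simp)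
    note bp' = bp and rg' = rg
    from t show ?thesis
    proof
      assume "\<forall>s\<in>J. P.tc s = f2_star M H c bp k (r s)"
      then have "lift J = graph M (regionII M) (f2_star M H c bp k) (r ` J)" by (intro right[OF sub]) blast
      then show ?thesis unfolding lift_J rg' by - (rule disjI2, rule disjI2, rule disjI2, rule disjI1, use bp' c' in blast)
    next
      assume "\<forall>s\<in>J. P.tc s = f2_dstar M H c bp k (r s)"
      then have "lift J = graph M (regionII M) (f2_dstar M H c bp k) (r ` J)" by (intro left[OF sub]) blast
      then show ?thesis unfolding lift_J rg' by - (rule disjI2, rule disjI2, rule disjI2, rule disjI1, use bp' c' in blast)
    qed
  next
    case 5
    then obtain \<rho> k A B where c: "c_min M H < c" "c < - 8 * M ^ 3 * H" and dom: "{\<rho>..<2 * M} \<in> components (f2_dom M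
        H c)" "kH M H \<rho> = c"
      and AB: "KII = A \<union> B" "r ` A = {\<rho>..<2 * M}" "r ` B = {\<rho>..<2 * M}"
      and t: "\<forall>s\<in>A. P.tc s = f2_star M H c \<rho> k (r s)" "\<forall>s\<in>B. P.tc s = f2_dstar M H c \<rho> k (r s)"
      and z: "\<exists>z\<in>J. z = 0 \<and> g z > 0" and y: "\<exists>z\<in>J. g z = 0 \<and> z < 0"
      and KI: "KI \<noteq> {}" "KI' \<noteq> {}" and sg: "\<forall>s\<in>J. s < 0 \<or> g s > 0"
      unfolding P.res_out_def by (elim exE conjE) (rule that)
    have sub: "A \<subseteq> KII" "B \<subseteq> KII" unfolding AB(1) by blast+
    have "lift A = graph M (regionII M) (f2_star M H c \<rho> k) {\<rho>..<2 * M}" unfolding AB(2)[symmetric]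
        by (rule right[OF sub(1)]) (use t(1) in blast)
    moreover have "lift B = graph M (regionII M) (f2_dstar M H c \<rho> k) {\<rho>..<2 * M}" unfolding AB(3)[symmetric]
        by (rule left[OF sub(2)]) (use t(2) in blast)
    ultimately have B: "lift KII = both2 M H c \<rho> k {\<rho>..<2 * M}" unfolding AB(1) lift_Un both2_def by simp
    obtain k1 k3 where k1: "lift KI = Sigma1 M H c r1 k1" and k3: "lift KI' = Sigma3 M H c r3 k3"
      using lift_I[OF P r1 KI(1)] lift_I'[OF P r3 KI(2)] by blast
    \<comment> \<open>The arm through \<open>U = 0\<close> is joined to region I, the one through
      \<open>V = 0\<close> to region I'; the two joined pieces overlap in the part inside region
      II.\<close>
    have j1: "connect_smoothly M (lift KI) (lift KII) \<and> joined M (lift KI) (lift KII) = lift {s \<in> J. g s > 0}"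
        using join_zero(1) z by blast
    have j2: "connect_smoothly M (lift KII) (lift KI') \<and> joined M (lift KII) (lift KI') = lift {s \<in> J. s < 0}"
        using join_zero_g(2) y by blast
    have "J = {s \<in> J. g s > 0} \<union> {s \<in> J. s < 0}" using sg by blast
    then have "S = lift {s \<in> J. g s > 0} \<union> lift {s \<in> J. s < 0}" using lift_Un lift_J by metis
    then have S: "S = joined M (lift KI) (lift KII) \<union> joined M (lift KII) (lift KI')" using j1 j2 by simp
    note jj = j1[THEN conjunct1, unfolded B k1] j2[THEN conjunct1, unfolded B k3] S[unfolded B k1 k3]
    from c dom jj show ?thesis by - (rule disjI2, rule disjI2, rule disjI1, blast)
  next
    case 6
    then obtain \<rho> k A B where c: "c_min M H < c" "c < 0" and dom: "{0<..\<rho>} \<in> components (f2_dom M H c)" "kH M H \<rho> = c"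
      and KJ: "KII = J" and AB: "J = A \<union> B" "r ` A = {0<..\<rho>}" "r ` B = {0<..\<rho>}"
      and t: "\<forall>s\<in>A. P.tc s = f2_star M H c \<rho> k (r s)" "\<forall>s\<in>B. P.tc s = f2_dstar M H c \<rho> k (r s)"
      unfolding P.res_in_def by (elim exE conjE) (rule that)
    have sub: "A \<subseteq> KII" "B \<subseteq> KII" unfolding KJ using AB(1) by blast+
    have "lift A = graph M (regionII M) (f2_star M H c \<rho> k) {0<..\<rho>}" unfolding AB(2)[symmetric]
        by (rule right[OF sub(1)]) (use t(1) in blast)
    moreover have "lift B = graph M (regionII M) (f2_dstar M H c \<rho> k) {0<..\<rho>}" unfolding AB(3)[symmetric]
        by (rule left[OF sub(2)]) (use t(2) in blast)
    moreover have "S = lift A \<union> lift B" using lift_J lift_Un AB(1) by metis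
    ultimately have S: "S = both2 M H c \<rho> k {0<..\<rho>}" unfolding both2_def by simp
    \<comment> \<open>\<open>kH\<close> is negative left of \<open>r_min\<close>, so
      \<open>c < 0\<close> in this case, which implies the listed bound.\<close>
    have "c < max 0 (- 8 * M ^ 3 * H)" using c(2) by simp
    with c(1) dom S show ?thesis by - (rule disjI2, rule disjI2, rule disjI2, rule disjI2, rule disjI1, blast)
  qed
qed

text \<open>The swapped profile has the parameters \<open>- H\<close> and \<open>- c\<close>, and
  its region II is region II' of the original. As time is negated, a starred branch of
  \<open>f2\<close> turns into a double-starred branch of \<open>f4\<close> with constant
  \<open>- k\<close>, and conversely.\<close>

lemma classification_II':
  assumes P: "profile M H c J (\<lambda>U. U) g a b m r p" and r1: "r1 > 2 * M" and r3: "r3 > 2 * M" and ne: "KII' \<noteq> {}"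
  shows "(c > C_max M H \<and>
      (\<exists>k1 b k. b \<in> {0<..<2 * M} \<and>
        joins (Sigma1 M H c r1 k1) (graph M (regionII' M) (f4_dstar M H c b k) {0<..<2 * M}))) \<or>
    (c = C_max M H \<and>
      (\<exists>k1 b k. b \<in> {R_max M H<..<2 * M} \<and>
        joins (Sigma1 M H c r1 k1) (graph M (regionII' M) (f4_dstar M H c b k) {R_max M H<..<2 * M}))) \<or>
    (- 8 * M ^ 3 * H < c \<and> c < C_max M H \<and>
      (\<exists>k1 r'' k k3. {r''..<2 * M} \<in> components (f4_dom M H c) \<and> kH' M H r'' = c \<and>
        connect_smoothly M (Sigma1 M H c r1 k1) (both4 M H c r'' k {r''..<2 * M}) \<and>
        connect_smoothly M (both4 M H c r'' k {r''..<2 * M}) (Sigma3 M H c r3 k3) \<and>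
        S = joined M (Sigma1 M H c r1 k1) (both4 M H c r'' k {r''..<2 * M}) \<union>
          joined M (both4 M H c r'' k {r''..<2 * M}) (Sigma3 M H c r3 k3))) \<or>
    (c = C_max M H \<and>
      (\<exists>b k. b \<in> {0<..<R_max M H} \<and>
        (S = graph M (regionII' M) (f4_star M H c b k) {0<..<R_max M H} \<or>
         S = graph M (regionII' M) (f4_dstar M H c b k) {0<..<R_max M H}))) \<or>
    (min 0 (- 8 * M ^ 3 * H) < c \<and> c < C_max M H \<and>
      (\<exists>r' k. {0<..r'} \<in> components (f4_dom M H c) \<and> kH' M H r' = c \<and>
        S = both4 M H c r' k {0<..r'})) \<or>
    (c > C_max M H \<and>
      (\<exists>k3 b k. b \<in> {0<..<2 * M} \<and>
        joins (Sigma3 M H c r3 k3) (graph M (regionII' M) (f4_star M H c b k) {0<..<2 * M}))) \<or>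
    (c = C_max M H \<and>
      (\<exists>k3 b k. b \<in> {R_max M H<..<2 * M} \<and>
        joins (Sigma3 M H c r3 k3) (graph M (regionII' M) (f4_star M H c b k) {R_max M H<..<2 * M}))) \<or>
    (\<exists>r0\<in>{0<..<2 * M}. S = {p \<in> regionII M. radius M p = r0} \<or>
         S = {p \<in> regionII' M. radius M p = r0})"
proof -
  interpret P: profile M H c J "\<lambda>U. U" g a b m r p by (fact P)
  interpret N: profile M "- H" "- c" J g "\<lambda>U. U" b a m r p by (rule P.swap)
  have tc: "2 * M * ln \<bar>g s / s\<bar> = - N.tc s" if "s \<in> KII'" for s
    using P.tc_swap[of s] that by (simp add: P.tc_def)
  have K: "{s \<in> J. g s < 0 \<and> 0 < s} = KII'" "{s \<in> J. 0 < g s \<and> 0 < s} = KI" "{s \<in> J. g s < 0 \<and> s < 0} = KI'" by auto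
  have ex: "(\<exists>r0. N.case_cyl r0) \<or> N.res_right \<or> N.res_left \<or> N.res_inner \<or> N.res_out \<or> N.res_in"
      by (rule N.region_II_result) (unfold K, fact ne)
  note cr = C_max_c_min[of M H] R_max_r_min[of M H]
  have right: "lift C = graph M (regionII' M) (f4_dstar M H c bp (- k)) (r ` C)" if C: "C \<subseteq> KII'"
      and t: "\<And>s. s \<in> C \<Longrightarrow> N.tc s = f2_star M (- H) (- c) bp k (r s)" for C bp k
  proof (rule lift_regions(4)[OF C])
    fix s assume s: "s \<in> C"
    show "2 * M * ln \<bar>g s / s\<bar> = f4_dstar M H c bp (- k) (r s)"
      unfolding tc[OF subsetD[OF C s]] t[OF s] f4_f2 f2_dstar_star by simp
  qed
  have left: "lift C = graph M (regionII' M) (f4_star M H c bp (- k)) (r ` C)" if C: "C \<subseteq> KII'" and t: "\<And>s. s \<in> C \<Longrightarrow>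
      N.tc s = f2_dstar M (- H) (- c) bp k (r s)" for C bp k
  proof (rule lift_regions(4)[OF C])
    fix s assume s: "s \<in> C"
    show "2 * M * ln \<bar>g s / s\<bar> = f4_star M H c bp (- k) (r s)"
      unfolding tc[OF subsetD[OF C s]] t[OF s] f4_f2 f2_dstar_star by simp
  qed
  from ex consider r0 where "N.case_cyl r0" | "N.res_right" | "N.res_left" | "N.res_inner" | "N.res_out" |
      "N.res_in" by blast
  then show ?thesis
  proof cases
    case 1
    \<comment> \<open>In the swapped profile it is \<open>g\<close> that exhausts the negative axis,
      so a point of the cylinder is matched through its \<open>V\<close>.\<close>
    then have r0: "0 < r0" "r0 < 2 * M" and s: "\<And>s. s \<in> J \<Longrightarrow> r s = r0 \<and> 0 < s \<and> g s < 0" and J: "g ` J = {..<0}"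
      by (auto simp: N.case_cyl_def)
    have "S = {p \<in> regionII' M. radius M p = r0}"
    proof (intro equalityI subsetI)
      fix q assume "q \<in> S"
      moreover obtain U V x where q: "q = (U, V, x)" by (cases q)
      ultimately have "U \<in> J" "V = g U" "norm x = 1" by (simp_all add: S_iff')
      then show "q \<in> {p \<in> regionII' M. radius M p = r0}"
        using s[of U] UV[of U] by (simp add: q regionII'_def kruskal_iff radius_rho r_def)
    next
      fix q assume q: "q \<in> {p \<in> regionII' M. radius M p = r0}"
      obtain U V x where qe: "q = (U, V, x)" by (cases q)
      have q: "V < 0" "U * V > - 2 * M" "norm x = 1" "rho M (U * V) = r0"
        using q by (auto simp: qe regionII'_def kruskal_iff radius_rho)
      then have "V \<in> g ` J" by (simp add: J)
      then obtain z where z: "z \<in> J" "V = g z" by blast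
      have "U * V = z * g z"
        using kappa_rho[OF M q(2)] kappa_rho[OF M UV[OF z(1)]] s[OF z(1)] q(4) unfolding r_def by metis
      then show "q \<in> S" using z q by (simp add: qe S_iff')
    qed
    then show ?thesis using r0 by (intro disjI2 bexI[of _ r0]) auto
  next
    case 2
    then obtain \<rho> bp k z where c: "(- c < c_min M (- H) \<and> \<rho> = 0) \<or> (- c = c_min M (- H) \<and> \<rho> = r_min M (- H))"
      and bp: "bp \<in> {\<rho><..<2 * M}" and sg: "\<And>s. s \<in> J \<Longrightarrow> s > 0" and rg: "r ` KII' = {\<rho><..<2 * M}"
      and z: "z \<in> J" "g z = 0" and KI: "KI \<noteq> {}" and t: "\<And>s. s \<in> KII' \<Longrightarrow> N.tc s = f2_star M (- H) (- c) bp k (r s)"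
      unfolding N.res_right_def K by blast
    obtain k1 where k1: "lift KI = Sigma1 M H c r1 k1" using lift_I[OF P r1 KI] by blast
    have B: "lift KII' = graph M (regionII' M) (f4_dstar M H c bp (- k)) {\<rho><..<2 * M}" using right[OF order.refl t]
        unfolding rg .
    have T: "{s \<in> J. s > 0} = J" using sg by auto
    note j = join_zero_g(1)[OF z, OF sg[OF z(1)], unfolded T lift_J B k1]
    have j': "connect_smoothly M (Sigma1 M H c r1 k1) (graph M (regionII' M) (f4_dstar M H c bp (- k)) {\<rho><..<2 * M})"
      "S = joined M (Sigma1 M H c r1 k1) (graph M (regionII' M) (f4_dstar M H c bp (- k)) {\<rho><..<2 * M})" using j by simp_all
    from c show ?thesis
    proof (elim disjE conjE)
      assume c: "- c < c_min M (- H)" and \<rho>: "\<rho> = 0"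
      have "c > C_max M H" using c by (simp add: cr)
      then show ?thesis by - (rule disjI1, use bp[unfolded \<rho>] j'[unfolded \<rho>] in blast)
    next
      assume c: "- c = c_min M (- H)" and "\<rho> = r_min M (- H)"
      then have "c = C_max M H" and \<rho>: "\<rho> = R_max M H" by (simp_all add: cr)
      then show ?thesis by - (rule disjI2, rule disjI1, use bp[unfolded \<rho>] j'[unfolded \<rho>] in blast)
    qed
  next
    case 3
    then obtain \<rho> bp k z where c: "(- c < c_min M (- H) \<and> \<rho> = 0) \<or> (- c = c_min M (- H) \<and> \<rho> = r_min M (- H))"
      and bp: "bp \<in> {\<rho><..<2 * M}" and sg: "\<And>s. s \<in> J \<Longrightarrow> g s < 0" and rg: "r ` KII' = {\<rho><..<2 * M}"
      and z: "z \<in> J" "z = 0" and KI: "KI' \<noteq> {}" and t: "\<And>s. s \<in> KII' \<Longrightarrow> N.tc s = f2_dstar M (- H) (- c) bp k (r s)"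
      unfolding N.res_left_def K by blast
    obtain k3 where k3: "lift KI' = Sigma3 M H c r3 k3" using lift_I'[OF P r3 KI] by blast
    have B: "lift KII' = graph M (regionII' M) (f4_star M H c bp (- k)) {\<rho><..<2 * M}" using left[OF order.refl t]
        unfolding rg .
    have T: "{s \<in> J. g s < 0} = J" using sg by auto
    note j = join_zero(2)[OF z(1)[unfolded z(2)], OF sg[OF z(1), unfolded z(2)], unfolded T lift_J B k3]
    have j': "connect_smoothly M (Sigma3 M H c r3 k3) (graph M (regionII' M) (f4_star M H c bp (- k)) {\<rho><..<2 * M})"
      "S = joined M (Sigma3 M H c r3 k3) (graph M (regionII' M) (f4_star M H c bp (- k)) {\<rho><..<2 * M})"
      using j connect_smoothly_commute[of M "Sigma3 M H c r3 k3"] joined_commute[of M "Sigma3 M H c r3 k3"] by simp_all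
    from c show ?thesis
    proof (elim disjE conjE)
      assume c: "- c < c_min M (- H)" and \<rho>: "\<rho> = 0"
      have "c > C_max M H" using c by (simp add: cr)
      then show ?thesis by - (rule disjI2, rule disjI2, rule disjI2, rule disjI2, rule disjI2, rule disjI1, use
          bp[unfolded \<rho>] j'[unfolded \<rho>] in blast)
    next
      assume c: "- c = c_min M (- H)" and "\<rho> = r_min M (- H)"
      then have "c = C_max M H" and \<rho>: "\<rho> = R_max M H" by (simp_all add: cr)
      then show ?thesis by - (rule disjI2, rule disjI2, rule disjI2, rule disjI2, rule disjI2, rule disjI2, rule
          disjI1, use bp[unfolded \<rho>] j'[unfolded \<rho>] in blast)
    qed
  next
    case 4
    then obtain bp k where c: "- c = c_min M (- H)" and bp: "bp \<in> {0<..<r_min M (- H)}" and KJ: "KII' = J"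
        and rg: "r ` J = {0<..<r_min M (- H)}"
      and t: "(\<forall>s\<in>J. N.tc s = f2_star M (- H) (- c) bp k (r s)) \<or> (\<forall>s\<in>J. N.tc s = f2_dstar M (- H) (- c) bp k (r s))"
      unfolding N.res_inner_def K by blast
    have sub: "J \<subseteq> KII'" by (simp only: KJ order.refl)
    have c': "c = C_max M H" using c by (simp add: cr)
    note bp' = bp[folded cr(2)] and rg' = rg[folded cr(2)]
    from t show ?thesis
    proof
      assume "\<forall>s\<in>J. N.tc s = f2_star M (- H) (- c) bp k (r s)"
      then have "lift J = graph M (regionII' M) (f4_dstar M H c bp (- k)) (r ` J)" by (intro right[OF sub]) blast
      then show ?thesis unfolding lift_J rg' by - (rule disjI2, rule disjI2, rule disjI2, rule disjI1, use bp' c' in blast)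
    next
      assume "\<forall>s\<in>J. N.tc s = f2_dstar M (- H) (- c) bp k (r s)"
      then have "lift J = graph M (regionII' M) (f4_star M H c bp (- k)) (r ` J)" by (intro left[OF sub]) blast
      then show ?thesis unfolding lift_J rg' by - (rule disjI2, rule disjI2, rule disjI2, rule disjI1, use bp' c' in blast)
    qed
  next
    case 5
    then obtain \<rho> k A B where c: "c_min M (- H) < - c" "- c < - 8 * M ^ 3 * - H"
        and dom: "{\<rho>..<2 * M} \<in> components (f2_dom M (- H) (- c))" "kH M (- H) \<rho> = - c"
      and AB: "KII' = A \<union> B" "r ` A = {\<rho>..<2 * M}" "r ` B = {\<rho>..<2 * M}"
      and t: "\<forall>s\<in>A. N.tc s = f2_star M (- H) (- c) \<rho> k (r s)" "\<forall>s\<in>B. N.tc s = f2_dstar M (- H) (- c) \<rho> k (r s)"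
      and z: "\<exists>z\<in>J. g z = 0 \<and> z > 0" and y: "\<exists>z\<in>J. z = 0 \<and> g z < 0"
      and KI: "KI \<noteq> {}" "KI' \<noteq> {}" and sg: "\<forall>s\<in>J. g s < 0 \<or> s > 0"
      unfolding N.res_out_def K by (elim exE conjE) (rule that)
    have sub: "A \<subseteq> KII'" "B \<subseteq> KII'" unfolding AB(1) by blast+
    have "lift A = graph M (regionII' M) (f4_dstar M H c \<rho> (- k)) {\<rho>..<2 * M}" unfolding AB(2)[symmetric]
        by (rule right[OF sub(1)]) (use t(1) in blast)
    moreover have "lift B = graph M (regionII' M) (f4_star M H c \<rho> (- k)) {\<rho>..<2 * M}" unfolding AB(3)[symmetric]
        by (rule left[OF sub(2)]) (use t(2) in blast)
    ultimately have B: "lift KII' = both4 M H c \<rho> (- k) {\<rho>..<2 * M}" unfolding AB(1) lift_Un both4_def by blast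
    obtain k1 k3 where k1: "lift KI = Sigma1 M H c r1 k1" and k3: "lift KI' = Sigma3 M H c r3 k3"
      using lift_I[OF P r1 KI(1)] lift_I'[OF P r3 KI(2)] by blast
    have j1: "connect_smoothly M (lift KI) (lift KII') \<and> joined M (lift KI) (lift KII') = lift {s \<in> J. s > 0}"
        using join_zero_g(1) z by blast
    have j2: "connect_smoothly M (lift KII') (lift KI') \<and> joined M (lift KII') (lift KI') = lift {s \<in> J. g s < 0}"
        using join_zero(2) y by blast
    have "J = {s \<in> J. s > 0} \<union> {s \<in> J. g s < 0}" using sg by blast
    then have "S = lift {s \<in> J. s > 0} \<union> lift {s \<in> J. g s < 0}" using lift_Un lift_J by metis
    then have S: "S = joined M (lift KI) (lift KII') \<union> joined M (lift KII') (lift KI')" using j1 j2 by simp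
    note jj = j1[THEN conjunct1, unfolded B k1] j2[THEN conjunct1, unfolded B k3] S[unfolded B k1 k3]
    have "- 8 * M ^ 3 * H < c" "c < C_max M H" "{\<rho>..<2 * M} \<in> components (f4_dom M H c)" "kH' M H \<rho> = c"
      using c dom by (simp_all add: cr f4_dom_f2 kH'_kH)
    then show ?thesis using jj by - (rule disjI2, rule disjI2, rule disjI1, blast)
  next
    case 6
    then obtain \<rho> k A B where c: "c_min M (- H) < - c" "- c < 0" and dom: "{0<..\<rho>} \<in> components (f2_dom M (- H) (-
        c))" "kH M (- H) \<rho> = - c"
      and KJ: "KII' = J" and AB: "J = A \<union> B" "r ` A = {0<..\<rho>}" "r ` B = {0<..\<rho>}"
      and t: "\<forall>s\<in>A. N.tc s = f2_star M (- H) (- c) \<rho> k (r s)" "\<forall>s\<in>B. N.tc s = f2_dstar M (- H) (- c) \<rho> k (r s)"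
      unfolding N.res_in_def K by (elim exE conjE) (rule that)
    have sub: "A \<subseteq> KII'" "B \<subseteq> KII'" unfolding KJ using AB(1) by blast+
    have "lift A = graph M (regionII' M) (f4_dstar M H c \<rho> (- k)) {0<..\<rho>}" unfolding AB(2)[symmetric]
        by (rule right[OF sub(1)]) (use t(1) in blast)
    moreover have "lift B = graph M (regionII' M) (f4_star M H c \<rho> (- k)) {0<..\<rho>}" unfolding AB(3)[symmetric]
        by (rule left[OF sub(2)]) (use t(2) in blast)
    moreover have "S = lift A \<union> lift B" using lift_J lift_Un AB(1) by metis
    ultimately have S: "S = both4 M H c \<rho> (- k) {0<..\<rho>}" unfolding both4_def by blast
    have "min 0 (- 8 * M ^ 3 * H) < c" "c < C_max M H" "{0<..\<rho>} \<in> components (f4_dom M H c)" "kH' M H \<rho> = c"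
      using c dom by (simp_all add: cr f4_dom_f2 kH'_kH)
    then show ?thesis using S by - (rule disjI2, rule disjI2, rule disjI2, rule disjI2, rule disjI1, blast)
  qed
qed

text \<open>Without points in region II or II' the horizon can only be met at
  \<open>U = V = 0\<close>, and the curve extends to both sides of this point, into regions I and
  I'.\<close>

lemma classification_bifurcation:
  assumes P: "profile M H c J (\<lambda>U. U) g a b m r p" and r1: "r1 > 2 * M" and r3: "r3 > 2 * M" and e: "KII = {}" "KII' = {}"
  shows "c = - 8 * M ^ 3 * H \<and> (\<exists>k1 k3. connect_smoothly_at M 0 0 (Sigma1 M H c r1 k1) (Sigma3 M H c r3 k3) \<and>
      S = joined M (Sigma1 M H c r1 k1) (Sigma3 M H c r3 k3))"
proof -
  interpret P: profile M H c J "\<lambda>U. U" g a b m r p by (fact P)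
  have "\<exists>s\<in>J. s = 0 \<and> g s = 0"
    by (rule P.meets_interior_or_bifurcation) (use e in blast)+
  then have z: "0 \<in> J" "g 0 = 0" by auto
  have c: "c = - 8 * M ^ 3 * H" by (rule P.bifurcation[OF z(1) refl z(2)])
  obtain s t where "s \<in> J" "s < 0" "t \<in> J" "0 < t" using P.J_left[OF z(1)] P.J_right[OF z(1)] by metis
  then have ne: "KI \<noteq> {}" "KI' \<noteq> {}" using g_less_iff[OF z(1), of t] g_less_iff[OF _ z(1), of s] z(2) by auto
  obtain k1 k3 where k: "lift KI = Sigma1 M H c r1 k1" "lift KI' = Sigma3 M H c r3 k3"
    using lift_I[OF P r1 ne(1)] lift_I'[OF P r3 ne(2)] by blast
  show ?thesis using c join_zero(3)[OF z, unfolded k] by blast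
qed

end

theorem theorem6:
  fixes M H r1 r3 :: real and S :: "event set"
  assumes "M > 0" and "r1 > 2 * M" and "r3 > 2 * M"
    and "complete_SS_CMC M H S"
  shows "\<exists>c::real.
    \<comment> \<open>(1)\<close>
    (c < c_min M H \<and>
      (\<exists>k1 b k. b \<in> {0<..<2 * M} \<and>
        (let A = Sigma1 M H c r1 k1; B = graph M (regionII M) (f2_star M H c b k) {0<..<2 * M}
         in connect_smoothly M A B \<and> S = joined M A B))) \<or>
    \<comment> \<open>(2)\<close>
    (c = c_min M H \<and>
      (\<exists>k1 b k. b \<in> {r_min M H<..<2 * M} \<and>
        (let A = Sigma1 M H c r1 k1; B = graph M (regionII M) (f2_star M H c b k) {r_min M H<..<2 * M}
         in connect_smoothly M A B \<and> S = joined M A B))) \<or>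
    \<comment> \<open>(3)\<close>
    (c_min M H < c \<and> c < - 8 * M ^ 3 * H \<and>
      (\<exists>k1 r'' k k3. {r''..<2 * M} \<in> components (f2_dom M H c) \<and> kH M H r'' = c \<and>
        (let A = Sigma1 M H c r1 k1; B = both2 M H c r'' k {r''..<2 * M}; C = Sigma3 M H c r3 k3
         in connect_smoothly M A B \<and> connect_smoothly M B C \<and> S = joined M A B \<union> joined M B C))) \<or>
    \<comment> \<open>(4)\<close>
    (c > C_max M H \<and>
      (\<exists>k1 b k. b \<in> {0<..<2 * M} \<and>
        (let A = Sigma1 M H c r1 k1; B = graph M (regionII' M) (f4_dstar M H c b k) {0<..<2 * M}
         in connect_smoothly M A B \<and> S = joined M A B))) \<or>
    \<comment> \<open>(5)\<close>
    (c = C_max M H \<and>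
      (\<exists>k1 b k. b \<in> {R_max M H<..<2 * M} \<and>
        (let A = Sigma1 M H c r1 k1; B = graph M (regionII' M) (f4_dstar M H c b k) {R_max M H<..<2 * M}
         in connect_smoothly M A B \<and> S = joined M A B))) \<or>
    \<comment> \<open>(6)\<close>
    (- 8 * M ^ 3 * H < c \<and> c < C_max M H \<and>
      (\<exists>k1 r'' k k3. {r''..<2 * M} \<in> components (f4_dom M H c) \<and> kH' M H r'' = c \<and>
        (let A = Sigma1 M H c r1 k1; B = both4 M H c r'' k {r''..<2 * M}; C = Sigma3 M H c r3 k3
         in connect_smoothly M A B \<and> connect_smoothly M B C \<and> S = joined M A B \<union> joined M B C))) \<or>
    \<comment> \<open>(7)\<close>
    (c = - 8 * M ^ 3 * H \<and>
      (\<exists>k1 k3.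
        (let A = Sigma1 M H c r1 k1; C = Sigma3 M H c r3 k3
         in connect_smoothly_at M 0 0 A C \<and> S = joined M A C))) \<or>
    \<comment> \<open>(8)\<close>
    (c = c_min M H \<and>
      (\<exists>b k. b \<in> {0<..<r_min M H} \<and>
        (S = graph M (regionII M) (f2_star M H c b k) {0<..<r_min M H} \<or>
         S = graph M (regionII M) (f2_dstar M H c b k) {0<..<r_min M H}))) \<or>
    \<comment> \<open>(9)\<close>
    (c_min M H < c \<and> c < max 0 (- 8 * M ^ 3 * H) \<and>
      (\<exists>r' k. {0<..r'} \<in> components (f2_dom M H c) \<and> kH M H r' = c \<and>
        S = both2 M H c r' k {0<..r'})) \<or>
    \<comment> \<open>(10)\<close>
    (c = C_max M H \<and>
      (\<exists>b k. b \<in> {0<..<R_max M H} \<and>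
        (S = graph M (regionII' M) (f4_star M H c b k) {0<..<R_max M H} \<or>
         S = graph M (regionII' M) (f4_dstar M H c b k) {0<..<R_max M H}))) \<or>
    \<comment> \<open>(11)\<close>
    (min 0 (- 8 * M ^ 3 * H) < c \<and> c < C_max M H \<and>
      (\<exists>r' k. {0<..r'} \<in> components (f4_dom M H c) \<and> kH' M H r' = c \<and>
        S = both4 M H c r' k {0<..r'})) \<or>
    \<comment> \<open>(12)\<close>
    (c < c_min M H \<and>
      (\<exists>k3 b k. b \<in> {0<..<2 * M} \<and>
        (let A = Sigma3 M H c r3 k3; B = graph M (regionII M) (f2_dstar M H c b k) {0<..<2 * M}
         in connect_smoothly M A B \<and> S = joined M A B))) \<or>
    (c = c_min M H \<and>
      (\<exists>k3 b k. b \<in> {r_min M H<..<2 * M} \<and>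
        (let A = Sigma3 M H c r3 k3; B = graph M (regionII M) (f2_dstar M H c b k) {r_min M H<..<2 * M}
         in connect_smoothly M A B \<and> S = joined M A B))) \<or>
    (c > C_max M H \<and>
      (\<exists>k3 b k. b \<in> {0<..<2 * M} \<and>
        (let A = Sigma3 M H c r3 k3; B = graph M (regionII' M) (f4_star M H c b k) {0<..<2 * M}
         in connect_smoothly M A B \<and> S = joined M A B))) \<or>
    (c = C_max M H \<and>
      (\<exists>k3 b k. b \<in> {R_max M H<..<2 * M} \<and>
        (let A = Sigma3 M H c r3 k3; B = graph M (regionII' M) (f4_star M H c b k) {R_max M H<..<2 * M}
         in connect_smoothly M A B \<and> S = joined M A B))) \<or>
    \<comment> \<open>(13)\<close>
    (\<exists>r0\<in>{0<..<2 * M}. S = {p \<in> regionII M. radius M p = r0} \<or>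
                       S = {p \<in> regionII' M. radius M p = r0})"
proof -
  have "cmc_surface M S H"
    using assms(1,4) unfolding complete_SS_CMC_def SS_CMC_def by unfold_locales blast+
  then interpret cmc_surface M S H .
  \<comment> \<open>\<open>c\<close> is the constant of the first integral; it is the witness in
    every alternative.\<close>
  obtain c m where P: "profile M H c J (\<lambda>U. U) g a b m r p" using profile_exists by blast
  \<comment> \<open>The interior region that is entered decides the list to be used; if there is
    none, the hypersurface passes through the bifurcation sphere.\<close>
  consider "KII \<noteq> {}" | "KII' \<noteq> {}" | "KII = {}" "KII' = {}" by blast
  then show ?thesis
  proof cases
    case 1
    from classification_II[OF P assms(2,3) 1] show ?thesis unfolding Let_def
      by - (rule exI[of _ c], elim disjE; ((rule disjI1, assumption) | rule disjI2 | assumption)+)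
  next
    case 2
    from classification_II'[OF P assms(2,3) 2] show ?thesis unfolding Let_def
      by - (rule exI[of _ c], elim disjE; ((rule disjI1, assumption) | rule disjI2 | assumption)+)
  next
    case 3
    from classification_bifurcation[OF P assms(2,3) 3] show ?thesis unfolding Let_def
      by - (rule exI[of _ c], ((rule disjI1, assumption) | rule disjI2)+)
  qed
qed

end
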